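(* There exist an algebraic hypersurface $\mathcal A$ in the space $\mathbb R^m$ of the parameters $\xi$, and a finite number of algebraic functions $\theta_i(\xi)$, homogeneous of degree $1$ on the region $\mathbb R^m\setminus\mathcal A$, so that the eigenvalues of $Q=-\tfrac12\mathrm i\,\mathrm{ad}(N)$ on $F^{0,1}$ are of the form $n+\theta_j(\xi)+a(\xi)$, where $a(\xi)=\sum_j n_j\xi_j$, $n_j\in\mathbb Z$, $\sum_j n_j=-1$, and $n\in\mathbb N$. In particular, the eigenvalues are all distinct and non-zero outside the countable union of the hypersurfaces $\theta_i(\xi)-\theta_j(\xi)-a(\xi)=0$, for all $i\neq j$ and all such $a(\xi)$.
   Context: $S=\{v_1,\dots,v_m\}\subset\mathbb Z^n$ (the tangential sites) is assumed generic, i.e. $P(v_1,\dots,v_m)\ne0$ for a suitable nonzero polynomial $P$ in the coordinates of the $v_i$. $S^c=\mathbb Z^n\setminus S$. An algebraic function is a function algebraic over $\mathbb Q(\xi_1,\dots,\xi_m)$. The integer $n$ in the claim is not the dimension of $\mathbb Z^n$. $e_1,\dots,e_m$ is the standard basis of $\mathbb Z^m$; $\eta:\mathbb Z^m\to\mathbb Z$ is linear with $\eta(e_i)=1$; $\pi:\mathbb Z^m\to\mathbb Z^n$ is linear with $\pi(e_i)=v_i$; $\Theta=\ker\pi$. $N$ is the quadratic normal form Hamiltonian of the completely resonant cubic nonlinear Schrödinger equation $\mathrm i u_t-\Delta u=|u|^2u$ on the $n$-dimensional torus, with tangential sites $S$; it depends on parameters $\xi=(\xi_1,\dots,\xi_m)$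 (the actions of the excited frequencies), and $x_1,\dots,x_m$ are the angles and $z_k,\bar z_k$ ($k\in S^c$) the normal variables. $F^{0,1}$ is the space with basis (the frequency basis) the elements $e^{\mathrm i\sum_j\nu_jx_j}z_k$ and $e^{-\mathrm i\sum_j\nu_jx_j}\bar z_k$ with $k\in S^c$, $\nu\in\mathbb Z^m$, $\pi(\nu)+k=0$ and $\sum_j\nu_j+1=0$. $\mathrm{ad}(N)$ acts on it, and $\mathrm{ad}(N)=2\mathrm i Q$. The matrix of $Q$ in this basis is as follows. $G=\mathbb Z^m\rtimes\mathbb Z/(2)$ consists of elements $a=(a,+)$ and $a\tau=(a,-)$, $a\in\mathbb Z^m$, with $\tau^2=1$, $\tau a=(-a)\tau$. The basis element $e^{\mathrm i\sum_j\nu_jx_j}z_k$ corresponds to $a=\sum_j\nu_je_j$ and its conjugate to $a\tau$. Let $X=\{e_i-e_j: i\ne j\}\cup\{(-e_i-e_j)\tau: i\neq j\}$; in the Cayley graph $G_X$, $u,v\in G$ are joined by an edge marked $x\in X$ when $v=xu$. For $u=(a,\sigma)$, $a=\sum_i a_ie_i$, $\sigma=\pm1$, put $K(u)=\frac{\sigma}{2}\big(|\sum_i a_iv_i|^2+\sum_i a_i|v_i|^2\big)$. Let $G^1=\{a,a\tau:\eta(a)=-1\}$. The graph $\Lambda_S$ has vertex set $G^1\setminus\bigcup_i\{-e_i+\Theta,(-e_i+\Theta)\tau\}$ and as edges those edges of $G_X$ between such vertices $u,v$ with $K(u)=K(v)$. The entries of $Q$ are: $Q_{a,a}=K(a)-\sum_j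 a_j\xi_j$, $Q_{a\tau,a\tau}=K(a\tau)+\sum_j a_j\xi_j$; $Q_{a,b}=2\sqrt{\xi_i\xi_j}$, $Q_{a\tau,b\tau}=-2\sqrt{\xi_i\xi_j}$ if the two vertices are joined in $\Lambda_S$ by an edge marked $e_i-e_j$; $Q_{a,b\tau}=-2\sqrt{\xi_i\xi_j}$, $Q_{b\tau,a}=2\sqrt{\xi_i\xi_j}$ if $a,b\tau$ are joined in $\Lambda_S$ by an edge marked $(-e_i-e_j)\tau$; all other entries are $0$. $Q$ is the direct sum of infinitely many finite-dimensional blocks, indexed by the connected components of $\Lambda_S$; the characteristic polynomial of each block is a polynomial in $t,\xi$ (the square roots disappear), and the eigenvalues of $Q$ are the roots of these polynomials.
   Formalization: The integer n ranges over all integers, not only N, since K takes negative values; the exceptional hypersurfaces are n+θ_i−θ_j−a=0 with n an integer, a of coefficient sum 0 instead of −1, and i=j allowed if (n,a)≠(0,0), since the printed loci miss affine crossings. *)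

theory Defs
  imports
    "HOL-Analysis.Analysis"
    "HOL-Computational_Algebra.Polynomial"
    "HOL-Combinatorics.Permutations"
    "HOL-Library.Poly_Mapping"
begin

section \<open>Multivariate polynomials, hypersurfaces, algebraic functions\<close>

text \<open>A polynomial in variables indexed by \<open>'v\<close> is a finitely supported map from monomials
  (finitely supported exponent functions) to coefficients.\<close>

type_synonym ('v, 'a) mpoly = "('v \<Rightarrow>\<^sub>0 nat) \<Rightarrow>\<^sub>0 'a"

definition mpoly_eval :: "('v, 'a::comm_semiring_1) mpoly \<Rightarrow> ('v \<Rightarrow> 'a) \<Rightarrow> 'a" where
  "mpoly_eval p x =
     (\<Sum>\<alpha>\<in>Poly_Mapping.keys p. Poly_Mapping.lookup p \<alpha> *
        (\<Prod>i\<in>Poly_Mapping.keys \<alpha>. x i ^ Poly_Mapping.lookup \<alpha> i))"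

text \<open>The zero set of a non-constant real polynomial.\<close>

definition algebraic_hypersurface :: "(real^'m::finite) set \<Rightarrow> bool" where
  "algebraic_hypersurface A \<longleftrightarrow>
     (\<exists>p :: ('m, real) mpoly. \<not> Poly_Mapping.keys p \<subseteq> {0} \<and> A = {\<xi>. mpoly_eval p (($) \<xi>) = 0})"

text \<open>A (single-valued, continuous, possibly complex) branch over \<open>U\<close> of a function algebraic over
  the field of rational functions with rational coefficients; denominators have been cleared, so
  that the annihilating polynomial \<open>F\<close> in \<open>t\<close> has coefficients in \<open>\<rat>[\<xi>]\<close>.\<close>

definition algebraic_function_on :: "(real^'m::finite) set \<Rightarrow> (real^'m \<Rightarrow> complex) \<Rightarrow> bool" where
  "algebraic_function_on U f \<longleftrightarrow> continuous_on U f \<and>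
     (\<exists>F :: ('m, rat) mpoly poly. F \<noteq> 0 \<and>
        (\<forall>\<xi>\<in>U. poly (map_poly (\<lambda>c. mpoly_eval (Poly_Mapping.map of_rat c)
                                     (\<lambda>i. complex_of_real (\<xi> $ i))) F) (f \<xi>) = 0))"

definition homogeneous1_on :: "(real^'m::finite) set \<Rightarrow> (real^'m \<Rightarrow> complex) \<Rightarrow> bool" where
  "homogeneous1_on U f \<longleftrightarrow>
     (\<forall>\<xi>\<in>U. \<forall>s::real. s \<noteq> 0 \<longrightarrow> s *\<^sub>R \<xi> \<in> U \<and> f (s *\<^sub>R \<xi>) = of_real s * f \<xi>)"

text \<open>The linear form \<open>a(\<xi>)\<close> with integer coefficients.\<close>

definition lform :: "int^'m::finite \<Rightarrow> real^'m \<Rightarrow> real" where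
  "lform a \<xi> = (\<Sum>i\<in>UNIV. of_int (a $ i) * \<xi> $ i)"

section \<open>The group \<open>G\<close> and the graph \<open>\<Lambda>\<^sub>S\<close>\<close>

text \<open>\<open>(a, True)\<close> is the element \<open>a\<close> and \<open>(a, False)\<close> is \<open>a\<tau>\<close>.\<close>

type_synonym 'm grp = "(int^'m) \<times> bool"

definition sg :: "bool \<Rightarrow> int" where
  "sg \<sigma> = (if \<sigma> then 1 else -1)"

text \<open>Semidirect product: \<open>\<tau> b = (-b) \<tau>\<close>.\<close>

definition gmult :: "'m::finite grp \<Rightarrow> 'm grp \<Rightarrow> 'm grp" where
  "gmult u w = (fst u + sg (snd u) *s fst w, snd u = snd w)"

definition edge_marks :: "'m::finite grp set" where
  "edge_marks = {(axis i 1 - axis j 1, True) | i j. i \<noteq> j} \<union>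
                {(- axis i 1 - axis j 1, False) | i j. i \<noteq> j}"

definition eta :: "int^'m::finite \<Rightarrow> int" where
  "eta a = (\<Sum>i\<in>UNIV. a $ i)"

definition sqnorm :: "int^'n::finite \<Rightarrow> int" where
  "sqnorm k = (\<Sum>l\<in>UNIV. (k $ l)\<^sup>2)"

text \<open>Below, \<open>v :: 'm \<Rightarrow> int^'n\<close> is the family of tangential sites.\<close>

definition mom :: "('m::finite \<Rightarrow> int^'n::finite) \<Rightarrow> int^'m \<Rightarrow> int^'n" where
  "mom v a = (\<Sum>i\<in>UNIV. a $ i *s v i)"

definition Theta :: "('m::finite \<Rightarrow> int^'n::finite) \<Rightarrow> (int^'m) set" where
  "Theta v = {a. mom v a = 0}"

definition energy :: "('m::finite \<Rightarrow> int^'n::finite) \<Rightarrow> 'm grp \<Rightarrow> real" where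
  "energy v u = of_int (sg (snd u)) / 2 *
     of_int (sqnorm (mom v (fst u)) + (\<Sum>i\<in>UNIV. fst u $ i * sqnorm (v i)))"

text \<open>The vertices are the indices of the frequency basis of \<open>F\<^bsup>0,1\<^esup>\<close>:
  for \<open>\<eta>(a) = -1\<close>, \<open>a\<close> lies in no \<open>-e\<^sub>i + \<Theta>\<close> iff \<open>k = -\<pi>(a)\<close> is not a tangential site.\<close>

definition vertices :: "('m::finite \<Rightarrow> int^'n::finite) \<Rightarrow> 'm grp set" where
  "vertices v = {u. eta (fst u) = -1} -
     (\<Union>i. {(- axis i 1 + t, \<sigma>) | t \<sigma>. t \<in> Theta v})"

definition joined :: "('m::finite \<Rightarrow> int^'n::finite) \<Rightarrow> 'm grp \<Rightarrow> 'm grp \<Rightarrow> 'm grp \<Rightarrow> bool" where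
  "joined v x u w \<longleftrightarrow> x \<in> edge_marks \<and> u \<in> vertices v \<and> w \<in> vertices v \<and>
     w = gmult x u \<and> energy v u = energy v w"

text \<open>The vertex sets of the connected components of \<open>\<Lambda>\<^sub>S\<close>; the edge relation is symmetric because
  the set of marks is closed under inversion.\<close>

definition blocks :: "('m::finite \<Rightarrow> int^'n::finite) \<Rightarrow> 'm grp set set" where
  "blocks v = vertices v // {(u, w). \<exists>x. joined v x u w}\<^sup>*"

section \<open>The matrix \<open>Q\<close>, its blocks and eigenvalues\<close>

text \<open>For a mark \<open>\<plusminus>e\<^sub>i - e\<^sub>j\<close> this is \<open>\<surd>\<xi>\<^sub>i \<surd>\<xi>\<^sub>j\<close>. Since the parameters are arbitrary reals,
  the root of the product has to be read as a product of complex roots: with this reading (and for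
  either choice of the roots) the characteristic polynomials are polynomials in \<open>t, \<xi>\<close> on the whole
  parameter space, whereas \<open>csqrt (\<xi>\<^sub>i * \<xi>\<^sub>j)\<close> would introduce absolute values.\<close>

definition mark_root :: "real^'m::finite \<Rightarrow> 'm grp \<Rightarrow> complex" where
  "mark_root \<xi> x = (\<Prod>i\<in>{i. fst x $ i \<noteq> 0}. csqrt (complex_of_real (\<xi> $ i)))"

text \<open>The mark joining \<open>u\<close> to \<open>w\<close> is unique (it is \<open>w u\<^sup>-\<^sup>1\<close>). The sign of an off-diagonal
  entry is that of its column index.\<close>

definition Qmat :: "('m::finite \<Rightarrow> int^'n::finite) \<Rightarrow> real^'m \<Rightarrow> 'm grp \<Rightarrow> 'm grp \<Rightarrow> complex" where
  "Qmat v \<xi> u w =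
     (if u = w then of_real (energy v u - of_int (sg (snd u)) * lform (fst u) \<xi>)
      else if \<exists>x. joined v x u w
        then of_int (sg (snd w)) * 2 * mark_root \<xi> (THE x. joined v x u w)
      else 0)"

text \<open>\<open>det (t I - Q)\<close> for the block of \<open>Q\<close> with the (finite) index set \<open>C\<close>, by the Leibniz
  formula.\<close>

definition block_charpoly ::
    "('m::finite \<Rightarrow> int^'n::finite) \<Rightarrow> real^'m \<Rightarrow> 'm grp set \<Rightarrow> complex poly" where
  "block_charpoly v \<xi> C =
     (\<Sum>p | p permutes C. of_int (sign p) *
        (\<Prod>u\<in>C. (if p u = u then [:0, 1:] else 0) - [:Qmat v \<xi> u (p u):]))"

definition block_eigenvalues ::
    "('m::finite \<Rightarrow> int^'n::finite) \<Rightarrow> real^'m \<Rightarrow> 'm grp set \<Rightarrow> complex set" where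
  "block_eigenvalues v \<xi> C = {z. poly (block_charpoly v \<xi> C) z = 0}"

text \<open>All eigenvalues of \<open>Q\<close>, counted with multiplicity over all blocks, are distinct.\<close>

definition eigenvalues_distinct :: "('m::finite \<Rightarrow> int^'n::finite) \<Rightarrow> real^'m \<Rightarrow> bool" where
  "eigenvalues_distinct v \<xi> \<longleftrightarrow>
     (\<forall>C\<in>blocks v. rsquarefree (block_charpoly v \<xi> C)) \<and>
     disjoint_family_on (block_eigenvalues v \<xi>) (blocks v)"

text \<open>The locus \<open>n + \<theta>\<^sub>i - \<theta>\<^sub>j - a = 0\<close> in the region \<open>U\<close>.\<close>

definition coincidence_locus ::
    "(real^'m::finite) set \<Rightarrow> (nat \<Rightarrow> real^'m \<Rightarrow> complex) \<Rightarrow> int \<Rightarrow> nat \<Rightarrow> nat \<Rightarrow> int^'m \<Rightarrow> (real^'m) set"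
  where
  "coincidence_locus U \<theta> n i j a =
     {\<xi>\<in>U. of_int n + \<theta> i \<xi> - \<theta> j \<xi> - of_real (lform a \<xi>) = 0}"

text \<open>Its indices. The difference of \<open>n + \<theta>\<^sub>i + a\<close> and \<open>n' + \<theta>\<^sub>j + a'\<close> with
  \<open>\<eta>(a) = \<eta>(a') = -1\<close> involves a linear form with coefficient sum \<open>0\<close>; the indices of the
  identically vanishing differences are left out.\<close>

definition coincidence_indices :: "nat \<Rightarrow> (int \<times> nat \<times> nat \<times> (int^'m::finite)) set" where
  "coincidence_indices d =
     {(n, i, j, a). i < d \<and> j < d \<and> eta a = 0 \<and> (i \<noteq> j \<or> n \<noteq> 0 \<or> a \<noteq> 0)}"

end

theory Submission
  imports Defs "Jordan_Normal_Form.Char_Poly"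
begin

no_notation Matrix.vec_index (infixl "$" 100)
hide_const (open) Module.smult

text \<open>Encode the vertex (a, \<sigma>) by the lattice point x = \<sigma> a. A block becomes a
  finite connected set C of points with \<eta>(x) = 1 or -1, and its matrix is similar, by a
  diagonal matrix that removes the square roots, to K + \<open>pmat\<close>. Here the integer K is
  the common energy, and \<open>pmat\<close> depends on C and \<xi> only and is polynomial in \<xi>
  (\<open>Qmat_block\<close>). Translating C by b with \<eta>(b) = 0 subtracts the linear form
  b(\<xi>) from the spectrum. For generic sites every C is a \<open>block_shape\<close> whose
  coordinates differ by at most 2m (\<open>cluster_block_shape\<close>,
  \<open>cluster_card\<close>), so up to translation only finitely many matrices occur. The
  \<theta>_j are the roots of their characteristic polynomials, shifted by one parameter so that the
  remaining linear forms have coefficient sum -1.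

  It remains to see that coincidences happen only on hypersurfaces. They are polynomial conditions,
  so it suffices to exhibit one real point \<xi> without collisions
  (\<open>separating_parameters\<close>), and this is done 2-adically. Embed Z[y][s] in the reals,
  extend the Gauss valuation at 2 to a valuation ring V of the complex numbers, and put \<xi>_i =
  z_i (z_i + s), where the z_i are distinct powers of y. Modulo 2 the matrix is diagonal, so an
  eigenvalue has a label x in C, the place where its eigenvector is largest, and second order
  perturbation theory determines it modulo 16 (\<open>eigen_expansion\<close>). The first order
  terms 4 \<xi>_i \<xi>_j / (\<xi>_i \<plusminus> \<xi>_j) have poles, which modulo 2 lie at the
  distinct points s = z_i + z_j. Therefore the eigenvalue determines x modulo 4 and, for each pair
  i, j, which kinds of edges occur at x (\<open>label_parity\<close>). As each mark sits on at most
  one edge of C, the label is unique, and an orthogonality argument shows that different eigenvalues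
  have different labels.

  The sum of the roots of an irreducible factor of the characteristic polynomial has no poles, so no
  edge of C can leave the set of their labels: the characteristic polynomial is irreducible
  (\<open>charpoly_irreducible\<close>). Two shapes with a common eigenvalue then have the same
  spectrum, matching labels makes them translates of each other, and comparing the sums of the
  eigenvalues shows that the translation is zero (\<open>common_root_separation\<close>).

  The geometric input is that the energy is a quadratic form in x with coefficients built from |v_a
  - v_b|^2. An affine relation among points of equal energy gives an equation for the sites whose
  coefficients are the off-diagonal second moments of the relation; for generic sites these moments
  vanish (\<open>generic_polynomial\<close>). This bounds the number of points of each colour by m
  and makes marks unique.

  The roots become continuous homogeneous functions by ordering them by the real part of \<omega> z
  for a suitable \<omega>, off the zero set of a discriminant
  (\<open>continuous_root_functions\<close>). A coincidence locus lies in the zero set of a product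
  over all pairs of roots, which is polynomial in \<xi> by symmetry and nonzero at a multiple of the
  separating point (\<open>family_locus\<close>).\<close>

section \<open>Characteristic polynomials indexed by finite sets\<close>

text \<open>\<open>block_charpoly\<close> with the matrix as a parameter. Index sets are sets of
  group elements or of lattice points; numbered rows enter only through
  \<open>leibniz_charpoly_char_poly\<close>.\<close>

definition leibniz_charpoly :: "'i set \<Rightarrow> ('i \<Rightarrow> 'i \<Rightarrow> 'a::comm_ring_1) \<Rightarrow> 'a poly" where
  "leibniz_charpoly X M =
     (\<Sum>p | p permutes X. of_int (sign p) *
        (\<Prod>u\<in>X. (if p u = u then [:0, 1:] else 0) - [:M u (p u):]))"

text \<open>Conjugation by \<open>h\<close> is a sign-preserving bijection between the permutations
  of \<open>X\<close> and those of \<open>Y\<close>.\<close>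

lemma sum_permutes_reindex:
  fixes F :: "'j \<Rightarrow> 'j \<Rightarrow> 'a::comm_ring_1"
  assumes "finite X" "bij_betw h X Y"
  shows "(\<Sum>p | p permutes Y. of_int (sign p) * (\<Prod>u\<in>Y. F u (p u))) =
         (\<Sum>p | p permutes X. of_int (sign p) * (\<Prod>u\<in>X. F (h u) (h (p u))))"
proof -
  have inj: "inj_on h X" and Y: "Y = h ` X"
    using assms(2) by (auto simp: bij_betw_def)
  define k where "k = inv_into X h"
  have kh: "k (h x) = x" if "x \<in> X" for x
    using that inj by (simp add: k_def)
  have hk: "h (k y) = y" if "y \<in> Y" for y
    using that by (simp add: k_def Y f_inv_into_f)
  have bk: "bij_betw k Y X"
    unfolding k_def using assms(2) by (rule bij_betw_inv_into)
  show ?thesis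
  proof (rule sum.reindex_bij_witness[where i = "map_permutation X h" and j = "map_permutation Y k"])
    fix p assume p: "p \<in> {p. p permutes Y}"
    show "map_permutation X h (map_permutation Y k p) = p"
      using p hk by (intro map_permutation_compose_inv[OF bk]) auto
    show "map_permutation Y k p \<in> {p. p permutes X}"
      using p by (auto intro: map_permutation_permutes[OF bk])
    have ik: "inj_on k Y" using bk by (simp add: bij_betw_def)
    have fY: "finite Y" using assms(1) by (simp add: Y)
    have s: "sign (map_permutation Y k p) = sign p"
      using p fY ik by (intro sign_map_permutation) auto
    have "(\<Prod>u\<in>X. F (h u) (h (map_permutation Y k p u))) = (\<Prod>u\<in>Y. F u (p u))"
    proof (rule prod.reindex_bij_witness[where i = k and j = h])
      fix x assume x: "x \<in> X"
      show "k (h x) = x" by (rule kh[OF x])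
      show "h x \<in> Y" using x Y by auto
      have "map_permutation Y k p (k (h x)) = k (p (h x))"
        using x Y by (intro map_permutation_apply[OF ik]) auto
      moreover have "p (h x) \<in> Y" using p x Y permutes_in_image[of p Y] by auto
      ultimately show "F (h x) (p (h x)) = F (h x) (h (map_permutation Y k p x))"
        by (simp add: kh[OF x] hk)
    next
      fix y assume y: "y \<in> Y"
      show "h (k y) = y" by (rule hk[OF y])
      show "k y \<in> X" using y bk by (auto simp: bij_betw_def)
    qed
    then show "of_int (sign (map_permutation Y k p)) * (\<Prod>u\<in>X. F (h u) (h (map_permutation Y k p u))) =
       of_int (sign p) * (\<Prod>u\<in>Y. F u (p u))"
      by (simp add: s)
  next
    fix p assume p: "p \<in> {p. p permutes X}"
    show "map_permutation Y k (map_permutation X h p) = p"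
      using p kh by (intro map_permutation_compose_inv[OF assms(2)]) auto
    show "map_permutation X h p \<in> {p. p permutes Y}"
      using p by (auto intro: map_permutation_permutes[OF assms(2)])
  qed
qed

lemma leibniz_charpoly_reindex:
  assumes "finite X" "bij_betw h X Y"
  shows "leibniz_charpoly Y M = leibniz_charpoly X (\<lambda>u w. M (h u) (h w))"
proof -
  have inj: "inj_on h X" using assms(2) by (simp add: bij_betw_def)
  have "leibniz_charpoly Y M = (\<Sum>p | p permutes X. of_int (sign p) *
        (\<Prod>u\<in>X. (if h (p u) = h u then [:0, 1:] else 0) - [:M (h u) (h (p u)):]))"
    unfolding leibniz_charpoly_def by (rule sum_permutes_reindex[OF assms])
  also have "\<dots> = leibniz_charpoly X (\<lambda>u w. M (h u) (h w))"
    unfolding leibniz_charpoly_def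
    by (intro sum.cong prod.cong refl arg_cong2[where f = "(*)"])
       (auto simp: inj_on_eq_iff[OF inj] permutes_in_image)
  finally show ?thesis .
qed

lemma leibniz_charpoly_cong:
  assumes "\<And>u w. u \<in> X \<Longrightarrow> w \<in> X \<Longrightarrow> M u w = M' u w"
  shows "leibniz_charpoly X M = leibniz_charpoly X M'"
  unfolding leibniz_charpoly_def
  by (intro sum.cong prod.cong refl arg_cong2[where f = "(*)"])
     (auto simp: permutes_in_image assms)

lemma leibniz_charpoly_char_poly:
  assumes "bij_betw e {0..<n} X"
  shows "leibniz_charpoly X M = char_poly (Matrix.mat n n (\<lambda>(i, j). M (e i) (e j)))"
proof -
  have "leibniz_charpoly X M = leibniz_charpoly {0..<n} (\<lambda>u w. M (e u) (e w))"
    by (rule leibniz_charpoly_reindex[OF _ assms]) simp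
  also have "\<dots> = char_poly (Matrix.mat n n (\<lambda>(i, j). M (e i) (e j)))"
    unfolding leibniz_charpoly_def char_poly_def char_poly_matrix_def
    by (subst det_def'[where n = n])
       (auto intro!: sum.cong prod.cong arg_cong2[where f = "(*)"] simp: permutes_in_image)
  finally show ?thesis .
qed

lemma leibniz_charpoly_degree:
  assumes "finite X"
  shows "degree (leibniz_charpoly X M) = card X" "coeff (leibniz_charpoly X M) (card X) = 1"
proof -
  obtain e where e: "bij_betw e {0..<card X} X"
    using ex_bij_betw_nat_finite[OF assms] by blast
  let ?A = "Matrix.mat (card X) (card X) (\<lambda>(i, j). M (e i) (e j))"
  have "?A \<in> carrier_mat (card X) (card X)" by simp
  from degree_monic_char_poly[OF this]
  show "degree (leibniz_charpoly X M) = card X" "coeff (leibniz_charpoly X M) (card X) = 1"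
    by (simp_all add: leibniz_charpoly_char_poly[OF e])
qed

lemma leibniz_charpoly_factor:
  fixes M :: "'i \<Rightarrow> 'i \<Rightarrow> complex"
  assumes "finite X"
  shows "\<exists>a. leibniz_charpoly X M = (\<Prod>s<card X. [:- a s, 1:])"
proof -
  obtain e where e: "bij_betw e {0..<card X} X"
    using ex_bij_betw_nat_finite[OF assms] by blast
  let ?A = "Matrix.mat (card X) (card X) (\<lambda>(i, j). M (e i) (e j))"
  have "?A \<in> carrier_mat (card X) (card X)" by simp
  from char_poly_factorized[OF this] obtain as
    where "char_poly ?A = (\<Prod>a\<leftarrow>as. [:- a, 1:])" "length as = card X" by blast
  then have "leibniz_charpoly X M = (\<Prod>s<card X. [:- (as ! s), 1:])"
    by (simp add: leibniz_charpoly_char_poly[OF e] prod.list_conv_set_nth atLeast0LessThan)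
  then show ?thesis by blast
qed

lemma leibniz_charpoly_eigenvector:
  fixes M :: "'i \<Rightarrow> 'i \<Rightarrow> 'a::field"
  assumes "finite X" "poly (leibniz_charpoly X M) l = 0"
  obtains z where "\<exists>x\<in>X. z x \<noteq> 0" "\<And>x. x \<in> X \<Longrightarrow> (\<Sum>w\<in>X. M x w * z w) = l * z x"
proof -
  let ?n = "card X"
  obtain e where e: "bij_betw e {0..<?n} X"
    using ex_bij_betw_nat_finite[OF assms(1)] by blast
  let ?A = "Matrix.mat ?n ?n (\<lambda>(i, j). M (e i) (e j))"
  have A: "?A \<in> carrier_mat ?n ?n" by simp
  have "eigenvalue ?A l"
    using assms(2) eigenvalue_root_char_poly[OF A] by (simp add: leibniz_charpoly_char_poly[OF e])
  then obtain v where v: "v \<in> carrier_vec ?n" "v \<noteq> 0\<^sub>v ?n" "?A *\<^sub>v v = l \<cdot>\<^sub>v v"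
    unfolding eigenvalue_def eigenvector_def by auto
  define k where "k = inv_into {0..<?n} e"
  have ke: "k (e i) = i" if "i < ?n" for i
    using that e unfolding k_def bij_betw_def by (auto intro: inv_into_f_f)
  have surj: "\<exists>i<?n. x = e i" if "x \<in> X" for x
    using that e unfolding bij_betw_def by fastforce
  have eX: "e i \<in> X" if "i < ?n" for i
    using that e unfolding bij_betw_def by auto
  define z where "z x = vec_index v (k x)" for x
  have "\<exists>i<?n. vec_index v i \<noteq> 0"
    using v(1,2) by (metis carrier_vecD eq_vecI index_zero_vec(1) index_zero_vec(2))
  then have 1: "\<exists>x\<in>X. z x \<noteq> 0"
    using ke eX by (metis z_def)
  have 2: "(\<Sum>w\<in>X. M x w * z w) = l * z x" if "x \<in> X" for x
  proof -
    from surj[OF that] obtain i where i: "i < ?n" "x = e i" by blast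
    have "vec_index (?A *\<^sub>v v) i = (\<Sum>j = 0..<?n. M (e i) (e j) * vec_index v j)"
      using i v(1) by (simp add: scalar_prod_def)
    also have "\<dots> = (\<Sum>w\<in>X. M x w * z w)"
      using ke i(2)
      by (subst sum.reindex_bij_betw[OF e, symmetric]) (auto simp: z_def intro!: sum.cong)
    finally show ?thesis using i v(1,3) ke by (simp add: z_def)
  qed
  show ?thesis using that[OF 1 2] .
qed

lemma poly_leibniz_charpoly:
  "poly (leibniz_charpoly X M) t =
     (\<Sum>p | p permutes X. of_int (sign p) * (\<Prod>u\<in>X. (if p u = u then t else 0) - M u (p u)))"
  unfolding leibniz_charpoly_def
  by (simp add: poly_sum poly_prod if_distrib[of "\<lambda>q. poly q t"] cong: if_cong)

text \<open>Each Leibniz product changes by the product of the \<open>D (p u) / D u\<close>, which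
  is 1 because \<open>p\<close> permutes \<open>X\<close>. Such diagonal similarities remove the
  square roots from Q and exhibit the homogeneity in the parameters.\<close>

lemma leibniz_charpoly_similar:
  fixes M :: "'i \<Rightarrow> 'i \<Rightarrow> 'a::field"
  assumes "finite X" "\<And>u. u \<in> X \<Longrightarrow> D u \<noteq> 0"
  shows "leibniz_charpoly X (\<lambda>u w. M u w * D w / D u) = leibniz_charpoly X M"
  unfolding leibniz_charpoly_def
proof (intro sum.cong refl arg_cong2[where f = "(*)"])
  fix p assume "p \<in> {p. p permutes X}"
  then have p: "p permutes X" by simp
  have "(\<Prod>u\<in>X. (if p u = u then [:0, 1:] else 0) - [:M u (p u) * D (p u) / D u:]) =
        (\<Prod>u\<in>X. smult (D (p u) / D u) ((if p u = u then [:0, 1:] else 0) - [:M u (p u):]))"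
    by (intro prod.cong refl) (auto simp: assms(2))
  also have "\<dots> = smult (\<Prod>u\<in>X. D (p u) / D u)
      (\<Prod>u\<in>X. (if p u = u then [:0, 1:] else 0) - [:M u (p u):])"
    by (rule prod_smult)
  also have "(\<Prod>u\<in>X. D (p u) / D u) = 1"
    using prod.permute[OF p, of D] assms by (simp add: prod_dividef o_def permutes_in_image[OF p])
  finally show "(\<Prod>u\<in>X. (if p u = u then [:0, 1:] else 0) - [:M u (p u) * D (p u) / D u:]) =
    (\<Prod>u\<in>X. (if p u = u then [:0, 1:] else 0) - [:M u (p u):])" by simp
qed

lemma leibniz_charpoly_scale:
  "poly (leibniz_charpoly X (\<lambda>u w. c * M u w)) (c * t) = c ^ card X * poly (leibniz_charpoly X M) t"
proof -
  have "(\<Prod>u\<in>X. (if p u = u then c * t else 0) - c * M u (p u)) =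
      c ^ card X * (\<Prod>u\<in>X. (if p u = u then t else 0) - M u (p u))" for p
  proof -
    have "(\<Prod>u\<in>X. (if p u = u then c * t else 0) - c * M u (p u)) =
       (\<Prod>u\<in>X. c * ((if p u = u then t else 0) - M u (p u)))"
      by (intro prod.cong refl) (auto simp: algebra_simps)
    then show ?thesis by (simp add: prod.distrib)
  qed
  then show ?thesis
    by (simp add: poly_leibniz_charpoly sum_distrib_left mult_ac)
qed

lemma leibniz_charpoly_shift:
  "poly (leibniz_charpoly X (\<lambda>u w. M u w + (if u = w then c else 0))) (t + c) =
   poly (leibniz_charpoly X M) t"
  unfolding poly_leibniz_charpoly
  by (intro sum.cong prod.cong refl arg_cong2[where f = "(*)"]) auto

lemma leibniz_charpoly_hom:
  assumes "comm_ring_hom f"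
  shows "map_poly f (leibniz_charpoly X M) = leibniz_charpoly X (\<lambda>u w. f (M u w))"
proof -
  interpret f: comm_ring_hom f by fact
  interpret mf: map_poly_comm_ring_hom f ..
  show ?thesis
    unfolding leibniz_charpoly_def
    by (simp add: mf.hom_sum mf.hom_mult mf.hom_prod mf.hom_minus mf.hom_of_int f.map_poly_pCons_hom
        if_distrib[of "map_poly f"] cong: if_cong)
qed

subsection \<open>Power sums\<close>

text \<open>This is the quotient of p(x) - p(c) by x - c: the term a_i x^i contributes a_i c^(i-1-j)
  x^j for every j < i.\<close>

lemma coeff_synthetic_div:
  fixes c :: "'a::comm_ring_1"
  shows "coeff (synthetic_div p c) j = (\<Sum>i\<in>{j<..degree p}. coeff p i * c ^ (i - Suc j))"
proof (induction p arbitrary: j)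
  case 0
  then show ?case by simp
next
  case (pCons a p)
  show ?case
  proof (cases "p = 0")
    case True
    then show ?thesis by simp
  next
    case False
    show ?thesis
    proof (cases j)
      case 0
      have "poly p c = (\<Sum>i\<le>degree p. coeff p i * c ^ i)" by (simp only: poly_altdef)
      also have "\<dots> = (\<Sum>i\<in>{0<..Suc (degree p)}. coeff (pCons a p) i * c ^ (i - Suc 0))"
        by (rule sum.reindex_bij_witness[where i = "\<lambda>i. i - 1" and j = Suc]) (auto simp: coeff_pCons split: nat.splits)
      finally show ?thesis using False 0 by simp
    next
      case (Suc k)
      have "coeff (synthetic_div (pCons a p) c) j = (\<Sum>i\<in>{k<..degree p}. coeff p i * c ^ (i - Suc k))"
        using pCons.IH Suc by simp
      also have "\<dots> = (\<Sum>i\<in>{j<..Suc (degree p)}. coeff (pCons a p) i * c ^ (i - Suc j))"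
        unfolding Suc
        by (rule sum.reindex_bij_witness[where i = "\<lambda>i. i - 1" and j = Suc])
           (auto simp: coeff_pCons split: nat.splits)
      finally show ?thesis using False by simp
    qed
  qed
qed

text \<open>The derivative of \<open>q\<close> is the sum over s of q / (x - a_s), and each summand
  is a synthetic division; the identity compares the coefficients of x^(N-1-k).\<close>

lemma newton_identity_low:
  fixes a :: "nat \<Rightarrow> 'a::{field_char_0}" and N :: nat
  defines "q \<equiv> (\<Prod>s<N. [:- a s, 1:])"
  assumes "k < N"
  shows "(\<Sum>s<N. a s ^ k) = of_nat (N - k) * coeff q (N - k) -
           (\<Sum>l<k. coeff q (N - k + l) * (\<Sum>s<N. a s ^ l))"
proof -
  have deg: "degree q = N"
    unfolding q_def by (subst degree_prod_eq_sum_degree) auto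
  have lc: "coeff q N = 1"
  proof -
    have "lead_coeff q = 1" unfolding q_def by (simp add: lead_coeff_prod)
    then show ?thesis by (simp add: deg)
  qed
  have sd: "synthetic_div q (a s) = (\<Prod>r\<in>{..<N} - {s}. [:- a r, 1:])" if "s < N" for s
  proof -
    have qs: "q = [:- a s, 1:] * (\<Prod>r\<in>{..<N} - {s}. [:- a r, 1:])"
      unfolding q_def using that by (subst prod.remove[of _ s]) auto
    have "poly q (a s) = 0" by (subst qs) simp
    then have "[:- a s, 1:] * synthetic_div q (a s) = q"
      using synthetic_div_correct'[of "a s" q] by simp
    then have "[:- a s, 1:] * synthetic_div q (a s) = [:- a s, 1:] * (\<Prod>r\<in>{..<N} - {s}. [:- a r, 1:])"
      using qs by metis
    then show ?thesis
      by (metis mult_cancel_left pCons_eq_0_iff zero_neq_one)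
  qed
  have "pderiv q = (\<Sum>s<N. synthetic_div q (a s))"
  proof -
    have "pderiv q = (\<Sum>s<N. prod (\<lambda>r. [:- a r, 1:]) ({..<N} - {s}) * pderiv [:- a s, 1:])"
      unfolding q_def by (rule pderiv_prod)
    then show ?thesis using sd by (simp add: pderiv_pCons)
  qed
  then have "coeff (pderiv q) (N - Suc k) = (\<Sum>s<N. \<Sum>i\<in>{N - Suc k<..N}. coeff q i * a s ^ (i - Suc (N - Suc k)))"
    by (simp add: coeff_sum coeff_synthetic_div deg)
  also have "\<dots> = (\<Sum>s<N. \<Sum>l\<le>k. coeff q (N - k + l) * a s ^ l)"
    using assms(2)
    by (intro sum.cong refl sum.reindex_bij_witness[where i = "\<lambda>l. N - k + l" and j = "\<lambda>i. i - (N - k)"])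
       (auto simp: Suc_diff_Suc)
  also have "\<dots> = (\<Sum>l\<le>k. coeff q (N - k + l) * (\<Sum>s<N. a s ^ l))"
    by (subst sum.swap) (simp add: sum_distrib_left)
  also have "\<dots> = (\<Sum>l<k. coeff q (N - k + l) * (\<Sum>s<N. a s ^ l)) + (\<Sum>s<N. a s ^ k)"
    using assms(2) lc by (simp add: lessThan_Suc_atMost[symmetric])
  finally show ?thesis
    using assms(2) by (simp add: coeff_pderiv Suc_diff_Suc algebra_simps)
qed

text \<open>Multiply q(a_s) = 0 by a_s^(k-N) and sum over s.\<close>

lemma newton_identity_high:
  fixes a :: "nat \<Rightarrow> 'a::{field_char_0}" and N :: nat
  defines "q \<equiv> (\<Prod>s<N. [:- a s, 1:])"
  assumes "N \<le> k"
  shows "(\<Sum>s<N. a s ^ k) = - (\<Sum>l<N. coeff q l * (\<Sum>s<N. a s ^ (k - N + l)))"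
proof -
  have deg: "degree q = N"
    unfolding q_def by (subst degree_prod_eq_sum_degree) auto
  have lc: "coeff q N = 1"
  proof -
    have "lead_coeff q = 1" unfolding q_def by (simp add: lead_coeff_prod)
    then show ?thesis by (simp add: deg)
  qed
  have "a s ^ k + (\<Sum>l<N. coeff q l * a s ^ (k - N + l)) = 0" if "s < N" for s
  proof -
    have "poly q (a s) = 0" unfolding q_def using that by (auto simp: poly_prod)
    then have "0 = a s ^ (k - N) * (\<Sum>l\<le>N. coeff q l * a s ^ l)"
      by (simp add: poly_altdef deg)
    also have "\<dots> = (\<Sum>l\<le>N. coeff q l * a s ^ (k - N + l))"
      by (simp add: sum_distrib_left power_add mult_ac)
    also have "\<dots> = (\<Sum>l<N. coeff q l * a s ^ (k - N + l)) + a s ^ k"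
      using assms(2) lc by (simp add: lessThan_Suc_atMost[symmetric])
    finally show ?thesis by (simp add: add.commute)
  qed
  then have "(\<Sum>s<N. a s ^ k + (\<Sum>l<N. coeff q l * a s ^ (k - N + l))) = 0" by simp
  then have "(\<Sum>s<N. a s ^ k) + (\<Sum>s<N. \<Sum>l<N. coeff q l * a s ^ (k - N + l)) = 0"
    by (simp only: sum.distrib)
  moreover have "(\<Sum>s<N. \<Sum>l<N. coeff q l * a s ^ (k - N + l)) =
      (\<Sum>l<N. coeff q l * (\<Sum>s<N. a s ^ (k - N + l)))"
    by (subst sum.swap) (simp add: sum_distrib_left)
  ultimately show ?thesis by (simp add: add_eq_0_iff2)
qed

text \<open>The determinant of the matrix with entries \<open>s (i + j)\<close>. For power sums of
  roots it is their discriminant, written without any choice of an order of the roots.\<close>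

definition hankel :: "nat \<Rightarrow> (nat \<Rightarrow> 'a::comm_ring_1) \<Rightarrow> 'a" where
  "hankel n s = (\<Sum>p | p permutes {0..<n}. of_int (sign p) * (\<Prod>i = 0..<n. s (i + p i)))"

text \<open>The Hankel matrix of the power sums is \<open>V V\<^sup>T\<close> for the Vandermonde matrix \<open>V\<close>.\<close>

lemma hankel_power_sums:
  fixes v :: "nat \<Rightarrow> 'a::field"
  shows "hankel n (\<lambda>k. \<Sum>s<n. v s ^ k) \<noteq> 0 \<longleftrightarrow> inj_on v {..<n}"
proof -
  define V where "V = Matrix.mat n n (\<lambda>(i, s). v s ^ i)"
  have V: "V \<in> carrier_mat n n" by (simp add: V_def)
  have "hankel n (\<lambda>k. \<Sum>s<n. v s ^ k) = Determinant.det (Matrix.mat n n (\<lambda>(i, j). \<Sum>s<n. v s ^ (i + j)))"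
    unfolding hankel_def
    by (subst det_def'[where n = n])
       (auto intro!: sum.cong prod.cong arg_cong2[where f = "(*)"] simp: permutes_in_image)
  also have "Matrix.mat n n (\<lambda>(i, j). \<Sum>s<n. v s ^ (i + j)) = V * V\<^sup>T"
    by (intro eq_matI) (auto simp: V_def scalar_prod_def power_add atLeast0LessThan)
  also have "Determinant.det (V * V\<^sup>T) = Determinant.det V * Determinant.det V"
    using V by (simp add: Determinant.det_mult[of _ n] Determinant.det_transpose[of _ n])
  finally have *: "hankel n (\<lambda>k. \<Sum>s<n. v s ^ k) = Determinant.det (V\<^sup>T) * Determinant.det (V\<^sup>T)"
    using V by (simp add: Determinant.det_transpose[of _ n])
  have VT: "V\<^sup>T \<in> carrier_mat n n" using V by simp
  show ?thesis
  proof
    assume h: "hankel n (\<lambda>k. \<Sum>s<n. v s ^ k) \<noteq> 0"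
    show "inj_on v {..<n}"
    proof (rule inj_onI, rule ccontr)
      fix s t assume st: "s \<in> {..<n}" "t \<in> {..<n}" "v s = v t" "s \<noteq> t"
      have "Determinant.det (V\<^sup>T) = 0"
        using st by (intro Determinant.det_identical_rows[OF VT, of s t]) (auto simp: V_def intro!: eq_vecI)
      then show False using h * by simp
    qed
  next
    assume inj: "inj_on v {..<n}"
    show "hankel n (\<lambda>k. \<Sum>s<n. v s ^ k) \<noteq> 0"
    proof
      assume "hankel n (\<lambda>k. \<Sum>s<n. v s ^ k) = 0"
      then have "Determinant.det (V\<^sup>T) = 0" using * by simp
      then obtain c where c: "c \<in> carrier_vec n" "c \<noteq> 0\<^sub>v n" "V\<^sup>T *\<^sub>v c = 0\<^sub>v n"
        using det_0_iff_vec_prod_zero_field[OF VT] by blast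
      \<comment> \<open>A kernel vector of the transposed Vandermonde matrix lists the coefficients
        of a polynomial of degree below n with n distinct zeros.\<close>
      define q where "q = (\<Sum>i<n. monom (vec_index c i) i)"
      have cq: "coeff q i = (if i < n then vec_index c i else 0)" for i
        by (auto simp: q_def coeff_sum coeff_monom)
      have "q \<noteq> 0"
      proof
        assume "q = 0"
        then have "\<forall>i<n. vec_index c i = 0" using cq by (metis coeff_0)
        then have "c = 0\<^sub>v n" using c(1) by (intro eq_vecI) auto
        then show False using c by simp
      qed
      have "degree q < n"
      proof (rule ccontr)
        assume "\<not> degree q < n"
        then have "lead_coeff q = 0" using cq by simp
        then show False using \<open>q \<noteq> 0\<close> by simp
      qed
      have "poly q (v s) = 0" if "s < n" for s
      proof -
        have "vec_index (V\<^sup>T *\<^sub>v c) s = 0" using c that by simp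
        then have "(\<Sum>i = 0..<n. v s ^ i * vec_index c i) = 0"
          using that c(1) by (simp add: scalar_prod_def V_def)
        then show ?thesis
          by (simp add: q_def poly_sum poly_monom atLeast0LessThan mult.commute)
      qed
      then have "v ` {..<n} \<subseteq> {x. poly q x = 0}" by auto
      then have "card (v ` {..<n}) \<le> card {x. poly q x = 0}"
        by (intro card_mono poly_roots_finite \<open>q \<noteq> 0\<close>)
      also have "\<dots> \<le> degree q" by (rule card_poly_roots_bound[OF \<open>q \<noteq> 0\<close>])
      finally show False using \<open>degree q < n\<close> by (simp add: card_image[OF inj])
    qed
  qed
qed

subsection \<open>Evaluation of multivariate polynomials\<close>

definition monom_eval :: "('v \<Rightarrow>\<^sub>0 nat) \<Rightarrow> ('v \<Rightarrow> 'a::comm_semiring_1) \<Rightarrow> 'a" where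
  "monom_eval \<alpha> x = (\<Prod>i\<in>Poly_Mapping.keys \<alpha>. x i ^ Poly_Mapping.lookup \<alpha> i)"

text \<open>The coefficients pass through \<open>h\<close>, so that integer, rational and real
  polynomials are treated together.\<close>

definition hom_eval :: "('b::zero \<Rightarrow> 'a::comm_semiring_1) \<Rightarrow> ('v, 'b) mpoly \<Rightarrow> ('v \<Rightarrow> 'a) \<Rightarrow> 'a" where
  "hom_eval h p x = (\<Sum>\<alpha>\<in>Poly_Mapping.keys p. h (Poly_Mapping.lookup p \<alpha>) * monom_eval \<alpha> x)"

lemma mpoly_eval_hom_eval: "mpoly_eval p = hom_eval (\<lambda>c. c) p"
  by (auto simp: fun_eq_iff mpoly_eval_def hom_eval_def monom_eval_def)

lemma hom_eval_superset:
  assumes "h 0 = 0" "finite S" "Poly_Mapping.keys p \<subseteq> S"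
  shows "hom_eval h p x = (\<Sum>\<alpha>\<in>S. h (Poly_Mapping.lookup p \<alpha>) * monom_eval \<alpha> x)"
  unfolding hom_eval_def using assms
  by (intro sum.mono_neutral_left) (auto simp: in_keys_iff)

lemma hom_eval_map:
  assumes "h 0 = 0"
  shows "mpoly_eval (Poly_Mapping.map h p) x = hom_eval h p x"
proof -
  have l: "Poly_Mapping.lookup (Poly_Mapping.map h p) \<alpha> = h (Poly_Mapping.lookup p \<alpha>)" for \<alpha>
    by (simp add: Poly_Mapping.map.rep_eq when_def assms)
  have "mpoly_eval (Poly_Mapping.map h p) x =
      (\<Sum>\<alpha>\<in>Poly_Mapping.keys p. Poly_Mapping.lookup (Poly_Mapping.map h p) \<alpha> * monom_eval \<alpha> x)"
    unfolding mpoly_eval_hom_eval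
    by (rule hom_eval_superset) (auto simp: in_keys_iff l assms)
  then show ?thesis by (simp add: l hom_eval_def)
qed

lemma monom_eval_add: "monom_eval (\<alpha> + \<beta>) x = monom_eval \<alpha> x * monom_eval \<beta> x"
proof -
  let ?S = "Poly_Mapping.keys \<alpha> \<union> Poly_Mapping.keys \<beta>"
  have *: "monom_eval \<gamma> x = (\<Prod>i\<in>?S. x i ^ Poly_Mapping.lookup \<gamma> i)"
    if "Poly_Mapping.keys \<gamma> \<subseteq> ?S" for \<gamma>
    unfolding monom_eval_def using that
    by (intro prod.mono_neutral_left) (auto simp: in_keys_iff)
  show ?thesis
    using Poly_Mapping.keys_add[of \<alpha> \<beta>]
    by (simp add: * lookup_add power_add prod.distrib)
qed

lemma hom_eval_zero [simp]: "hom_eval h 0 x = 0"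
  by (simp add: hom_eval_def)

lemma hom_eval_single:
  assumes "h 0 = 0"
  shows "hom_eval h (Poly_Mapping.single \<alpha> c) x = h c * monom_eval \<alpha> x"
  using assms by (cases "c = 0") (simp_all add: hom_eval_def)

lemma hom_eval_add:
  fixes h :: "'b::comm_ring_1 \<Rightarrow> 'a::comm_ring_1"
  assumes "comm_ring_hom h"
  shows "hom_eval h (p + q) x = hom_eval h p x + hom_eval h q x"
proof -
  interpret h: comm_ring_hom h by fact
  let ?S = "Poly_Mapping.keys p \<union> Poly_Mapping.keys q"
  have *: "hom_eval h r x = (\<Sum>\<alpha>\<in>?S. h (Poly_Mapping.lookup r \<alpha>) * monom_eval \<alpha> x)"
    if "Poly_Mapping.keys r \<subseteq> ?S" for r
    using that by (intro hom_eval_superset) auto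
  show ?thesis
    using Poly_Mapping.keys_add[of p q]
    by (simp add: * lookup_add h.hom_add algebra_simps sum.distrib)
qed

lemma hom_eval_sum:
  fixes h :: "'b::comm_ring_1 \<Rightarrow> 'a::comm_ring_1"
  assumes "comm_ring_hom h"
  shows "hom_eval h (sum f I) x = (\<Sum>i\<in>I. hom_eval h (f i) x)"
  by (induction I rule: infinite_finite_induct) (simp_all add: hom_eval_add[OF assms])

lemma mpoly_sum_single:
  "p = (\<Sum>\<alpha>\<in>Poly_Mapping.keys p. Poly_Mapping.single \<alpha> (Poly_Mapping.lookup p \<alpha>))"
  by (rule poly_mapping_eqI) (auto simp: lookup_sum lookup_single when_def in_keys_iff sum.delta)

lemma hom_eval_mult:
  fixes h :: "'b::comm_ring_1 \<Rightarrow> 'a::comm_ring_1"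
  assumes "comm_ring_hom h"
  shows "hom_eval h (p * q) x = hom_eval h p x * hom_eval h q x"
proof -
  interpret h: comm_ring_hom h by fact
  have "p * q = (\<Sum>\<alpha>\<in>Poly_Mapping.keys p. Poly_Mapping.single \<alpha> (Poly_Mapping.lookup p \<alpha>)) *
      (\<Sum>\<alpha>\<in>Poly_Mapping.keys q. Poly_Mapping.single \<alpha> (Poly_Mapping.lookup q \<alpha>))"
    by (rule arg_cong2[OF mpoly_sum_single mpoly_sum_single])
  also have "hom_eval h \<dots> x = (\<Sum>\<alpha>\<in>Poly_Mapping.keys p. \<Sum>\<beta>\<in>Poly_Mapping.keys q.
      (h (Poly_Mapping.lookup p \<alpha>) * monom_eval \<alpha> x) * (h (Poly_Mapping.lookup q \<beta>) * monom_eval \<beta> x))"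
    by (simp add: sum_product hom_eval_sum[OF assms] mult_single hom_eval_single monom_eval_add
        h.hom_mult mult_ac)
  also have "\<dots> = hom_eval h p x * hom_eval h q x"
    by (simp add: hom_eval_def sum_product)
  finally show ?thesis .
qed

lemma hom_eval_const:
  assumes "h 0 = 0"
  shows "hom_eval h (Poly_Mapping.single 0 c) x = h c"
  using assms by (simp add: hom_eval_single monom_eval_def)

lemma hom_eval_var:
  fixes h :: "'b::comm_ring_1 \<Rightarrow> 'a::comm_ring_1"
  assumes "comm_ring_hom h"
  shows "hom_eval h (Poly_Mapping.single (Poly_Mapping.single i 1) 1) x = x i"
proof -
  interpret h: comm_ring_hom h by fact
  show ?thesis by (simp add: hom_eval_single monom_eval_def)
qed

text \<open>Functions on \<open>'s\<close> that are polynomial, with coefficients taken from \<open>'b\<close> along \<open>h\<close>, in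
  the coordinates \<open>c s i\<close>.\<close>

definition poly_fun :: "('b::comm_ring_1 \<Rightarrow> 'a::comm_ring_1) \<Rightarrow> ('s \<Rightarrow> 'v \<Rightarrow> 'a) \<Rightarrow> ('s \<Rightarrow> 'a) \<Rightarrow> bool" where
  "poly_fun h c f \<longleftrightarrow> (\<exists>p :: ('v, 'b) mpoly. \<forall>s. f s = hom_eval h p (c s))"

locale poly_functions = comm_ring_hom h for h :: "'b::comm_ring_1 \<Rightarrow> 'a::comm_ring_1" +
  fixes c :: "'s \<Rightarrow> 'v \<Rightarrow> 'a"
begin

lemma hom: "comm_ring_hom h" ..

lemma const: "poly_fun h c (\<lambda>s. h a)"
  unfolding poly_fun_def by (rule exI[of _ "Poly_Mapping.single 0 a"]) (simp add: hom_eval_const)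

lemma var: "poly_fun h c (\<lambda>s. c s i)"
  unfolding poly_fun_def
  by (rule exI[of _ "Poly_Mapping.single (Poly_Mapping.single i 1) 1"]) (simp add: hom_eval_var[OF hom, simplified])

lemma add:
  assumes "poly_fun h c f" "poly_fun h c g"
  shows "poly_fun h c (\<lambda>s. f s + g s)"
proof -
  obtain p q where "\<forall>s. f s = hom_eval h p (c s)" "\<forall>s. g s = hom_eval h q (c s)"
    using assms unfolding poly_fun_def by (elim exE)
  then show ?thesis
    unfolding poly_fun_def by (intro exI[of _ "p + q"]) (simp add: hom_eval_add[OF hom])
qed

lemma mult:
  assumes "poly_fun h c f" "poly_fun h c g"
  shows "poly_fun h c (\<lambda>s. f s * g s)"
proof -
  obtain p q where "\<forall>s. f s = hom_eval h p (c s)" "\<forall>s. g s = hom_eval h q (c s)"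
    using assms unfolding poly_fun_def by (elim exE)
  then show ?thesis
    unfolding poly_fun_def by (intro exI[of _ "p * q"]) (simp add: hom_eval_mult[OF hom])
qed

lemma of_int: "poly_fun h c (\<lambda>s. of_int k)"
  using const[of "of_int k"] by (simp add: hom_of_int)

lemma of_nat: "poly_fun h c (\<lambda>s. of_nat k)"
  using of_int[of "int k"] by simp

lemma one: "poly_fun h c (\<lambda>s. 1)" and zero: "poly_fun h c (\<lambda>s. 0)"
  using of_int[of 1] of_int[of 0] by simp_all

lemma minus:
  assumes "poly_fun h c f"
  shows "poly_fun h c (\<lambda>s. - f s)"
  using mult[OF of_int[of "-1"] assms] by simp

lemma diff:
  assumes "poly_fun h c f" "poly_fun h c g"
  shows "poly_fun h c (\<lambda>s. f s - g s)"
  using add[OF assms(1) minus[OF assms(2)]] by simp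

lemma sum:
  assumes "\<And>i. i \<in> I \<Longrightarrow> poly_fun h c (f i)"
  shows "poly_fun h c (\<lambda>s. \<Sum>i\<in>I. f i s)"
  using assms
proof (induction I rule: infinite_finite_induct)
  case (insert i I)
  have "poly_fun h c (\<lambda>s. f i s + (\<Sum>i\<in>I. f i s))"
    by (rule add[OF insert.prems insert.IH]) (simp_all add: insert.prems)
  then show ?case by (simp only: sum.insert[OF insert.hyps])
qed (simp_all add: zero)

lemma prod:
  assumes "\<And>i. i \<in> I \<Longrightarrow> poly_fun h c (f i)"
  shows "poly_fun h c (\<lambda>s. \<Prod>i\<in>I. f i s)"
  using assms
proof (induction I rule: infinite_finite_induct)
  case (insert i I)
  have "poly_fun h c (\<lambda>s. f i s * (\<Prod>i\<in>I. f i s))"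
    by (rule mult[OF insert.prems insert.IH]) (simp_all add: insert.prems)
  then show ?case by (simp only: prod.insert[OF insert.hyps])
qed (simp_all add: one)

lemma power:
  assumes "poly_fun h c f"
  shows "poly_fun h c (\<lambda>s. f s ^ k)"
  using prod[of "{..<k}" "\<lambda>_. f"] assms by simp

end

lemma poly_functions_id: "poly_functions (\<lambda>c. c)"
  by unfold_locales auto

lemma poly_fun_line:
  fixes f :: "('v \<Rightarrow> int) \<Rightarrow> int"
  assumes "poly_fun (\<lambda>c. c) (\<lambda>x. x) f"
  shows "\<exists>q. \<forall>s. f (\<lambda>i. a i + s * b i) = poly q s"
proof -
  obtain p where p: "\<And>x. f x = hom_eval (\<lambda>c. c) p x" using assms unfolding poly_fun_def by blast
  show ?thesis
    by (rule exI[of _ "\<Sum>\<alpha>\<in>Poly_Mapping.keys p. [:Poly_Mapping.lookup p \<alpha>:] *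
          (\<Prod>i\<in>Poly_Mapping.keys \<alpha>. [:a i, b i:] ^ Poly_Mapping.lookup \<alpha> i)"])
       (simp add: p hom_eval_def monom_eval_def poly_sum poly_prod)
qed

text \<open>On the line through two points both polynomials have only finitely many zeros.\<close>

lemma poly_fun_common_nonzero:
  fixes f g :: "('v \<Rightarrow> int) \<Rightarrow> int"
  assumes "poly_fun (\<lambda>c. c) (\<lambda>x. x) f" "f a \<noteq> 0" "poly_fun (\<lambda>c. c) (\<lambda>x. x) g" "g b \<noteq> 0"
  shows "\<exists>x. f x * g x \<noteq> 0"
proof -
  obtain p where p: "\<And>s. f (\<lambda>i. a i + s * (b i - a i)) = poly p s"
    using poly_fun_line[OF assms(1), of a "\<lambda>i. b i - a i"] by blast
  obtain q where q: "\<And>s. g (\<lambda>i. a i + s * (b i - a i)) = poly q s"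
    using poly_fun_line[OF assms(3), of a "\<lambda>i. b i - a i"] by blast
  have "p \<noteq> 0" using p[of 0] assms(2) by auto
  moreover have "q \<noteq> 0" using q[of 1] assms(4) by auto
  ultimately have "finite ({s. poly p s = 0} \<union> {s. poly q s = 0})"
    by (simp add: poly_roots_finite)
  then obtain s where "s \<notin> {s. poly p s = 0} \<union> {s. poly q s = 0}"
    using ex_new_if_finite[OF infinite_UNIV_int] by blast
  then show ?thesis
    using p[of s] q[of s] by (intro exI[of _ "\<lambda>i. a i + s * (b i - a i)"]) auto
qed

text \<open>Combines finitely many nonzero conditions on the sites into one polynomial, by induction
  with \<open>poly_fun_common_nonzero\<close>.\<close>

lemma poly_fun_prod_nonzero:
  fixes f :: "'i \<Rightarrow> ('v \<Rightarrow> int) \<Rightarrow> int"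
  assumes "finite I" "\<And>i. i \<in> I \<Longrightarrow> poly_fun (\<lambda>c. c) (\<lambda>x. x) (f i)" "\<And>i. i \<in> I \<Longrightarrow> \<exists>x. f i x \<noteq> 0"
  shows "\<exists>x. (\<Prod>i\<in>I. f i x) \<noteq> 0"
  using assms
proof (induction I rule: finite_induct)
  case empty
  then show ?case by simp
next
  case (insert i I)
  have "poly_fun (\<lambda>c. c) (\<lambda>x. x) (\<lambda>x. \<Prod>i\<in>I. f i x)"
    using insert.prems by (intro poly_functions.prod[OF poly_functions_id]) auto
  moreover obtain a b where "f i a \<noteq> 0" "(\<Prod>i\<in>I. f i b) \<noteq> 0"
    using insert by blast
  moreover have "poly_fun (\<lambda>c. c) (\<lambda>x. x) (f i)" using insert.prems by auto
  ultimately have "\<exists>x. f i x * (\<Prod>i\<in>I. f i x) \<noteq> 0"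
    by (intro poly_fun_common_nonzero)
  then show ?case using insert.hyps by simp
qed

subsection \<open>Complex polynomial functions of the real parameters\<close>

text \<open>Split into real and imaginary part because hypersurfaces are zero sets of real
  polynomials.\<close>

definition cpoly_fun :: "(real^'m::finite \<Rightarrow> complex) \<Rightarrow> bool" where
  "cpoly_fun f \<longleftrightarrow> poly_fun (\<lambda>c. c) ($) (\<lambda>\<xi>. Re (f \<xi>)) \<and> poly_fun (\<lambda>c. c) ($) (\<lambda>\<xi>. Im (f \<xi>))"

lemma cpoly_fun_const: "cpoly_fun (\<lambda>_. a)"
  unfolding cpoly_fun_def by (intro conjI poly_functions.const[OF poly_functions_id])

lemma cpoly_fun_var: "cpoly_fun (\<lambda>\<xi>. complex_of_real (\<xi> $ i))"
  unfolding cpoly_fun_def Re_complex_of_real Im_complex_of_real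
  by (intro conjI poly_functions.zero[OF poly_functions_id] poly_functions.var[OF poly_functions_id])

lemma cpoly_fun_add: "cpoly_fun f \<Longrightarrow> cpoly_fun g \<Longrightarrow> cpoly_fun (\<lambda>\<xi>. f \<xi> + g \<xi>)"
  unfolding cpoly_fun_def plus_complex.sel by (intro conjI poly_functions.add[OF poly_functions_id]; elim conjE; assumption)

lemma cpoly_fun_mult: "cpoly_fun f \<Longrightarrow> cpoly_fun g \<Longrightarrow> cpoly_fun (\<lambda>\<xi>. f \<xi> * g \<xi>)"
  unfolding cpoly_fun_def times_complex.sel
  by (intro conjI poly_functions.add[OF poly_functions_id] poly_functions.diff[OF poly_functions_id] poly_functions.mult[OF poly_functions_id]; elim conjE; assumption)

lemma cpoly_fun_minus:
  assumes "cpoly_fun f"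
  shows "cpoly_fun (\<lambda>\<xi>. - f \<xi>)"
proof -
  have "cpoly_fun (\<lambda>\<xi>. - 1 * f \<xi>)" by (rule cpoly_fun_mult[OF cpoly_fun_const assms])
  then show ?thesis by (simp only: mult_minus1)
qed

lemma cpoly_fun_diff:
  assumes "cpoly_fun f" "cpoly_fun g"
  shows "cpoly_fun (\<lambda>\<xi>. f \<xi> - g \<xi>)"
proof -
  have "cpoly_fun (\<lambda>\<xi>. f \<xi> + - g \<xi>)" by (rule cpoly_fun_add[OF assms(1) cpoly_fun_minus[OF assms(2)]])
  then show ?thesis by (simp only: add_uminus_conv_diff)
qed

lemma cpoly_fun_sum:
  assumes "\<And>i. i \<in> I \<Longrightarrow> cpoly_fun (f i)"
  shows "cpoly_fun (\<lambda>\<xi>. \<Sum>i\<in>I. f i \<xi>)"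
  using assms
proof (induction I rule: infinite_finite_induct)
  case (infinite A)
  show ?case unfolding sum.infinite[OF infinite(1)] by (rule cpoly_fun_const)
next
  case empty
  show ?case unfolding sum.empty by (rule cpoly_fun_const)
next
  case (insert i I)
  have 1: "cpoly_fun (f i)" by (rule insert.prems) (rule insertI1)
  have 2: "cpoly_fun (\<lambda>\<xi>. \<Sum>i\<in>I. f i \<xi>)"
    by (rule insert.IH) (rule insert.prems, erule insertI2)
  show ?case unfolding sum.insert[OF insert.hyps] by (rule cpoly_fun_add[OF 1 2])
qed

lemma cpoly_fun_prod:
  assumes "\<And>i. i \<in> I \<Longrightarrow> cpoly_fun (f i)"
  shows "cpoly_fun (\<lambda>\<xi>. \<Prod>i\<in>I. f i \<xi>)"
  using assms
proof (induction I rule: infinite_finite_induct)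
  case (infinite A)
  show ?case unfolding prod.infinite[OF infinite(1)] by (rule cpoly_fun_const)
next
  case empty
  show ?case unfolding prod.empty by (rule cpoly_fun_const)
next
  case (insert i I)
  have 1: "cpoly_fun (f i)" by (rule insert.prems) (rule insertI1)
  have 2: "cpoly_fun (\<lambda>\<xi>. \<Prod>i\<in>I. f i \<xi>)"
    by (rule insert.IH) (rule insert.prems, erule insertI2)
  show ?case unfolding prod.insert[OF insert.hyps] by (rule cpoly_fun_mult[OF 1 2])
qed

lemma cpoly_fun_power:
  assumes "cpoly_fun f"
  shows "cpoly_fun (\<lambda>\<xi>. f \<xi> ^ k)"
proof (induction k)
  case 0
  show ?case unfolding power_0 by (rule cpoly_fun_const)
next
  case (Suc k)
  show ?case unfolding power_Suc by (rule cpoly_fun_mult[OF assms Suc])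
qed

lemmas cpoly_fun_intros =
  cpoly_fun_const cpoly_fun_var cpoly_fun_add cpoly_fun_mult cpoly_fun_minus cpoly_fun_diff
  cpoly_fun_sum cpoly_fun_prod cpoly_fun_power

lemma cpoly_fun_rational:
  fixes f :: "real^'m::finite \<Rightarrow> complex"
  assumes "poly_fun of_rat (\<lambda>\<xi> i. complex_of_real (\<xi> $ i)) f"
  shows "cpoly_fun f"
proof -
  obtain p :: "('m, rat) mpoly" where p: "\<And>\<xi>. f \<xi> = hom_eval of_rat p (\<lambda>i. complex_of_real (\<xi> $ i))"
    using assms unfolding poly_fun_def by blast
  show ?thesis
    unfolding p hom_eval_def monom_eval_def
    by (intro cpoly_fun_sum cpoly_fun_mult cpoly_fun_const cpoly_fun_prod cpoly_fun_power cpoly_fun_var)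
qed

lemma poly_fun_continuous:
  fixes f :: "real^'m::finite \<Rightarrow> real"
  assumes "poly_fun (\<lambda>c. c) ($) f"
  shows "continuous_on S f"
proof -
  obtain p where p: "\<And>\<xi>. f \<xi> = hom_eval (\<lambda>c. c) p (($) \<xi>)"
    using assms unfolding poly_fun_def by (elim exE) simp
  have c: "continuous_on S (\<lambda>\<xi>::real^'m. (\<xi> $ i) ^ k)" for i k
    by (rule continuous_on_power[OF continuous_on_component[OF continuous_on_id]])
  have m: "continuous_on S (\<lambda>\<xi>::real^'m. monom_eval \<alpha> (($) \<xi>))" for \<alpha>
    unfolding monom_eval_def by (rule continuous_on_prod) (rule c)
  have "continuous_on S (\<lambda>\<xi>. hom_eval (\<lambda>c. c) p (($) \<xi>))"
    unfolding hom_eval_def by (rule continuous_on_sum) (rule continuous_on_mult[OF continuous_on_const m])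
  then show ?thesis by (simp only: p[symmetric] )
qed

lemma cpoly_fun_continuous:
  assumes "cpoly_fun f"
  shows "continuous_on S f"
proof -
  have R: "continuous_on S (\<lambda>\<xi>. Re (f \<xi>))" and I: "continuous_on S (\<lambda>\<xi>. Im (f \<xi>))"
    using assms unfolding cpoly_fun_def by (blast intro: poly_fun_continuous)+
  have "continuous_on S (\<lambda>\<xi>. complex_of_real (Re (f \<xi>)) + \<i> * complex_of_real (Im (f \<xi>)))"
    by (intro continuous_on_add continuous_on_mult continuous_on_const continuous_on_of_real R I)
  then show ?thesis by (simp only: complex_eq[symmetric])
qed

text \<open>The squared modulus of \<open>f\<close> is a real polynomial with the same zeros; the
  points \<open>a\<close> and \<open>b\<close> show that it is not constant.\<close>

lemma algebraic_hypersurface_zero_set: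
  fixes f :: "real^'m::finite \<Rightarrow> complex"
  assumes "cpoly_fun f" "f a = 0" "f b \<noteq> 0"
  shows "algebraic_hypersurface {\<xi>. f \<xi> = 0}"
proof -
  have "poly_fun (\<lambda>c. c) ($) (\<lambda>\<xi>. (Re (f \<xi>))\<^sup>2 + (Im (f \<xi>))\<^sup>2)"
    using assms(1) unfolding cpoly_fun_def
    by (elim conjE) (intro poly_functions.add[OF poly_functions_id] poly_functions.power[OF poly_functions_id])
  then obtain p :: "('m, real) mpoly"
    where p: "\<forall>\<xi>. (Re (f \<xi>))\<^sup>2 + (Im (f \<xi>))\<^sup>2 = mpoly_eval p (($) \<xi>)"
    unfolding poly_fun_def mpoly_eval_hom_eval by (rule exE)
  have z: "f \<xi> = 0 \<longleftrightarrow> mpoly_eval p (($) \<xi>) = 0" for \<xi>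
    using p[rule_format, of \<xi>, symmetric] by (simp add: complex_eq_iff sum_power2_eq_zero_iff)
  have "\<not> Poly_Mapping.keys p \<subseteq> {0}"
  proof
    assume "Poly_Mapping.keys p \<subseteq> {0}"
    then have "Poly_Mapping.keys p = {} \<or> Poly_Mapping.keys p = {0}" by blast
    then have "mpoly_eval p (($) a) = mpoly_eval p (($) b)"
      unfolding mpoly_eval_def by (elim disjE) simp_all
    then show False using z[of a] z[of b] assms(2,3) by simp
  qed
  moreover have "{\<xi>. f \<xi> = 0} = {\<xi>. mpoly_eval p (($) \<xi>) = 0}"
    by (intro Collect_cong z)
  ultimately show ?thesis
    unfolding algebraic_hypersurface_def by (intro exI[of _ p] conjI)
qed

text \<open>The function \<open>f\<close> may be a nonzero constant, whose zero set is no
  hypersurface. A linear factor that vanishes somewhere but not at \<open>b\<close> repairs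
  this.\<close>

lemma zero_set_subset_hypersurface:
  fixes f :: "real^'m::finite \<Rightarrow> complex"
  assumes "cpoly_fun f" "f b \<noteq> 0" "\<And>\<xi>. \<xi> \<in> L \<Longrightarrow> f \<xi> = 0" 
  shows "\<exists>H. algebraic_hypersurface H \<and> L \<subseteq> H"
proof -
  fix i :: 'm
  define g where "g c \<xi> = f \<xi> * (complex_of_real (\<xi> $ i) - of_real c)" for c \<xi>
  let ?c = "b $ i + 1"
  have "cpoly_fun (g ?c)" unfolding g_def by (intro cpoly_fun_intros assms(1))
  moreover have "g ?c (b + axis i 1) = 0" by (simp add: g_def axis_def)
  moreover have "g ?c b \<noteq> 0" using assms(2) by (simp add: g_def)
  ultimately have "algebraic_hypersurface {\<xi>. g ?c \<xi> = 0}"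
    by (rule algebraic_hypersurface_zero_set[of "g ?c" "b + axis i 1" b])
  moreover have "L \<subseteq> {\<xi>. g ?c \<xi> = 0}"
    by (rule subsetI) (simp add: g_def assms(3))
  ultimately show ?thesis by (intro exI[of _ "{\<xi>. g ?c \<xi> = 0}"] conjI)
qed

subsection \<open>Extension of valuation rings\<close>

definition subring_of_field :: "'a::field set \<Rightarrow> bool" where
  "subring_of_field S \<longleftrightarrow> 1 \<in> S \<and> (\<forall>a\<in>S. \<forall>b\<in>S. a - b \<in> S \<and> a * b \<in> S)"

lemma subring_of_fieldD:
  assumes "subring_of_field S"
  shows "0 \<in> S" "1 \<in> S" "a \<in> S \<Longrightarrow> - a \<in> S" "a \<in> S \<Longrightarrow> b \<in> S \<Longrightarrow> a - b \<in> S"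
    "a \<in> S \<Longrightarrow> b \<in> S \<Longrightarrow> a + b \<in> S" "a \<in> S \<Longrightarrow> b \<in> S \<Longrightarrow> a * b \<in> S"
    "a \<in> S \<Longrightarrow> a ^ n \<in> S" "of_int k \<in> S" "of_nat l \<in> S"
    "(\<And>i. i \<in> I \<Longrightarrow> f i \<in> S) \<Longrightarrow> sum f I \<in> S"
    "(\<And>i. i \<in> I \<Longrightarrow> f i \<in> S) \<Longrightarrow> prod f I \<in> S"
proof -
  have 1: "1 \<in> S" and d: "a \<in> S \<Longrightarrow> b \<in> S \<Longrightarrow> a - b \<in> S" and m: "a \<in> S \<Longrightarrow> b \<in> S \<Longrightarrow> a * b \<in> S" for a b
    using assms by (auto simp: subring_of_field_def)
  have 0: "0 \<in> S" using d[OF 1 1] by simp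
  have u: "- a \<in> S" if "a \<in> S" for a using d[OF 0 that] by simp
  have p: "a + b \<in> S" if "a \<in> S" "b \<in> S" for a b using d[OF that(1) u[OF that(2)]] by simp
  have n: "of_nat l \<in> S" for l by (induction l) (simp_all add: 0 1 p)
  show "0 \<in> S" "1 \<in> S" "a \<in> S \<Longrightarrow> - a \<in> S" "a \<in> S \<Longrightarrow> b \<in> S \<Longrightarrow> a - b \<in> S"
    "a \<in> S \<Longrightarrow> b \<in> S \<Longrightarrow> a + b \<in> S" "a \<in> S \<Longrightarrow> b \<in> S \<Longrightarrow> a * b \<in> S" "of_nat l \<in> S"
    by (fact 0 1 u d p m n)+
  show "a \<in> S \<Longrightarrow> a ^ n \<in> S" by (induction n) (simp_all add: 1 m)
  show "of_int k \<in> S" by (cases k rule: int_cases2) (simp_all add: n u)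
  show "(\<And>i. i \<in> I \<Longrightarrow> f i \<in> S) \<Longrightarrow> sum f I \<in> S"
    by (induction I rule: infinite_finite_induct) (simp_all add: 0 p)
  show "(\<And>i. i \<in> I \<Longrightarrow> f i \<in> S) \<Longrightarrow> prod f I \<in> S"
    by (induction I rule: infinite_finite_induct) (simp_all add: 1 m)
qed

definition polys_over :: "'a::field set \<Rightarrow> 'a poly set" where
  "polys_over S = {q. \<forall>n. coeff q n \<in> S}"

text \<open>Chevalley's argument. If neither z nor 1/z lies in \<open>S\<close>, maximality puts 1/p
  into both S[z] and S[1/z]. Since 1 - p c is a unit of \<open>S\<close> for every c in
  \<open>S\<close>, either relation can be used to eliminate the leading power of the other, and the
  degrees descend to a contradiction.\<close>

lemma maximal_subring_valuation:
  fixes p :: "'a::field"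
  assumes S: "subring_of_field S" and p: "p \<in> S" "p \<noteq> 0" "inverse p \<notin> S"
    and max: "\<And>T. subring_of_field T \<Longrightarrow> S \<subseteq> T \<Longrightarrow> inverse p \<notin> T \<Longrightarrow> T = S"
  shows "z \<in> S \<or> inverse z \<in> S"
proof -
  note sr = subring_of_fieldD[OF S]
  have adjoin: "\<exists>q\<in>polys_over S. poly q z = inverse p" if z: "z \<notin> S" for z
  proof (rule ccontr)
    assume neg: "\<not> ?thesis"
    define T where "T = (\<lambda>q. poly q z) ` polys_over S"
    have "subring_of_field T"
      unfolding subring_of_field_def
    proof (intro conjI ballI)
      have "(1::'a poly) \<in> polys_over S" by (auto simp: polys_over_def coeff_1 sr)
      then show "1 \<in> T" unfolding T_def by (metis imageI poly_1)
    next
      fix a b assume "a \<in> T" "b \<in> T"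
      then obtain q r where qr: "q \<in> polys_over S" "r \<in> polys_over S" "a = poly q z" "b = poly r z"
        unfolding T_def by auto
      have "q - r \<in> polys_over S" "q * r \<in> polys_over S"
        using qr(1,2) by (auto simp: polys_over_def coeff_mult intro!: sr)
      then show "a - b \<in> T" "a * b \<in> T"
        unfolding T_def qr by (metis imageI poly_diff, metis imageI poly_mult)
    qed
    moreover have "S \<subseteq> T"
    proof
      fix a assume "a \<in> S"
      then have "[:a:] \<in> polys_over S" by (auto simp: polys_over_def coeff_pCons sr split: nat.splits)
      then show "a \<in> T" unfolding T_def by (force intro!: image_eqI[of _ _ "[:a:]"])
    qed
    moreover have "inverse p \<notin> T" using neg unfolding T_def by force
    moreover have "z \<in> T"
    proof -
      have "[:0, 1:] \<in> polys_over S" by (auto simp: polys_over_def coeff_pCons sr split: nat.splits)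
      then show ?thesis unfolding T_def by (force intro!: image_eqI[of _ _ "[:0, 1:]"])
    qed
    ultimately show False using max[of T] z by auto
  qed
  \<comment> \<open>If 1/u were outside \<open>S\<close>, then 1/p would be a polynomial in 1/u over
    \<open>S\<close>. Multiplying by u^n puts u^n / p into \<open>S\<close>; as u^n is 1 modulo p,
    this would put 1/p into \<open>S\<close>.\<close>
  have unit: "1 - p * c \<noteq> 0 \<and> inverse (1 - p * c) \<in> S" if c: "c \<in> S" for c
  proof
    define u where "u = 1 - p * c"
    show "1 - p * c \<noteq> 0"
    proof
      assume "1 - p * c = 0"
      then have "inverse p = c" by (intro inverse_unique) simp
      then show False using p c by simp
    qed
    then have u0: "u \<noteq> 0" by (simp add: u_def)
    show "inverse (1 - p * c) \<in> S"
    proof (rule ccontr)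
      assume "inverse (1 - p * c) \<notin> S"
      then obtain q where q: "q \<in> polys_over S" "poly q (inverse u) = inverse p"
        using adjoin unfolding u_def by blast
      let ?n = "degree q"
      have uS: "u \<in> S" unfolding u_def using c p by (intro sr)
      have "u ^ ?n * inverse p = (\<Sum>i\<le>?n. coeff q i * (inverse u ^ i * u ^ ?n))"
        unfolding q(2)[symmetric] by (simp add: poly_altdef sum_distrib_left mult_ac)
      also have "\<dots> = (\<Sum>i\<le>?n. coeff q i * u ^ (?n - i))"
        using u0 by (intro sum.cong refl) (simp add: power_diff power_inverse field_simps)
      also have "\<dots> \<in> S" using q(1) uS by (intro sr) (auto simp: polys_over_def)
      finally have 1: "u ^ ?n * inverse p \<in> S" .
      have "\<exists>c'\<in>S. u ^ k = 1 - p * c'" for k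
      proof (induction k)
        case 0
        show ?case by (rule bexI[of _ 0]) (simp_all add: sr)
      next
        case (Suc k)
        then obtain c' where c': "c' \<in> S" "u ^ k = 1 - p * c'" by blast
        have "u ^ Suc k = u * (1 - p * c')" by (simp add: c'(2))
        also have "\<dots> = 1 - p * (c + c' - p * c * c')" by (simp add: u_def algebra_simps)
        finally have "u ^ Suc k = 1 - p * (c + c' - p * c * c')" .
        moreover have "c + c' - p * c * c' \<in> S" using c c' p by (intro sr)
        ultimately show ?case by blast
      qed
      then obtain c' where c': "c' \<in> S" "u ^ ?n = 1 - p * c'" by blast
      have "inverse p = u ^ ?n * inverse p + c'"
        unfolding c' using p by (simp add: algebra_simps)
      also have "\<dots> \<in> S" by (rule sr(5)[OF 1 c'(1)])
      finally show False using p by simp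
    qed
  qed
  \<comment> \<open>Descent on the sum of the two degrees: \<open>main\<close> lowers the larger
    one, and the second case is the first with z replaced by its inverse.\<close>
  have no_pair: False
    if "q \<in> polys_over S" "r \<in> polys_over S" "poly q z = inverse p" "poly r (inverse z) = inverse p" "z \<noteq> 0" for q r z
    using that
  proof (induction "degree q + degree r" arbitrary: q r z rule: less_induct)
    case less
    have main: False
      if le: "degree r \<le> degree q" and q: "q \<in> polys_over S" "poly q z = inverse p"
        and r: "r \<in> polys_over S" "poly r (inverse z) = inverse p" and z: "z \<noteq> 0"
        and IH: "\<And>q'. degree q' < degree q \<Longrightarrow> q' \<in> polys_over S \<Longrightarrow> poly q' z = inverse p \<Longrightarrow> False"
      for q r z
    proof -
      let ?n = "degree q" and ?k = "degree r"
      have qS: "coeff q i \<in> S" and rS: "coeff r i \<in> S" for i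
        using q r by (auto simp: polys_over_def)
      have "?n \<noteq> 0"
      proof
        assume "?n = 0"
        then have "poly q z = coeff q 0" by (simp add: poly_altdef)
        then show False using q(2) qS p by metis
      qed
      \<comment> \<open>Moving the constant coefficient of \<open>r\<close> to the other side leaves
        the unit 1 - p r_0 there, and the relation becomes a formula for z^n in lower powers of
        z.\<close>
      define u where "u = 1 - p * coeff r 0"
      have u: "u \<noteq> 0" "inverse u \<in> S" using unit[OF rS] by (auto simp: u_def)
      have "inverse p = (\<Sum>j\<le>?k. coeff r j * inverse z ^ j)"
        using r(2) by (simp add: poly_altdef)
      also have "\<dots> = coeff r 0 + (\<Sum>j\<in>{1..?k}. coeff r j * inverse z ^ j)"
        by (simp add: atMost_atLeast0 sum.atLeast_Suc_atMost)
      finally have "p * inverse p = p * coeff r 0 + p * (\<Sum>j\<in>{1..?k}. coeff r j * inverse z ^ j)"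
        by (simp add: distrib_left)
      then have "u = p * (\<Sum>j\<in>{1..?k}. coeff r j * inverse z ^ j)"
        using p by (simp add: u_def algebra_simps)
      then have "z ^ ?n * (inverse u * u) = z ^ ?n * (inverse u * (p * (\<Sum>j\<in>{1..?k}. coeff r j * inverse z ^ j)))"
        by simp
      then have zn: "z ^ ?n = (\<Sum>j\<in>{1..?k}. p * coeff r j * inverse u * (z ^ ?n * inverse z ^ j))"
        using u by (simp add: sum_distrib_left mult_ac)
      also have "\<dots> = (\<Sum>j\<in>{1..?k}. p * coeff r j * inverse u * z ^ (?n - j))"
        using z le by (intro sum.cong refl) (simp add: power_diff power_inverse field_simps)
      finally have zn: "z ^ ?n = (\<Sum>j\<in>{1..?k}. p * coeff r j * inverse u * z ^ (?n - j))" .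
      define s where "s = (\<Sum>j\<in>{1..?k}. monom (p * coeff r j * inverse u) (?n - j))"
      define q' where "q' = q - monom (coeff q ?n) ?n + smult (coeff q ?n) s"
      have cs: "coeff s i = (\<Sum>j\<in>{1..?k}. if ?n - j = i then p * coeff r j * inverse u else 0)" for i
        by (simp add: s_def coeff_sum coeff_monom)
      have "coeff s i \<in> S" for i
        unfolding cs using p rS u by (intro sr(10)) (auto intro!: sr)
      then have q'S: "q' \<in> polys_over S"
        unfolding q'_def polys_over_def
        using qS by (auto simp: coeff_monom intro!: sr)
      have "poly s z = z ^ ?n" by (simp add: s_def poly_sum poly_monom zn)
      then have q'z: "poly q' z = inverse p"
        using q(2) by (simp add: q'_def poly_monom)
      have "coeff q' i = 0" if "i \<ge> ?n" for i
      proof -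
        have "coeff s i = 0"
          unfolding cs using that \<open>?n \<noteq> 0\<close> by (intro sum.neutral) auto
        then show ?thesis
          using that by (cases "i = ?n") (auto simp: q'_def coeff_monom coeff_eq_0)
      qed
      then have "degree q' < ?n"
        using \<open>?n \<noteq> 0\<close> by (metis leading_coeff_0_iff degree_0 not_le_imp_less zero_less_iff_neq_zero)
      then show False using IH q'S q'z by blast
    qed
    show False
    proof (cases "degree r \<le> degree q")
      case True
      show False
      proof (rule main[OF True less.prems(1,3,2,4,5)])
        fix q' assume "degree q' < degree q" "q' \<in> polys_over S" "poly q' z = inverse p"
        then show False using less.hyps[of q' r z] less.prems by simp
      qed
    next
      case False
      then have "degree q \<le> degree r" by simp
      then show False
      proof (rule main[of q r "inverse z"])
        fix r' assume "degree r' < degree r" "r' \<in> polys_over S" "poly r' (inverse z) = inverse p"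
        then show False using less.hyps[of q r' z] less.prems by simp
      qed (use less.prems in auto)
    qed
  qed
  show ?thesis
  proof (rule ccontr)
    assume neg: "\<not> ?thesis"
    then have "z \<noteq> 0" using sr by auto
    obtain q r where "q \<in> polys_over S" "r \<in> polys_over S" "poly q z = inverse p" "poly r (inverse z) = inverse p"
      using neg adjoin by blast
    then show False using no_pair \<open>z \<noteq> 0\<close> by blast
  qed
qed

text \<open>Zorn's lemma for the subrings that contain \<open>A\<close> and avoid 1/p;
  \<open>maximal_subring_valuation\<close> applies to a maximal one.\<close>

lemma valuation_ring_exists:
  fixes p :: "'a::field"
  assumes A: "subring_of_field A" and p: "p \<in> A" "p \<noteq> 0" "inverse p \<notin> A"
  shows "\<exists>V. subring_of_field V \<and> A \<subseteq> V \<and> inverse p \<notin> V \<and> (\<forall>z. z \<in> V \<or> inverse z \<in> V)"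
proof -
  define F where "F = {S. subring_of_field S \<and> A \<subseteq> S \<and> inverse p \<notin> S}"
  have "\<exists>M\<in>F. \<forall>X\<in>F. M \<subseteq> X \<longrightarrow> X = M"
  proof (rule subset_Zorn_nonempty)
    show "F \<noteq> {}" using A p by (auto simp: F_def)
  next
    fix C assume C: "C \<noteq> {}" "subset.chain F C"
    have CF: "C \<subseteq> F" and ch: "\<And>S T. S \<in> C \<Longrightarrow> T \<in> C \<Longrightarrow> S \<subseteq> T \<or> T \<subseteq> S"
      using C(2) by (auto simp: subset.chain_def)
    have "subring_of_field (\<Union>C)"
      unfolding subring_of_field_def
    proof (intro conjI ballI)
      show "1 \<in> \<Union>C" using C(1) CF by (auto simp: F_def subring_of_field_def)
    next
      fix a b assume "a \<in> \<Union>C" "b \<in> \<Union>C"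
      then obtain S T where ST: "S \<in> C" "a \<in> S" "T \<in> C" "b \<in> T" by blast
      from ch[OF ST(1,3)] have "\<exists>U\<in>C. a \<in> U \<and> b \<in> U"
      proof
        assume "S \<subseteq> T"
        then show ?thesis using ST by (intro bexI[of _ T]) auto
      next
        assume "T \<subseteq> S"
        then show ?thesis using ST by (intro bexI[of _ S]) auto
      qed
      then obtain U where U: "U \<in> C" "a \<in> U" "b \<in> U" by blast
      then have "U \<in> F" using CF by blast
      then have "subring_of_field U" unfolding F_def by simp
      then have "a - b \<in> U" "a * b \<in> U" using U by (auto simp: subring_of_field_def)
      then show "a - b \<in> \<Union>C" "a * b \<in> \<Union>C" using U(1) by blast+
    qed
    then show "\<Union>C \<in> F" using C(1) CF by (auto simp: F_def)
  qed
  then obtain V where V: "V \<in> F" "\<forall>X\<in>F. V \<subseteq> X \<longrightarrow> X = V" by (elim bexE)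
  have "z \<in> V \<or> inverse z \<in> V" for z
  proof (rule maximal_subring_valuation[of V p])
    show "subring_of_field V" "p \<in> V" "p \<noteq> 0" "inverse p \<notin> V" using V(1) p by (auto simp: F_def)
    show "T = V" if "subring_of_field T" "V \<subseteq> T" "inverse p \<notin> T" for T
      using V that by (auto simp: F_def)
  qed
  then show ?thesis using V(1) by (auto simp: F_def)
qed

subsection \<open>The ring of two-variable integer polynomials at the prime 2\<close>

lemma prime_elem_two_poly: "prime_elem (2 :: int poly)" "prime_elem (2 :: int poly poly)"
proof -
  have "prime_elem (2::int)" by simp
  then have "prime_elem [:2::int:]" by (rule lift_prime_elem_poly)
  then show *: "prime_elem (2 :: int poly)" by (simp add: numeral_poly)
  then have "prime_elem [:2::int poly:]" by (rule lift_prime_elem_poly)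
  then show "prime_elem (2 :: int poly poly)" by (simp add: numeral_poly)
qed

lemma two_dvd_mult_poly_iff:
  fixes a b :: "int poly" and c d :: "int poly poly"
  shows "2 dvd a * b \<longleftrightarrow> 2 dvd a \<or> 2 dvd b" "2 dvd c * d \<longleftrightarrow> 2 dvd c \<or> 2 dvd d"
  using prime_elem_two_poly prime_elem_dvd_mult_iff by blast+

lemma two_power_dvd_poly_iff: "2 ^ k dvd (p :: int poly) \<longleftrightarrow> (\<forall>n. 2 ^ k dvd coeff p n)"
proof -
  have "(2 :: int poly) ^ k = [:2 ^ k:]"
    by (induction k) (simp_all add: numeral_poly)
  then show ?thesis by (simp add: const_poly_dvd_iff)
qed

lemma two_power_dvd_poly_poly_iff: "2 ^ k dvd (p :: int poly poly) \<longleftrightarrow> (\<forall>n. 2 ^ k dvd coeff p n)"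
proof -
  have "(2 :: int poly poly) ^ k = [:2 ^ k:]"
    by (induction k) (simp_all add: numeral_poly)
  then show ?thesis by (simp add: const_poly_dvd_iff)
qed

lemma two_dvd_poly_iff: "2 dvd (p :: int poly) \<longleftrightarrow> (\<forall>n. even (coeff p n))"
  using two_power_dvd_poly_iff[of 1 p] by simp

lemma two_dvd_of_int_poly: "2 dvd (of_int k :: int poly) \<longleftrightarrow> even k"
  unfolding two_dvd_poly_iff
  by (auto simp: of_int_poly coeff_pCons split: nat.splits)

text \<open>\<open>V\<close> is a valuation ring of the complex numbers that restricts to the 2-adic Gauss valuation on
  the image of \<open>\<int>[y][s]\<close>.\<close>

locale two_adic =
  fixes ev :: "int poly poly \<Rightarrow> complex" and V :: "complex set" and kk :: "'m::finite \<Rightarrow> nat"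
  assumes ev: "comm_ring_hom ev" and inj_ev: "inj ev" and inj_kk: "inj kk"
    and V: "subring_of_field V" and val: "z \<in> V \<or> inverse z \<in> V"
    and ev_frac: "\<not> 2 dvd q \<Longrightarrow> ev p / ev q \<in> V" and half: "inverse 2 \<notin> V"
begin

sublocale ev: comm_ring_hom ev by (rule ev)

lemmas V_intros = subring_of_fieldD[OF V]

lemma ev_V: "ev p \<in> V"
  using ev_frac[of 1 p] by (simp add: two_dvd_mult_poly_iff prime_elem_two_poly(2)[THEN prime_elem_not_unit])

lemma ev_eq_0_iff [simp]: "ev p = 0 \<longleftrightarrow> p = 0"
  using inj_ev by (metis ev.hom_zero injD)

lemma ev_two [simp]: "ev (numeral k) = numeral k"
  by (rule ev.hom_numeral)

text \<open>Membership in 2^k V, which serves as congruence to 0 modulo 2^k for arbitrary complex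
  numbers.\<close>

definition two_dvd_V :: "nat \<Rightarrow> complex \<Rightarrow> bool" where
  "two_dvd_V k z \<longleftrightarrow> z / 2 ^ k \<in> V"

lemma two_dvd_V_0: "two_dvd_V 0 z \<longleftrightarrow> z \<in> V"
  by (simp add: two_dvd_V_def)

lemma two_dvd_V_zero [simp]: "two_dvd_V k 0"
  by (simp add: two_dvd_V_def V_intros)

lemma two_dvd_V_add: "two_dvd_V k x \<Longrightarrow> two_dvd_V k y \<Longrightarrow> two_dvd_V k (x + y)"
  by (auto simp: two_dvd_V_def add_divide_distrib intro: V_intros)

lemma two_dvd_V_minus: "two_dvd_V k x \<Longrightarrow> two_dvd_V k (- x)"
  by (auto simp: two_dvd_V_def intro: V_intros)

lemma two_dvd_V_diff: "two_dvd_V k x \<Longrightarrow> two_dvd_V k y \<Longrightarrow> two_dvd_V k (x - y)"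
  by (auto simp: two_dvd_V_def diff_divide_distrib intro: V_intros)

lemma two_dvd_V_mult: "two_dvd_V j x \<Longrightarrow> two_dvd_V k y \<Longrightarrow> two_dvd_V (j + k) (x * y)"
  using V_intros(6)[of "x / 2 ^ j" "y / 2 ^ k"] by (simp add: two_dvd_V_def power_add)

lemma two_dvd_V_mult_V: "two_dvd_V j x \<Longrightarrow> y \<in> V \<Longrightarrow> two_dvd_V j (x * y)"
  using two_dvd_V_mult[of j x 0 y] by (simp add: two_dvd_V_0)

lemma two_dvd_V_sum: "(\<And>i. i \<in> I \<Longrightarrow> two_dvd_V k (f i)) \<Longrightarrow> two_dvd_V k (sum f I)"
  by (induction I rule: infinite_finite_induct) (simp_all add: two_dvd_V_add)

lemma two_dvd_V_mono:
  assumes "two_dvd_V k x" "j \<le> k"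
  shows "two_dvd_V j x"
proof -
  have "x / 2 ^ k * 2 ^ (k - j) \<in> V"
    using assms(1) V_intros(9)[of 2] unfolding two_dvd_V_def by (intro V_intros) simp_all
  also have "x / 2 ^ k * 2 ^ (k - j) = x / 2 ^ j"
    using assms(2) by (simp add: power_diff)
  finally show ?thesis by (simp add: two_dvd_V_def)
qed

lemma two_dvd_V_times_power: "x \<in> V \<Longrightarrow> two_dvd_V k (2 ^ k * x)"
  by (simp add: two_dvd_V_def)

text \<open>If b is odd, 1 / \<open>ev b\<close> lies in V, so that \<open>ev b / 2\<close> in V
  would put 1/2 into V. Hence V sees exactly the powers of 2 that divide a polynomial.\<close>

lemma two_dvd_V_ev_iff: "two_dvd_V k (ev a) \<longleftrightarrow> 2 ^ k dvd a"
proof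
  assume "2 ^ k dvd a"
  then obtain b where "a = 2 ^ k * b" by blast
  then show "two_dvd_V k (ev a)"
    using two_dvd_V_times_power[OF ev_V] by (simp add: ev.hom_mult ev.hom_power)
next
  show "two_dvd_V k (ev a) \<Longrightarrow> 2 ^ k dvd a"
  proof (induction k)
    case 0
    then show ?case by simp
  next
    case (Suc k)
    then obtain b where b: "a = 2 ^ k * b" using two_dvd_V_mono[OF Suc.prems] by auto
    have h: "ev b / 2 \<in> V"
      using Suc.prems by (simp add: two_dvd_V_def b ev.hom_mult ev.hom_power)
    have "2 dvd b"
    proof (rule ccontr)
      assume nb: "\<not> 2 dvd b"
      then have "ev b \<noteq> 0" by auto
      then have "inverse 2 = ev b / 2 * (ev 1 / ev b)" by (simp add: field_simps)
      also have "\<dots> \<in> V" using h ev_frac[OF nb] by (intro V_intros)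
      finally show False using half by simp
    qed
    then show ?case by (auto simp: b mult.commute)
  qed
qed

definition unit_V :: "complex \<Rightarrow> bool" where
  "unit_V u \<longleftrightarrow> u \<noteq> 0 \<and> u \<in> V \<and> inverse u \<in> V"

lemma unit_V_ev: "\<not> 2 dvd q \<Longrightarrow> unit_V (ev q)"
  using ev_frac[of q 1] ev_V by (auto simp: unit_V_def divide_inverse)

text \<open>2 is a nonunit of the local ring V. Concretely, for w = 1 + 2c with c in V the number
  w/2 is not in V, so 2/w is, and 1/w = 1 - c (2/w).\<close>

lemma unit_V_add:
  assumes "unit_V u" "two_dvd_V 1 d"
  shows "unit_V (u + d)"
proof -
  have uV: "u \<noteq> 0" "u \<in> V" "inverse u \<in> V" using assms by (auto simp: unit_V_def)
  have dV: "d / 2 \<in> V" using assms by (simp add: two_dvd_V_def)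
  define c where "c = d / 2 * inverse u"
  have c: "c \<in> V" unfolding c_def by (rule V_intros(6)[OF dV uV(3)])
  define w where "w = 1 + 2 * c"
  have ud: "u + d = u * w" using uV by (simp add: w_def c_def field_simps)
  have w0: "w \<noteq> 0"
  proof
    assume "w = 0"
    then have "inverse 2 = - c" by (simp add: w_def add_eq_0_iff field_simps)
    then show False using half V_intros(3)[OF c] by (simp only: not_True_eq_False)
  qed
  have "w / 2 \<notin> V"
  proof
    assume "w / 2 \<in> V"
    then have "w / 2 - c \<in> V" by (rule V_intros(4)[OF _ c])
    then show False using half by (simp add: w_def field_simps)
  qed
  then have "2 / w \<in> V" using val[of "w / 2"] by simp
  then have "1 - c * (2 / w) \<in> V" using c by (intro V_intros)
  moreover have "1 - c * (2 / w) = inverse w" using w0 by (simp add: w_def field_simps)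
  ultimately have "inverse w \<in> V" by simp
  moreover have "2 \<in> V" using V_intros(9)[of 2] by simp
  then have "w \<in> V" unfolding w_def using c by (intro V_intros)
  ultimately show ?thesis
    using uV w0 V_intros(6) by (simp add: unit_V_def ud)
qed

lemma two_dvd_V_divide_unit: "two_dvd_V k x \<Longrightarrow> unit_V u \<Longrightarrow> two_dvd_V k (x / u)"
  using two_dvd_V_mult_V[of k x "inverse u"] by (simp add: unit_V_def divide_inverse)

text \<open>The parameters are specialised to \<open>\<xi>\<^sub>i = z\<^sub>i (z\<^sub>i + s)\<close>, so that modulo 2 the poles
  \<open>\<xi>\<^sub>i = \<plusminus>\<xi>\<^sub>j\<close> lie at the pairwise distinct points \<open>s = z\<^sub>i + z\<^sub>j\<close>.\<close>

definition zz :: "'m \<Rightarrow> int poly" where "zz i = monom 1 (kk i)"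

definition xi :: "'m \<Rightarrow> int poly poly" where "xi i = [:zz i * zz i, zz i:]"

definition at_pole :: "'m \<Rightarrow> 'm \<Rightarrow> int poly poly \<Rightarrow> int poly" where
  "at_pole i j q = poly q (zz i + zz j)"

text \<open>The localisation of Z[y][s] at the prime (2, s - z_i - z_j), viewed inside the complex
  numbers.\<close>

definition loc :: "'m \<Rightarrow> 'm \<Rightarrow> complex set" where
  "loc i j = {ev a / ev q | a q. \<not> 2 dvd at_pole i j q}"

lemma coeff_zz: "coeff (zz i) n = (if n = kk i then 1 else 0)"
  by (auto simp: zz_def coeff_monom)

lemma kk_eq_iff [simp]: "kk i = kk j \<longleftrightarrow> i = j"
  using inj_kk by (auto simp: inj_eq)

lemma at_pole_simps:
  "at_pole i j (a + b) = at_pole i j a + at_pole i j b"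
  "at_pole i j (a - b) = at_pole i j a - at_pole i j b"
  "at_pole i j (a * b) = at_pole i j a * at_pole i j b"
  "at_pole i j (- a) = - at_pole i j a"
  "at_pole i j (of_int k) = of_int k"
  "at_pole i j (numeral n) = numeral n"
  "at_pole i j 1 = 1"
  "at_pole i j 0 = 0"
  by (simp_all add: at_pole_def of_int_poly)

lemma at_pole_two_dvd: "2 dvd q \<Longrightarrow> 2 dvd at_pole i j q"
  by (auto simp: dvd_def at_pole_simps)

lemma loc_subring: "subring_of_field (loc i j)"
  unfolding subring_of_field_def
proof (intro conjI ballI)
  have "\<not> 2 dvd at_pole i j 1"
    using prime_elem_two_poly(1)[THEN prime_elem_not_unit] by (simp add: at_pole_simps)
  then show "1 \<in> loc i j" unfolding loc_def by (force intro!: exI[of _ 1])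
next
  fix a b assume "a \<in> loc i j" "b \<in> loc i j"
  then obtain p q r t where
    *: "a = ev p / ev q" "b = ev r / ev t" "\<not> 2 dvd at_pole i j q" "\<not> 2 dvd at_pole i j t"
    unfolding loc_def by blast
  have nz: "q \<noteq> 0" "t \<noteq> 0" using * by (auto simp: at_pole_simps)
  have qt: "\<not> 2 dvd at_pole i j (q * t)" using * by (simp add: at_pole_simps two_dvd_mult_poly_iff)
  have "a - b = ev (p * t - r * q) / ev (q * t)" "a * b = ev (p * r) / ev (q * t)"
    using nz by (simp_all add: * ev.hom_mult ev.hom_minus field_simps)
  then show "a - b \<in> loc i j" "a * b \<in> loc i j" unfolding loc_def using qt by blast+
qed

lemmas loc_intros = subring_of_fieldD[OF loc_subring]

lemma ev_loc: "ev a \<in> loc i j"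
proof -
  have "\<not> 2 dvd at_pole i j 1"
    using prime_elem_two_poly(1)[THEN prime_elem_not_unit] by (simp add: at_pole_simps)
  then show ?thesis
    unfolding loc_def mem_Collect_eq by (intro exI[of _ a] exI[of _ "1 :: int poly poly"]) simp
qed

lemma inverse_loc: "\<not> 2 dvd at_pole i j q \<Longrightarrow> inverse (ev q) \<in> loc i j"
  unfolding loc_def mem_Collect_eq
  by (rule exI[of _ "1 :: int poly poly"], rule exI[of _ q]) (simp add: inverse_eq_divide)

lemma loc_V: "x \<in> loc i j \<Longrightarrow> x \<in> V"
  unfolding loc_def using ev_frac at_pole_two_dvd by blast

lemma two_dvd_zz: "\<not> 2 dvd zz i"
  by (auto simp: two_dvd_poly_iff coeff_zz intro!: exI[of _ "kk i"])

lemma at_pole_xi: "at_pole i j (xi k) = zz k * (zz k + zz i + zz j)"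
  by (simp add: at_pole_def xi_def algebra_simps)

lemma not_two_dvd_xi: "i \<noteq> j \<Longrightarrow> \<not> 2 dvd at_pole i j (xi i)" "i \<noteq> j \<Longrightarrow> \<not> 2 dvd at_pole i j (xi j)"
proof -
  have "at_pole i j (xi i) = 2 * (zz i * zz i) + zz i * zz j"
    "at_pole i j (xi j) = 2 * (zz j * zz j) + zz i * zz j"
    by (simp_all add: at_pole_xi algebra_simps)
  then have "2 dvd at_pole i j (xi i) \<longleftrightarrow> 2 dvd zz i * zz j" "2 dvd at_pole i j (xi j) \<longleftrightarrow> 2 dvd zz i * zz j"
    by (simp_all add: dvd_add_right_iff)
  then show "\<not> 2 dvd at_pole i j (xi i)" "\<not> 2 dvd at_pole i j (xi j)"
    by (simp_all add: two_dvd_mult_poly_iff two_dvd_zz)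
qed

lemma not_two_dvd_xi_diff:
  assumes "i \<noteq> j"
  shows "\<not> 2 dvd xi i - xi j"
proof
  assume "2 dvd xi i - xi j"
  then have "2 dvd coeff (xi i - xi j) 1"
    using two_power_dvd_poly_poly_iff[of 1 "xi i - xi j"] by simp
  then have "2 dvd zz i - zz j" by (simp add: xi_def)
  then have "even (coeff (zz i - zz j) (kk i))" by (simp add: two_dvd_poly_iff)
  then show False using assms by (simp add: coeff_zz)
qed

lemma two_dvd_at_pole_xi_diff: "2 dvd at_pole i j (xi i - xi j)"
proof -
  have "at_pole i j (xi i - xi j) = 2 * (zz i * zz i - zz j * zz j)"
    by (simp add: at_pole_simps at_pole_xi algebra_simps)
  then show ?thesis by simp
qed

text \<open>At s = z_i + z_j the difference becomes (z_k - z_l) (z_k + z_l + z_i + z_j). The z's are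
  distinct monomials, so the second factor vanishes modulo 2 only for {k, l} = {i, j}: the poles of
  different pairs are separated.\<close>

lemma not_two_dvd_at_pole_xi_diff:
  assumes "k \<noteq> l" "{k, l} \<noteq> {i, j}" "i \<noteq> j"
  shows "\<not> 2 dvd at_pole i j (xi k - xi l)" "\<not> 2 dvd at_pole i j (xi k + xi l)"
proof -
  have 1: "\<not> 2 dvd zz k - zz l"
    using assms by (auto simp: two_dvd_poly_iff coeff_zz intro!: exI[of _ "kk k"])
  have "\<exists>n. odd (coeff (zz k + zz l + zz i + zz j) n)"
  proof (cases "k \<in> {i, j}")
    case False
    then show ?thesis using assms by (intro exI[of _ "kk k"]) (auto simp: coeff_zz)
  next
    case True
    then have "l \<notin> {i, j}" using assms by auto
    then show ?thesis using assms by (intro exI[of _ "kk l"]) (auto simp: coeff_zz)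
  qed
  then have 2: "\<not> 2 dvd zz k + zz l + zz i + zz j" by (simp add: two_dvd_poly_iff)
  have "at_pole i j (xi k - xi l) = (zz k - zz l) * (zz k + zz l + zz i + zz j)"
    by (simp add: at_pole_simps at_pole_xi algebra_simps)
  then show 3: "\<not> 2 dvd at_pole i j (xi k - xi l)"
    using 1 2 by (simp add: two_dvd_mult_poly_iff)
  have "at_pole i j (xi k + xi l) = at_pole i j (xi k - xi l) + 2 * at_pole i j (xi l)"
    by (simp add: at_pole_simps)
  then show "\<not> 2 dvd at_pole i j (xi k + xi l)" using 3 by (simp add: dvd_add_left_iff)
qed

definition lin :: "int^'m \<Rightarrow> int poly poly" where
  "lin a = (\<Sum>k\<in>UNIV. of_int (a $ k) * xi k)"

lemma lin_simps: "lin (a + b) = lin a + lin b" "lin (a - b) = lin a - lin b" "lin (- a) = - lin a"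
  by (simp_all add: lin_def algebra_simps sum.distrib sum_subtractf sum_negf)

text \<open>The coefficient of s in \<open>lin a\<close> is the sum of the a_k z_k, and the z_k are
  distinct monomials in y, so every a_k can be read off.\<close>

lemma two_power_dvd_lin_iff: "2 ^ k dvd lin a \<longleftrightarrow> (\<forall>i. 2 ^ k dvd a $ i)"
proof
  assume "2 ^ k dvd lin a"
  then have "2 ^ k dvd coeff (lin a) 1" using two_power_dvd_poly_poly_iff[of k] by blast
  also have "coeff (lin a) 1 = (\<Sum>l\<in>UNIV. of_int (a $ l) * zz l)"
    by (simp add: lin_def coeff_sum xi_def of_int_poly)
  finally have *: "2 ^ k dvd coeff (\<Sum>l\<in>UNIV. of_int (a $ l) * zz l) n" for n
    using two_power_dvd_poly_iff[of k] by blast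
  have "coeff (\<Sum>l\<in>UNIV. of_int (a $ l) * zz l) (kk i) = a $ i" for i
    by (simp add: coeff_sum of_int_poly coeff_zz if_distrib[of "(*) _"] cong: if_cong)
  then show "\<forall>i. 2 ^ k dvd a $ i" using * by metis
next
  assume *: "\<forall>i. 2 ^ k dvd a $ i"
  show "2 ^ k dvd lin a"
    unfolding lin_def
  proof (rule dvd_sum)
    fix i
    obtain b where "a $ i = 2 ^ k * b" using * by blast
    then show "2 ^ k dvd of_int (a $ i) * xi i" by simp
  qed
qed

definition X :: "'m \<Rightarrow> complex" where "X i = ev (xi i)"

text \<open>The residual information, modulo 16, that an eigenvalue carries at the pole \<open>\<xi>\<^sub>i = \<plusminus>\<xi>\<^sub>j\<close>.\<close>

definition pole_part :: "'m \<Rightarrow> 'm \<Rightarrow> complex \<Rightarrow> int \<Rightarrow> int \<Rightarrow> bool" where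
  "pole_part i j x \<alpha> \<beta> \<longleftrightarrow> (\<exists>D a a' r. a \<in> loc i j \<and> a' \<in> loc i j \<and> r \<in> V \<and>
     x = ev D + 4 * a + 8 * a' / (X i - X j)
       + 4 * X i * X j * (of_int \<alpha> / (X i - X j) + of_int \<beta> / (X i + X j)) + 16 * r)"

lemma pole_part_diff:
  assumes "pole_part i j x \<alpha> \<beta>" "pole_part i j y \<alpha>' \<beta>'"
  shows "pole_part i j (x - y) (\<alpha> - \<alpha>') (\<beta> - \<beta>')"
proof -
  obtain D a a' r where 1: "a \<in> loc i j" "a' \<in> loc i j" "r \<in> V"
    "x = ev D + 4 * a + 8 * a' / (X i - X j)
       + 4 * X i * X j * (of_int \<alpha> / (X i - X j) + of_int \<beta> / (X i + X j)) + 16 * r"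
    using assms(1) unfolding pole_part_def by blast
  obtain E b b' s where 2: "b \<in> loc i j" "b' \<in> loc i j" "s \<in> V"
    "y = ev E + 4 * b + 8 * b' / (X i - X j)
       + 4 * X i * X j * (of_int \<alpha>' / (X i - X j) + of_int \<beta>' / (X i + X j)) + 16 * s"
    using assms(2) unfolding pole_part_def by blast
  show ?thesis
    unfolding pole_part_def
    by (rule exI[of _ "D - E"], rule exI[of _ "a - b"], rule exI[of _ "a' - b'"], rule exI[of _ "r - s"])
       (use 1 2 in \<open>auto simp: ev.hom_minus algebra_simps diff_divide_distrib intro: loc_intros V_intros\<close>)
qed

lemma pole_part_ev: "pole_part i j (ev D) 0 0"
  unfolding pole_part_def
  by (rule exI[of _ D], rule exI[of _ 0], rule exI[of _ 0], rule exI[of _ 0])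
     (auto intro: loc_intros V_intros)

lemma pole_part_sum:
  assumes "\<And>l. l \<in> L \<Longrightarrow> pole_part i j (f l) (\<alpha> l) (\<beta> l)"
  shows "pole_part i j (sum f L) (sum \<alpha> L) (sum \<beta> L)"
  using assms
proof (induction L rule: infinite_finite_induct)
  case (insert l L)
  have 0: "pole_part i j (- sum f L) (- sum \<alpha> L) (- sum \<beta> L)"
    using pole_part_diff[OF pole_part_ev[of i j 0]] insert by simp
  have "pole_part i j (f l - - sum f L) (\<alpha> l - - sum \<alpha> L) (\<beta> l - - sum \<beta> L)"
    by (rule pole_part_diff[OF _ 0]) (use insert in auto)
  then show ?case using insert by simp
qed (use pole_part_ev[of i j 0] in auto)

lemma ev_dvd_cancel:
  fixes q D :: "int poly poly"
  assumes "\<not> 2 dvd q" "2 ^ k dvd q * D"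
  shows "2 ^ k dvd D"
proof -
  have "q \<noteq> 0" using assms(1) by auto
  have "two_dvd_V k (ev (q * D) / ev q)"
    using assms by (intro two_dvd_V_divide_unit unit_V_ev) (simp_all add: two_dvd_V_ev_iff)
  then show ?thesis using \<open>q \<noteq> 0\<close> by (simp add: ev.hom_mult two_dvd_V_ev_iff)
qed

text \<open>Clearing denominators with u h^2, where h = \<xi>_i - \<xi>_j and u is a unit of
  \<open>loc i j\<close>, turns the relation into divisibility of a polynomial \<open>G\<close> by
  16. Dividing by powers of 2 and evaluating modulo 2 at the pole, where h vanishes and u \<xi>_i
  \<xi>_j does not, isolates first \<alpha> + \<beta> and then \<beta>.\<close>

lemma pole_part_zero:
  assumes ij: "i \<noteq> j" and x: "pole_part i j 0 \<alpha> \<beta>"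
  shows "even \<alpha> \<and> even \<beta>"
proof -
  obtain D a a' r where aa: "a \<in> loc i j" "a' \<in> loc i j" and r: "r \<in> V"
    and eq: "0 = ev D + 4 * a + 8 * a' / (X i - X j)
       + 4 * X i * X j * (of_int \<alpha> / (X i - X j) + of_int \<beta> / (X i + X j)) + 16 * r"
    using x unfolding pole_part_def by blast
  obtain a0 q0 where a0: "a = ev a0 / ev q0" "\<not> 2 dvd at_pole i j q0" using aa(1) unfolding loc_def by blast
  obtain a1 q1 where a1: "a' = ev a1 / ev q1" "\<not> 2 dvd at_pole i j q1" using aa(2) unfolding loc_def by blast
  define u where "u = q0 * q1"
  define b where "b = a0 * q1"
  define c where "c = a1 * q0"
  define h where "h = xi i - xi j"
  define p where "p = xi i + xi j"
  have u: "\<not> 2 dvd at_pole i j u" using a0 a1 by (simp add: u_def at_pole_simps two_dvd_mult_poly_iff)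
  have u2: "\<not> 2 dvd u" using u at_pole_two_dvd by blast
  have h2: "\<not> 2 dvd h" unfolding h_def using not_two_dvd_xi_diff[OF ij] .
  have p2: "\<not> 2 dvd p"
  proof
    assume "2 dvd p"
    then have "2 dvd p - 2 * xi j" by simp
    then show False using h2 by (simp add: p_def h_def)
  qed
  have nz: "ev u \<noteq> 0" "ev h \<noteq> 0" "ev p \<noteq> 0" "ev q0 \<noteq> 0" "ev q1 \<noteq> 0"
    using u2 h2 p2 by (auto simp: u_def)
  have hX: "X i - X j = ev h" and pX: "X i + X j = ev p"
    by (simp_all add: X_def h_def p_def ev.hom_minus ev.hom_add)
  have ph: "ev p = ev h + 2 * X j" by (simp add: p_def h_def X_def ev.hom_add ev.hom_minus)
  have ab: "a * ev u = ev b" "a' * ev u = ev c"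
    using nz by (simp_all add: a0 a1 u_def b_def c_def ev.hom_mult field_simps)
  define G where "G = u * h * h * D + 4 * h * h * b + 8 * h * c
     + 4 * u * xi i * xi j * (of_int (\<alpha> + \<beta>) * h - 2 * of_int \<beta> * xi j)"
  \<comment> \<open>The pole at \<xi>_i + \<xi>_j = h + 2 \<xi>_j is expressed through h. What
    remains over \<open>p\<close> has a factor 4, which together with the outer 4 disappears modulo
    16.\<close>
  have e1: "ev h * ev h / ev p = ev h - 2 * X j + 4 * X j * X j / ev p"
  proof -
    have "ev h * ev h = (ev h - 2 * X j) * ev p + 4 * X j * X j" by (simp add: ph algebra_simps)
    then show ?thesis using nz by (simp add: field_simps)
  qed
  have "0 = ev u * ev h * ev h * (ev D + 4 * a + 8 * a' / ev h
       + 4 * X i * X j * (of_int \<alpha> / ev h + of_int \<beta> / ev p) + 16 * r)"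
    using eq by (simp add: hX pX)
  also have "\<dots> = ev u * ev h * ev h * ev D + 4 * ev h * ev h * (a * ev u) + 8 * ev h * (a' * ev u)
       + 4 * ev u * X i * X j * (of_int \<alpha> * ev h + of_int \<beta> * (ev h * ev h / ev p))
       + 16 * (ev u * ev h * ev h * r)"
    using nz(2) by (simp add: algebra_simps)
  also have "\<dots> = ev G + 16 * (ev u * X i * X j * of_int \<beta> * X j * X j / ev p + ev u * ev h * ev h * r)"
    unfolding ab e1 G_def
    by (simp add: ev.hom_add ev.hom_mult ev.hom_minus ev.hom_of_int X_def algebra_simps)
  finally have "ev G = - (2 ^ 4 * (ev u * X i * X j * of_int \<beta> * X j * X j / ev p + ev u * ev h * ev h * r))"
    by (simp add: add_eq_0_iff2)
  moreover have "inverse (ev p) \<in> V" using unit_V_ev[OF p2] by (simp add: unit_V_def)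
  then have "ev u * X i * X j * of_int \<beta> * X j * X j / ev p + ev u * ev h * ev h * r \<in> V"
    unfolding X_def divide_inverse using r ev_V by (intro V_intros)
  ultimately have "two_dvd_V 4 (ev G)" by (metis two_dvd_V_minus two_dvd_V_times_power)
  then have G16: "16 dvd G" using two_dvd_V_ev_iff[of 4 G] by simp
  moreover have "(4 :: int poly poly) dvd 16" by (rule dvdI[of _ _ 4]) simp
  ultimately have "4 dvd G" by (metis dvd_trans)
  moreover have "4 dvd 4 * (h * h * b + 2 * h * c + u * xi i * xi j * (of_int (\<alpha> + \<beta>) * h - 2 * of_int \<beta> * xi j))"
    by (rule dvd_triv_left)
  ultimately have "4 dvd G - 4 * (h * h * b + 2 * h * c + u * xi i * xi j * (of_int (\<alpha> + \<beta>) * h - 2 * of_int \<beta> * xi j))"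
    by (rule dvd_diff)
  then have "2 ^ 2 dvd (u * h * h) * D" by (simp add: G_def algebra_simps)
  then have "2 ^ 2 dvd D"
    by (rule ev_dvd_cancel[rotated]) (simp add: two_dvd_mult_poly_iff u2 h2)
  then obtain D' where D': "D = 4 * D'" by auto
  \<comment> \<open>All terms of \<open>G\<close> other than \<open>u * h * h * D\<close> have a
    factor 4, and u h^2 is odd, so D is divisible by 4 too; \<open>G1\<close> is \<open>G\<close>
    divided by 4.\<close>
  define G1 where "G1 = u * h * h * D' + h * h * b + 2 * h * c
     + u * xi i * xi j * (of_int (\<alpha> + \<beta>) * h - 2 * of_int \<beta> * xi j)"
  have "4 * 4 dvd 4 * G1" using G16 by (simp add: G_def G1_def D' algebra_simps)
  then have G1: "4 dvd G1" by (simp only: dvd_mult_cancel_left) simp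
  moreover have "(2 :: int poly poly) dvd 4" by (rule dvdI[of _ _ 2]) simp
  ultimately have "2 dvd G1" by (metis dvd_trans)
  then have "2 dvd G1 - 2 * (h * c - u * xi i * xi j * of_int \<beta> * xi j)" by simp
  also have "G1 - 2 * (h * c - u * xi i * xi j * of_int \<beta> * xi j) =
      h * (h * (u * D' + b) + of_int (\<alpha> + \<beta>) * (u * xi i * xi j))"
    by (simp add: G1_def algebra_simps)
  finally have H: "2 dvd h * (u * D' + b) + of_int (\<alpha> + \<beta>) * (u * xi i * xi j)"
    using h2 by (simp add: two_dvd_mult_poly_iff)
  have hp: "2 dvd at_pole i j h" unfolding h_def by (rule two_dvd_at_pole_xi_diff)
  have "2 dvd at_pole i j h * at_pole i j (u * D' + b) + of_int (\<alpha> + \<beta>) * at_pole i j (u * xi i * xi j)"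
    using at_pole_two_dvd[OF H] by (simp only: at_pole_simps)
  then have "2 dvd of_int (\<alpha> + \<beta>) * at_pole i j (u * xi i * xi j)"
    using hp by (simp add: dvd_add_right_iff)
  then have "2 dvd (of_int (\<alpha> + \<beta>) :: int poly)"
    using u not_two_dvd_xi[OF ij] by (simp add: two_dvd_mult_poly_iff at_pole_simps)
  then have ev_sum: "even (\<alpha> + \<beta>)" by (simp only: two_dvd_of_int_poly)
  then obtain \<kappa> where \<kappa>: "\<alpha> + \<beta> = 2 * \<kappa>" by blast
  have "2 dvd h * (u * D' + b)"
    using H unfolding \<kappa> by (simp add: dvd_add_left_iff mult.assoc)
  then have "2 dvd u * D' + b" using h2 by (simp add: two_dvd_mult_poly_iff)
  then obtain e where e: "u * D' + b = 2 * e" by blast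
  \<comment> \<open>With \<alpha> + \<beta> = 2 \<kappa> and u D' + b = 2 e, \<open>G1\<close> is
    twice an explicit polynomial in which only the term with \<beta> survives at the pole.\<close>
  have "G1 = h * h * (u * D' + b) + 2 * h * c + u * xi i * xi j * (of_int (\<alpha> + \<beta>) * h - 2 * of_int \<beta> * xi j)"
    by (simp add: G1_def algebra_simps)
  also have "\<dots> = 2 * (h * (h * e + c + u * xi i * xi j * of_int \<kappa>) - of_int \<beta> * (u * xi i * xi j * xi j))"
    unfolding e \<kappa> by (simp add: algebra_simps)
  finally have "2 * 2 dvd 2 * (h * (h * e + c + u * xi i * xi j * of_int \<kappa>) - of_int \<beta> * (u * xi i * xi j * xi j))"
    using G1 by simp
  then have "2 dvd h * (h * e + c + u * xi i * xi j * of_int \<kappa>) - of_int \<beta> * (u * xi i * xi j * xi j)"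
    by (simp only: dvd_mult_cancel_left) simp
  from at_pole_two_dvd[OF this, of i j]
  have "2 dvd at_pole i j h * at_pole i j (h * e + c + u * xi i * xi j * of_int \<kappa>)
     - of_int \<beta> * at_pole i j (u * xi i * xi j * xi j)"
    by (simp only: at_pole_simps)
  then have "2 dvd of_int \<beta> * at_pole i j (u * xi i * xi j * xi j)"
    using hp by (metis dvd_diff_right_iff dvd_mult2)
  then have "2 dvd (of_int \<beta> :: int poly)"
    using u not_two_dvd_xi[OF ij] by (simp add: two_dvd_mult_poly_iff at_pole_simps)
  then have "even \<beta>" by (simp only: two_dvd_of_int_poly)
  then show ?thesis using ev_sum by auto
qed

end

subsection \<open>Signed coordinates and shapes of blocks\<close>

text \<open>The vertex \<open>(a, \<sigma>)\<close> is represented by \<open>x = \<sigma> a\<close>; for \<open>\<eta>(a) = -1\<close> the sign is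
  recovered as \<open>\<sigma> = -\<eta>(x)\<close>, the diagonal entry becomes \<open>-x \<cdot> \<xi>\<close> for both signs, and
  every edge is a translation by some \<open>\<plusminus>e\<^sub>i \<plusminus> e\<^sub>j\<close>.\<close>

definition pair_adj :: "'m::finite \<Rightarrow> 'm \<Rightarrow> int^'m \<Rightarrow> int^'m \<Rightarrow> bool" where
  "pair_adj i j x w \<longleftrightarrow> w = x + axis i 1 - axis j 1 \<or> w = x - axis i 1 + axis j 1 \<or>
     (eta x = -1 \<and> w = x + axis i 1 + axis j 1) \<or> (eta x = 1 \<and> w = x - axis i 1 - axis j 1)"

definition adj :: "int^'m::finite \<Rightarrow> int^'m \<Rightarrow> bool" where
  "adj x w \<longleftrightarrow> (\<exists>i j. i \<noteq> j \<and> pair_adj i j x w)"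

text \<open>The block matrix without its energy and after a diagonal similarity that removes the square
  roots; the entry at a root \<open>\<plusminus>e\<^sub>i \<plusminus> e\<^sub>j\<close> carries the variables with coefficient \<open>+1\<close>.\<close>

definition pmat :: "('m::finite \<Rightarrow> 'a::comm_ring_1) \<Rightarrow> int^'m \<Rightarrow> int^'m \<Rightarrow> 'a" where
  "pmat \<xi> x w = (if x = w then - (\<Sum>k\<in>UNIV. of_int (x $ k) * \<xi> k)
     else if adj x w then of_int (- 2 * eta w) * (\<Prod>k | (w - x) $ k = 1. \<xi> k) else 0)"

lemma eta_simps:
  "eta (a + b) = eta a + eta b" "eta (a - b) = eta a - eta b" "eta (- a) = - eta a"
  "eta (axis i k) = k" "eta 0 = 0"
proof -
  show "eta (a + b) = eta a + eta b" "eta (a - b) = eta a - eta b" "eta (- a) = - eta a" "eta 0 = 0"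
    by (simp_all add: eta_def sum.distrib sum_subtractf sum_negf)
  have "eta (axis i k) = (\<Sum>l\<in>UNIV. if i = l then k else 0)"
    unfolding eta_def by (intro sum.cong refl) (simp add: axis_def)
  then show "eta (axis i k) = k" by simp
qed

lemma axis_nth_int: "axis i (1::int) $ k = (if k = i then 1 else 0)"
  by (simp add: axis_def)

lemma pair_adj_commute: "pair_adj i j x w \<longleftrightarrow> pair_adj j i x w"
  by (auto simp: pair_adj_def vec_eq_iff algebra_simps)

lemma pair_adj_sym: "pair_adj i j x w \<Longrightarrow> pair_adj i j w x"
  unfolding pair_adj_def
  by (elim disjE conjE; hypsubst) (simp_all add: eta_simps)

lemma adj_sym: "adj x w \<Longrightarrow> adj w x"
  unfolding adj_def using pair_adj_sym by blast

lemma pair_adj_odd: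
  assumes "pair_adj i j x w" "i \<noteq> j"
  shows "odd ((w - x) $ k) \<longleftrightarrow> k \<in> {i, j}" "\<bar>(w - x) $ k\<bar> \<le> 1"
  using assms unfolding pair_adj_def by (auto simp: axis_nth_int split: if_splits)

lemma pair_adj_irrefl:
  assumes "pair_adj i j x w" "i \<noteq> j"
  shows "w \<noteq> x"
  using pair_adj_odd(1)[OF assms, of i] by auto

lemma adj_irrefl: "\<not> adj x x"
  unfolding adj_def using pair_adj_irrefl by blast

text \<open>At each point there is at most one edge for each pair i, j. Hence the product of two
  energy denominators belonging to different neighbours of x has no double pole.\<close>

definition local_shape :: "(int^'m::finite) set \<Rightarrow> bool" where
  "local_shape C \<longleftrightarrow> finite C \<and> (\<forall>x\<in>C. eta x = 1 \<or> eta x = -1) \<and>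
     (\<forall>x\<in>C. \<forall>w\<in>C. \<forall>w'\<in>C. \<forall>i j. i \<noteq> j \<longrightarrow> pair_adj i j x w \<longrightarrow> pair_adj i j x w' \<longrightarrow> w = w')"

text \<open>The coordinates where w - x is 1 and those where it is -1 together make up {i, j}. This
  product is the numerator of the first order correction of an eigenvalue.\<close>

lemma pmat_products:
  assumes "pair_adj i j x w" "i \<noteq> j" "eta x = 1 \<or> eta x = -1" "eta w = 1 \<or> eta w = -1"
  shows "pmat \<xi> x w * pmat \<xi> w x = 4 * of_int (eta x * eta w) * \<xi> i * \<xi> j"
proof -
  have ne: "w \<noteq> x" using pair_adj_irrefl[OF assms(1,2)] .
  have a: "adj x w" "adj w x" using assms(1,2) pair_adj_sym unfolding adj_def by blast+
  have S: "{k. (axis i 1 - axis j (1::int)) $ k = 1} = {i}" "{k. (axis j 1 - axis i (1::int)) $ k = 1} = {j}"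
    "{k. (axis i 1 + axis j (1::int)) $ k = 1} = {i, j}" "{k. (- axis i 1 - axis j (1::int)) $ k = 1} = {}"
    using assms(2) by (auto simp: axis_nth_int split: if_splits)
  have *: "pmat \<xi> x w * pmat \<xi> w x =
     4 * of_int (eta x * eta w) * ((\<Prod>k | (w - x) $ k = 1. \<xi> k) * (\<Prod>k | (x - w) $ k = 1. \<xi> k))"
    using ne a by (simp add: pmat_def algebra_simps)
  have "(\<Prod>k | (w - x) $ k = 1. \<xi> k) * (\<Prod>k | (x - w) $ k = 1. \<xi> k) = \<xi> i * \<xi> j"
    using assms(1)[unfolded pair_adj_def]
  proof (elim disjE conjE)
    assume w: "w = x + axis i 1 - axis j 1"
    have "w - x = axis i 1 - axis j 1" "x - w = axis j 1 - axis i 1" by (simp_all add: w)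
    then show ?thesis by (simp only: S) simp
  next
    assume w: "w = x - axis i 1 + axis j 1"
    have "w - x = axis j 1 - axis i 1" "x - w = axis i 1 - axis j 1" by (simp_all add: w)
    then show ?thesis by (simp only: S) (simp add: mult.commute)
  next
    assume w: "w = x + axis i 1 + axis j 1"
    have "w - x = axis i 1 + axis j 1" "x - w = - axis i 1 - axis j 1" by (simp_all add: w algebra_simps)
    then show ?thesis using assms(2) by (simp only: S) simp
  next
    assume w: "w = x - axis i 1 - axis j 1"
    have "x - w = axis i 1 + axis j 1" "w - x = - axis i 1 - axis j 1" by (simp_all add: w algebra_simps)
    then show ?thesis using assms(2) by (simp only: S) simp
  qed
  then show ?thesis using * by (simp add: mult.assoc)
qed

text \<open>\<open>black_ind\<close> and \<open>red_ind\<close> are the coefficients of 4 \<xi>_i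
  \<xi>_j / (\<xi>_i - \<xi>_j) and of 4 \<xi>_i \<xi>_j / (\<xi>_i + \<xi>_j) in the first order
  correction of the eigenvalue belonging to x.\<close>

definition black_ind :: "(int^'m::finite) set \<Rightarrow> 'm \<Rightarrow> 'm \<Rightarrow> int^'m \<Rightarrow> int" where
  "black_ind C i j x = of_bool (x + axis i 1 - axis j 1 \<in> C) - of_bool (x - axis i 1 + axis j 1 \<in> C)"

definition red_ind :: "(int^'m::finite) set \<Rightarrow> 'm \<Rightarrow> 'm \<Rightarrow> int^'m \<Rightarrow> int" where
  "red_ind C i j x = of_bool (eta x = 1 \<and> x - axis i 1 - axis j 1 \<in> C)
     - of_bool (eta x = -1 \<and> x + axis i 1 + axis j 1 \<in> C)"

context two_adic
begin

lemma pole_part_add: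
  assumes "pole_part i j x \<alpha> \<beta>" "pole_part i j y \<alpha>' \<beta>'"
  shows "pole_part i j (x + y) (\<alpha> + \<alpha>') (\<beta> + \<beta>')"
proof -
  have "pole_part i j (ev 0 - y) (0 - \<alpha>') (0 - \<beta>')"
    by (rule pole_part_diff[OF pole_part_ev assms(2)])
  from pole_part_diff[OF assms(1) this] show ?thesis by simp
qed

lemma pole_part_loc:
  assumes "a \<in> loc i j"
  shows "pole_part i j (4 * a) 0 0"
  unfolding pole_part_def
  by (rule exI[of _ 0], rule exI[of _ a], rule exI[of _ 0], rule exI[of _ 0])
     (use assms in \<open>auto intro: loc_intros V_intros\<close>)

lemma pole_part_simple:
  assumes "a \<in> loc i j"
  shows "pole_part i j (8 * a / (X i - X j)) 0 0"
  unfolding pole_part_def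
  by (rule exI[of _ 0], rule exI[of _ 0], rule exI[of _ a], rule exI[of _ 0])
     (use assms in \<open>auto intro: loc_intros V_intros\<close>)

lemma pole_part_remainder:
  assumes "two_dvd_V 4 r"
  shows "pole_part i j r 0 0"
  unfolding pole_part_def
  by (rule exI[of _ 0], rule exI[of _ 0], rule exI[of _ 0], rule exI[of _ "r / 16"])
     (use assms in \<open>auto simp: two_dvd_V_def intro: loc_intros V_intros\<close>)

lemma pole_part_double:
  "pole_part i j (4 * X i * X j * (of_int \<alpha> / (X i - X j) + of_int \<beta> / (X i + X j))) \<alpha> \<beta>"
  unfolding pole_part_def
  by (rule exI[of _ 0], rule exI[of _ 0], rule exI[of _ 0], rule exI[of _ 0])
     (auto intro: loc_intros V_intros)

lemma X_units:
  assumes "i \<noteq> j"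
  shows "unit_V (X i - X j)" "unit_V (X i + X j)"
proof -
  show "unit_V (X i - X j)"
    using unit_V_ev[OF not_two_dvd_xi_diff[OF assms]] by (simp add: X_def ev.hom_minus)
  from unit_V_add[OF this, of "2 * X j"] show "unit_V (X i + X j)"
    using two_dvd_V_times_power[of "X j" 1] ev_V by (simp add: X_def algebra_simps)
qed

text \<open>8 / (X_i - X_j) and 8 / (X_i + X_j) differ by 16 X_j over a unit, so modulo 16 the two
  simple poles cannot be told apart.\<close>

lemma pole_part_simple':
  assumes "a \<in> loc i j" "i \<noteq> j"
  shows "pole_part i j (8 * a / (X i + X j)) 0 0"
proof -
  have nz: "X i - X j \<noteq> 0" "X i + X j \<noteq> 0"
    and V: "inverse (X i - X j) \<in> V" "inverse (X i + X j) \<in> V"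
    using X_units[OF assms(2)] by (auto simp: unit_V_def)
  have "16 * (a * X j * inverse (X i - X j) * inverse (X i + X j)) = 8 * a / (X i - X j) - 8 * a / (X i + X j)"
    using nz by (simp add: field_simps)
  moreover have "a * X j * inverse (X i - X j) * inverse (X i + X j) \<in> V"
    using V loc_V[OF assms(1)] ev_V unfolding X_def by (intro V_intros)
  then have "two_dvd_V 4 (16 * (a * X j * inverse (X i - X j) * inverse (X i + X j)))"
    by (simp add: two_dvd_V_def)
  ultimately have "two_dvd_V 4 (8 * a / (X i - X j) - 8 * a / (X i + X j))" by metis
  from pole_part_diff[OF pole_part_simple[OF assms(1)] pole_part_remainder[OF this]]
  show ?thesis by simp
qed

abbreviation M :: "int^'m \<Rightarrow> int^'m \<Rightarrow> complex" where "M \<equiv> pmat X"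

lemma ev_lin: "ev (lin a) = (\<Sum>k\<in>UNIV. of_int (a $ k) * X k)"
  by (simp add: lin_def X_def ev.hom_sum ev.hom_mult ev.hom_of_int)

lemma M_diag: "M x x = - ev (lin x)"
  by (simp add: pmat_def ev_lin)

lemma M_off:
  assumes "x \<noteq> w"
  obtains m where "M x w = 2 * ev m"
proof -
  have "M x w = 2 * ev (if adj x w then of_int (- eta w) * (\<Prod>k | (w - x) $ k = 1. xi k) else 0)"
    using assms by (simp add: pmat_def X_def ev.hom_mult ev.hom_prod ev.hom_of_int ev.hom_uminus)
  then show thesis using that by blast
qed

lemma M_two_dvd: "x \<noteq> w \<Longrightarrow> two_dvd_V 1 (M x w)"
  using M_off[of x w] two_dvd_V_times_power[OF ev_V, of 1] by (metis power_one_right)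

lemma M_nonadj: "x \<noteq> w \<Longrightarrow> \<not> adj x w \<Longrightarrow> M x w = 0"
  by (simp add: pmat_def)

lemma two_dvd_lin_iff: "2 dvd lin a \<longleftrightarrow> (\<forall>i. even (a $ i))"
  using two_power_dvd_lin_iff[of 1 a] by simp

lemma root_gap:
  assumes "pair_adj k l x w" "k \<noteq> l"
  obtains s where "s = 1 \<or> s = -1" "lin (w - x) = of_int s * (xi k - xi l) \<or> lin (w - x) = of_int s * (xi k + xi l)"
proof -
  have ax: "lin (axis i 1) = xi i" for i
  proof -
    have "lin (axis i 1) = (\<Sum>k\<in>UNIV. if i = k then xi k else 0)"
      unfolding lin_def by (intro sum.cong refl) (auto simp: axis_nth_int)
    then show ?thesis by simp
  qed
  show thesis
    using assms(1)[unfolded pair_adj_def]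
  proof (elim disjE conjE)
    assume "w = x + axis k 1 - axis l 1"
    then have "lin (w - x) = xi k - xi l" by (simp add: lin_simps ax)
    then show thesis using that[of 1] by simp
  next
    assume "w = x - axis k 1 + axis l 1"
    then have "lin (w - x) = - (xi k - xi l)" by (simp add: lin_simps ax)
    then show thesis using that[of "-1"] by simp
  next
    assume "w = x + axis k 1 + axis l 1"
    then have "lin (w - x) = xi k + xi l" by (simp add: lin_simps ax)
    then show thesis using that[of 1] by simp
  next
    assume "w = x - axis k 1 - axis l 1"
    then have "lin (w - x) = - (xi k + xi l)" by (simp add: lin_simps ax)
    then show thesis using that[of "-1"] by simp
  qed
qed

lemma root_gap_loc:
  assumes "pair_adj k l x w" "k \<noteq> l" "\<not> pair_adj i j x w" "i \<noteq> j"
  shows "inverse (ev (lin (w - x))) \<in> loc i j"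
proof -
  have kl: "{k, l} \<noteq> {i, j}"
    using assms pair_adj_commute by (metis doubleton_eq_iff)
  obtain s where s: "s = 1 \<or> s = -1"
    "lin (w - x) = of_int s * (xi k - xi l) \<or> lin (w - x) = of_int s * (xi k + xi l)"
    using root_gap[OF assms(1,2)] .
  have "odd s" using s(1) by auto
  then have "\<not> 2 dvd at_pole i j (lin (w - x))"
    using s(2) not_two_dvd_at_pole_xi_diff[OF assms(2) kl assms(4)]
    by (elim disjE) (simp_all only: at_pole_simps(3,5) two_dvd_mult_poly_iff two_dvd_of_int_poly simp_thms)
  then show ?thesis by (rule inverse_loc)
qed

lemma root_gap_simple:
  assumes "pair_adj i j x w" "i \<noteq> j" "a \<in> loc i j"
  shows "pole_part i j (8 * a / ev (lin (w - x))) 0 0"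
proof -
  obtain s where s: "s = 1 \<or> s = -1"
    "lin (w - x) = of_int s * (xi i - xi j) \<or> lin (w - x) = of_int s * (xi i + xi j)"
    using root_gap[OF assms(1,2)] .
  have sa: "of_int s * a \<in> loc i j" using assms(3) by (intro loc_intros)
  have "8 * a / ev (lin (w - x)) = 8 * (of_int s * a) / (X i - X j) \<or>
        8 * a / ev (lin (w - x)) = 8 * (of_int s * a) / (X i + X j)"
    using s by (auto simp: X_def ev.hom_minus ev.hom_add ev.hom_uminus
        minus_divide_right[symmetric] divide_minus1 simp del: minus_diff_eq minus_add_distrib)
  then show ?thesis
    using pole_part_simple[OF sa] pole_part_simple'[OF sa assms(2)] by auto
qed

end

section \<open>Second order perturbation expansion of an eigenvalue modulo 16\<close>

lemma quotient_split:
  fixes m s t b u g :: "'a::field"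
  shows "(m + s + t) / u - m / g - b / g = (s - b + t) / u + (m / u - m / g) + (b / u - b / g)"
  by (simp add: add_divide_distrib diff_divide_distrib)

lemma local_shapeD:
  assumes "local_shape C"
  shows "finite C" "x \<in> C \<Longrightarrow> eta x = 1 \<or> eta x = -1"
    "x \<in> C \<Longrightarrow> w \<in> C \<Longrightarrow> w' \<in> C \<Longrightarrow> i \<noteq> j \<Longrightarrow> pair_adj i j x w \<Longrightarrow> pair_adj i j x w' \<Longrightarrow> w = w'"
  using assms unfolding local_shape_def by blast+

context two_adic
begin

lemma two_dvd_V_power_mult:
  "two_dvd_V 1 x \<Longrightarrow> two_dvd_V k y \<Longrightarrow> two_dvd_V (Suc k) (x * y)"
  using two_dvd_V_mult[of 1 x k y] by simp

lemma inverse_diff_bound: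
  assumes "two_dvd_V k a" "unit_V u" "unit_V w" "two_dvd_V j (u - w)"
  shows "two_dvd_V (k + j) (a / u - a / w)"
proof -
  have nz: "u \<noteq> 0" "w \<noteq> 0" using assms by (auto simp: unit_V_def)
  have "a / u - a / w = (a * (- (u - w))) / u / w" using nz by (simp add: field_simps)
  moreover have "two_dvd_V (k + j) (a * (- (u - w)))"
    by (rule two_dvd_V_mult[OF assms(1) two_dvd_V_minus[OF assms(4)]])
  ultimately show ?thesis using two_dvd_V_divide_unit assms(2,3) by metis
qed

definition nbrs :: "(int^'m) set \<Rightarrow> int^'m \<Rightarrow> (int^'m) set" where
  "nbrs C x = {w \<in> C. adj x w}"

definition gap :: "int^'m \<Rightarrow> int^'m \<Rightarrow> complex" where
  "gap x w = ev (lin (w - x))"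

definition first_order :: "int^'m \<Rightarrow> int^'m \<Rightarrow> complex" where
  "first_order x w = M w x / gap x w"

text \<open>The second order term of the eigenvector coordinate at w; it comes from the triangles x,
  u, w.\<close>

definition second_order :: "(int^'m) set \<Rightarrow> int^'m \<Rightarrow> int^'m \<Rightarrow> complex" where
  "second_order C x w = (\<Sum>u\<in>{u \<in> nbrs C x. adj w u}. M w u * M u x / (gap x w * gap x u))"

lemma finite_nbrs: "local_shape C \<Longrightarrow> finite (nbrs C x)"
  using local_shapeD(1)[of C] by (simp add: nbrs_def)

context
  fixes C :: "(int^'m) set" and l :: complex and z :: "int^'m \<Rightarrow> complex" and x :: "int^'m"
  assumes C: "local_shape C" and xC: "x \<in> C" and zx: "z x = 1"
    and zV: "\<And>w. w \<in> C \<Longrightarrow> z w \<in> V"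
    and eig: "\<And>y. y \<in> C \<Longrightarrow> (\<Sum>w\<in>C. M y w * z w) = l * z y"
begin

text \<open>The eigenvector is normalised to 1 at x with all coordinates in V. Since off-diagonal
  entries are divisible by 2, these row equations improve the bounds on the eigenvalue and on the
  coordinates in turn.\<close>

lemma eigen_row:
  assumes "y \<in> C"
  shows "(l + ev (lin y)) * z y = (\<Sum>w\<in>C - {y}. M y w * z w)"
proof -
  have "(\<Sum>w\<in>C. M y w * z w) = M y y * z y + (\<Sum>w\<in>C - {y}. M y w * z w)"
    using assms local_shapeD(1)[OF C] by (simp add: sum.remove)
  then show ?thesis using eig[OF assms] by (simp add: M_diag algebra_simps)
qed

lemma eigen_near1: "two_dvd_V 1 (l + ev (lin x))"
proof -
  have "two_dvd_V 1 (\<Sum>w\<in>C - {x}. M x w * z w)"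
    using zV by (intro two_dvd_V_sum two_dvd_V_mult_V M_two_dvd) auto
  then show ?thesis using eigen_row[OF xC] by (simp add: zx)
qed

lemma shift_unit_odd:
  assumes "odd ((w - x) $ k)"
  shows "unit_V (ev (lin (w - x)))" "unit_V (l + ev (lin w))"
proof -
  have "\<not> 2 dvd lin (w - x)" using assms by (auto simp: two_dvd_lin_iff)
  then show 1: "unit_V (ev (lin (w - x)))" by (rule unit_V_ev)
  have eq: "l + ev (lin w) = ev (lin (w - x)) + (l + ev (lin x))"
    by (simp add: lin_simps ev.hom_minus)
  show "unit_V (l + ev (lin w))" unfolding eq by (rule unit_V_add[OF 1 eigen_near1])
qed

text \<open>At an odd displacement from x the factor l + w(\<xi>) is congruent modulo 2 to (w -
  x)(\<xi>), hence a unit, and the row of w can be divided by it.\<close>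

lemma coord_odd:
  assumes "w \<in> C" "odd ((w - x) $ k)"
  shows "two_dvd_V 1 (z w)"
proof -
  have u: "unit_V (l + ev (lin w))" by (rule shift_unit_odd(2)[OF assms(2)])
  then have "l + ev (lin w) \<noteq> 0" by (simp add: unit_V_def)
  then have "z w = (l + ev (lin w)) * z w / (l + ev (lin w))" by simp
  then have zw: "z w = (\<Sum>u\<in>C - {w}. M w u * z u) / (l + ev (lin w))"
    by (simp only: eigen_row[OF assms(1)])
  have "two_dvd_V 1 (\<Sum>u\<in>C - {w}. M w u * z u)"
    using zV by (intro two_dvd_V_sum two_dvd_V_mult_V M_two_dvd) auto
  then show ?thesis unfolding zw by (rule two_dvd_V_divide_unit[OF _ u])
qed

lemma adj_odd:
  assumes "adj y w"
  obtains k where "odd ((w - y) $ k)"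
  using assms pair_adj_odd(1) unfolding adj_def by blast

text \<open>Neighbours of x are at odd displacement, so both the entry and the coordinate in each
  term of row x are divisible by 2.\<close>

lemma eigen_near2: "two_dvd_V 2 (l + ev (lin x))"
proof -
  have "two_dvd_V 2 (M x w * z w)" if w: "w \<in> C - {x}" for w
  proof (cases "adj x w")
    case True
    then obtain k where "odd ((w - x) $ k)" by (rule adj_odd)
    then have "two_dvd_V 1 (z w)" using w by (intro coord_odd) auto
    then show ?thesis using two_dvd_V_power_mult[OF M_two_dvd] w by (metis DiffE Suc_1 singletonI)
  next
    case False
    then show ?thesis using w M_nonadj[of x w] by auto
  qed
  then have "two_dvd_V 2 (\<Sum>w\<in>C - {x}. M x w * z w)" by (rule two_dvd_V_sum)
  then show ?thesis using eigen_row[OF xC] by (simp add: zx)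
qed

text \<open>For an even displacement not divisible by 4, \<open>eigen_near2\<close> makes l +
  w(\<xi>) twice a unit. Neighbours of w are at odd displacement from x, so the right-hand side of
  the row is divisible by 4, and a factor 2 is left over.\<close>

lemma coord_not_four:
  assumes "w \<in> C" "\<not> 4 dvd (w - x) $ k"
  shows "two_dvd_V 1 (z w)"
proof (cases "\<forall>k. even ((w - x) $ k)")
  case False
  then show ?thesis using coord_odd[OF assms(1)] by blast
next
  case True
  then have "2 dvd lin (w - x)" by (simp add: two_dvd_lin_iff)
  then obtain q where q: "lin (w - x) = 2 * q" by blast
  have "\<not> 2 dvd q"
  proof
    assume "2 dvd q"
    then have "2 ^ 2 dvd lin (w - x)" unfolding q by (auto elim!: dvdE)
    then show False using assms(2) by (simp only: two_power_dvd_lin_iff) simp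
  qed
  moreover have "two_dvd_V 1 ((l + ev (lin x)) / 2)"
    using eigen_near2 by (simp add: two_dvd_V_def power2_eq_square)
  ultimately have u: "unit_V (ev q + (l + ev (lin x)) / 2)"
    by (intro unit_V_add unit_V_ev)
  have "lin w = 2 * q + lin x" using q by (simp add: lin_simps algebra_simps)
  then have lw: "l + ev (lin w) = 2 * (ev q + (l + ev (lin x)) / 2)"
    by (simp add: ev.hom_add ev.hom_mult)
  have "two_dvd_V 2 (M w u * z u)" if u: "u \<in> C - {w}" for u
  proof (cases "adj w u")
    case True
    then obtain k where "odd ((u - w) $ k)" by (rule adj_odd)
    then have "odd ((u - x) $ k)" using \<open>\<forall>k. even ((w - x) $ k)\<close>[rule_format, of k] by auto
    then have "two_dvd_V 1 (z u)" using u by (intro coord_odd) auto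
    then show ?thesis using two_dvd_V_power_mult[OF M_two_dvd] u by (metis DiffE Suc_1 singletonI)
  next
    case False
    then show ?thesis using u M_nonadj[of w u] by auto
  qed
  then have "two_dvd_V 2 ((l + ev (lin w)) * z w)"
    unfolding eigen_row[OF assms(1)] by (rule two_dvd_V_sum)
  then have "2 * (ev q + (l + ev (lin x)) / 2) * z w / 2 ^ 2 \<in> V"
    unfolding lw two_dvd_V_def .
  also have "2 * (ev q + (l + ev (lin x)) / 2) * z w / 2 ^ 2 = (ev q + (l + ev (lin x)) / 2) * z w / 2 ^ 1"
    by (simp only: power2_eq_square power_one_right mult.assoc mult_divide_mult_cancel_left_if) simp
  finally have "two_dvd_V 1 ((ev q + (l + ev (lin x)) / 2) * z w)"
    unfolding two_dvd_V_def .
  from two_dvd_V_divide_unit[OF this u] show ?thesis using u by (simp add: unit_V_def)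
qed

lemma step_bound:
  assumes "adj y w"
  shows "\<bar>(w - y) $ k\<bar> \<le> 1"
  using assms pair_adj_odd(2) unfolding adj_def by blast

text \<open>In the row of u the factor l + u(\<xi>) is a unit, and all neighbours of u are points
  different from x within three steps of it, where \<open>coord_not_four\<close> applies.\<close>

lemma coord_distance_two:
  assumes "w \<in> C" "u \<in> C" "adj x w" "adj w u" "u \<noteq> x" "\<not> adj x u"
  shows "two_dvd_V 2 (z u)"
proof -
  \<comment> \<open>If u - x were even, both steps would use the same pair of indices, and
    \<open>local_shape\<close> at w would leave only the step back to x.\<close>
  have "\<exists>k. odd ((u - x) $ k)"
  proof (rule ccontr)
    assume neg: "\<nexists>k. odd ((u - x) $ k)"
    obtain i j where ij: "i \<noteq> j" "pair_adj i j x w" using assms unfolding adj_def by blast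
    obtain k l where kl: "k \<noteq> l" "pair_adj k l w u" using assms unfolding adj_def by blast
    have "odd ((w - x) $ m) \<longleftrightarrow> odd ((u - w) $ m)" for m
      using neg by auto
    then have "m \<in> {i, j} \<longleftrightarrow> m \<in> {k, l}" for m
      using pair_adj_odd(1)[OF ij(2,1)] pair_adj_odd(1)[OF kl(2,1)] by metis
    then have "{i, j} = {k, l}" by blast
    then have "pair_adj i j w u" using kl(2) pair_adj_commute by (metis doubleton_eq_iff)
    then have "u = x"
      using local_shapeD(3)[OF C assms(1,2) xC ij(1)] pair_adj_sym[OF ij(2)] by blast
    then show False using assms by simp
  qed
  then obtain k where k: "odd ((u - x) $ k)" ..
  have un: "unit_V (l + ev (lin u))" by (rule shift_unit_odd(2)[OF k])
  have "two_dvd_V 2 (M u w' * z w')" if w': "w' \<in> C - {u}" for w'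
  proof (cases "adj u w'")
    case True
    have "w' \<noteq> x" using True assms(6) adj_sym by blast
    then obtain m where "w' $ m \<noteq> x $ m" by (auto simp: Finite_Cartesian_Product.vec_eq_iff)
    then have m: "(w' - x) $ m \<noteq> 0" by simp
    \<comment> \<open>Each of the three steps changes a coordinate by at most 1, so a nonzero
      coordinate of w' - x is too small to be divisible by 4.\<close>
    have "(w' - x) $ m = (w' - u) $ m + (u - w) $ m + (w - x) $ m" by simp
    then have "\<bar>(w' - x) $ m\<bar> \<le> 3"
      using step_bound[OF True, of m] step_bound[OF assms(3), of m] step_bound[OF assms(4), of m] by linarith
    then have "\<not> 4 dvd (w' - x) $ m" using m by presburger
    then have "two_dvd_V 1 (z w')" using w' by (intro coord_not_four) auto
    then show ?thesis using two_dvd_V_power_mult[OF M_two_dvd] w' by (metis DiffE Suc_1 singletonI)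
  next
    case False
    then show ?thesis using w' M_nonadj[of u w'] by auto
  qed
  then have "two_dvd_V 2 ((l + ev (lin u)) * z u)"
    unfolding eigen_row[OF assms(2)] by (rule two_dvd_V_sum)
  from two_dvd_V_divide_unit[OF this un] show ?thesis using un by (simp add: unit_V_def)
qed

lemma gap_unit: "w \<in> nbrs C x \<Longrightarrow> unit_V (gap x w)"
  unfolding nbrs_def gap_def using adj_odd shift_unit_odd(1) by blast

text \<open>Neighbours of w other than x that are not adjacent to x have coordinates divisible by 4
  and enter with an even entry, so they vanish modulo 8; only triangles through x remain.\<close>

lemma nbr_row:
  assumes w: "w \<in> nbrs C x"
  shows "\<exists>r. two_dvd_V 3 r \<and> (l + ev (lin w)) * z w = M w x + (\<Sum>u\<in>{u \<in> nbrs C x. adj w u}. M w u * z u) + r"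
proof -
  have wC: "w \<in> C" "adj x w" and wx: "w \<noteq> x" using w adj_irrefl unfolding nbrs_def by auto
  define r where "r = (\<Sum>u\<in>C - {w} - {x} - {u \<in> nbrs C x. adj w u}. M w u * z u)"
  have sub: "{u \<in> nbrs C x. adj w u} \<subseteq> C - {w} - {x}"
    using adj_irrefl by (auto simp: nbrs_def)
  have fin: "finite (C - {w} - {x})" using local_shapeD(1)[OF C] by simp
  have "(\<Sum>u\<in>C - {w}. M w u * z u) = M w x * z x + (\<Sum>u\<in>C - {w} - {x}. M w u * z u)"
    using wx xC local_shapeD(1)[OF C] by (intro sum.remove) auto
  also have "(\<Sum>u\<in>C - {w} - {x}. M w u * z u) = r + (\<Sum>u\<in>{u \<in> nbrs C x. adj w u}. M w u * z u)"
    unfolding r_def by (rule sum.subset_diff[OF sub fin])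
  finally have "(l + ev (lin w)) * z w = M w x + (\<Sum>u\<in>{u \<in> nbrs C x. adj w u}. M w u * z u) + r"
    unfolding eigen_row[OF wC(1)] by (simp add: zx)
  moreover have "two_dvd_V 3 r"
    unfolding r_def
  proof (rule two_dvd_V_sum)
    fix u assume u: "u \<in> C - {w} - {x} - {u \<in> nbrs C x. adj w u}"
    show "two_dvd_V 3 (M w u * z u)"
    proof (cases "adj w u")
      case True
      then have "two_dvd_V 2 (z u)"
        using u wC by (intro coord_distance_two[of w]) (auto simp: nbrs_def)
      moreover have "two_dvd_V 1 (M w u)" using u by (intro M_two_dvd) auto
      ultimately have "two_dvd_V (Suc 2) (M w u * z u)" by (intro two_dvd_V_power_mult)
      then show ?thesis by (simp add: numeral_3_eq_3)
    next
      case False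
      then show ?thesis using u M_nonadj[of w u] by auto
    qed
  qed
  ultimately show ?thesis by blast
qed

lemma nbr_shift:
  assumes w: "w \<in> nbrs C x"
  shows "unit_V (l + ev (lin w))" "two_dvd_V 2 ((l + ev (lin w)) - gap x w)"
proof -
  show "unit_V (l + ev (lin w))" using w shift_unit_odd(2) adj_odd unfolding nbrs_def by blast
  have eq: "(l + ev (lin w)) - gap x w = l + ev (lin x)" by (simp add: gap_def lin_simps ev.hom_minus)
  show "two_dvd_V 2 ((l + ev (lin w)) - gap x w)" unfolding eq by (rule eigen_near2)
qed

lemma nbr_coord:
  assumes w: "w \<in> nbrs C x"
  shows "two_dvd_V 1 (z w)"
  using w coord_odd adj_odd unfolding nbrs_def by blast

lemma nbr_M: "w \<in> nbrs C x \<Longrightarrow> two_dvd_V 1 (M w x)" "w \<in> nbrs C x \<Longrightarrow> two_dvd_V 1 (M x w)"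
  using adj_irrefl unfolding nbrs_def by (metis (mono_tags) M_two_dvd mem_Collect_eq)+

lemma nbr_first:
  assumes w: "w \<in> nbrs C x"
  shows "two_dvd_V 2 (z w - first_order x w)"
proof -
  obtain r where r: "two_dvd_V 3 r"
    "(l + ev (lin w)) * z w = M w x + (\<Sum>u\<in>{u \<in> nbrs C x. adj w u}. M w u * z u) + r"
    using nbr_row[OF w] by blast
  let ?L = "l + ev (lin w)"
  note u = nbr_shift(1)[OF w]
  have s: "two_dvd_V 2 (\<Sum>u\<in>{u \<in> nbrs C x. adj w u}. M w u * z u)"
  proof (rule two_dvd_V_sum)
    fix v assume v: "v \<in> {u \<in> nbrs C x. adj w u}"
    then have "w \<noteq> v" using adj_irrefl by auto
    then have "two_dvd_V (Suc 1) (M w v * z v)"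
      using v by (intro two_dvd_V_power_mult M_two_dvd nbr_coord) auto
    then show "two_dvd_V 2 (M w v * z v)" by (simp add: numeral_2_eq_2)
  qed
  have "two_dvd_V 2 (((\<Sum>u\<in>{u \<in> nbrs C x. adj w u}. M w u * z u) + r) / ?L)"
    using two_dvd_V_add[OF s two_dvd_V_mono[OF r(1)]] u by (intro two_dvd_V_divide_unit) auto
  moreover have "two_dvd_V 2 (M w x / ?L - M w x / gap x w)"
    using two_dvd_V_mono[OF inverse_diff_bound[OF nbr_M(1)[OF w] u gap_unit[OF w] nbr_shift(2)[OF w]], of 2] by simp
  ultimately have "two_dvd_V 2 (((\<Sum>u\<in>{u \<in> nbrs C x. adj w u}. M w u * z u) + r) / ?L + (M w x / ?L - M w x / gap x w))"
    by (rule two_dvd_V_add)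
  also have "((\<Sum>u\<in>{u \<in> nbrs C x. adj w u}. M w u * z u) + r) / ?L + (M w x / ?L - M w x / gap x w) = ?L * z w / ?L - first_order x w"
    unfolding r(2) first_order_def by (simp add: add_divide_distrib)
  also have "?L * z w / ?L = z w" using u by (simp add: unit_V_def)
  finally show ?thesis .
qed

text \<open>Insert the first order coordinates into \<open>nbr_row\<close>. Replacing l + w(\<xi>)
  by \<open>gap x w\<close> changes the quotient by a multiple of 4 times the numerator, which is
  already even.\<close>

lemma nbr_second:
  assumes w: "w \<in> nbrs C x"
  shows "two_dvd_V 3 (z w - first_order x w - second_order C x w)"
proof -
  obtain r where r: "two_dvd_V 3 r"
    "(l + ev (lin w)) * z w = M w x + (\<Sum>u\<in>{u \<in> nbrs C x. adj w u}. M w u * z u) + r"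
    using nbr_row[OF w] by blast
  let ?L = "l + ev (lin w)" and ?T = "{u \<in> nbrs C x. adj w u}"
  note u = nbr_shift(1)[OF w]
  have wne: "w \<noteq> v" if "v \<in> ?T" for v using that adj_irrefl by auto
  define a where "a = (\<Sum>u\<in>?T. M w u * first_order x u)"
  have a2: "two_dvd_V 2 a"
    unfolding a_def
  proof (rule two_dvd_V_sum)
    fix v assume v: "v \<in> ?T"
    have "two_dvd_V 1 (first_order x v)"
      unfolding first_order_def using v by (intro two_dvd_V_divide_unit nbr_M gap_unit) auto
    then have "two_dvd_V (Suc 1) (M w v * first_order x v)"
      by (intro two_dvd_V_power_mult M_two_dvd wne[OF v])
    then show "two_dvd_V 2 (M w v * first_order x v)" by (simp add: numeral_2_eq_2)
  qed
  have d3: "two_dvd_V 3 ((\<Sum>u\<in>?T. M w u * z u) - a)"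
  proof -
    have "(\<Sum>u\<in>?T. M w u * z u) - a = (\<Sum>u\<in>?T. M w u * (z u - first_order x u))"
      by (simp add: a_def right_diff_distrib sum_subtractf)
    moreover have "two_dvd_V 3 (\<Sum>u\<in>?T. M w u * (z u - first_order x u))"
    proof (rule two_dvd_V_sum)
      fix v assume v: "v \<in> ?T"
      then have "two_dvd_V (Suc 2) (M w v * (z v - first_order x v))"
        by (intro two_dvd_V_power_mult M_two_dvd wne nbr_first) auto
      then show "two_dvd_V 3 (M w v * (z v - first_order x v))" by (simp add: numeral_3_eq_3)
    qed
    ultimately show ?thesis by simp
  qed
  have 1: "two_dvd_V 3 (((\<Sum>u\<in>?T. M w u * z u) - a + r) / ?L)"
    by (rule two_dvd_V_divide_unit[OF two_dvd_V_add[OF d3 r(1)] u])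
  have 2: "two_dvd_V 3 (M w x / ?L - M w x / gap x w)"
    using inverse_diff_bound[OF nbr_M(1)[OF w] u gap_unit[OF w] nbr_shift(2)[OF w]] by (simp add: numeral_3_eq_3)
  have 3: "two_dvd_V 3 (a / ?L - a / gap x w)"
    by (rule two_dvd_V_mono[OF inverse_diff_bound[OF a2 u gap_unit[OF w] nbr_shift(2)[OF w]]]) simp
  have so: "second_order C x w = a / gap x w"
    by (simp add: second_order_def a_def first_order_def sum_divide_distrib mult.commute)
  have "z w = ?L * z w / ?L" using u by (simp add: unit_V_def)
  then have zw: "z w = (M w x + (\<Sum>u\<in>?T. M w u * z u) + r) / ?L" by (simp only: r(2))
  have eq: "z w - first_order x w - second_order C x w =
      ((\<Sum>u\<in>?T. M w u * z u) - a + r) / ?L + (M w x / ?L - M w x / gap x w) + (a / ?L - a / gap x w)"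
    unfolding so first_order_def by (subst zw) (rule quotient_split)
  show ?thesis unfolding eq by (rule two_dvd_V_add[OF two_dvd_V_add[OF 1 2] 3])
qed

text \<open>Row x with the second order coordinates inserted: their error is divisible by 8 and is
  multiplied by an even entry.\<close>

lemma eigen_expansion:
  "two_dvd_V 4 (l + ev (lin x) - (\<Sum>w\<in>nbrs C x. M x w * first_order x w) - (\<Sum>w\<in>nbrs C x. M x w * second_order C x w))"
proof -
  have "l + ev (lin x) = (\<Sum>w\<in>C - {x}. M x w * z w)"
    using eigen_row[OF xC] by (simp add: zx)
  also have "\<dots> = (\<Sum>w\<in>nbrs C x. M x w * z w)"
  proof (rule sum.mono_neutral_right)
    show "finite (C - {x})" using local_shapeD(1)[OF C] by simp
    show "nbrs C x \<subseteq> C - {x}" using adj_irrefl by (auto simp: nbrs_def)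
    show "\<forall>w\<in>C - {x} - nbrs C x. M x w * z w = 0"
    proof
      fix w assume "w \<in> C - {x} - nbrs C x"
      then have "x \<noteq> w" "\<not> adj x w" by (auto simp: nbrs_def)
      then show "M x w * z w = 0" by (simp add: M_nonadj)
    qed
  qed
  finally have "l + ev (lin x) - (\<Sum>w\<in>nbrs C x. M x w * first_order x w) - (\<Sum>w\<in>nbrs C x. M x w * second_order C x w)
     = (\<Sum>w\<in>nbrs C x. M x w * (z w - first_order x w - second_order C x w))"
    by (simp add: right_diff_distrib sum_subtractf)
  moreover have "two_dvd_V 4 (\<Sum>w\<in>nbrs C x. M x w * (z w - first_order x w - second_order C x w))"
  proof (rule two_dvd_V_sum)
    fix w assume w: "w \<in> nbrs C x"
    have "two_dvd_V (Suc 3) (M x w * (z w - first_order x w - second_order C x w))"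
      by (rule two_dvd_V_power_mult[OF nbr_M(2)[OF w] nbr_second[OF w]])
    then show "two_dvd_V 4 (M x w * (z w - first_order x w - second_order C x w))"
      by (simp add: eval_nat_numeral)
  qed
  ultimately show ?thesis by simp
qed

end

end

section \<open>The pole part of an eigenvalue\<close>

lemma pair_adj_coords:
  assumes "i \<noteq> j"
  shows "x + axis i 1 - axis j 1 \<noteq> x - axis i 1 + axis j (1::int)"
    "x + axis i 1 - axis j 1 \<noteq> x + axis i 1 + axis j (1::int)"
    "x + axis i 1 - axis j 1 \<noteq> x - axis i 1 - axis j (1::int)"
    "x - axis i 1 + axis j 1 \<noteq> x + axis i 1 + axis j (1::int)"
    "x - axis i 1 + axis j 1 \<noteq> x - axis i 1 - axis j (1::int)"
    "x + axis i 1 + axis j 1 \<noteq> x - axis i 1 - axis j (1::int)"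
proof -
  have ne: "\<And>v w k. v $ k \<noteq> w $ k \<Longrightarrow> v \<noteq> w" by auto
  show "x + axis i 1 - axis j 1 \<noteq> x - axis i 1 + axis j (1::int)"
    "x + axis i 1 - axis j 1 \<noteq> x - axis i 1 - axis j (1::int)"
    "x - axis i 1 + axis j 1 \<noteq> x + axis i 1 + axis j (1::int)"
    "x + axis i 1 + axis j 1 \<noteq> x - axis i 1 - axis j (1::int)"
    by (rule ne[where k = i]; use assms in \<open>simp add: axis_nth_int\<close>)+
  show "x + axis i 1 - axis j 1 \<noteq> x + axis i 1 + axis j (1::int)"
    "x - axis i 1 + axis j 1 \<noteq> x - axis i 1 - axis j (1::int)"
    by (rule ne[where k = j]; use assms in \<open>simp add: axis_nth_int\<close>)+
qed

context two_adic
begin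

lemma lin_axis: "lin (axis i 1) = xi i"
proof -
  have "lin (axis i 1) = (\<Sum>k\<in>UNIV. if i = k then xi k else 0)"
    unfolding lin_def by (intro sum.cong refl) (auto simp: axis_nth_int)
  then show ?thesis by simp
qed

context
  fixes C :: "(int^'m) set" and x :: "int^'m" and i j :: 'm
  assumes C: "local_shape C" and xC: "x \<in> C" and ij: "i \<noteq> j"
begin

text \<open>The numerator is given by \<open>pmat_products\<close>. If w is not joined to x through
  the pair i, j, the denominator is a unit of \<open>loc i j\<close>; otherwise the direction of the
  edge and the value of \<eta> fix the sign of the pole.\<close>

lemma pole_part_first:
  assumes w: "w \<in> nbrs C x"
  shows "pole_part i j (M x w * first_order x w)
    (of_bool (w = x + axis i 1 - axis j 1) - of_bool (w = x - axis i 1 + axis j 1))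
    (of_bool (eta x = 1 \<and> w = x - axis i 1 - axis j 1) - of_bool (eta x = -1 \<and> w = x + axis i 1 + axis j 1))"
proof -
  have wC: "w \<in> C" and a: "adj x w" using w by (auto simp: nbrs_def)
  have ex: "eta x = 1 \<or> eta x = -1" "eta w = 1 \<or> eta w = -1"
    using local_shapeD(2)[OF C] xC wC by blast+
  have f: "M x w * first_order x w = M x w * M w x / ev (lin (w - x))"
    by (simp add: first_order_def gap_def)
  note ne = pair_adj_coords[OF ij, of x]
  show ?thesis
  proof (cases "pair_adj i j x w")
    case False
    obtain k l where kl: "k \<noteq> l" "pair_adj k l x w" using a unfolding adj_def by blast
    have "M x w * first_order x w = 4 * (of_int (eta x * eta w) * X k * X l * inverse (ev (lin (w - x))))"
      unfolding f pmat_products[OF kl(2,1) ex] by (simp add: divide_inverse)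
    moreover have "of_int (eta x * eta w) * X k * X l * inverse (ev (lin (w - x))) \<in> loc i j"
      using root_gap_loc[OF kl(2,1) False ij] ev_loc unfolding X_def by (intro loc_intros)
    ultimately have "pole_part i j (M x w * first_order x w) 0 0"
      using pole_part_loc by metis
    moreover have "w \<noteq> x + axis i 1 - axis j 1" "w \<noteq> x - axis i 1 + axis j 1"
      "\<not> (eta x = 1 \<and> w = x - axis i 1 - axis j 1)" "\<not> (eta x = -1 \<and> w = x + axis i 1 + axis j 1)"
      using False unfolding pair_adj_def by blast+
    ultimately show ?thesis by (simp only: of_bool_eq) simp
  next
    case True
    have g: "M x w * first_order x w = 4 * of_int (eta x * eta w) * X i * X j / ev (lin (w - x))"
      unfolding f pmat_products[OF True ij ex] ..
    from True[unfolded pair_adj_def] show ?thesis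
    proof (elim disjE conjE)
      assume w': "w = x + axis i 1 - axis j 1"
      have "eta w = eta x" by (simp add: w' eta_simps)
      moreover have "ev (lin (w - x)) = X i - X j"
        by (simp add: w' lin_simps lin_axis X_def ev.hom_minus)
      ultimately have "M x w * first_order x w = 4 * X i * X j * (of_int 1 / (X i - X j) + of_int 0 / (X i + X j))"
        unfolding g using ex by auto
      then show ?thesis using pole_part_double[of i j 1 0] ne by (simp add: w')
    next
      assume w': "w = x - axis i 1 + axis j 1"
      have "eta w = eta x" by (simp add: w' eta_simps)
      moreover have "ev (lin (w - x)) = - (X i - X j)"
        by (simp add: w' lin_simps lin_axis X_def ev.hom_minus)
      ultimately have "M x w * first_order x w = 4 * X i * X j * (of_int (-1) / (X i - X j) + of_int 0 / (X i + X j))"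
        unfolding g using ex by (auto simp: divide_minus_right simp del: minus_diff_eq)
      then show ?thesis using pole_part_double[of i j "-1" 0] ne by (simp add: w')
    next
      assume e: "eta x = -1" and w': "w = x + axis i 1 + axis j 1"
      have "eta w = 1" by (simp add: w' eta_simps e)
      moreover have "ev (lin (w - x)) = X i + X j"
        by (simp add: w' lin_simps lin_axis X_def ev.hom_add)
      ultimately have "M x w * first_order x w = 4 * X i * X j * (of_int 0 / (X i - X j) + of_int (-1) / (X i + X j))"
        unfolding g using e by auto
      then show ?thesis using pole_part_double[of i j 0 "-1"] ne[symmetric] by (simp add: w' e)
    next
      assume e: "eta x = 1" and w': "w = x - axis i 1 - axis j 1"
      have "eta w = -1" by (simp add: w' eta_simps e)
      moreover have "ev (lin (w - x)) = - (X i + X j)"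
        by (simp add: w' lin_simps lin_axis X_def ev.hom_add ev.hom_minus ev.hom_uminus)
      ultimately have "M x w * first_order x w = 4 * X i * X j * (of_int 0 / (X i - X j) + of_int 1 / (X i + X j))"
        unfolding g using e by (auto simp: divide_minus_right simp del: minus_add_distrib)
      then show ?thesis using pole_part_double[of i j 0 1] ne[symmetric] by (simp add: w' e)
    qed
  qed
qed

text \<open>A triangle contributes 8 m / (gap gap). By \<open>local_shape\<close> at most one of the
  two gaps belongs to the pair i, j, so the pole is at most simple and is absorbed by the term
  \<open>8 * a' / (X i - X j)\<close> of \<open>pole_part\<close>.\<close>

lemma pole_part_second:
  assumes w: "w \<in> nbrs C x" and u: "u \<in> nbrs C x" and wu: "adj w u"
  shows "pole_part i j (M x w * (M w u * M u x / (gap x w * gap x u))) 0 0"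
proof -
  have wC: "w \<in> C" "adj x w" and uC: "u \<in> C" "adj x u" using w u by (auto simp: nbrs_def)
  have ne: "x \<noteq> w" "w \<noteq> u" "u \<noteq> x" using wC uC wu adj_irrefl by auto
  obtain m1 where m1: "M x w = 2 * ev m1" using M_off[OF ne(1)] .
  obtain m2 where m2: "M w u = 2 * ev m2" using M_off[OF ne(2)] .
  obtain m3 where m3: "M u x = 2 * ev m3" using M_off[OF ne(3)] .
  define m where "m = m1 * m2 * m3"
  have prod: "M x w * (M w u * M u x / (gap x w * gap x u)) = 8 * ev m / (gap x w * gap x u)"
    by (simp add: m1 m2 m3 m_def ev.hom_mult)
  have gw: "gap x w = ev (lin (w - x))" and gu: "gap x u = ev (lin (u - x))"
    by (simp_all add: gap_def)
  obtain k l where kl: "k \<noteq> l" "pair_adj k l x w" using wC(2) unfolding adj_def by blast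
  obtain k' l' where kl': "k' \<noteq> l'" "pair_adj k' l' x u" using uC(2) unfolding adj_def by blast
  have not_both: "\<not> (pair_adj i j x w \<and> pair_adj i j x u)"
    using local_shapeD(3)[OF C xC wC(1) uC(1) ij] ne(2) by blast
  consider "\<not> pair_adj i j x w" "\<not> pair_adj i j x u" | "pair_adj i j x w" "\<not> pair_adj i j x u"
    | "\<not> pair_adj i j x w" "pair_adj i j x u"
    using not_both by blast
  then show ?thesis
  proof cases
    case 1
    have "2 * (ev m * inverse (gap x w) * inverse (gap x u)) \<in> loc i j"
      using root_gap_loc[OF kl(2,1) 1(1) ij] root_gap_loc[OF kl'(2,1) 1(2) ij] ev_loc
        loc_intros(9)[of 2] unfolding gw gu by (intro loc_intros) simp_all
    from pole_part_loc[OF this] show ?thesis unfolding prod by (simp add: divide_inverse mult.assoc)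
  next
    case 2
    have "ev m * inverse (gap x u) \<in> loc i j"
      using root_gap_loc[OF kl'(2,1) 2(2) ij] ev_loc unfolding gu by (intro loc_intros)
    from root_gap_simple[OF 2(1) ij this] show ?thesis
      unfolding prod gw[symmetric] by (simp add: divide_inverse mult_ac)
  next
    case 3
    have "ev m * inverse (gap x w) \<in> loc i j"
      using root_gap_loc[OF kl(2,1) 3(1) ij] ev_loc unfolding gw by (intro loc_intros)
    from root_gap_simple[OF 3(2) ij this] show ?thesis
      unfolding prod gu[symmetric] by (simp add: divide_inverse mult_ac)
  qed
qed

lemma sum_nbrs_indicator:
  assumes "P \<Longrightarrow> pair_adj i j x y"
  shows "(\<Sum>w\<in>nbrs C x. of_bool (P \<and> w = y)) = (of_bool (P \<and> y \<in> C) :: int)"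
proof -
  have fin: "finite (nbrs C x)" using finite_nbrs[OF C] .
  have "(\<Sum>w\<in>nbrs C x. of_bool (P \<and> w = y)) = (\<Sum>w\<in>nbrs C x. if w = y then of_bool P else (0::int))"
    by (intro sum.cong refl) auto
  also have "\<dots> = of_bool (P \<and> y \<in> nbrs C x)" using fin by simp
  also have "(P \<and> y \<in> nbrs C x) = (P \<and> y \<in> C)"
    using assms ij unfolding nbrs_def adj_def by blast
  finally show ?thesis .
qed

lemma pole_part_eigenvalue:
  assumes zx: "z x = 1" and zV: "\<And>w. w \<in> C \<Longrightarrow> z w \<in> V"
    and eig: "\<And>y. y \<in> C \<Longrightarrow> (\<Sum>w\<in>C. M y w * z w) = l * z y"
  shows "pole_part i j l (black_ind C i j x) (red_ind C i j x)"
proof -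
  let ?N = "nbrs C x"
  let ?\<alpha> = "\<lambda>w. of_bool (w = x + axis i 1 - axis j 1) - of_bool (w = x - axis i 1 + axis j 1) :: int"
  let ?\<beta> = "\<lambda>w. of_bool (eta x = 1 \<and> w = x - axis i 1 - axis j 1)
      - of_bool (eta x = -1 \<and> w = x + axis i 1 + axis j 1) :: int"
  define r where "r = l + ev (lin x) - (\<Sum>w\<in>?N. M x w * first_order x w) - (\<Sum>w\<in>?N. M x w * second_order C x w)"
  have r: "two_dvd_V 4 r"
    unfolding r_def by (rule eigen_expansion[OF C xC zx zV eig])
  have 1: "pole_part i j (\<Sum>w\<in>?N. M x w * first_order x w) (sum ?\<alpha> ?N) (sum ?\<beta> ?N)"
    by (rule pole_part_sum) (rule pole_part_first)
  have "pole_part i j (M x w * second_order C x w) 0 0" if w: "w \<in> ?N" for w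
  proof -
    have "pole_part i j (\<Sum>u\<in>{u \<in> ?N. adj w u}. M x w * (M w u * M u x / (gap x w * gap x u)))
        (\<Sum>u\<in>{u \<in> ?N. adj w u}. 0) (\<Sum>u\<in>{u \<in> ?N. adj w u}. 0)"
      by (rule pole_part_sum) (use pole_part_second[OF w] in auto)
    then show ?thesis unfolding second_order_def sum_distrib_left by (simp only: sum.neutral_const)
  qed
  then have 2: "pole_part i j (\<Sum>w\<in>?N. M x w * second_order C x w) (\<Sum>w\<in>?N. 0) (\<Sum>w\<in>?N. 0)"
    by (intro pole_part_sum)
  have "pole_part i j (ev (- lin x) + (\<Sum>w\<in>?N. M x w * first_order x w) + (\<Sum>w\<in>?N. M x w * second_order C x w) + r)
     (0 + sum ?\<alpha> ?N + (\<Sum>w\<in>?N. 0) + 0) (0 + sum ?\<beta> ?N + (\<Sum>w\<in>?N. 0) + 0)"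
    by (intro pole_part_add pole_part_ev 1 2 pole_part_remainder r)
  moreover have "ev (- lin x) + (\<Sum>w\<in>?N. M x w * first_order x w) + (\<Sum>w\<in>?N. M x w * second_order C x w) + r = l"
    by (simp add: r_def ev.hom_uminus)
  moreover have "sum ?\<alpha> ?N = black_ind C i j x"
    using sum_nbrs_indicator[of True "x + axis i 1 - axis j 1"] sum_nbrs_indicator[of True "x - axis i 1 + axis j 1"]
    by (simp add: sum_subtractf black_ind_def pair_adj_def)
  moreover have "sum ?\<beta> ?N = red_ind C i j x"
    using sum_nbrs_indicator[of "eta x = 1" "x - axis i 1 - axis j 1"] sum_nbrs_indicator[of "eta x = -1" "x + axis i 1 + axis j 1"]
    by (simp add: sum_subtractf red_ind_def pair_adj_def)
  ultimately show ?thesis by simp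
qed

end

end

text \<open>What genericity of the sites gives for a block: it is connected and each mark, black or
  red, sits on at most one edge. The sites do not occur, so shapes can be translated and
  enumerated.\<close>

definition block_shape :: "(int^'m::finite) set \<Rightarrow> bool" where
  "block_shape C \<longleftrightarrow> local_shape C \<and> C \<noteq> {} \<and>
     (\<forall>x\<in>C. \<forall>y\<in>C. (x, y) \<in> {(x, y). x \<in> C \<and> y \<in> C \<and> adj x y}\<^sup>*) \<and>
     (\<forall>x\<in>C. \<forall>y\<in>C. \<forall>i j. i \<noteq> j \<longrightarrow> x + axis i 1 - axis j 1 \<in> C \<longrightarrow> y + axis i 1 - axis j 1 \<in> C \<longrightarrow> x = y) \<and>
     (\<forall>x\<in>C. \<forall>y\<in>C. \<forall>i j. i \<noteq> j \<longrightarrow> eta x = -1 \<longrightarrow> eta y = -1 \<longrightarrow>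
        x + axis i 1 + axis j 1 \<in> C \<longrightarrow> y + axis i 1 + axis j 1 \<in> C \<longrightarrow> x = y)"

lemma block_shapeD:
  assumes "block_shape C"
  shows "local_shape C" "C \<noteq> {}" "finite C"
    "x \<in> C \<Longrightarrow> y \<in> C \<Longrightarrow> (x, y) \<in> {(x, y). x \<in> C \<and> y \<in> C \<and> adj x y}\<^sup>*"
    "x \<in> C \<Longrightarrow> y \<in> C \<Longrightarrow> i \<noteq> j \<Longrightarrow> x + axis i 1 - axis j 1 \<in> C \<Longrightarrow> y + axis i 1 - axis j 1 \<in> C \<Longrightarrow> x = y"
    "x \<in> C \<Longrightarrow> y \<in> C \<Longrightarrow> i \<noteq> j \<Longrightarrow> eta x = -1 \<Longrightarrow> eta y = -1 \<Longrightarrow>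
        x + axis i 1 + axis j 1 \<in> C \<Longrightarrow> y + axis i 1 + axis j 1 \<in> C \<Longrightarrow> x = y"
proof -
  note a = assms[unfolded block_shape_def]
  show 1: "local_shape C" and "C \<noteq> {}" using a by simp_all
  show "finite C" by (rule local_shapeD(1)[OF 1])
  show "(x, y) \<in> {(x, y). x \<in> C \<and> y \<in> C \<and> adj x y}\<^sup>*" if "x \<in> C" "y \<in> C"
    using a that by meson
  show "x = y" if "x \<in> C" "y \<in> C" "i \<noteq> j" "x + axis i 1 - axis j 1 \<in> C" "y + axis i 1 - axis j 1 \<in> C"
    using a[THEN conjunct2, THEN conjunct2, THEN conjunct2, THEN conjunct1, rule_format, OF that] .
  show "x = y" if "x \<in> C" "y \<in> C" "i \<noteq> j" "eta x = -1" "eta y = -1"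
      "x + axis i 1 + axis j 1 \<in> C" "y + axis i 1 + axis j 1 \<in> C"
    using a[THEN conjunct2, THEN conjunct2, THEN conjunct2, THEN conjunct2, rule_format, OF that] .
qed

lemma block_shape_closed:
  assumes "block_shape C" "x \<in> S" "x \<in> C" "\<And>x w. x \<in> S \<Longrightarrow> x \<in> C \<Longrightarrow> w \<in> C \<Longrightarrow> adj x w \<Longrightarrow> w \<in> S"
  shows "C \<subseteq> S"
proof
  fix y assume "y \<in> C"
  with assms have "(x, y) \<in> {(x, y). x \<in> C \<and> y \<in> C \<and> adj x y}\<^sup>*" by (intro block_shapeD(4))
  then have "y \<in> S \<and> y \<in> C"
    by (induction rule: rtrancl_induct) (use assms in auto)
  then show "y \<in> S" ..
qed

lemma adj_cases:
  assumes "adj x w"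
  obtains (black) i j where "i \<noteq> j" "w = x + axis i 1 - axis j 1"
    | (red_up) i j where "i \<noteq> j" "eta x = -1" "w = x + axis i 1 + axis j 1"
    | (red_down) i j where "i \<noteq> j" "eta x = 1" "w = x - axis i 1 - axis j 1"
proof -
  obtain i j where ij: "i \<noteq> j" "pair_adj i j x w" using assms unfolding adj_def by blast
  have "x - axis i 1 + axis j 1 = x + axis j 1 - axis i (1::int)" by simp
  then show thesis
    using ij(2) black[OF ij(1)] black[OF ij(1)[symmetric]] red_up[OF ij(1)] red_down[OF ij(1)]
    unfolding pair_adj_def by metis
qed

lemma local_shape_black_ind:
  assumes "local_shape C" "x \<in> C" "i \<noteq> j"
  shows "odd (black_ind C i j x) \<longleftrightarrow> x + axis i 1 - axis j 1 \<in> C \<or> x - axis i 1 + axis j 1 \<in> C"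
proof -
  have "\<not> (x + axis i 1 - axis j 1 \<in> C \<and> x - axis i 1 + axis j 1 \<in> C)"
    using local_shapeD(3)[OF assms(1,2) _ _ assms(3)] pair_adj_coords(1)[OF assms(3)]
    unfolding pair_adj_def by blast
  then show ?thesis by (auto simp: black_ind_def)
qed

lemma red_ind_odd:
  "odd (red_ind C i j x) \<longleftrightarrow> (eta x = 1 \<and> x - axis i 1 - axis j 1 \<in> C) \<or> (eta x = -1 \<and> x + axis i 1 + axis j 1 \<in> C)"
  by (auto simp: red_ind_def)

lemma monic_poly_sum_roots:
  fixes a :: "nat \<Rightarrow> complex"
  assumes "N > 0"
  shows "(\<Sum>s<N. a s) = - coeff (\<Prod>s<N. [:- a s, 1:]) (N - 1)"
proof (cases "N = 1")
  case True
  then show ?thesis by simp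
next
  case False
  then have N: "1 < N" using assms by simp
  show ?thesis
    using newton_identity_low[OF N, of a] N by (simp add: of_nat_diff algebra_simps)
qed

section \<open>Labels of eigenvalues\<close>

context two_adic
begin

text \<open>A label is a position where some eigenvector is largest for V; dividing by that
  coordinate gives \<open>z\<close>.\<close>

definition is_label :: "(int^'m) set \<Rightarrow> complex \<Rightarrow> int^'m \<Rightarrow> bool" where
  "is_label C l x \<longleftrightarrow> x \<in> C \<and> (\<exists>z. z x = 1 \<and> (\<forall>w\<in>C. z w \<in> V) \<and>
     (\<forall>y\<in>C. (\<Sum>w\<in>C. M y w * z w) = l * z y))"

lemma is_label_near:
  assumes "local_shape C" "is_label C l x"
  shows "two_dvd_V 2 (l + ev (lin x))"
  using assms eigen_near2[OF assms(1)] unfolding is_label_def by blast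

lemma is_label_pole_part:
  assumes "local_shape C" "is_label C l x" "i \<noteq> j"
  shows "pole_part i j l (black_ind C i j x) (red_ind C i j x)"
  using assms pole_part_eigenvalue[OF assms(1) _ assms(3)] unfolding is_label_def by blast

lemma valuation_maximum:
  assumes "finite S" "S \<noteq> {}" "\<And>w. w \<in> S \<Longrightarrow> z w \<noteq> (0::complex)"
  shows "\<exists>x\<in>S. \<forall>w\<in>S. z w / z x \<in> V"
  using assms
proof (induction S rule: finite_ne_induct)
  case (singleton x)
  then show ?case using V_intros(2) by simp
next
  case (insert a S)
  then obtain x where x: "x \<in> S" "\<forall>w\<in>S. z w / z x \<in> V" by auto
  have nz: "z x \<noteq> 0" "z a \<noteq> 0" using insert.prems x by auto
  show ?case
  proof (cases "z a / z x \<in> V")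
    case True
    then show ?thesis using x by auto
  next
    case False
    then have ax: "z x / z a \<in> V" using val[of "z a / z x"] by simp
    have "z w / z a \<in> V" if "w \<in> insert a S" for w
    proof (cases "w = a")
      case True
      then show ?thesis using nz V_intros(2) by simp
    next
      case False
      then have "z w / z x * (z x / z a) \<in> V" using that x ax by (intro V_intros) auto
      then show ?thesis using nz by simp
    qed
    then show ?thesis by blast
  qed
qed

lemma label_exists:
  assumes "local_shape C" "poly (leibniz_charpoly C M) l = 0"
  shows "\<exists>x. is_label C l x"
proof -
  have fin: "finite C" by (rule local_shapeD(1)[OF assms(1)])
  have "\<exists>z. (\<exists>x\<in>C. z x \<noteq> 0) \<and> (\<forall>x\<in>C. (\<Sum>w\<in>C. M x w * z w) = l * z x)"
  proof (rule leibniz_charpoly_eigenvector[OF fin assms(2)])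
    fix z assume "\<exists>x\<in>C. z x \<noteq> 0" "\<And>x. x \<in> C \<Longrightarrow> (\<Sum>w\<in>C. M x w * z w) = l * z x"
    then show ?thesis by blast
  qed
  then obtain z where z: "\<exists>x\<in>C. z x \<noteq> 0" "\<And>x. x \<in> C \<Longrightarrow> (\<Sum>w\<in>C. M x w * z w) = l * z x"
    by blast
  have "\<exists>x\<in>{x \<in> C. z x \<noteq> 0}. \<forall>w\<in>{x \<in> C. z x \<noteq> 0}. z w / z x \<in> V"
    by (rule valuation_maximum) (use z(1) fin in auto)
  then obtain x where x: "x \<in> C" "z x \<noteq> 0" "\<And>w. w \<in> C \<Longrightarrow> z w \<noteq> 0 \<Longrightarrow> z w / z x \<in> V" by blast
  have "z w / z x \<in> V" if "w \<in> C" for w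
    using x(3)[OF that] V_intros(1) by (cases "z w = 0") auto
  moreover have "(\<Sum>w\<in>C. M y w * (z w / z x)) = l * (z y / z x)" if "y \<in> C" for y
    using z(2)[OF that] by (simp add: sum_divide_distrib[symmetric])
  ultimately show ?thesis
    unfolding is_label_def using x(1,2) by (intro exI[of _ x] conjI exI[of _ "\<lambda>w. z w / z x"]) auto
qed

text \<open>Both labels describe the same number. Subtracting the approximations modulo 4 compares x
  with y, and subtracting the pole parts gives a pole part of 0, to which
  \<open>pole_part_zero\<close> applies.\<close>

lemma label_parity:
  assumes "local_shape C" "local_shape C'" "is_label C l x" "is_label C' l y"
  shows "4 dvd (x - y) $ k"
    "i \<noteq> j \<Longrightarrow> odd (black_ind C i j x) \<longleftrightarrow> odd (black_ind C' i j y)"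
    "i \<noteq> j \<Longrightarrow> odd (red_ind C i j x) \<longleftrightarrow> odd (red_ind C' i j y)"
proof -
  have "two_dvd_V 2 ((l + ev (lin x)) - (l + ev (lin y)))"
    by (rule two_dvd_V_diff[OF is_label_near[OF assms(1,3)] is_label_near[OF assms(2,4)]])
  then have "two_dvd_V 2 (ev (lin (x - y)))" by (simp add: lin_simps ev.hom_minus)
  then show "4 dvd (x - y) $ k" using two_power_dvd_lin_iff[of 2 "x - y"] two_dvd_V_ev_iff by simp
  have *: "even (black_ind C i j x - black_ind C' i j y) \<and> even (red_ind C i j x - red_ind C' i j y)"
    if ij: "i \<noteq> j"
  proof (rule pole_part_zero[OF ij])
    show "pole_part i j 0 (black_ind C i j x - black_ind C' i j y) (red_ind C i j x - red_ind C' i j y)"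
      using pole_part_diff[OF is_label_pole_part[OF assms(1,3) ij] is_label_pole_part[OF assms(2,4) ij]] by simp
  qed
  then show "i \<noteq> j \<Longrightarrow> odd (black_ind C i j x) \<longleftrightarrow> odd (black_ind C' i j y)"
    "i \<noteq> j \<Longrightarrow> odd (red_ind C i j x) \<longleftrightarrow> odd (red_ind C' i j y)" by auto
qed

lemma label_eta:
  assumes "local_shape C" "local_shape C'" "is_label C l x" "is_label C' l y"
  shows "eta x = eta y"
proof -
  have "4 dvd eta (x - y)"
    unfolding eta_def by (rule dvd_sum) (rule label_parity(1)[OF assms])
  then have "4 dvd eta x - eta y" by (simp add: eta_simps)
  moreover have "eta x = 1 \<or> eta x = -1" "eta y = 1 \<or> eta y = -1"
    using assms local_shapeD(2) unfolding is_label_def by blast+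
  ultimately show ?thesis by auto
qed

text \<open>If x and y were two labels, x would have a neighbour by connectedness. By
  \<open>label_parity\<close> an edge with the same mark also ends at y, and marks are unique, so y
  is the other end of the edge at x. This contradicts x \<equiv> y modulo 4, or \<eta>(x) =
  \<eta>(y) for a red edge.\<close>

lemma label_unique:
  assumes C: "block_shape C" and l: "is_label C l x" "is_label C l y"
  shows "x = y"
proof (rule ccontr)
  assume ne: "x \<noteq> y"
  note L = block_shapeD(1)[OF C]
  have xy: "x \<in> C" "y \<in> C" using l by (auto simp: is_label_def)
  have "(x, y) \<in> {(x, y). x \<in> C \<and> y \<in> C \<and> adj x y}\<^sup>*" by (rule block_shapeD(4)[OF C xy])
  then obtain w where w: "w \<in> C" "adj x w" using ne by (cases rule: converse_rtranclE) auto
  have not_adj: False if "odd ((y - x) $ k)" for k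
  proof -
    have "(2::int) dvd 4" by simp
    then have "even ((x - y) $ k)" using label_parity(1)[OF L L l, of k] by (rule dvd_trans)
    then show False using that by simp
  qed
  show False
    using w(2)
  proof (cases rule: adj_cases)
    case (black i j)
    then have "odd (black_ind C i j y)"
      using w(1) label_parity(2)[OF L L l black(1)] local_shape_black_ind[OF L xy(1) black(1)] by simp
    then consider "y + axis i 1 - axis j 1 \<in> C" | "y - axis i 1 + axis j 1 \<in> C"
      using local_shape_black_ind[OF L xy(2) black(1)] by blast
    then show False
    proof cases
      case 1
      then show False using block_shapeD(5)[OF C xy black(1)] w(1) black(2) ne by blast
    next
      case 2
      have "(y - axis i 1 + axis j 1) + axis i 1 - axis j 1 \<in> C" using xy by simp
      then have "x = y - axis i 1 + axis j 1"
        using block_shapeD(5)[OF C xy(1) 2 black(1)] w(1) black(2) by blast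
      then have "(y - x) $ i = 1" using black(1) by (simp add: axis_nth_int)
      then show False using not_adj[of i] by simp
    qed
  next
    case (red_up i j)
    then have "odd (red_ind C i j y)"
      using w(1) label_parity(3)[OF L L l red_up(1)] by (simp add: red_ind_odd)
    then have "y + axis i 1 + axis j 1 \<in> C" "eta y = -1"
      using label_eta[OF L L l] red_up(2) by (auto simp: red_ind_odd)
    then show False using block_shapeD(6)[OF C xy red_up(1,2)] w(1) red_up(3) ne by blast
  next
    case (red_down i j)
    then have "odd (red_ind C i j y)"
      using w(1) label_parity(3)[OF L L l red_down(1)] by (simp add: red_ind_odd)
    then have y': "y - axis i 1 - axis j 1 \<in> C" "eta y = 1"
      using label_eta[OF L L l] red_down(2) by (auto simp: red_ind_odd)
    have "x - axis i 1 - axis j 1 = y - axis i 1 - axis j 1"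
      using block_shapeD(6)[OF C _ y'(1) red_down(1), of w] w(1) red_down y' xy
      by (simp add: eta_simps)
    then show False using ne by simp
  qed
qed

subsection \<open>Orthogonality of eigenvectors\<close>

lemma X_unit: "unit_V (X k)"
proof -
  have "\<not> 2 dvd xi k"
  proof
    assume "2 dvd xi k"
    then have "2 dvd coeff (xi k) 1" using two_power_dvd_poly_poly_iff[of 1 "xi k"] by simp
    then show False using two_dvd_zz by (simp add: xi_def)
  qed
  then show ?thesis unfolding X_def by (rule unit_V_ev)
qed

lemma unit_V_mult: "unit_V a \<Longrightarrow> unit_V b \<Longrightarrow> unit_V (a * b)"
  by (auto simp: unit_V_def inverse_mult_distrib intro: V_intros)

lemma unit_V_inverse: "unit_V a \<Longrightarrow> unit_V (inverse a)"
  by (auto simp: unit_V_def)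

lemma unit_V_prod: "(\<And>i. i \<in> I \<Longrightarrow> unit_V (f i)) \<Longrightarrow> unit_V (prod f I)"
proof (induction I rule: infinite_finite_induct)
  case (insert i I)
  then show ?case by (simp add: unit_V_mult)
qed (auto simp: unit_V_def V_intros)

lemma unit_V_powi: "unit_V a \<Longrightarrow> unit_V (a powi n)"
proof -
  assume a: "unit_V a"
  have p: "unit_V (b ^ k)" if "unit_V b" for b k
    using that unit_V_prod[of "{..<k}" "\<lambda>_. b"] by simp
  show ?thesis using p[OF a] p[OF unit_V_inverse[OF a]] by (simp add: power_int_def)
qed

text \<open>A diagonal matrix that symmetrises \<open>M\<close> (\<open>weight_sym\<close>), so that
  eigenvectors for different eigenvalues are orthogonal for the weighted bilinear form. At the
  points of a block the weights are units of V.\<close>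

definition weight :: "int^'m \<Rightarrow> complex" where
  "weight y = of_int (- eta y) * (\<Prod>k\<in>UNIV. X k powi (y $ k))"

lemma weight_unit:
  assumes "eta y = 1 \<or> eta y = -1"
  shows "unit_V (weight y)"
  unfolding weight_def
proof (intro unit_V_mult unit_V_prod unit_V_powi X_unit)
  show "unit_V (of_int (- eta y))" using assms V_intros(2) V_intros(3)[of 1] by (auto simp: unit_V_def)
qed

lemma weight_sym: "weight y * M y w = weight w * M w y"
proof (cases "y = w")
  case False
  show ?thesis
  proof (cases "adj y w")
    case True
    then obtain i j where ij: "i \<noteq> j" "pair_adj i j y w" unfolding adj_def by blast
    have "X k powi (y $ k) * (if (w - y) $ k = 1 then X k else 1) =
          X k powi (w $ k) * (if (y - w) $ k = 1 then X k else 1)" for k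
    proof -
      have nz: "X k \<noteq> 0" using X_unit by (simp add: unit_V_def)
      have "(w - y) $ k = -1 \<or> (w - y) $ k = 0 \<or> (w - y) $ k = 1"
        using pair_adj_odd(2)[OF ij(2,1), of k] by linarith
      then have "y $ k = w $ k + 1 \<or> w $ k = y $ k \<or> w $ k = y $ k + 1" by auto
      then show ?thesis
      proof (elim disjE)
        assume "y $ k = w $ k + 1"
        then show ?thesis using nz by (simp add: power_int_add_1)
      next
        assume "w $ k = y $ k + 1"
        then show ?thesis using nz by (simp add: power_int_add_1)
      qed simp
    qed
    then have "(\<Prod>k\<in>UNIV. X k powi (y $ k) * (if (w - y) $ k = 1 then X k else 1)) =
        (\<Prod>k\<in>UNIV. X k powi (w $ k) * (if (y - w) $ k = 1 then X k else 1))" by simp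
    then have "(\<Prod>k\<in>UNIV. X k powi (y $ k)) * (\<Prod>k | (w - y) $ k = 1. X k) =
        (\<Prod>k\<in>UNIV. X k powi (w $ k)) * (\<Prod>k | (y - w) $ k = 1. X k)"
      by (simp add: prod.distrib prod.If_cases)
    then show ?thesis
      using False True adj_sym[OF True] by (simp add: pmat_def weight_def mult_ac)
  next
    case nadj: False
    then have "\<not> adj w y" using adj_sym by blast
    then show ?thesis using False nadj M_nonadj[of y w] M_nonadj[of w y] by simp
  qed
qed simp

definition nonunit_V :: "complex \<Rightarrow> bool" where
  "nonunit_V a \<longleftrightarrow> a \<in> V \<and> \<not> unit_V a"

lemma nonunit_V_mult: "nonunit_V a \<Longrightarrow> b \<in> V \<Longrightarrow> nonunit_V (a * b)"
proof -
  assume a: "nonunit_V a" and b: "b \<in> V"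
  have "\<not> unit_V (a * b)"
  proof
    assume u: "unit_V (a * b)"
    then have nz: "a \<noteq> 0" "b \<noteq> 0" by (auto simp: unit_V_def)
    have "inverse a = b * inverse (a * b)" using nz by (simp add: field_simps)
    also have "\<dots> \<in> V" using u b by (intro V_intros) (auto simp: unit_V_def)
    finally show False using a nz by (simp add: nonunit_V_def unit_V_def)
  qed
  then show ?thesis using a b by (auto simp: nonunit_V_def intro: V_intros)
qed

lemma nonunit_V_add_aux:
  assumes "nonunit_V a" "nonunit_V b" "b \<noteq> 0" "a / b \<in> V"
  shows "nonunit_V (a + b)"
proof -
  have "nonunit_V (b * (a / b + 1))"
    using assms by (intro nonunit_V_mult V_intros)
  then show ?thesis using assms(3) by (simp add: distrib_left)
qed

lemma nonunit_V_add:
  assumes "nonunit_V a" "nonunit_V b"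
  shows "nonunit_V (a + b)"
proof (cases "a = 0 \<or> b = 0")
  case True
  then show ?thesis using assms by auto
next
  case False
  then have "a / b \<in> V \<or> b / a \<in> V" using val[of "a / b"] by simp
  then show ?thesis
    using nonunit_V_add_aux[OF assms] nonunit_V_add_aux[OF assms(2,1)] False by (auto simp: add.commute)
qed

lemma nonunit_V_sum: "(\<And>i. i \<in> I \<Longrightarrow> nonunit_V (f i)) \<Longrightarrow> nonunit_V (sum f I)"
proof (induction I rule: infinite_finite_induct)
  case (insert i I)
  then show ?case by (simp add: nonunit_V_add)
qed (auto simp: nonunit_V_def unit_V_def V_intros)

text \<open>Eigenvectors of two different eigenvalues would be orthogonal for the weighted form.
  With a common label x the term at x is a unit, while all other terms are nonunits by
  \<open>label_unique\<close>, so the sum cannot vanish.\<close>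

lemma label_eigenvalue_unique:
  assumes C: "block_shape C" and l: "is_label C l x" "is_label C l' x"
  shows "l = l'"
proof (rule ccontr)
  assume ne: "l \<noteq> l'"
  note L = block_shapeD(1)[OF C]
  have fin: "finite C" and xC: "x \<in> C" using L local_shapeD(1) l by (auto simp: is_label_def)
  obtain z where z: "z x = 1" "\<And>w. w \<in> C \<Longrightarrow> z w \<in> V" "\<And>y. y \<in> C \<Longrightarrow> (\<Sum>w\<in>C. M y w * z w) = l * z y"
    using l(1) unfolding is_label_def by blast
  obtain z' where z': "z' x = 1" "\<And>w. w \<in> C \<Longrightarrow> z' w \<in> V" "\<And>y. y \<in> C \<Longrightarrow> (\<Sum>w\<in>C. M y w * z' w) = l' * z' y"
    using l(2) unfolding is_label_def by blast
  have "l * (\<Sum>y\<in>C. weight y * z y * z' y) = (\<Sum>y\<in>C. weight y * (l * z y) * z' y)"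
    by (simp add: sum_distrib_left mult_ac)
  also have "\<dots> = (\<Sum>y\<in>C. \<Sum>w\<in>C. weight y * M y w * z w * z' y)"
  proof (rule sum.cong[OF refl])
    fix y assume y: "y \<in> C"
    have "(\<Sum>w\<in>C. weight y * M y w * z w * z' y) = weight y * (\<Sum>w\<in>C. M y w * z w) * z' y"
      by (simp add: sum_distrib_left sum_distrib_right mult.assoc)
    then show "weight y * (l * z y) * z' y = (\<Sum>w\<in>C. weight y * M y w * z w * z' y)"
      by (simp only: z(3)[OF y])
  qed
  also have "\<dots> = (\<Sum>y\<in>C. \<Sum>w\<in>C. weight w * M w y * z w * z' y)"
    by (intro sum.cong refl) (simp only: weight_sym)
  also have "\<dots> = (\<Sum>w\<in>C. \<Sum>y\<in>C. weight w * M w y * z w * z' y)" by (rule sum.swap)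
  also have "\<dots> = (\<Sum>w\<in>C. weight w * z w * (l' * z' w))"
  proof (rule sum.cong[OF refl])
    fix w assume w: "w \<in> C"
    have "(\<Sum>y\<in>C. weight w * M w y * z w * z' y) = weight w * z w * (\<Sum>y\<in>C. M w y * z' y)"
      by (simp add: sum_distrib_left mult_ac)
    then show "(\<Sum>y\<in>C. weight w * M w y * z w * z' y) = weight w * z w * (l' * z' w)"
      by (simp only: z'(3)[OF w])
  qed
  also have "\<dots> = l' * (\<Sum>y\<in>C. weight y * z y * z' y)"
    by (simp add: sum_distrib_left mult_ac)
  finally have "(\<Sum>y\<in>C. weight y * z y * z' y) = 0" using ne by simp
  then have "weight x + (\<Sum>y\<in>C - {x}. weight y * z y * z' y) = 0"
    using sum.remove[OF fin xC, of "\<lambda>y. weight y * z y * z' y"] z(1) z'(1) by simp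
  then have w: "weight x = - 1 * (\<Sum>y\<in>C - {x}. weight y * z y * z' y)" by (simp add: add_eq_0_iff2)
  have "nonunit_V (\<Sum>y\<in>C - {x}. weight y * z y * z' y)"
  proof (rule nonunit_V_sum)
    fix y assume y: "y \<in> C - {x}"
    \<comment> \<open>A unit coordinate at y would make y a second label of
      \<open>l\<close>.\<close>
    have "\<not> unit_V (z y)"
    proof
      assume u: "unit_V (z y)"
      have "is_label C l y"
        unfolding is_label_def
      proof (intro conjI exI[of _ "\<lambda>w. z w / z y"] ballI)
        show "y \<in> C" using y by simp
        show "z y / z y = 1" using u by (simp add: unit_V_def)
        show "z w / z y \<in> V" if "w \<in> C" for w
          unfolding divide_inverse using z(2)[OF that] u by (intro V_intros) (auto simp: unit_V_def)
        show "(\<Sum>w\<in>C. M v w * (z w / z y)) = l * (z v / z y)" if "v \<in> C" for v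
          using z(3)[OF that] by (simp add: sum_divide_distrib[symmetric])
      qed
      from label_unique[OF C l(1) this] show False using y by simp
    qed
    then have "nonunit_V (z y)" using z(2) y by (simp add: nonunit_V_def)
    moreover have "weight y * z' y \<in> V"
      using weight_unit[of y] local_shapeD(2)[OF L, of y] z'(2) y
      by (intro V_intros) (auto simp: unit_V_def)
    ultimately have "nonunit_V (z y * (weight y * z' y))" by (rule nonunit_V_mult)
    then show "nonunit_V (weight y * z y * z' y)" by (simp add: mult_ac)
  qed
  then have "nonunit_V (weight x)"
    unfolding w using V_intros(3)[OF V_intros(2)] nonunit_V_mult by (metis mult.commute)
  then show False
    using weight_unit[of x] local_shapeD(2)[OF L xC] by (simp add: nonunit_V_def)
qed

end

subsection \<open>Irreducibility and separation\<close>

context two_adic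
begin

text \<open>Divisibility holds over Z[y][s] itself, by Gauss's lemma: the primitive part of a
  polynomial of least degree vanishing at \<open>l\<close> divides every other one. It divides the
  monic \<open>q\<close>, so its leading coefficient is a unit and can be normalised.\<close>

lemma minimal_polynomial:
  assumes q: "poly (map_poly ev q) l = 0" "lead_coeff q = 1"
  obtains p where "lead_coeff p = 1" "poly (map_poly ev p) l = 0"
    "\<And>r. poly (map_poly ev r) l = 0 \<Longrightarrow> p dvd r"
proof -
  interpret mp: map_poly_comm_ring_hom ev ..
  define P where "P r \<longleftrightarrow> r \<noteq> 0 \<and> poly (map_poly ev r) l = 0" for r
  have "P q" using q by (auto simp: P_def)
  then obtain p0 where p0: "P p0" "\<And>r. P r \<Longrightarrow> degree p0 \<le> degree r"
    using ex_has_least_nat[of P q degree] by blast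
  define c where "c = content p0"
  define p1 where "p1 = primitive_part p0"
  have p01: "p0 = smult c p1" by (simp add: c_def p1_def)
  have c0: "c \<noteq> 0" and p10: "p1 \<noteq> 0" using p0(1) p01 by (auto simp: P_def)
  have cont: "content p1 = 1" using p10 p0(1) by (simp add: p1_def P_def)
  have deg: "degree p1 = degree p0" using c0 by (simp add: p01)
  have "map_poly ev p0 = smult (ev c) (map_poly ev p1)"
    unfolding p01 by (rule ev.map_poly_hom_smult)
  then have P1: "P p1" using p0(1) c0 p10 by (simp add: P_def)
  have dvd1: "p1 dvd r" if r: "poly (map_poly ev r) l = 0" for r
  proof -
    \<comment> \<open>The pseudo-remainder vanishes at \<open>l\<close> and has too small a degree,
      so it is 0. The factor \<open>a\<close> introduced by pseudo-division is then cancelled by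
      comparing contents.\<close>
    obtain s t where st: "pseudo_divmod r p1 = (s, t)" by fastforce
    define a where "a = coeff p1 (degree p1) ^ (Suc (degree r) - degree p1)"
    have eq: "smult a r = p1 * s + t" and t: "t = 0 \<or> degree t < degree p1"
      using pseudo_divmod[OF p10 st] by (simp_all add: a_def)
    have a0: "a \<noteq> 0" using p10 by (simp add: a_def)
    have "poly (map_poly ev (smult a r)) l = 0" using r by (simp add: ev.map_poly_hom_smult)
    then have "poly (map_poly ev t) l = 0"
      using P1 unfolding eq P_def by (simp add: mp.hom_add mp.hom_mult)
    then have "t = 0 \<or> degree p0 \<le> degree t" using p0(2)[of t] unfolding P_def by blast
    then have "t = 0" using t deg by linarith
    then have eq: "smult a r = p1 * s" using eq by simp
    then have "[:a:] * r = p1 * s" by simp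
    then have "[:a:] dvd p1 * s" by (rule dvdI[OF sym])
    then have "a dvd content (p1 * s)" by (simp add: const_poly_dvd_iff_dvd_content)
    then have "a dvd content s" by (simp add: content_mult cont)
    then have "[:a:] dvd s" by (simp add: const_poly_dvd_iff_dvd_content)
    then obtain s' where "s = [:a:] * s'" by (rule dvdE)
    then have s': "s = smult a s'" by simp
    then have "smult a r = smult a (p1 * s')" using eq by simp
    then have "r = p1 * s'" using a0 by (simp add: smult_cancel)
    then show ?thesis by simp
  qed
  obtain t where t: "q = p1 * t" using dvd1[OF q(1)] by blast
  have lc: "lead_coeff p1 * lead_coeff t = 1" using q(2) by (simp add: t lead_coeff_mult)
  define u where "u = lead_coeff t"
  have u: "lead_coeff p1 * u = 1" "u \<noteq> 0" using lc by (auto simp: u_def)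
  show thesis
  proof (rule that[of "smult u p1"])
    show "lead_coeff (smult u p1) = 1" using u by (simp add: mult.commute)
    show "poly (map_poly ev (smult u p1)) l = 0" using P1 by (simp add: P_def ev.map_poly_hom_smult)
    fix r assume "poly (map_poly ev r) l = 0"
    then obtain s where s: "r = p1 * s" using dvd1 by blast
    have "r = smult u p1 * smult (lead_coeff p1) s"
      using u by (simp add: s mult.commute)
    then show "smult u p1 dvd r" by (metis dvd_triv_left)
  qed
qed

lemma ev_monic:
  assumes "lead_coeff p = 1"
  shows "degree (map_poly ev p) = degree p" "lead_coeff (map_poly ev p) = 1"
proof -
  show "degree (map_poly ev p) = degree p"
    by (rule degree_map_poly) (use assms in auto)
  then show "lead_coeff (map_poly ev p) = 1" using assms by simp
qed

lemma ev_pderiv: "map_poly ev (pderiv p) = pderiv (map_poly ev p)"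
  by (rule poly_eqI) (simp add: coeff_pderiv coeff_map_poly ev.hom_mult ev.hom_of_nat del: of_nat_Suc)

text \<open>Separability in characteristic 0, together with the fact that the sum of the roots is a
  coefficient up to sign, hence in the image of \<open>ev\<close>.\<close>

lemma minimal_polynomial_roots:
  assumes p: "lead_coeff p = 1" "poly (map_poly ev p) l = 0"
    and min: "\<And>r. poly (map_poly ev r) l = 0 \<Longrightarrow> p dvd r"
  defines "R \<equiv> {m. poly (map_poly ev p) m = 0}"
  shows "finite R" "card R = degree p" "\<exists>D. (\<Sum>m\<in>R. m) = ev D" "l \<in> R" "degree p > 0"
proof -
  interpret mp: map_poly_comm_ring_hom ev ..
  let ?f = "map_poly ev p"
  let ?N = "degree p"
  show "l \<in> R" using p by (simp add: R_def)
  show N: "?N > 0"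
  proof (rule ccontr)
    assume "\<not> ?N > 0"
    then have "p = 1" using p(1) by (metis degree_0_id gr0I one_pCons)
    then show False using p(2) by simp
  qed
  have f0: "?f \<noteq> 0" using ev_monic[OF p(1)] by auto
  show "finite R" unfolding R_def by (rule poly_roots_finite[OF f0])
  \<comment> \<open>The minimal polynomial q of a multiple root m divides both p and its derivative.
    Writing p = q t, the number \<open>l\<close> is a root of q or of t, and either contradicts the
    minimality of p on degree grounds.\<close>
  have simple: "poly (pderiv ?f) m \<noteq> 0" if m: "m \<in> R" for m
  proof
    assume d: "poly (pderiv ?f) m = 0"
    obtain q where q: "lead_coeff q = 1" "poly (map_poly ev q) m = 0"
      "\<And>r. poly (map_poly ev r) m = 0 \<Longrightarrow> q dvd r"
      using minimal_polynomial[of p m] m p(1) unfolding R_def by blast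
    have "degree q > 0"
    proof (rule ccontr)
      assume "\<not> degree q > 0"
      then have "q = 1" using q(1) by (metis degree_0_id gr0I one_pCons)
      then show False using q(2) by simp
    qed
    obtain t where t: "p = q * t" using q(3) m unfolding R_def by blast
    have nz: "q \<noteq> 0" "t \<noteq> 0" "p \<noteq> 0" using p(1) t by auto
    have "poly (map_poly ev q) l = 0 \<or> poly (map_poly ev t) l = 0"
      using p(2) by (simp add: t mp.hom_mult)
    then show False
    proof
      assume "poly (map_poly ev q) l = 0"
      then have "p dvd q" by (rule min)
      then have "degree p \<le> degree q" using nz by (intro dvd_imp_degree_le)
      moreover have "poly (map_poly ev (pderiv p)) m = 0" using d by (simp only: ev_pderiv)
      then have "q dvd pderiv p" by (rule q(3))
      moreover have "pderiv p \<noteq> 0" using N by (simp add: pderiv_eq_0_iff)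
      ultimately have le: "degree p \<le> degree q" "q dvd pderiv p" "pderiv p \<noteq> 0" by blast+
      have "degree q \<le> degree (pderiv p)" using le(2,3) by (rule dvd_imp_degree_le)
      then show False using N le(1) by (simp add: degree_pderiv)
    next
      assume "poly (map_poly ev t) l = 0"
      then have "p dvd t" by (rule min)
      then have "degree p \<le> degree t" using nz by (intro dvd_imp_degree_le)
      then show False using t nz \<open>degree q > 0\<close> by (simp add: degree_mult_eq)
    qed
  qed
  obtain as where as: "smult (lead_coeff ?f) (\<Prod>a\<leftarrow>as. [:- a, 1:]) = ?f" "length as = degree ?f"
    using fundamental_theorem_algebra_factorized[of ?f] by blast
  define a where "a s = as ! s" for s
  have fa: "?f = (\<Prod>s<?N. [:- a s, 1:])"
    using as ev_monic[OF p(1)] by (simp add: prod.list_conv_set_nth a_def atLeast0LessThan)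
  have Ra: "R = a ` {..<?N}"
    unfolding R_def fa by (auto simp: poly_prod)
  have inj: "inj_on a {..<?N}"
  proof (rule inj_onI, rule ccontr)
    fix s t assume st: "s \<in> {..<?N}" "t \<in> {..<?N}" "a s = a t" "s \<noteq> t"
    define g where "g r = [:- a r, 1:]" for r
    define h where "h = prod g ({..<?N} - {s} - {t})"
    have "prod g {..<?N} = g s * prod g ({..<?N} - {s})" using st by (intro prod.remove) auto
    also have "prod g ({..<?N} - {s}) = g t * h"
      unfolding h_def using st by (intro prod.remove) auto
    finally have "?f = [:- a s, 1:] * ([:- a t, 1:] * h)"
      unfolding fa g_def .
    then have "pderiv ?f = [:- a s, 1:] * pderiv ([:- a t, 1:] * h) + ([:- a t, 1:] * h) * pderiv [:- a s, 1:]"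
      by (simp only: pderiv_mult)
    then have "poly (pderiv ?f) (a s) = 0"
      using st(3) by (simp only: poly_add poly_mult) simp
    moreover have "a s \<in> R" using st Ra by auto
    ultimately show False using simple by blast
  qed
  show "card R = ?N" unfolding Ra by (simp add: card_image[OF inj])
  have "(\<Sum>m\<in>R. m) = (\<Sum>s<?N. a s)" unfolding Ra by (simp add: sum.reindex[OF inj])
  also have "\<dots> = - coeff ?f (?N - 1)" unfolding fa by (rule monic_poly_sum_roots[OF N])
  also have "\<dots> = ev (- coeff p (?N - 1))" by (simp add: ev.hom_uminus)
  finally show "\<exists>D. (\<Sum>m\<in>R. m) = ev D" by blast
qed

lemma ev_pmat: "ev (pmat xi x w) = M x w"
  by (simp add: pmat_def X_def ev.hom_mult ev.hom_prod ev.hom_of_int ev.hom_uminus ev.hom_sum)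

lemma ev_charpoly: "map_poly ev (leibniz_charpoly C (pmat xi)) = leibniz_charpoly C M"
  unfolding leibniz_charpoly_hom[OF ev] ev_pmat ..

lemma odd_sum_single:
  fixes f :: "'i \<Rightarrow> int"
  assumes "finite S" "x \<in> S" "odd (f x)" "\<And>y. y \<in> S \<Longrightarrow> odd (f y) \<Longrightarrow> y = x"
  shows "odd (sum f S)"
proof -
  have "even (f y)" if "y \<in> S - {x}" for y using assms(4)[of y] that by blast
  then have "even (sum f (S - {x}))" by (rule dvd_sum)
  then show ?thesis using assms(3) by (simp add: sum.remove[OF assms(1,2)])
qed

lemma block_shape_black_ind:
  assumes C: "block_shape C" and x: "x \<in> C" "x + axis i 1 - axis j 1 \<in> C" "i \<noteq> j" and y: "y \<in> C"
  shows "odd (black_ind C i j y) \<longleftrightarrow> y = x \<or> y = x + axis i 1 - axis j 1"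
proof -
  have "y - axis i 1 + axis j 1 \<in> C \<longleftrightarrow> y = x + axis i 1 - axis j 1"
  proof
    assume y': "y - axis i 1 + axis j 1 \<in> C"
    have "(y - axis i 1 + axis j 1) + axis i 1 - axis j 1 \<in> C" using y by simp
    then have "y - axis i 1 + axis j 1 = x"
      by (rule block_shapeD(5)[OF C y' x(1,3) _ x(2)])
    then show "y = x + axis i 1 - axis j 1" by (simp add: algebra_simps)
  qed (use x in simp)
  moreover have "y + axis i 1 - axis j 1 \<in> C \<longleftrightarrow> y = x"
    using block_shapeD(5)[OF C y x(1,3) _ x(2)] x by blast
  ultimately show ?thesis
    by (simp add: local_shape_black_ind[OF block_shapeD(1)[OF C] y x(3)])
qed

lemma block_shape_red_ind:
  assumes C: "block_shape C" and x: "x \<in> C" "x + axis i 1 + axis j 1 \<in> C" "i \<noteq> j" "eta x = -1" and y: "y \<in> C"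
  shows "odd (red_ind C i j y) \<longleftrightarrow> y = x \<or> y = x + axis i 1 + axis j 1"
proof -
  have "eta y = 1 \<and> y - axis i 1 - axis j 1 \<in> C \<longleftrightarrow> y = x + axis i 1 + axis j 1"
  proof
    assume y': "eta y = 1 \<and> y - axis i 1 - axis j 1 \<in> C"
    have "(y - axis i 1 - axis j 1) + axis i 1 + axis j 1 \<in> C" using y by simp
    then have "y - axis i 1 - axis j 1 = x"
      using y' by (intro block_shapeD(6)[OF C _ x(1,3) _ x(4) _ x(2)]) (auto simp: eta_simps)
    then show "y = x + axis i 1 + axis j 1" by (simp add: algebra_simps)
  qed (use x in \<open>simp add: eta_simps\<close>)
  moreover have "eta y = -1 \<and> y + axis i 1 + axis j 1 \<in> C \<longleftrightarrow> y = x"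
    using block_shapeD(6)[OF C y x(1,3) _ x(4) _ x(2)] x by blast
  ultimately show ?thesis by (auto simp: red_ind_odd)
qed

text \<open>The roots of the minimal polynomial p of one eigenvalue have pairwise different labels
  in C. If these did not exhaust C, some edge would leave them and its pole would survive in the sum
  of the roots of p, which has no poles. So p has as many roots as C has points, and it equals the
  characteristic polynomial.\<close>

lemma charpoly_irreducible:
  assumes C: "block_shape C"
    and p: "lead_coeff p = 1" "poly (map_poly ev p) l = 0" "\<And>r. poly (map_poly ev r) l = 0 \<Longrightarrow> p dvd r"
    and root: "poly (leibniz_charpoly C M) l = 0"
  shows "p = leibniz_charpoly C (pmat xi)"
    "\<exists>lab. bij_betw lab {m. poly (leibniz_charpoly C M) m = 0} C \<and>
       (\<forall>m. poly (leibniz_charpoly C M) m = 0 \<longrightarrow> is_label C m (lab m))"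
    "card {m. poly (leibniz_charpoly C M) m = 0} = card C"
proof -
  interpret mp: map_poly_comm_ring_hom ev ..
  note L = block_shapeD(1)[OF C]
  define R where "R = {m. poly (map_poly ev p) m = 0}"
  note R = minimal_polynomial_roots[OF p, folded R_def]
  let ?chi = "leibniz_charpoly C (pmat xi)"
  have "p dvd ?chi" using root by (intro p(3)) (simp add: ev_charpoly)
  then obtain t where t: "?chi = p * t" by blast
  have Rroot: "poly (leibniz_charpoly C M) m = 0" if "m \<in> R" for m
    using that unfolding R_def ev_charpoly[symmetric] t by (simp add: mp.hom_mult)
  define lab where "lab m = (SOME x. is_label C m x)" for m
  have lab: "is_label C m (lab m)" if "m \<in> R" for m
    unfolding lab_def using label_exists[OF L Rroot[OF that]] by (rule someI_ex)
  have inj: "inj_on lab R"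
  proof (rule inj_onI)
    fix m m' assume m: "m \<in> R" "m' \<in> R" "lab m = lab m'"
    show "m = m'" by (rule label_eigenvalue_unique[OF C lab[OF m(1)]]) (use lab[OF m(2)] m(3) in simp)
  qed
  have labC: "lab ` R \<subseteq> C" using lab by (auto simp: is_label_def)
  have fin: "finite (lab ` R)" using R(1) by simp
  \<comment> \<open>The sum of the roots lies in the image of \<open>ev\<close>, so its pole part is
    0 at every pair i, j.\<close>
  have even_sums: "even (\<Sum>x\<in>lab ` R. black_ind C i j x) \<and> even (\<Sum>x\<in>lab ` R. red_ind C i j x)"
    if ij: "i \<noteq> j" for i j
  proof -
    obtain D where D: "(\<Sum>m\<in>R. m) = ev D" using R(3) by blast
    have "pole_part i j (\<Sum>m\<in>R. m) (\<Sum>m\<in>R. black_ind C i j (lab m)) (\<Sum>m\<in>R. red_ind C i j (lab m))"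
      by (rule pole_part_sum) (rule is_label_pole_part[OF L lab ij])
    from pole_part_diff[OF this pole_part_ev[of i j D]]
    have "pole_part i j 0 (\<Sum>m\<in>R. black_ind C i j (lab m)) (\<Sum>m\<in>R. red_ind C i j (lab m))"
      by (simp add: D)
    then show ?thesis using pole_part_zero[OF ij] by (simp add: sum.reindex[OF inj])
  qed
  \<comment> \<open>The mark of an edge leaving the label set occurs on no other edge, so exactly
    one label has an odd indicator for it and the sum is odd.\<close>
  have "C \<subseteq> lab ` R"
  proof (rule block_shape_closed[OF C, of "lab l"])
    show "lab l \<in> lab ` R" "lab l \<in> C" using R(4) labC by auto
    fix x w assume x: "x \<in> lab ` R" "x \<in> C" and w: "w \<in> C" "adj x w"
    show "w \<in> lab ` R"
    proof (rule ccontr)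
      assume nw: "w \<notin> lab ` R"
      show False
        using w(2)
      proof (cases rule: adj_cases)
        case (black i j)
        note ind = block_shape_black_ind[OF C x(2) w(1)[unfolded black(2)] black(1)]
        have "odd (\<Sum>x\<in>lab ` R. black_ind C i j x)"
        proof (rule odd_sum_single[OF fin x(1)])
          show "odd (black_ind C i j x)" using ind[OF x(2)] by simp
          fix y assume y: "y \<in> lab ` R" "odd (black_ind C i j y)"
          then have "y \<in> C" "y \<noteq> w" using labC nw by blast+
          then show "y = x" using ind[of y] y(2) black(2) by simp
        qed
        then show False using even_sums[OF black(1)] by simp
      next
        case (red_up i j)
        note ind = block_shape_red_ind[OF C x(2) w(1)[unfolded red_up(3)] red_up(1,2)]
        have "odd (\<Sum>x\<in>lab ` R. red_ind C i j x)"
        proof (rule odd_sum_single[OF fin x(1)])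
          show "odd (red_ind C i j x)" using ind[OF x(2)] by simp
          fix y assume y: "y \<in> lab ` R" "odd (red_ind C i j y)"
          then have "y \<in> C" "y \<noteq> w" using labC nw by blast+
          then show "y = x" using ind[of y] y(2) red_up(3) by simp
        qed
        then show False using even_sums[OF red_up(1)] by simp
      next
        case (red_down i j)
        have wx: "w + axis i 1 + axis j 1 = x" and ew: "eta w = -1"
          using red_down by (simp_all add: eta_simps)
        note ind = block_shape_red_ind[OF C w(1) _ red_down(1) ew, unfolded wx, OF x(2)]
        have "odd (\<Sum>x\<in>lab ` R. red_ind C i j x)"
        proof (rule odd_sum_single[OF fin x(1)])
          show "odd (red_ind C i j x)" using ind[OF x(2)] by simp
          fix y assume y: "y \<in> lab ` R" "odd (red_ind C i j y)"
          then have "y \<in> C" "y \<noteq> w" using labC nw by blast+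
          then show "y = x" using ind[of y] y(2) by simp
        qed
        then show False using even_sums[OF red_down(1)] by simp
      qed
    qed
  qed
  then have labR: "lab ` R = C" using labC by blast
  have cR: "card R = card C" using card_image[OF inj] by (simp add: labR)
  have chi: "degree ?chi = card C" by (rule leibniz_charpoly_degree(1)[OF block_shapeD(3)[OF C]])
  have chi1: "lead_coeff ?chi = 1"
    unfolding chi by (rule leibniz_charpoly_degree(2)[OF block_shapeD(3)[OF C]])
  have "p * t \<noteq> 0"
  proof
    assume "p * t = 0"
    then have "?chi = 0" using t by (rule trans[rotated])
    then show False using chi1 by simp
  qed
  then have nz: "p \<noteq> 0" "t \<noteq> 0" by auto
  have "degree ?chi = degree p + degree t" unfolding t by (rule degree_mult_eq[OF nz])
  then have "degree t = 0" using chi R(2) cR by linarith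
  then obtain e where e: "t = [:e:]" by (rule degree_eq_zeroE)
  have "lead_coeff ?chi = lead_coeff p * lead_coeff t" unfolding t by (rule lead_coeff_mult)
  then have "lead_coeff t = 1" unfolding chi1 p(1) by simp
  then have "t = 1" by (simp add: e)
  then show pchi: "p = ?chi" using t by simp
  have RR: "R = {m. poly (leibniz_charpoly C M) m = 0}" unfolding R_def pchi ev_charpoly ..
  show "card {m. poly (leibniz_charpoly C M) m = 0} = card C" using cR unfolding RR .
  show "\<exists>lab. bij_betw lab {m. poly (leibniz_charpoly C M) m = 0} C \<and>
       (\<forall>m. poly (leibniz_charpoly C M) m = 0 \<longrightarrow> is_label C m (lab m))"
    using inj labR lab unfolding RR by (intro exI[of _ lab]) (auto simp: bij_betw_def)
qed

lemma charpoly_minimal_polynomial: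
  assumes "finite C" "poly (leibniz_charpoly C M) l = 0"
  obtains p where "lead_coeff p = 1" "poly (map_poly ev p) l = 0"
    "\<And>r. poly (map_poly ev r) l = 0 \<Longrightarrow> p dvd r"
proof (rule minimal_polynomial)
  show "poly (map_poly ev (leibniz_charpoly C (pmat xi))) l = 0" using assms(2) by (simp add: ev_charpoly)
  show "lead_coeff (leibniz_charpoly C (pmat xi)) = 1"
    unfolding leibniz_charpoly_degree(1)[OF assms(1)] by (rule leibniz_charpoly_degree(2)[OF assms(1)])
qed (rule that)

lemma simple_spectrum:
  assumes C: "block_shape C"
  shows "card {m. poly (leibniz_charpoly C M) m = 0} = card C"
proof -
  have fin: "finite C" and "card C > 0"
    using block_shapeD(2,3)[OF C] by (simp_all add: card_gt_0_iff)
  then have "degree (leibniz_charpoly C M) \<noteq> 0"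
    unfolding leibniz_charpoly_degree(1)[OF fin] by linarith
  then have "\<not> constant (poly (leibniz_charpoly C M))" by (simp add: constant_degree)
  then obtain l where l: "poly (leibniz_charpoly C M) l = 0"
    using fundamental_theorem_of_algebra by blast
  show ?thesis
  proof (rule charpoly_minimal_polynomial[OF fin l])
    fix p assume "lead_coeff p = 1" "poly (map_poly ev p) l = 0"
      "\<And>r. poly (map_poly ev r) l = 0 \<Longrightarrow> p dvd r"
    from charpoly_irreducible(3)[OF C this l] show ?thesis .
  qed
qed

end

section \<open>Translates and shapes with a common eigenvalue\<close>

lemma pair_adj_translate: "eta b = 0 \<Longrightarrow> pair_adj i j (x + b) (w + b) \<longleftrightarrow> pair_adj i j x w"
proof -
  assume b: "eta b = 0"
  have "w + b = x + b + axis i 1 - axis j 1 \<longleftrightarrow> w = x + axis i 1 - axis j 1"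
    "w + b = x + b - axis i 1 + axis j 1 \<longleftrightarrow> w = x - axis i 1 + axis j 1"
    "w + b = x + b + axis i 1 + axis j 1 \<longleftrightarrow> w = x + axis i 1 + axis j 1"
    "w + b = x + b - axis i 1 - axis j 1 \<longleftrightarrow> w = x - axis i 1 - axis j 1"
    by (simp_all add: algebra_simps)
  then show ?thesis using b by (simp add: pair_adj_def eta_simps)
qed

lemma adj_translate: "eta b = 0 \<Longrightarrow> adj (x + b) (w + b) \<longleftrightarrow> adj x w"
  by (simp add: adj_def pair_adj_translate)

lemma pmat_translate:
  assumes "eta b = 0"
  shows "pmat \<xi> (x + b) (w + b) =
    pmat \<xi> x w + (if x = w then - (\<Sum>k\<in>UNIV. of_int (b $ k) * \<xi> k) else 0)"
  using assms by (simp add: pmat_def adj_translate eta_simps distrib_right sum.distrib)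

lemma leibniz_charpoly_pmat_translate:
  assumes "finite C" "eta b = 0"
  shows "poly (leibniz_charpoly ((\<lambda>x. x + b) ` C) (pmat \<xi>)) (t - (\<Sum>k\<in>UNIV. of_int (b $ k) * \<xi> k)) =
    poly (leibniz_charpoly C (pmat \<xi>)) t"
proof -
  have "bij_betw (\<lambda>x. x + b) C ((\<lambda>x. x + b) ` C)" by (simp add: bij_betw_def)
  then have "leibniz_charpoly ((\<lambda>x. x + b) ` C) (pmat \<xi>) =
      leibniz_charpoly C (\<lambda>x w. pmat \<xi> x w + (if x = w then - (\<Sum>k\<in>UNIV. of_int (b $ k) * \<xi> k) else 0))"
    by (simp only: leibniz_charpoly_reindex[OF assms(1)] pmat_translate[OF assms(2)])
  then show ?thesis
    using leibniz_charpoly_shift[of C "pmat \<xi>" "- (\<Sum>k\<in>UNIV. of_int (b $ k) * \<xi> k)" t] by simp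
qed

context two_adic
begin

lemma lin_eq_0: "lin b = 0 \<longleftrightarrow> b = 0"
proof
  assume "lin b = 0"
  have "b $ k = 0" for k
  proof (rule ccontr)
    assume nz: "b $ k \<noteq> 0"
    have "(2::int) ^ nat \<bar>b $ k\<bar> dvd b $ k"
      using two_power_dvd_lin_iff[of "nat \<bar>b $ k\<bar>" b] \<open>lin b = 0\<close> by simp
    then have "\<bar>(2::int) ^ nat \<bar>b $ k\<bar>\<bar> \<le> \<bar>b $ k\<bar>" using nz by (intro dvd_imp_le_int)
    moreover have "nat \<bar>b $ k\<bar> < 2 ^ nat \<bar>b $ k\<bar>" by (rule less_exp)
    then have "int (nat \<bar>b $ k\<bar>) < int (2 ^ nat \<bar>b $ k\<bar>)" by (simp only: of_nat_less_iff)
    ultimately show False by simp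
  qed
  then show "b = 0" by (simp add: Finite_Cartesian_Product.vec_eq_iff)
qed (simp add: lin_def)

text \<open>The eigenvalue is congruent to -x(\<xi>) modulo 4 for its label x. Equality with
  b(\<xi>) would make b + x divisible by 4, hence also \<eta>(x), which is 1 or -1.\<close>

lemma root_not_linear:
  assumes C: "block_shape C" and root: "poly (leibniz_charpoly C M) l = 0" and b: "eta b = 0"
  shows "l \<noteq> ev (lin b)"
proof
  assume l: "l = ev (lin b)"
  note L = block_shapeD(1)[OF C]
  obtain x where x: "is_label C l x" using label_exists[OF L root] by blast
  have "two_dvd_V 2 (ev (lin b) + ev (lin x))" using is_label_near[OF L x] by (simp add: l)
  then have "two_dvd_V 2 (ev (lin (b + x)))" by (simp add: lin_simps ev.hom_add)
  then have "4 dvd (b + x) $ k" for k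
    unfolding two_dvd_V_ev_iff using two_power_dvd_lin_iff[of 2 "b + x"] by simp
  then have "4 dvd eta (b + x)" unfolding eta_def by (intro dvd_sum)
  then have "4 dvd eta x" using b by (simp add: eta_simps)
  moreover have "eta x = 1 \<or> eta x = -1" using x local_shapeD(2)[OF L] unfolding is_label_def by blast
  ultimately show False by auto
qed

text \<open>By \<open>label_parity\<close> the mark of the edge from x to w also occurs in C' at x +
  b and at y. It sits on a single edge there, so x + b and y are ends of that edge; the congruences
  modulo 4, or \<eta> for a red mark, tell which is which.\<close>

lemma common_label_step:
  assumes C: "block_shape C" "block_shape C'"
    and l: "is_label C l x" "is_label C' l (x + b)" and m: "is_label C m w" "is_label C' m y"
    and adj: "adj x w"
  shows "y = w + b"
proof -
  note L = block_shapeD(1)[OF C(1)] and L' = block_shapeD(1)[OF C(2)]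
  have mem: "x \<in> C" "x + b \<in> C'" "w \<in> C" "y \<in> C'" using l m by (simp_all add: is_label_def)
  have etas: "eta (x + b) = eta x" "eta y = eta w"
    using label_eta[OF L L' l] label_eta[OF L L' m] by simp_all
  show ?thesis
    using adj
  proof (cases rule: adj_cases)
    case (black i j)
    have up: "odd (black_ind C i j x)"
      using local_shape_black_ind[OF L mem(1) black(1)] mem(3) black(2) by simp
    have "odd (black_ind C i j w)"
      using local_shape_black_ind[OF L mem(3) black(1)] mem(1) black(2) by simp
    then have odds: "odd (black_ind C' i j (x + b))" "odd (black_ind C' i j y)"
      using up label_parity(2)[OF L L' l black(1)] label_parity(2)[OF L L' m black(1)] by blast+
    obtain x' where x': "x' \<in> C'" "x' + axis i 1 - axis j 1 \<in> C'"
    proof -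
      have "y + axis i 1 - axis j 1 \<in> C' \<or> y - axis i 1 + axis j 1 \<in> C'"
        using odds(2) local_shape_black_ind[OF L' mem(4) black(1)] by simp
      then show thesis
      proof
        assume "y - axis i 1 + axis j 1 \<in> C'"
        then show thesis using mem(4) by (intro that[of "y - axis i 1 + axis j 1"]) simp_all
      qed (rule that[OF mem(4)])
    qed
    note ind = block_shape_black_ind[OF C(2) x' black(1)]
    have "4 dvd (x - (x + b)) $ i - (w - y) $ i"
      by (rule dvd_diff[OF label_parity(1)[OF L L' l] label_parity(1)[OF L L' m]])
    then have "4 dvd (y - (x + b)) $ i - 1" using black by (simp add: axis_nth_int algebra_simps)
    then have not4: "(y - (x + b)) $ i \<noteq> 0" "(y - (x + b)) $ i \<noteq> -1" by auto
    have "x + b = x' \<or> x + b = x' + axis i 1 - axis j 1" "y = x' \<or> y = x' + axis i 1 - axis j 1"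
      using ind[OF mem(2)] ind[OF mem(4)] odds by blast+
    then consider "y = x + b" | "x + b = y + axis i 1 - axis j 1" | "y = x + b + axis i 1 - axis j 1"
      by metis
    then show ?thesis
    proof cases
      case 3
      then show ?thesis by (simp add: black(2) algebra_simps)
    qed (use not4 black(1) in \<open>simp_all add: axis_nth_int\<close>)
  next
    case (red_up i j)
    have ew: "eta w = 1" using red_up by (simp add: eta_simps)
    have "odd (red_ind C i j x)" using red_up mem by (simp add: red_ind_odd)
    then have "odd (red_ind C' i j (x + b))" using label_parity(3)[OF L L' l red_up(1)] by blast
    then have xb: "x + b + axis i 1 + axis j 1 \<in> C'" using red_up(2) etas(1) by (auto simp: red_ind_odd)
    have "odd (red_ind C i j w)" using red_up mem ew by (simp add: red_ind_odd)
    then have "odd (red_ind C' i j y)" using label_parity(3)[OF L L' m red_up(1)] by blast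
    then have y': "y - axis i 1 - axis j 1 \<in> C'" using ew etas(2) by (auto simp: red_ind_odd)
    have "y - axis i 1 - axis j 1 = x + b"
      using y' etas ew red_up(2) mem(4) xb
      by (intro block_shapeD(6)[OF C(2) y' mem(2) red_up(1)]) (simp_all add: eta_simps)
    then show ?thesis by (simp add: red_up(3) algebra_simps)
  next
    case (red_down i j)
    have ew: "eta w = -1" using red_down by (simp add: eta_simps)
    have "odd (red_ind C i j x)" using red_down mem by (simp add: red_ind_odd)
    then have "odd (red_ind C' i j (x + b))" using label_parity(3)[OF L L' l red_down(1)] by blast
    then have xb: "x + b - axis i 1 - axis j 1 \<in> C'" using red_down(2) etas(1) by (auto simp: red_ind_odd)
    have "odd (red_ind C i j w)" using red_down mem ew by (simp add: red_ind_odd)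
    then have "odd (red_ind C' i j y)" using label_parity(3)[OF L L' m red_down(1)] by blast
    then have y': "y + axis i 1 + axis j 1 \<in> C'" using ew etas(2) by (auto simp: red_ind_odd)
    have "y = x + b - axis i 1 - axis j 1"
      using y' etas ew red_down(2) mem(2) xb
      by (intro block_shapeD(6)[OF C(2) mem(4) xb red_down(1)]) (simp_all add: eta_simps)
    then show ?thesis by (simp add: red_down(3) algebra_simps)
  qed
qed

text \<open>By irreducibility both characteristic polynomials are the minimal polynomial of
  \<open>l\<close>, so the spectra agree. Pairing the labels of each common eigenvalue and following
  the edges of C gives the same displacement b everywhere.\<close>

lemma common_root_translate:
  assumes C: "block_shape C" "block_shape C'"
    and root: "poly (leibniz_charpoly C M) l = 0" "poly (leibniz_charpoly C' M) l = 0"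
  shows "leibniz_charpoly C M = leibniz_charpoly C' M" "\<exists>b. eta b = 0 \<and> C' = (\<lambda>x. x + b) ` C"
proof -
  note L = block_shapeD(1)[OF C(1)] and L' = block_shapeD(1)[OF C(2)]
  note fin = block_shapeD(3)[OF C(1)] block_shapeD(3)[OF C(2)]
  let ?R = "{m. poly (leibniz_charpoly C M) m = 0}"
  obtain p where p: "lead_coeff p = 1" "poly (map_poly ev p) l = 0"
    "\<And>r. poly (map_poly ev r) l = 0 \<Longrightarrow> p dvd r"
  proof (rule charpoly_minimal_polynomial[OF fin(1) root(1)])
    fix q assume "lead_coeff q = 1" "poly (map_poly ev q) l = 0"
      "\<And>r. poly (map_poly ev r) l = 0 \<Longrightarrow> q dvd r"
    then show thesis by (rule that)
  qed
  have "leibniz_charpoly C (pmat xi) = leibniz_charpoly C' (pmat xi)"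
    using charpoly_irreducible(1)[OF C(1) p root(1)] charpoly_irreducible(1)[OF C(2) p root(2)] by (rule trans[OF sym])
  then show eq: "leibniz_charpoly C M = leibniz_charpoly C' M"
    unfolding ev_charpoly[symmetric] by (rule arg_cong)
  obtain lab where lab: "bij_betw lab ?R C" "\<And>m. m \<in> ?R \<Longrightarrow> is_label C m (lab m)"
    using charpoly_irreducible(2)[OF C(1) p root(1)] by blast
  \<comment> \<open>The pairing of points of C and C' that are labels of the same
    eigenvalue.\<close>
  define \<Phi> where "\<Phi> x y \<longleftrightarrow> (\<exists>m\<in>?R. is_label C m x \<and> is_label C' m y)" for x y
  have ex: "\<exists>y. \<Phi> x y" if x: "x \<in> C" for x
  proof -
    obtain m where m: "m \<in> ?R" "x = lab m" using lab(1) x by (auto simp: bij_betw_def)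
    have "poly (leibniz_charpoly C' M) m = 0" using m(1) unfolding eq by simp
    then obtain y where "is_label C' m y" using label_exists[OF L'] by blast
    then show ?thesis unfolding \<Phi>_def using m lab(2)[OF m(1)] by blast
  qed
  obtain x0 where x0: "x0 \<in> C" using block_shapeD(2)[OF C(1)] by blast
  obtain y0 where y0: "\<Phi> x0 y0" using ex[OF x0] by blast
  define b where "b = y0 - x0"
  obtain m0 where m0: "is_label C m0 x0" "is_label C' m0 y0" using y0 unfolding \<Phi>_def by blast
  have b0: "eta b = 0" using label_eta[OF L L' m0] by (simp add: b_def eta_simps)
  have "C \<subseteq> {x. \<Phi> x (x + b)}"
  proof (rule block_shape_closed[OF C(1) _ x0])
    show "x0 \<in> {x. \<Phi> x (x + b)}" using y0 by (simp add: b_def)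
    fix x w assume x: "x \<in> {x. \<Phi> x (x + b)}" "x \<in> C" and w: "w \<in> C" "adj x w"
    obtain y where y: "\<Phi> w y" using ex[OF w(1)] by blast
    obtain l' m where l': "is_label C l' x" "is_label C' l' (x + b)"
      and m: "is_label C m w" "is_label C' m y" using x(1) y unfolding \<Phi>_def mem_Collect_eq by blast
    have "y = w + b" by (rule common_label_step[OF C l' m w(2)])
    then show "w \<in> {x. \<Phi> x (x + b)}" using y by simp
  qed
  then have sub: "(\<lambda>x. x + b) ` C \<subseteq> C'" unfolding \<Phi>_def by (auto simp: is_label_def)
  have "card C = card C'"
    using simple_spectrum[OF C(1)] simple_spectrum[OF C(2)] unfolding eq by linarith
  then have "card ((\<lambda>x. x + b) ` C) = card C'" by (simp add: card_image)
  then have "(\<lambda>x. x + b) ` C = C'" by (rule card_subset_eq[OF fin(2) sub])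
  then show "\<exists>b. eta b = 0 \<and> C' = (\<lambda>x. x + b) ` C" using b0 by blast
qed

text \<open>The spectrum of C + b is that of C shifted by b(\<xi>), yet both spectra are equal.
  Summing over them gives \<open>card C\<close> times b(\<xi>) = 0, and b(\<xi>) = 0 forces b =
  0.\<close>

lemma common_root_separation:
  assumes C: "block_shape C" "block_shape C'"
    and root: "poly (leibniz_charpoly C M) l = 0" "poly (leibniz_charpoly C' M) l = 0"
  shows "C = C'"
proof -
  obtain b where b: "eta b = 0" "C' = (\<lambda>x. x + b) ` C" using common_root_translate(2)[OF C root] by blast
  note eq = common_root_translate(1)[OF C root]
  note fin = block_shapeD(3)[OF C(1)]
  define R where "R = {m. poly (leibniz_charpoly C M) m = 0}"
  have cR: "card R = card C" unfolding R_def by (rule simple_spectrum[OF C(1)])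
  have C0: "card C > 0" using fin block_shapeD(2)[OF C(1)] by (simp add: card_gt_0_iff)
  have "finite R" using cR C0 card_gt_0_iff by force
  have "(\<lambda>m. m - ev (lin b)) ` R \<subseteq> R"
  proof
    fix m' assume "m' \<in> (\<lambda>m. m - ev (lin b)) ` R"
    then obtain m where m: "m \<in> R" "m' = m - ev (lin b)" by blast
    have "poly (leibniz_charpoly C' M) (m - ev (lin b)) = poly (leibniz_charpoly C M) m"
      unfolding b(2) ev_lin by (rule leibniz_charpoly_pmat_translate[OF fin b(1)])
    then show "m' \<in> R" using m by (simp add: R_def eq)
  qed
  moreover have inj: "inj_on (\<lambda>m. m - ev (lin b)) R" by (rule inj_onI) simp
  ultimately have "(\<lambda>m. m - ev (lin b)) ` R = R"
    by (intro card_subset_eq[OF \<open>finite R\<close>]) (simp_all add: card_image)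
  then have "(\<Sum>m\<in>R. m) = (\<Sum>m\<in>R. m - ev (lin b))"
    using sum.reindex[OF inj, of "\<lambda>m. m"] by simp
  then have "of_nat (card R) * ev (lin b) = 0" by (simp add: sum_subtractf)
  then have "ev (lin b) = 0" unfolding cR using C0 by simp
  then have "b = 0" by (simp add: lin_eq_0)
  then show ?thesis using b(2) by simp
qed

end

section \<open>The two-adic place and a separating real point\<close>

lemma countable_UNIV_poly:
  assumes "countable (UNIV :: 'a::zero set)"
  shows "countable (UNIV :: 'a poly set)"
proof -
  have "countable (lists (UNIV :: 'a set))" using assms by (rule countable_lists)
  then have "countable (range (coeffs :: 'a poly \<Rightarrow> 'a list))" by (rule countable_subset[rotated]) simp
  then show ?thesis by (rule countable_image_inj_on) (simp add: inj_on_def coeffs_eq_iff)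
qed

text \<open>Countably many nonzero polynomials have countably many real roots; any other real number
  is transcendental over the image of \<open>h\<close>.\<close>

lemma transcendental_exists:
  fixes h :: "'a::comm_ring_1 \<Rightarrow> real"
  assumes h: "comm_ring_hom h" "inj h" and cnt: "countable (UNIV :: 'a set)"
  obtains h' :: "'a poly \<Rightarrow> real" where "comm_ring_hom h'" "inj h'"
proof -
  interpret h: comm_ring_hom h by fact
  interpret mp: map_poly_comm_ring_hom h ..
  have h0: "h c = 0 \<longleftrightarrow> c = 0" for c using h(2) h.hom_zero by (metis injD)
  define R where "R = (\<Union>p\<in>-{0}. {y. poly (map_poly h p) y = 0})"
  have "countable R"
    unfolding R_def
  proof (rule countable_UN)
    show "countable (- {0 :: 'a poly})"
      using countable_UNIV_poly[OF cnt] by (rule countable_subset[rotated]) simp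
    fix p :: "'a poly" assume "p \<in> - {0}"
    then have "map_poly h p \<noteq> 0"
      by (auto simp: poly_eq_iff coeff_map_poly h0)
    then show "countable {y. poly (map_poly h p) y = 0}"
      by (intro countable_finite poly_roots_finite)
  qed
  then have "R \<noteq> UNIV" using uncountable_UNIV_real by auto
  then obtain y where y: "y \<notin> R" by blast
  define h' where "h' p = poly (map_poly h p) y" for p
  have hom: "comm_ring_hom h'"
    by unfold_locales (simp_all add: h'_def mp.hom_add mp.hom_mult)
  interpret h': comm_ring_hom h' by (rule hom)
  have "inj h'"
  proof (rule injI)
    fix p q assume "h' p = h' q"
    then have "h' (p - q) = 0" by (simp add: h'.hom_minus)
    then have "p - q = 0" using y unfolding R_def h'_def by blast
    then show "p = q" by simp
  qed
  with hom show thesis by (rule that)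
qed

text \<open>Two transcendental extensions embed Z[y][s] in the reals, which keeps the parameters
  real. V extends the ring of fractions with odd denominator by
  \<open>valuation_ring_exists\<close>.\<close>

lemma two_adic_exists:
  "\<exists>(ev :: int poly poly \<Rightarrow> complex) V (kk :: 'm::finite \<Rightarrow> nat). two_adic ev V kk \<and> (\<forall>p. ev p \<in> \<real>)"
proof -
  have "comm_ring_hom (of_int :: int \<Rightarrow> real)" by unfold_locales simp_all
  then obtain h1 :: "int poly \<Rightarrow> real" where h1: "comm_ring_hom h1" "inj h1"
    by (rule transcendental_exists) (simp_all add: inj_on_def)
  obtain h2 :: "int poly poly \<Rightarrow> real" where h2: "comm_ring_hom h2" "inj h2"
    by (rule transcendental_exists[OF h1 countable_UNIV_poly]) simp_all
  interpret h2: comm_ring_hom h2 by (rule h2)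
  define ev where "ev p = complex_of_real (h2 p)" for p
  have hom: "comm_ring_hom ev"
    by unfold_locales (simp_all add: ev_def h2.hom_add h2.hom_mult)
  interpret ev: comm_ring_hom ev by (rule hom)
  have inj: "inj ev" using h2(2) by (auto simp: ev_def inj_on_def)
  have ev0: "ev p = 0 \<longleftrightarrow> p = 0" for p using inj ev.hom_zero by (metis injD)
  note dvd_iff = two_dvd_mult_poly_iff(2) and nu = prime_elem_two_poly(2)[THEN prime_elem_not_unit]
  define A where "A = {ev a / ev q | a q. \<not> 2 dvd q}"
  have A: "ev a / ev q \<in> A" if "\<not> 2 dvd q" for a q using that by (auto simp: A_def)
  have Aev: "ev a \<in> A" for a using A[of 1 a] nu by simp
  have nz: "ev q \<noteq> 0" if "\<not> 2 dvd q" for q using that by (auto simp: ev0)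
  have "subring_of_field A"
    unfolding subring_of_field_def
  proof (intro conjI ballI)
    show "1 \<in> A" using Aev[of 1] by (simp add: ev.hom_one)
    fix x z assume "x \<in> A" "z \<in> A"
    then obtain a q b r where x: "x = ev a / ev q" "\<not> 2 dvd q" and z: "z = ev b / ev r" "\<not> 2 dvd r"
      unfolding A_def by blast
    have qr: "\<not> 2 dvd q * r" using x z by (simp add: dvd_iff)
    have "x - z = ev (a * r - b * q) / ev (q * r)"
      using nz[OF x(2)] nz[OF z(2)] by (simp add: x z ev.hom_minus ev.hom_mult field_simps)
    then show "x - z \<in> A" using A[OF qr] by simp
    have "x * z = ev (a * b) / ev (q * r)" by (simp add: x z ev.hom_mult)
    then show "x * z \<in> A" using A[OF qr] by simp
  qed
  moreover have "2 \<in> A" using Aev[of 2] by (simp add: ev.hom_numeral)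
  moreover have "inverse 2 \<notin> A"
  proof
    assume "inverse 2 \<in> A"
    then obtain a q where q: "inverse 2 = ev a / ev q" "\<not> 2 dvd q" unfolding A_def by blast
    then have "ev q = ev (2 * a)" using nz[OF q(2)] by (simp add: ev.hom_mult ev.hom_numeral field_simps)
    then have "q = 2 * a" using inj by (simp add: inj_eq)
    then show False using q(2) by simp
  qed
  ultimately obtain V where V: "A \<subseteq> V" "subring_of_field V" "\<And>z. z \<in> V \<or> inverse z \<in> V" "inverse 2 \<notin> V"
    using valuation_ring_exists[of A 2] zero_neq_numeral[symmetric] by blast
  obtain kk :: "'m \<Rightarrow> nat" where kk: "inj kk" using finite_imp_inj_to_nat_seg[of "UNIV :: 'm set"] by auto
  have "two_adic ev V kk"
  proof
    fix p q :: "int poly poly" assume "\<not> 2 dvd q"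
    then show "ev p / ev q \<in> V" using A V(1) by blast
  qed (use inj kk V in \<open>auto intro: injD\<close>)
  moreover have "\<forall>p. ev p \<in> \<real>" by (simp add: ev_def)
  ultimately show ?thesis by blast
qed


text \<open>One point serves all shapes simultaneously. It witnesses that the discriminants and
  resultants formed from the characteristic polynomials do not vanish identically.\<close>

theorem separating_parameters:
  obtains \<xi> :: "real^'m::finite" where "\<And>i. \<xi> $ i \<noteq> 0"
    "\<And>C. block_shape C \<Longrightarrow>
      card {l. poly (leibniz_charpoly C (pmat (\<lambda>k. complex_of_real (\<xi> $ k)))) l = 0} = card C"
    "\<And>C C' l. block_shape C \<Longrightarrow> block_shape C' \<Longrightarrow>
      poly (leibniz_charpoly C (pmat (\<lambda>k. complex_of_real (\<xi> $ k)))) l = 0 \<Longrightarrow>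
      poly (leibniz_charpoly C' (pmat (\<lambda>k. complex_of_real (\<xi> $ k)))) l = 0 \<Longrightarrow> C = C'"
    "\<And>C l b. block_shape C \<Longrightarrow> eta b = 0 \<Longrightarrow>
      poly (leibniz_charpoly C (pmat (\<lambda>k. complex_of_real (\<xi> $ k)))) l = 0 \<Longrightarrow> l \<noteq> of_real (lform b \<xi>)"
proof -
  obtain ev :: "int poly poly \<Rightarrow> complex" and V and kk :: "'m \<Rightarrow> nat"
    where *: "two_adic ev V kk" "\<And>p. ev p \<in> \<real>"
    using two_adic_exists by blast
  interpret two_adic ev V kk by fact
  define \<xi> :: "real^'m" where "\<xi> = (\<chi> k. Re (X k))"
  have X: "complex_of_real (\<xi> $ k) = X k" for k
    using *(2)[of "xi k"] by (simp add: \<xi>_def X_def)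
  have lf: "of_real (lform b \<xi>) = ev (lin b)" for b
    by (simp add: lform_def ev_lin X)
  show thesis
  proof (rule that[of \<xi>, unfolded X lf])
    fix i show "\<xi> $ i \<noteq> 0"
    proof
      assume "\<xi> $ i = 0"
      then have "X i = 0" using X[of i] by simp
      then show False using X_unit[of i] by (simp add: unit_V_def)
    qed
    show "l \<noteq> ev (lin b)" if "block_shape C" "eta b = 0" "poly (leibniz_charpoly C M) l = 0" for C l b
      using that(1,3,2) by (rule root_not_linear)
  qed (fact simple_spectrum common_root_separation)+
qed

subsection \<open>Geometry of the blocks for generic sites\<close>

definition idot :: "int^'n::finite \<Rightarrow> int^'n \<Rightarrow> int" where
  "idot p q = (\<Sum>l\<in>UNIV. p $ l * q $ l)"

lemma idot_simps:
  "idot (p + q) r = idot p r + idot q r" "idot r (p + q) = idot r p + idot r q"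
  "idot (p - q) r = idot p r - idot q r" "idot r (p - q) = idot r p - idot r q"
  "idot (- p) r = - idot p r" "idot r (- p) = - idot r p"
  "idot (k *s p) r = k * idot p r" "idot r (k *s p) = k * idot r p"
  by (simp_all add: idot_def algebra_simps sum.distrib sum_subtractf sum_negf sum_distrib_left)

lemma idot_commute: "idot p q = idot q p"
  by (simp add: idot_def mult.commute)

lemma idot_nonneg: "idot p p \<ge> 0"
  by (simp add: idot_def sum_nonneg)

lemma idot_self_eq_0: "idot p p = 0 \<longleftrightarrow> p = 0"
  by (simp add: idot_def sum_nonneg_eq_0_iff Finite_Cartesian_Product.vec_eq_iff)

lemma sqnorm_idot: "sqnorm p = idot p p"
  by (simp add: sqnorm_def idot_def power2_eq_square)

lemma mom_simps:
  "mom v (a + b) = mom v a + mom v b" "mom v (a - b) = mom v a - mom v b" "mom v (- a) = - mom v a"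
  "mom v (k *s a) = k *s mom v a" "mom v (axis i 1) = v i"
proof -
  show "mom v (a + b) = mom v a + mom v b" "mom v (a - b) = mom v a - mom v b" "mom v (- a) = - mom v a"
    "mom v (k *s a) = k *s mom v a"
    by (simp_all add: mom_def Finite_Cartesian_Product.vec_eq_iff algebra_simps sum.distrib sum_subtractf
        sum_negf sum_distrib_left)
  have "mom v (axis i 1) = (\<Sum>l\<in>UNIV. if l = i then v l else 0)"
    unfolding mom_def by (intro sum.cong refl) (auto simp: axis_def)
  then show "mom v (axis i 1) = v i" by simp
qed

definition vsq :: "('m::finite \<Rightarrow> int^'n::finite) \<Rightarrow> int^'m \<Rightarrow> int" where
  "vsq v x = (\<Sum>i\<in>UNIV. x $ i * sqnorm (v i))"

lemma vsq_simps:
  "vsq v (a + b) = vsq v a + vsq v b" "vsq v (a - b) = vsq v a - vsq v b" "vsq v (k *s a) = k * vsq v a"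
  "vsq v (axis i 1) = idot (v i) (v i)"
proof -
  show "vsq v (a + b) = vsq v a + vsq v b" "vsq v (a - b) = vsq v a - vsq v b" "vsq v (k *s a) = k * vsq v a"
    by (simp_all add: vsq_def algebra_simps sum.distrib sum_subtractf sum_distrib_left)
  have "vsq v (axis i 1) = (\<Sum>l\<in>UNIV. if l = i then sqnorm (v l) else 0)"
    unfolding vsq_def by (intro sum.cong refl) (auto simp: axis_def)
  then show "vsq v (axis i 1) = idot (v i) (v i)" by (simp add: sqnorm_idot)
qed

text \<open>The vertices \<open>a\<close> and \<open>a\<tau>\<close> are encoded by \<open>a\<close> and \<open>-a\<close>; the second component is
  recovered from \<open>\<eta>\<close>. In these coordinates twice the energy takes the following form.\<close>

definition xc :: "'m::finite grp \<Rightarrow> int^'m" where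
  "xc u = sg (snd u) *s fst u"

definition xen :: "('m::finite \<Rightarrow> int^'n::finite) \<Rightarrow> int^'m \<Rightarrow> int" where
  "xen v x = vsq v x - eta x * idot (mom v x) (mom v x)"

definition xvertices :: "('m::finite \<Rightarrow> int^'n::finite) \<Rightarrow> (int^'m) set" where
  "xvertices v = {x. (eta x = 1 \<or> eta x = -1) \<and> (\<forall>i. mom v x \<noteq> eta x *s v i)}"

lemma minus_one_smult: "(-1) *s (a :: int^'m::finite) = - a"
  by (simp add: Finite_Cartesian_Product.vec_eq_iff)

lemma eta_scale: "eta (k *s a) = k * eta a"
  by (simp add: eta_def sum_distrib_left)

lemma sg_cases: "sg s = 1 \<or> sg s = -1" and sg_sg [simp]: "sg s * sg s = 1"
  by (auto simp: sg_def)

lemma energy_xen: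
  assumes "eta (fst u) = -1"
  shows "energy v u = of_int (xen v (xc u)) / 2"
proof -
  have "xen v (xc u) = sg (snd u) * (sqnorm (mom v (fst u)) + vsq v (fst u))"
    using sg_cases[of "snd u"] assms
    by (auto simp: xen_def xc_def vsq_simps eta_scale mom_simps idot_simps sqnorm_idot)
  then show ?thesis by (simp add: energy_def vsq_def)
qed

lemma xc_vertices: "u \<in> vertices v \<longleftrightarrow> eta (fst u) = -1 \<and> xc u \<in> xvertices v"
proof -
  obtain a s where u: "u = (a, s)" by (cases u)
  have sp: "u \<in> (\<Union>i. {(- axis i 1 + t, \<sigma>) | t \<sigma>. t \<in> Theta v}) \<longleftrightarrow> (\<exists>i. mom v a = - v i)"
  proof
    assume "\<exists>i. mom v a = - v i"
    then obtain i where "mom v a = - v i" by blast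
    then have "a + axis i 1 \<in> Theta v" "u = (- axis i 1 + (a + axis i 1), s)"
      by (simp_all add: Theta_def mom_simps u)
    then show "u \<in> (\<Union>i. {(- axis i 1 + t, \<sigma>) | t \<sigma>. t \<in> Theta v})" by blast
  qed (auto simp: Theta_def mom_simps u)
  have eq: "mom v (sg s *s a) = eta (sg s *s a) *s v i \<longleftrightarrow> mom v a = - v i" if "eta a = -1" for i
  proof (cases "sg s = 1")
    case True
    then show ?thesis using that by (simp add: minus_one_smult)
  next
    case False
    then have s: "sg s = -1" using sg_cases[of s] by blast
    have "- mom v a = v i \<longleftrightarrow> mom v a = - v i" by (metis minus_minus)
    then show ?thesis using that by (simp add: s minus_one_smult mom_simps eta_simps)
  qed
  have "eta (sg s *s a) = 1 \<or> eta (sg s *s a) = -1" if "eta a = -1"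
    using sg_cases[of s] that by (auto simp: eta_scale)
  then show ?thesis
    unfolding vertices_def Diff_iff sp using eq by (auto simp: u xvertices_def xc_def)
qed

lemma xc_inj:
  assumes "eta (fst u) = -1" "eta (fst w) = -1" "xc u = xc w"
  shows "u = w"
proof -
  have "eta (xc u) = - sg (snd u)" "eta (xc w) = - sg (snd w)" using assms(1,2) by (simp_all add: xc_def eta_scale)
  then have "sg (snd u) = sg (snd w)" using assms(3) by simp
  then have "snd u = snd w" by (auto simp: sg_def split: if_splits)
  moreover have "fst u = sg (snd u) *s xc u" "fst w = sg (snd w) *s xc w"
    by (simp_all add: xc_def vector_smult_assoc)
  ultimately show ?thesis using assms(3) by (simp add: prod_eq_iff)
qed

lemma xc_gmult:
  assumes "x \<in> edge_marks" "eta (fst u) = -1"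
  shows "adj (xc u) (xc (gmult x u))" "eta (fst (gmult x u)) = -1"
proof -
  have b: "adj p (p + axis i 1 - axis j 1)" if "i \<noteq> j" for p and i j :: 'a
    using that unfolding adj_def pair_adj_def by blast
  have r: "adj p (p + axis i 1 + axis j 1)" if "i \<noteq> j" "eta p = -1" for p and i j :: 'a
    using that unfolding adj_def pair_adj_def by blast
  obtain a s where u: "u = (a, s)" by (cases u)
  show "adj (xc u) (xc (gmult x u))"
  proof (cases s)
    case True
    show ?thesis using assms b[of _ _ a] r[of _ _ a]
      by (auto simp: edge_marks_def gmult_def xc_def u True sg_def minus_one_smult algebra_simps)
  next
    case False
    have b': "- (axis i 1 - axis j 1 + a) = - a + axis j 1 - axis i 1"
      and r': "- a = (- axis i 1 - axis j 1 - a) + axis i 1 + axis j 1" for i j :: 'a by simp_all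
    show ?thesis
      using assms(1) unfolding edge_marks_def
    proof (elim UnE CollectE exE conjE)
      fix i j :: 'a assume x: "x = (axis i 1 - axis j 1, True)" and "i \<noteq> j"
      then show ?thesis using b[of j i "- a"] by (simp add: gmult_def xc_def u False sg_def minus_one_smult algebra_simps)
    next
      fix i j :: 'a assume x: "x = (- axis i 1 - axis j 1, False)" and ij: "i \<noteq> j"
      have "adj (- axis i 1 - axis j 1 - a) ((- axis i 1 - axis j 1 - a) + axis i 1 + axis j 1)"
        using ij assms(2) by (intro r) (simp_all add: eta_simps u)
      then have "adj (- a) (- axis i 1 - axis j 1 - a)" using r' by (simp add: adj_sym)
      moreover have "xc (gmult x u) = - axis i 1 - axis j 1 - a" "xc u = - a"
        by (simp_all add: gmult_def xc_def u False x sg_def minus_one_smult)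
      ultimately show ?thesis by simp
    qed
  qed
  show "eta (fst (gmult x u)) = -1"
    using assms by (auto simp: edge_marks_def gmult_def u eta_simps eta_scale sg_def)
qed

lemma xc_adj_gmult:
  assumes "adj (xc u) (xc w)" "eta (fst u) = -1" "eta (fst w) = -1"
  shows "\<exists>x\<in>edge_marks. w = gmult x u"
proof -
  obtain a s where u: "u = (a, s)" by (cases u)
  define x where "x = (fst w - sg (snd w = s) *s a, snd w = s)"
  have "w = gmult x u" by (auto simp: gmult_def x_def u prod_eq_iff)
  moreover have "x \<in> edge_marks"
  proof -
    have w: "fst w = sg (snd w) *s xc w" by (simp add: xc_def vector_smult_assoc)
    have e: "eta (xc w) = - sg (snd w)" "eta (xc u) = - sg s" using assms by (simp_all add: xc_def eta_scale u)
    have a: "xc u = sg s *s a" by (simp add: xc_def u)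
    show ?thesis
      using assms(1)
    proof (cases rule: adj_cases)
      case (black i j)
      then have "snd w = s" using e by (auto simp: sg_def eta_simps split: if_splits)
      then have "x = ((if s then axis i 1 - axis j 1 else axis j 1 - axis i 1), True)"
        by (auto simp: x_def w black(2) a sg_def minus_one_smult algebra_simps)
      then show ?thesis using black(1) by (cases s) (auto simp: edge_marks_def)
    next
      case (red_up i j)
      then have s: "s" "\<not> snd w" using e by (auto simp: sg_def eta_simps split: if_splits)
      then have "x = (- axis i 1 - axis j 1, False)"
        by (auto simp: x_def w red_up(3) a sg_def minus_one_smult algebra_simps)
      then show ?thesis using red_up(1) by (auto simp: edge_marks_def)
    next
      case (red_down i j)
      then have s: "\<not> s" "snd w" using e by (auto simp: sg_def eta_simps split: if_splits)
      then have "x = (- axis i 1 - axis j 1, False)"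
        by (auto simp: x_def w red_down(3) a sg_def minus_one_smult algebra_simps)
      then show ?thesis using red_down(1) by (auto simp: edge_marks_def)
    qed
  qed
  ultimately show ?thesis by blast
qed

lemma joined_iff:
  "(\<exists>x. joined v x u w) \<longleftrightarrow> u \<in> vertices v \<and> w \<in> vertices v \<and> adj (xc u) (xc w) \<and> xen v (xc u) = xen v (xc w)"
proof -
  have "energy v u = energy v w \<longleftrightarrow> xen v (xc u) = xen v (xc w)" if "u \<in> vertices v" "w \<in> vertices v"
    using that by (simp add: xc_vertices energy_xen)
  moreover have "adj (xc u) (xc w) \<longleftrightarrow> (\<exists>x\<in>edge_marks. w = gmult x u)" if "u \<in> vertices v" "w \<in> vertices v"
    using that xc_gmult(1)[of _ u] xc_adj_gmult[of u w] by (auto simp: xc_vertices)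
  ultimately show ?thesis unfolding joined_def by blast
qed

text \<open>As n^2 \<equiv> n modulo 2, both terms of \<open>xen\<close> have the parity of the
  coordinate sum of \<open>mom v x\<close>. So the energies of vertices are integers.\<close>

lemma xen_even: "even (xen v x)" if "eta x = 1 \<or> eta x = -1"
proof -
  have sq: "even (idot p p - (\<Sum>l\<in>UNIV. p $ l))" for p :: "int^'c"
    unfolding idot_def sum_subtractf[symmetric] by (rule dvd_sum) simp
  have "even (vsq v x - (\<Sum>i\<in>UNIV. x $ i * (\<Sum>l\<in>UNIV. v i $ l)))"
    unfolding vsq_def sum_subtractf[symmetric] right_diff_distrib[symmetric] sqnorm_idot
    by (rule dvd_sum, rule dvd_mult, rule sq)
  moreover have "(\<Sum>i\<in>UNIV. x $ i * (\<Sum>l\<in>UNIV. v i $ l)) = (\<Sum>l\<in>UNIV. mom v x $ l)"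
    unfolding mom_def by (simp add: sum_distrib_left, subst sum.swap) simp
  ultimately show ?thesis using sq[of "mom v x"] that by (auto simp: xen_def)
qed

text \<open>Expanding |v_a - v_b|^2 shows that at a fixed value of \<eta> the energy is a quadratic
  form in x depending on the differences of the sites only.\<close>

lemma xen_quadratic:
  assumes "eta x = 1 \<or> eta x = -1"
  shows "(\<Sum>a\<in>UNIV. \<Sum>b\<in>UNIV. x $ a * x $ b * idot (v a - v b) (v a - v b)) = 2 * eta x * xen v x"
proof -
  have momdot: "idot (mom v x) p = (\<Sum>a\<in>UNIV. x $ a * idot (v a) p)" for p
    unfolding mom_def idot_def by (simp add: sum_distrib_left sum_distrib_right mult.assoc, subst sum.swap) simp
  have "(\<Sum>a\<in>UNIV. \<Sum>b\<in>UNIV. x $ a * x $ b * idot (v a - v b) (v a - v b)) =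
      (\<Sum>a\<in>UNIV. \<Sum>b\<in>UNIV. x $ b * (x $ a * sqnorm (v a)) + x $ a * (x $ b * sqnorm (v b))
        - 2 * (x $ a * (x $ b * idot (v b) (v a))))"
    by (intro sum.cong refl) (simp add: idot_simps sqnorm_idot idot_commute algebra_simps)
  also have "\<dots> = 2 * eta x * vsq v x - 2 * (\<Sum>a\<in>UNIV. x $ a * (\<Sum>b\<in>UNIV. x $ b * idot (v b) (v a)))"
    by (simp add: sum.distrib sum_subtractf sum_distrib_left[symmetric] sum_distrib_right[symmetric] eta_def vsq_def)
  also have "(\<Sum>a\<in>UNIV. x $ a * (\<Sum>b\<in>UNIV. x $ b * idot (v b) (v a))) = idot (mom v x) (mom v x)"
    unfolding momdot[symmetric] unfolding idot_commute[of "mom v x" "v _"] unfolding momdot[symmetric] ..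
  finally show ?thesis using assms by (auto simp: xen_def)
qed

text \<open>The sites are generic when an affine relation among points of equal energy lifts to the
  off-diagonal entries of the second moments.\<close>

definition generic :: "nat \<Rightarrow> ('m::finite \<Rightarrow> int^'n::finite) \<Rightarrow> bool" where
  "generic r v \<longleftrightarrow> (\<forall>Z \<gamma>. finite Z \<longrightarrow> (\<forall>x\<in>Z. \<forall>y\<in>Z. \<forall>k. \<bar>(x - y) $ k\<bar> \<le> int r) \<longrightarrow>
     (\<forall>x\<in>Z. \<forall>y\<in>Z. xen v x = xen v y) \<longrightarrow> (\<forall>x\<in>Z. eta x = 1 \<or> eta x = -1) \<longrightarrow>
     (\<Sum>x\<in>Z. \<gamma> x) = 0 \<longrightarrow> (\<forall>k. (\<Sum>x\<in>Z. \<gamma> x * x $ k) = 0) \<longrightarrow>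
     (\<forall>a b. a \<noteq> b \<longrightarrow> (\<Sum>x\<in>Z. \<gamma> x * x $ a * x $ b) = 0))"

section \<open>Second moments of affine relations and the genericity polynomial\<close>

definition second_moment :: "(int^'m::finite) set \<Rightarrow> (int^'m \<Rightarrow> int) \<Rightarrow> 'm \<Rightarrow> 'm \<Rightarrow> int" where
  "second_moment W \<gamma> a b = (\<Sum>x\<in>W. \<gamma> x * x $ a * x $ b)"

text \<open>A polynomial in the coordinates \<open>c\<close> of the sites. At the sites it is the
  sum of \<open>2 * eta x * xen v x\<close> weighted by \<gamma>.\<close>

definition moment_form :: "(int^'m::finite) set \<Rightarrow> (int^'m \<Rightarrow> int) \<Rightarrow> ('m \<times> 'n::finite \<Rightarrow> int) \<Rightarrow> int" where
  "moment_form W \<gamma> c = (\<Sum>a\<in>UNIV. \<Sum>b\<in>UNIV. second_moment W \<gamma> a b * (\<Sum>l\<in>UNIV. (c (a, l) - c (b, l)) * (c (a, l) - c (b, l))))"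

definition affine_relation :: "(int^'m::finite) set \<Rightarrow> (int^'m \<Rightarrow> int) \<Rightarrow> bool" where
  "affine_relation W \<gamma> \<longleftrightarrow> (\<Sum>x\<in>W. \<gamma> x) = 0 \<and> (\<forall>k. (\<Sum>x\<in>W. \<gamma> x * x $ k) = 0)"

lemma second_moment_sym: "second_moment W \<gamma> a b = second_moment W \<gamma> b a"
  by (simp add: second_moment_def mult_ac)

lemma moment_form_sites:
  "moment_form W \<gamma> (\<lambda>(i, l). v i $ l) =
     (\<Sum>a\<in>UNIV. \<Sum>b\<in>UNIV. second_moment W \<gamma> a b * idot (v a - v b) (v a - v b))"
  by (simp add: moment_form_def idot_def)

text \<open>By \<open>xen_quadratic\<close> the form is a multiple of the common energy times the
  \<gamma>-weighted sum of \<eta>, which vanishes because \<eta> is linear.\<close>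

lemma moment_form_energy:
  assumes Z: "finite Z" "\<And>x y. x \<in> Z \<Longrightarrow> y \<in> Z \<Longrightarrow> xen v x = xen v y" "\<And>x. x \<in> Z \<Longrightarrow> eta x = 1 \<or> eta x = -1"
    and \<gamma>: "affine_relation Z \<gamma>"
  shows "moment_form Z \<gamma> (\<lambda>(i, l). v i $ l) = 0"
proof (cases "Z = {}")
  case True
  then show ?thesis by (simp add: moment_form_sites second_moment_def)
next
  case False
  then obtain x0 where x0: "x0 \<in> Z" by blast
  have "moment_form Z \<gamma> (\<lambda>(i, l). v i $ l) =
      (\<Sum>a\<in>UNIV. \<Sum>b\<in>UNIV. \<Sum>x\<in>Z. \<gamma> x * (x $ a * x $ b * idot (v a - v b) (v a - v b)))"
    unfolding moment_form_sites second_moment_def by (simp add: sum_distrib_right mult.assoc)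
  also have "\<dots> = (\<Sum>a\<in>UNIV. \<Sum>x\<in>Z. \<Sum>b\<in>UNIV. \<gamma> x * (x $ a * x $ b * idot (v a - v b) (v a - v b)))"
    by (intro sum.cong refl sum.swap)
  also have "\<dots> = (\<Sum>x\<in>Z. \<Sum>a\<in>UNIV. \<Sum>b\<in>UNIV. \<gamma> x * (x $ a * x $ b * idot (v a - v b) (v a - v b)))"
    by (rule sum.swap)
  also have "\<dots> = (\<Sum>x\<in>Z. \<gamma> x * (2 * eta x * xen v x))"
    by (intro sum.cong refl) (simp add: sum_distrib_left[symmetric] xen_quadratic[OF Z(3)])
  also have "\<dots> = (\<Sum>x\<in>Z. 2 * xen v x0 * (\<gamma> x * eta x))"
    by (intro sum.cong refl) (simp add: Z(2)[OF _ x0])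
  also have "\<dots> = 2 * xen v x0 * (\<Sum>k\<in>UNIV. \<Sum>x\<in>Z. \<gamma> x * x $ k)"
    by (subst sum.swap) (simp add: eta_def sum_distrib_left)
  also have "\<dots> = 0" using \<gamma> by (simp add: affine_relation_def)
  finally show ?thesis .
qed

text \<open>If the form vanished identically, so would its polarisation in one space direction;
  indicator functions of \<open>i\<close> and \<open>j\<close> then pick out the second moment at
  (i, j).\<close>

lemma moment_form_nonzero:
  assumes ab: "i \<noteq> j" "second_moment W \<gamma> i j \<noteq> 0"
  shows "\<exists>c :: 'm::finite \<times> 'n::finite \<Rightarrow> int. moment_form W \<gamma> c \<noteq> 0"
proof (rule ccontr)
  assume "\<not> ?thesis"
  then have zero: "moment_form W \<gamma> c = 0" for c :: "'m \<times> 'n \<Rightarrow> int" by blast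
  let ?B = "second_moment W \<gamma>"
  have *: "(\<Sum>a\<in>UNIV. \<Sum>b\<in>UNIV. ?B a b * ((t a - t b) * (t a - t b))) = 0" for t
  proof -
    have "moment_form W \<gamma> (\<lambda>(a, l). if l = (undefined :: 'n) then t a else 0) =
        (\<Sum>a\<in>UNIV. \<Sum>b\<in>UNIV. ?B a b * (\<Sum>l\<in>UNIV. if l = (undefined :: 'n) then (t a - t b) * (t a - t b) else 0))"
      unfolding moment_form_def by (intro sum.cong refl arg_cong2[where f = "(*)"]) simp
    then show ?thesis using zero by simp
  qed
  \<comment> \<open>The product (s_a - s_b) (t_a - t_b) is nonzero only for {a, b} = {i, j}, where
    it is -1.\<close>
  define s t :: "'m \<Rightarrow> int" where "s a = of_bool (a = i)" and "t a = of_bool (a = j)" for a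
  have "(\<Sum>a\<in>UNIV. \<Sum>b\<in>UNIV. 2 * (?B a b * ((s a - s b) * (t a - t b)))) =
      (\<Sum>a\<in>UNIV. \<Sum>b\<in>UNIV. ?B a b * (((s a + t a) - (s b + t b)) * ((s a + t a) - (s b + t b)))
        - ?B a b * ((s a - s b) * (s a - s b)) - ?B a b * ((t a - t b) * (t a - t b)))"
    by (intro sum.cong refl) (simp add: algebra_simps)
  also have "\<dots> = 0" using *[of "\<lambda>a. s a + t a"] *[of s] *[of t] by (simp add: sum_subtractf)
  finally have "(\<Sum>a\<in>UNIV. \<Sum>b\<in>UNIV. ?B a b * ((s a - s b) * (t a - t b))) = 0"
    by (simp add: sum_distrib_left[symmetric])
  moreover have "(\<Sum>a\<in>UNIV. \<Sum>b\<in>UNIV. ?B a b * ((s a - s b) * (t a - t b))) =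
      (\<Sum>a\<in>UNIV. \<Sum>b\<in>UNIV. (if b = j then if a = i then - ?B a b else 0 else 0) +
         (if b = i then if a = j then - ?B a b else 0 else 0))"
    using ab(1) by (intro sum.cong refl) (auto simp: s_def t_def)
  then have "(\<Sum>a\<in>UNIV. \<Sum>b\<in>UNIV. ?B a b * ((s a - s b) * (t a - t b))) = - ?B i j - ?B j i"
    by (simp add: sum.distrib)
  ultimately show False using ab(2) second_moment_sym[of W \<gamma> i j] by simp
qed

lemma finite_box: "finite {d :: int^'m::finite. \<forall>k. \<bar>d $ k\<bar> \<le> r}"
proof -
  have "finite (Pi\<^sub>E (UNIV :: 'm set) (\<lambda>_. {- r..r}))" by (intro finite_PiE) auto
  moreover have "{d :: int^'m. \<forall>k. \<bar>d $ k\<bar> \<le> r} \<subseteq> vec_lambda ` (Pi\<^sub>E (UNIV :: 'm set) (\<lambda>_. {- r..r}))"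
  proof
    fix d :: "int^'m" assume "d \<in> {d. \<forall>k. \<bar>d $ k\<bar> \<le> r}"
    then have "\<bar>d $ k\<bar> \<le> r" for k by blast
    then have "(\<lambda>k. d $ k) \<in> Pi\<^sub>E (UNIV :: 'm set) (\<lambda>_. {- r..r})" by (auto simp: PiE_UNIV_domain abs_le_iff minus_le_iff)
    then show "d \<in> vec_lambda ` (Pi\<^sub>E (UNIV :: 'm set) (\<lambda>_. {- r..r}))"
      by (intro image_eqI[of _ _ "\<lambda>k. d $ k"]) simp_all
  qed
  ultimately show ?thesis using finite_surj by blast
qed

text \<open>The moments of order 0 and 1 vanish, so the second moments do not depend on the origin.
  This brings an arbitrary configuration into a fixed finite box.\<close>

lemma affine_relation_translate:
  assumes "affine_relation ((\<lambda>x. x - x0) ` Z) \<gamma>"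
  shows "affine_relation Z (\<lambda>x. \<gamma> (x - x0))"
    "second_moment Z (\<lambda>x. \<gamma> (x - x0)) a b = second_moment ((\<lambda>x. x - x0) ` Z) \<gamma> a b"
proof -
  have inj: "inj_on (\<lambda>x. x - x0) Z" by (rule inj_onI) simp
  have r: "(\<Sum>d\<in>(\<lambda>x. x - x0) ` Z. f d) = (\<Sum>x\<in>Z. f (x - x0))" for f :: "int^'a \<Rightarrow> int"
    by (simp add: sum.reindex[OF inj])
  have 0: "(\<Sum>x\<in>Z. \<gamma> (x - x0)) = 0" using assms unfolding affine_relation_def r by blast
  have 1: "(\<Sum>x\<in>Z. \<gamma> (x - x0) * x $ k) = 0" for k
  proof -
    have "(\<Sum>x\<in>Z. \<gamma> (x - x0) * (x - x0) $ k) = 0" using assms unfolding affine_relation_def r by blast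
    then show ?thesis using 0 by (simp add: right_diff_distrib sum_subtractf sum_distrib_right[symmetric])
  qed
  then show "affine_relation Z (\<lambda>x. \<gamma> (x - x0))" using 0 by (simp add: affine_relation_def)
  have "(\<Sum>x\<in>Z. \<gamma> (x - x0) * (x - x0) $ a * (x - x0) $ b) =
      (\<Sum>x\<in>Z. \<gamma> (x - x0) * x $ a * x $ b - \<gamma> (x - x0) * x $ a * x0 $ b
        - x0 $ a * (\<gamma> (x - x0) * x $ b) + \<gamma> (x - x0) * (x0 $ a * x0 $ b))"
    by (intro sum.cong refl) (simp add: algebra_simps)
  also have "\<dots> = (\<Sum>x\<in>Z. \<gamma> (x - x0) * x $ a * x $ b)"
    using 0 1 by (simp add: sum.distrib sum_subtractf sum_distrib_right[symmetric] sum_distrib_left[symmetric])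
  finally show "second_moment Z (\<lambda>x. \<gamma> (x - x0)) a b = second_moment ((\<lambda>x. x - x0) ` Z) \<gamma> a b"
    unfolding second_moment_def r by simp
qed

lemma affine_relation_image:
  assumes "affine_relation Z \<gamma>"
  shows "affine_relation ((\<lambda>x. x - x0) ` Z) (\<lambda>d. \<gamma> (d + x0))"
proof -
  have inj: "inj_on (\<lambda>x. x - x0) Z" by (rule inj_onI) simp
  have r: "(\<Sum>d\<in>(\<lambda>x. x - x0) ` Z. f d) = (\<Sum>x\<in>Z. f (x - x0))" for f :: "int^'a \<Rightarrow> int"
    by (simp add: sum.reindex[OF inj])
  show ?thesis using assms unfolding affine_relation_def r
    by (simp add: right_diff_distrib sum_subtractf sum_distrib_right[symmetric])
qed

text \<open>Up to translation only finitely many sets \<open>W\<close> occur. For each one that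
  carries a relation with a nonzero off-diagonal moment, one such relation is selected, and P is the
  product of the resulting forms. A configuration of equal energy violating genericity makes one of
  the factors vanish at the sites.\<close>

lemma generic_polynomial:
  "\<exists>P :: ('m::finite \<times> 'n::finite, int) mpoly. P \<noteq> 0 \<and>
     (\<forall>v :: 'm \<Rightarrow> int^'n. mpoly_eval P (\<lambda>(i, l). v i $ l) \<noteq> 0 \<longrightarrow> generic r v)"
proof -
  define D :: "(int^'m) set" where "D = {d. \<forall>k. \<bar>d $ k\<bar> \<le> int r}"
  define bad where "bad W \<gamma> \<longleftrightarrow> affine_relation W \<gamma> \<and> (\<exists>a b. a \<noteq> b \<and> second_moment W \<gamma> a b \<noteq> 0)"
    for W :: "(int^'m) set" and \<gamma>
  define I where "I = {W \<in> Pow D. \<exists>\<gamma>. bad W \<gamma>}"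
  define g where "g W = (SOME \<gamma>. bad W \<gamma>)" for W
  define f :: "(int^'m) set \<Rightarrow> ('m \<times> 'n \<Rightarrow> int) \<Rightarrow> int" where "f W = moment_form W (g W)" for W
  have g: "bad W (g W)" if "W \<in> I" for W
    using that someI_ex[of "bad W"] unfolding I_def g_def by blast
  have "finite (Pow D)" unfolding D_def by (simp only: finite_Pow_iff finite_box)
  then have fin: "finite I" unfolding I_def by simp
  note pf = poly_functions.sum[OF poly_functions_id] poly_functions.mult[OF poly_functions_id]
    poly_functions.diff[OF poly_functions_id] poly_functions.var[OF poly_functions_id]
  have "poly_fun (\<lambda>c. c) (\<lambda>x. x) (\<lambda>c. second_moment W \<gamma> a b)" for W :: "(int^'m) set" and \<gamma> a b
    by (rule poly_functions.const[OF poly_functions_id])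
  then have pfun: "poly_fun (\<lambda>c. c) (\<lambda>x. x) (f W)" for W
    unfolding f_def moment_form_def by (intro pf)
  have "\<exists>c. f W c \<noteq> 0" if "W \<in> I" for W
    unfolding f_def using g[OF that] moment_form_nonzero unfolding bad_def by blast
  then obtain c where c: "(\<Prod>W\<in>I. f W c) \<noteq> 0"
    using poly_fun_prod_nonzero[OF fin, of f] pfun by blast
  obtain P where P: "\<And>c. (\<Prod>W\<in>I. f W c) = hom_eval (\<lambda>c. c) P c"
    using poly_functions.prod[OF poly_functions_id, of I "\<lambda>x. x" f] pfun unfolding poly_fun_def by blast
  have "P \<noteq> 0" using c P[of c] by auto
  moreover have "generic r v" if nz: "mpoly_eval P (\<lambda>(i, l). v i $ l) \<noteq> 0" for v :: "'m \<Rightarrow> int^'n"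
    unfolding generic_def
  proof (intro allI impI)
    fix Z \<gamma> and a b :: 'm
    assume Z: "finite Z" "\<forall>x\<in>Z. \<forall>y\<in>Z. \<forall>k. \<bar>(x - y) $ k\<bar> \<le> int r" "\<forall>x\<in>Z. \<forall>y\<in>Z. xen v x = xen v y"
      "\<forall>x\<in>Z. eta x = 1 \<or> eta x = -1"
      and \<gamma>: "sum \<gamma> Z = 0" "\<forall>k. (\<Sum>x\<in>Z. \<gamma> x * x $ k) = 0" and ab: "a \<noteq> b"
    show "(\<Sum>x\<in>Z. \<gamma> x * x $ a * x $ b) = 0"
    proof (rule ccontr)
      assume ne: "(\<Sum>x\<in>Z. \<gamma> x * x $ a * x $ b) \<noteq> 0"
      then have "Z \<noteq> {}" by auto
      then obtain x0 where x0: "x0 \<in> Z" by blast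
      define W where "W = (\<lambda>x. x - x0) ` Z"
      have rel: "affine_relation W (\<lambda>d. \<gamma> (d + x0))"
        unfolding W_def by (rule affine_relation_image) (use \<gamma> in \<open>simp add: affine_relation_def\<close>)
      have "second_moment W (\<lambda>d. \<gamma> (d + x0)) a b \<noteq> 0"
        using affine_relation_translate(2)[OF rel[unfolded W_def], of a b] ne
        by (simp add: W_def second_moment_def)
      then have "bad W (\<lambda>d. \<gamma> (d + x0))" unfolding bad_def using rel ab by blast
      then have W: "W \<in> I" using Z(2) x0 by (auto simp: I_def W_def D_def)
      \<comment> \<open>From here on the relation selected for \<open>W\<close> replaces \<gamma>;
        transported back to \<open>Z\<close> it is again an affine relation among points of equal
        energy.\<close>
      note gW = g[OF W, unfolded bad_def, THEN conjunct1]
      note tr = affine_relation_translate[OF gW[unfolded W_def], folded W_def]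
      have "moment_form W (g W) (\<lambda>(i, l). v i $ l) = moment_form Z (\<lambda>x. g W (x - x0)) (\<lambda>(i, l). v i $ l)"
        unfolding moment_form_def tr(2) ..
      also have "\<dots> = 0"
      proof (rule moment_form_energy[OF Z(1)])
        show "affine_relation Z (\<lambda>x. g W (x - x0))" by (rule tr(1))
        show "xen v x = xen v y" if "x \<in> Z" "y \<in> Z" for x y using Z(3) that by blast
        show "eta x = 1 \<or> eta x = -1" if "x \<in> Z" for x using Z(4) that by blast
      qed
      finally have f0: "f W (\<lambda>(i, l). v i $ l) = 0" by (simp only: f_def)
      have "(\<Prod>W\<in>I. f W (\<lambda>(i, l). v i $ l)) = 0"
        by (rule prod_zero[OF fin]) (use W f0 in blast)
      then show False using nz unfolding P mpoly_eval_hom_eval by simp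
    qed
  qed
  ultimately show ?thesis by blast
qed

lemma genericD:
  assumes "generic r v" "finite Z" "\<And>x y k. x \<in> Z \<Longrightarrow> y \<in> Z \<Longrightarrow> \<bar>(x - y) $ k\<bar> \<le> int r"
    "\<And>x y. x \<in> Z \<Longrightarrow> y \<in> Z \<Longrightarrow> xen v x = xen v y" "\<And>x. x \<in> Z \<Longrightarrow> eta x = 1 \<or> eta x = -1"
    "affine_relation Z \<gamma>" "a \<noteq> b"
  shows "second_moment Z \<gamma> a b = 0"
proof -
  have "\<forall>x\<in>Z. \<forall>y\<in>Z. \<forall>k. \<bar>(x - y) $ k\<bar> \<le> int r" "\<forall>x\<in>Z. \<forall>y\<in>Z. xen v x = xen v y"
    "\<forall>x\<in>Z. eta x = 1 \<or> eta x = -1" using assms(3-5) by blast+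
  then show ?thesis
    using assms(1,2,6,7) unfolding generic_def affine_relation_def second_moment_def by blast
qed

text \<open>If \<open>\<gamma>\<close> is an affine relation among points of one colour, then genericity makes
  \<open>\<gamma>\<^sub>x (x\<^sub>a - z\<^sub>a)\<close> another one, with smaller support.\<close>

lemma no_affine_relation:
  assumes gen: "generic r v" and Z: "finite Z" "\<And>x y k. x \<in> Z \<Longrightarrow> y \<in> Z \<Longrightarrow> \<bar>(x - y) $ k\<bar> \<le> int r"
    "\<And>x y. x \<in> Z \<Longrightarrow> y \<in> Z \<Longrightarrow> xen v x = xen v y" "\<And>x. x \<in> Z \<Longrightarrow> eta x = c" "c = 1 \<or> c = -1"
    and \<gamma>: "affine_relation Z \<gamma>" and x: "x \<in> Z"
  shows "\<gamma> x = 0"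
  using \<gamma> x
proof (induction "card {x \<in> Z. \<gamma> x \<noteq> 0}" arbitrary: \<gamma> x rule: less_induct)
  case less
  have off: "second_moment Z \<gamma> a b = 0" if "a \<noteq> b" for a b
    using genericD[OF gen Z(1,2,3) _ less.prems(1) that] Z(4,5) by blast
  have rel: "(\<Sum>x\<in>Z. \<gamma> x) = 0" "(\<Sum>x\<in>Z. \<gamma> x * x $ k) = 0" for k
    using less.prems(1) unfolding affine_relation_def by blast+
  \<comment> \<open>The diagonal moments vanish too: a row of the moment matrix sums to c times a
    first moment, because \<eta> is constantly c on \<open>Z\<close>.\<close>
  have mom: "second_moment Z \<gamma> a b = 0" for a b
  proof (cases "a = b")
    case True
    have "(\<Sum>b\<in>UNIV. second_moment Z \<gamma> a b) = (\<Sum>x\<in>Z. \<gamma> x * x $ a * eta x)"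
      unfolding second_moment_def eta_def sum_distrib_left by (rule sum.swap)
    also have "\<dots> = (\<Sum>x\<in>Z. \<gamma> x * x $ a) * c"
      unfolding sum_distrib_right by (intro sum.cong refl) (simp add: Z(4))
    also have "\<dots> = 0" by (simp add: rel)
    finally have "(\<Sum>b\<in>UNIV. second_moment Z \<gamma> a b) = 0" .
    moreover have "(\<Sum>b\<in>UNIV. second_moment Z \<gamma> a b) = second_moment Z \<gamma> a a + (\<Sum>b\<in>UNIV - {a}. second_moment Z \<gamma> a b)"
      by (rule sum.remove) simp_all
    moreover have "(\<Sum>b\<in>UNIV - {a}. second_moment Z \<gamma> a b) = 0" by (rule sum.neutral) (simp add: off)
    ultimately show ?thesis using True by simp
  qed (rule off)
  show ?case
  proof (rule ccontr)
    assume nx: "\<gamma> x \<noteq> 0"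
    have same: "y = x" if y: "y \<in> Z" "\<gamma> y \<noteq> 0" for y
    proof -
      have "y $ a = x $ a" for a
      proof -
        define \<gamma>' where "\<gamma>' w = \<gamma> w * (w $ a - x $ a)" for w
        have "affine_relation Z \<gamma>'"
          unfolding affine_relation_def
        proof (intro conjI allI)
          show "sum \<gamma>' Z = 0"
            by (simp add: \<gamma>'_def right_diff_distrib sum_subtractf sum_distrib_right[symmetric] rel)
          fix k
          have "(\<Sum>w\<in>Z. \<gamma>' w * w $ k) = second_moment Z \<gamma> a k - x $ a * (\<Sum>w\<in>Z. \<gamma> w * w $ k)"
            by (simp add: \<gamma>'_def second_moment_def sum_subtractf[symmetric] sum_distrib_left algebra_simps)
          then show "(\<Sum>w\<in>Z. \<gamma>' w * w $ k) = 0" by (simp add: rel mom)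
        qed
        moreover have "card {w \<in> Z. \<gamma>' w \<noteq> 0} < card {w \<in> Z. \<gamma> w \<noteq> 0}"
          by (rule psubset_card_mono) (use Z(1) nx less.prems(2) in \<open>auto simp: \<gamma>'_def\<close>)
        ultimately have "\<gamma>' y = 0" using less.hyps y(1) by blast
        then show ?thesis using y(2) by (simp add: \<gamma>'_def)
      qed
      then show ?thesis by (simp add: Finite_Cartesian_Product.vec_eq_iff)
    qed
    have "(\<Sum>w\<in>Z. \<gamma> w) = \<gamma> x + (\<Sum>w\<in>Z - {x}. \<gamma> w)" using Z(1) less.prems(2) by (rule sum.remove)
    moreover have "(\<Sum>w\<in>Z - {x}. \<gamma> w) = 0" by (rule sum.neutral) (use same in blast)
    ultimately show False using rel(1) nx by simp
  qed
qed

lemma common_denominator: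
  fixes u :: "'a \<Rightarrow> rat"
  assumes "finite S"
  shows "\<exists>N::int. N \<noteq> 0 \<and> (\<forall>x\<in>S. of_int N * u x \<in> \<int>)"
  using assms
proof (induction S rule: finite_induct)
  case empty
  show ?case by (intro exI[of _ 1]) simp
next
  case (insert x S)
  then obtain N where N: "N \<noteq> 0" "\<And>y. y \<in> S \<Longrightarrow> of_int N * u y \<in> \<int>" by blast
  obtain p q where pq: "quotient_of (u x) = (p, q)" by fastforce
  have "q > 0" by (rule quotient_of_denom_pos[OF pq])
  have ux: "u x = of_int p / of_int q" by (rule quotient_of_div[OF pq])
  have "of_int (N * q) * u x = of_int (N * p)" using \<open>q > 0\<close> by (simp add: ux)
  then have "of_int (N * q) * u x \<in> \<int>" by (simp only: Ints_of_int)
  moreover have "of_int (N * q) * u y \<in> \<int>" if "y \<in> S" for y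
  proof -
    have "of_int q * (of_int N * u y) \<in> \<int>" by (intro Ints_mult Ints_of_int N(2) that)
    then show ?thesis by (simp add: mult_ac)
  qed
  ultimately show ?case using N(1) \<open>q > 0\<close> by (intro exI[of _ "N * q"]) simp
qed

text \<open>More than m points of Z^m are linearly dependent over the rationals. After clearing
  denominators, applying \<eta>, which is constant on \<open>Z\<close>, shows that the dependence is
  an affine relation, contrary to \<open>no_affine_relation\<close>.\<close>

lemma monochromatic_card:
  fixes Z :: "(int^'m::finite) set"
  assumes gen: "generic r v" and Z: "finite Z" "\<And>x y k. x \<in> Z \<Longrightarrow> y \<in> Z \<Longrightarrow> \<bar>(x - y) $ k\<bar> \<le> int r"
    "\<And>x y. x \<in> Z \<Longrightarrow> y \<in> Z \<Longrightarrow> xen v x = xen v y" "\<And>x. x \<in> Z \<Longrightarrow> eta x = c" "c = 1 \<or> c = -1"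
  shows "card Z \<le> CARD('m)"
proof (rule ccontr)
  assume "\<not> card Z \<le> CARD('m)"
  define h :: "int^'m \<Rightarrow> rat^'m" where "h x = (\<chi> k. of_int (x $ k))" for x
  have inj: "inj h" by (rule injI) (simp add: h_def Finite_Cartesian_Product.vec_eq_iff)
  then have injZ: "inj_on h Z" by (rule inj_on_subset) simp
  have "vec.dim (h ` Z) \<le> CARD('m)"
    using vec.dim_subset[of "h ` Z" UNIV] unfolding vec_dim_card by simp
  then have "vec.dependent (h ` Z)"
    using \<open>\<not> card Z \<le> CARD('m)\<close> by (intro vec.dependent_biggerset_general) (simp add: card_image[OF injZ])
  then obtain u where u: "\<exists>w\<in>h ` Z. u w \<noteq> 0" "(\<Sum>w\<in>h ` Z. u w *s w) = 0"
    using vec.dependent_finite[of "h ` Z"] Z(1) by auto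
  obtain N where N: "N \<noteq> 0" "\<And>w. w \<in> h ` Z \<Longrightarrow> of_int N * u w \<in> \<int>"
    using common_denominator[of "h ` Z" u] Z(1) by blast
  define \<gamma> :: "int^'m \<Rightarrow> int" where "\<gamma> x = \<lfloor>of_int N * u (h x)\<rfloor>" for x
  have \<gamma>: "of_int (\<gamma> x) = of_int N * u (h x)" if "x \<in> Z" for x
    unfolding \<gamma>_def by (rule of_int_floor[OF N(2)]) (use that in blast)
  have rel: "(\<Sum>x\<in>Z. \<gamma> x * x $ k) = 0" for k
  proof -
    have "rat_of_int (\<Sum>x\<in>Z. \<gamma> x * x $ k) = (\<Sum>x\<in>Z. of_int N * (u (h x) * h x $ k))"
      unfolding of_int_sum by (intro sum.cong refl) (simp add: \<gamma> h_def)
    also have "\<dots> = of_int N * (\<Sum>w\<in>h ` Z. u w *s w) $ k"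
      by (simp add: sum.reindex[OF injZ] sum_distrib_left)
    also have "\<dots> = 0" unfolding u(2) by simp
    finally show ?thesis by (simp only: of_int_eq_0_iff)
  qed
  have "(\<Sum>x\<in>Z. \<gamma> x) * c = (\<Sum>x\<in>Z. \<gamma> x * eta x)" by (simp add: sum_distrib_right Z(4))
  also have "\<dots> = (\<Sum>k\<in>UNIV. \<Sum>x\<in>Z. \<gamma> x * x $ k)"
    unfolding eta_def sum_distrib_left by (rule sum.swap)
  also have "\<dots> = 0" by (simp add: rel)
  finally have "(\<Sum>x\<in>Z. \<gamma> x) = 0" using Z(5) by auto
  then have aff: "affine_relation Z \<gamma>" using rel by (simp add: affine_relation_def)
  have "\<gamma> x = 0" if "x \<in> Z" for x by (rule no_affine_relation[OF gen Z aff that])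
  then have "u (h x) = 0" if "x \<in> Z" for x using \<gamma>[OF that] N(1) that by simp
  then show False using u(1) by blast
qed

text \<open>The image of a connected component of \<open>\<Lambda>\<^sub>S\<close> under the encoding.\<close>

definition cluster :: "('m::finite \<Rightarrow> int^'n::finite) \<Rightarrow> (int^'m) set \<Rightarrow> bool" where
  "cluster v X \<longleftrightarrow> X \<noteq> {} \<and> X \<subseteq> xvertices v \<and> (\<forall>x\<in>X. \<forall>y\<in>X. xen v x = xen v y) \<and>
     (\<forall>x\<in>X. \<forall>y\<in>X. (x, y) \<in> {(x, y). x \<in> X \<and> y \<in> X \<and> adj x y}\<^sup>*)"

lemma clusterD:
  assumes "cluster v X"
  shows "X \<noteq> {}" "x \<in> X \<Longrightarrow> eta x = 1 \<or> eta x = -1" "x \<in> X \<Longrightarrow> mom v x \<noteq> eta x *s v i"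
    "x \<in> X \<Longrightarrow> y \<in> X \<Longrightarrow> xen v x = xen v y"
    "x \<in> X \<Longrightarrow> y \<in> X \<Longrightarrow> (x, y) \<in> {(x, y). x \<in> X \<and> y \<in> X \<and> adj x y}\<^sup>*"
proof -
  note a = assms[unfolded cluster_def]
  show "X \<noteq> {}" using a by (rule conjunct1)
  show "eta x = 1 \<or> eta x = -1" "mom v x \<noteq> eta x *s v i" if "x \<in> X"
    using a that by (auto simp: xvertices_def subset_iff)
  show "xen v x = xen v y" if "x \<in> X" "y \<in> X" using a that by meson
  show "(x, y) \<in> {(x, y). x \<in> X \<and> y \<in> X \<and> adj x y}\<^sup>*" if "x \<in> X" "y \<in> X" using a that by meson
qed

section \<open>Size and shape of clusters\<close>

lemma adj_box: "adj x w \<Longrightarrow> \<bar>(w - x) $ k\<bar> \<le> 1"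
  unfolding adj_def using pair_adj_odd(2) by blast

lemma cluster_grow:
  assumes X: "cluster v X" and Z: "Z \<subseteq> X" "Z \<noteq> {}" "Z \<noteq> X"
  shows "\<exists>z\<in>Z. \<exists>w\<in>X - Z. adj z w"
proof -
  obtain z y where zy: "z \<in> Z" "y \<in> X" "y \<notin> Z" using Z by blast
  then have "(z, y) \<in> {(x, y). x \<in> X \<and> y \<in> X \<and> adj x y}\<^sup>*" using Z(1) by (intro clusterD(5)[OF X]) blast+
  then show ?thesis using zy(3)
  proof (induction rule: rtrancl_induct)
    case base
    then show ?case using zy by blast
  next
    case (step y w)
    then show ?case by (cases "y \<in> Z") blast+
  qed
qed

text \<open>Add one adjacent point at a time; every addition widens the coordinate ranges by at most
  1.\<close>

lemma cluster_balls:
  assumes X: "cluster v X" and k: "infinite X \<or> Suc k \<le> card X"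
  shows "\<exists>Z\<subseteq>X. finite Z \<and> card Z = Suc k \<and> (\<forall>x\<in>Z. \<forall>y\<in>Z. \<forall>l. \<bar>(x - y) $ l\<bar> \<le> int k)"
  using k
proof (induction k)
  case 0
  obtain x where "x \<in> X" using clusterD(1)[OF X] by blast
  then show ?case by (intro exI[of _ "{x}"]) simp
next
  case (Suc k)
  then obtain Z where Z: "Z \<subseteq> X" "finite Z" "card Z = Suc k" "\<And>x y l. x \<in> Z \<Longrightarrow> y \<in> Z \<Longrightarrow> \<bar>(x - y) $ l\<bar> \<le> int k"
    by (metis Suc_leD)
  have "Z \<noteq> X" using Z(2,3) Suc.prems by auto
  moreover have "Z \<noteq> {}" using Z(3) by auto
  ultimately obtain z w where zw: "z \<in> Z" "w \<in> X" "w \<notin> Z" "adj z w" using cluster_grow[OF X Z(1)] by blast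
  have wx: "\<bar>(w - x) $ l\<bar> \<le> int (Suc k)" if "x \<in> Z" for x l
    using adj_box[OF zw(4), of l] Z(4)[OF zw(1) that, of l] by simp
  have xw: "\<bar>(x - w) $ l\<bar> \<le> int (Suc k)" if "x \<in> Z" for x l
    using wx[OF that, of l] by simp
  have "\<bar>(x - y) $ l\<bar> \<le> int (Suc k)" if "x \<in> insert w Z" "y \<in> insert w Z" for x y l
  proof (cases "x = w \<or> y = w")
    case True
    then show ?thesis using that wx xw by auto
  next
    case False
    then show ?thesis using Z(4)[of x y l] that by simp
  qed
  then have "\<forall>x\<in>insert w Z. \<forall>y\<in>insert w Z. \<forall>l. \<bar>(x - y) $ l\<bar> \<le> int (Suc k)" by blast
  moreover have "insert w Z \<subseteq> X" "finite (insert w Z)" "card (insert w Z) = Suc (Suc k)"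
    using Z(1-3) zw(2,3) by simp_all
  ultimately show ?case by blast
qed

text \<open>Genericity only concerns configurations in a box of size 2m. So a subset of 2m + 1
  points grown by \<open>cluster_balls\<close> is excluded first, which bounds the cardinality; then
  X itself is such a grown set, and its extent is smaller than its cardinality.\<close>

lemma cluster_card:
  fixes X :: "(int^'m::finite) set"
  assumes X: "cluster v X" and gen: "generic (2 * CARD('m)) v"
  shows "finite X" "card X \<le> 2 * CARD('m)" "x \<in> X \<Longrightarrow> y \<in> X \<Longrightarrow> \<bar>(x - y) $ k\<bar> \<le> 2 * int CARD('m)"
proof -
  have small: "card Z \<le> 2 * CARD('m)"
    if Z: "Z \<subseteq> X" "finite Z" "\<And>x y l. x \<in> Z \<Longrightarrow> y \<in> Z \<Longrightarrow> \<bar>(x - y) $ l\<bar> \<le> int (2 * CARD('m))" for Z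
  proof -
    have c: "card {x \<in> Z. eta x = c} \<le> CARD('m)" if "c = 1 \<or> c = -1" for c
    proof (rule monochromatic_card[OF gen _ _ _ _ that])
      fix x y k assume xy: "x \<in> {x \<in> Z. eta x = c}" "y \<in> {x \<in> Z. eta x = c}"
      then have "x \<in> Z" "y \<in> Z" by simp_all
      then show "\<bar>(x - y) $ k\<bar> \<le> int (2 * CARD('m))" by (rule Z(3))
      show "xen v x = xen v y" using \<open>x \<in> Z\<close> \<open>y \<in> Z\<close> Z(1) by (intro clusterD(4)[OF X]) blast+
    qed (use Z(2) in simp_all)
    have "Z \<subseteq> {x \<in> Z. eta x = 1} \<union> {x \<in> Z. eta x = -1}" using clusterD(2)[OF X] Z(1) by blast
    then have "card Z \<le> card ({x \<in> Z. eta x = 1} \<union> {x \<in> Z. eta x = -1})" using Z(2) by (intro card_mono) simp_all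
    also have "\<dots> \<le> card {x \<in> Z. eta x = 1} + card {x \<in> Z. eta x = -1}" by (rule card_Un_le)
    also have "\<dots> \<le> CARD('m) + CARD('m)" by (intro add_mono c) simp_all
    finally show ?thesis by simp
  qed
  have "\<not> (infinite X \<or> Suc (2 * CARD('m)) \<le> card X)"
  proof
    assume "infinite X \<or> Suc (2 * CARD('m)) \<le> card X"
    then obtain Z where Z: "Z \<subseteq> X" "finite Z" "card Z = Suc (2 * CARD('m))"
      "\<forall>x\<in>Z. \<forall>y\<in>Z. \<forall>l. \<bar>(x - y) $ l\<bar> \<le> int (2 * CARD('m))"
      using cluster_balls[OF X] by blast
    then have "card Z \<le> 2 * CARD('m)" by (intro small) blast+
    then show False using Z(3) by simp
  qed
  then show fin: "finite X" and card: "card X \<le> 2 * CARD('m)" by simp_all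
  have "card X \<noteq> 0" using fin clusterD(1)[OF X] by simp
  then obtain k where k: "card X = Suc k" using not0_implies_Suc by blast
  then obtain Z where Z: "Z \<subseteq> X" "card Z = Suc k" "\<forall>x\<in>Z. \<forall>y\<in>Z. \<forall>l. \<bar>(x - y) $ l\<bar> \<le> int k"
    using cluster_balls[OF X, of k] by auto
  have "Z = X" by (rule card_subset_eq[OF fin Z(1)]) (simp add: Z(2) k)
  then show "\<bar>(x - y) $ k\<bar> \<le> 2 * int CARD('m)" if "x \<in> X" "y \<in> X" for x y k
  proof -
    have "\<bar>(x - y) $ k\<bar> \<le> int (card X - 1)" using Z(3) \<open>Z = X\<close> that k by simp
    then show ?thesis using card by linarith
  qed
qed

text \<open>The conclusion is the off-diagonal second moment of the affine relation x - (x + r) - y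
  + (y + r) = 0.\<close>

lemma parallelogram:
  fixes X :: "(int^'m::finite) set"
  assumes X: "cluster v X" and gen: "generic (2 * CARD('m)) v"
    and p: "x \<in> X" "x + r \<in> X" "y \<in> X" "y + r \<in> X" and ab: "a \<noteq> b"
  shows "(y - x) $ a * r $ b + r $ a * (y - x) $ b = 0"
proof -
  define Z where "Z = {x, x + r, y, y + r}"
  have ZX: "z \<in> X" if "z \<in> Z" for z using p that unfolding Z_def by blast
  \<comment> \<open>A sum of indicators, so that coinciding corners such as y = x + r add up
    correctly.\<close>
  define \<gamma> :: "int^'m \<Rightarrow> int" where
    "\<gamma> z = of_bool (z = x) - of_bool (z = x + r) - of_bool (z = y) + of_bool (z = y + r)" for z
  have fin: "finite Z" by (simp add: Z_def)
  have s: "(\<Sum>z\<in>Z. \<gamma> z * f z) = f x - f (x + r) - f y + f (y + r)" for f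
  proof -
    have *: "(\<Sum>z\<in>Z. of_bool (z = q) * f z) = f q" if "q \<in> Z" for q
    proof -
      have "(\<Sum>z\<in>Z. of_bool (z = q) * f z) = (\<Sum>z\<in>Z. if z = q then f z else 0)"
        by (intro sum.cong refl) simp
      then show ?thesis using fin that by simp
    qed
    have "x \<in> Z" "x + r \<in> Z" "y \<in> Z" "y + r \<in> Z" by (simp_all add: Z_def)
    note * = *[OF this(1)] *[OF this(2)] *[OF this(3)] *[OF this(4)]
    show ?thesis unfolding \<gamma>_def distrib_right left_diff_distrib sum.distrib sum_subtractf * ..
  qed
  have aff: "affine_relation Z \<gamma>"
    unfolding affine_relation_def using s[of "\<lambda>_. 1"] s[of "\<lambda>z. z $ _"] by simp
  have "second_moment Z \<gamma> a b = 0"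
  proof (rule genericD[OF gen fin _ _ _ aff ab])
    show "\<bar>(z - w) $ k\<bar> \<le> int (2 * CARD('m))" if "z \<in> Z" "w \<in> Z" for z w k
      using cluster_card(3)[OF X gen ZX[OF that(1)] ZX[OF that(2)], of k] by simp
    show "xen v z = xen v w" if "z \<in> Z" "w \<in> Z" for z w by (rule clusterD(4)[OF X ZX[OF that(1)] ZX[OF that(2)]])
    show "eta z = 1 \<or> eta z = -1" if "z \<in> Z" for z by (rule clusterD(2)[OF X ZX[OF that]])
  qed
  then have "x $ a * x $ b - (x + r) $ a * (x + r) $ b - y $ a * y $ b + (y + r) $ a * (y + r) $ b = 0"
    unfolding second_moment_def mult.assoc s[of "\<lambda>z. z $ a * z $ b"] .
  then show ?thesis by (simp add: algebra_simps)
qed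

lemma xen_black:
  shows "eta x = -1 \<Longrightarrow> xen v (x + axis i 1 - axis j 1) - xen v x = 2 * idot (mom v x + v i) (v i - v j)"
    "eta x = 1 \<Longrightarrow> xen v (x + axis i 1 - axis j 1) - xen v x = - 2 * idot (mom v x - v j) (v i - v j)"
  by (simp_all add: xen_def eta_simps mom_simps vsq_simps idot_simps idot_commute algebra_simps)

lemma xen_red:
  "eta x = -1 \<Longrightarrow> xen v (x + axis i 1 + axis j 1) - xen v x = - 2 * idot (mom v x + v i) (mom v x + v j)"
  by (simp add: xen_def eta_simps mom_simps vsq_simps idot_simps idot_commute algebra_simps)

text \<open>Let p = \<open>mom v x\<close> and \<eta>(x) = -1. Equal energies make p + v_i
  orthogonal to v_i - v_j by the black edge and to p + v_j by the red one, hence to itself. Then -p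
  = v_i is a tangential site, which vertices exclude. The other colour is similar.\<close>

lemma no_black_and_red:
  assumes X: "cluster v X" and x: "x \<in> X" "x + axis i 1 - axis j 1 \<in> X"
  shows "eta x = -1 \<Longrightarrow> x + axis i 1 + axis j 1 \<notin> X" "eta x = 1 \<Longrightarrow> x - axis i 1 - axis j 1 \<notin> X"
proof -
  note E = clusterD(4)[OF X x]
  show "x + axis i 1 + axis j 1 \<notin> X" if eta: "eta x = -1"
  proof
    assume y: "x + axis i 1 + axis j 1 \<in> X"
    have "idot (mom v x + v i) (v i - v j) = 0" using xen_black(1)[OF eta, of v i j] E by simp
    moreover have "idot (mom v x + v i) (mom v x + v j) = 0"
      using xen_red[OF eta, of v i j] clusterD(4)[OF X x(1) y] by simp
    ultimately have "idot (mom v x + v i) (mom v x + v i) = 0" by (simp add: idot_simps)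
    then have "mom v x = - v i" by (simp add: idot_self_eq_0 eq_neg_iff_add_eq_0)
    then show False using clusterD(3)[OF X x(1), of i] eta by (simp add: minus_one_smult)
  qed
  show "x - axis i 1 - axis j 1 \<notin> X" if eta: "eta x = 1"
  proof
    assume y: "x - axis i 1 - axis j 1 \<in> X"
    have ey: "eta (x - axis i 1 - axis j 1) = -1" using eta by (simp add: eta_simps)
    have "idot (mom v x - v j) (v i - v j) = 0" using xen_black(2)[OF eta, of v i j] E by simp
    moreover have "idot (mom v x - v j) (mom v x - v i) = 0"
      using xen_red[OF ey, of v i j] clusterD(4)[OF X x(1) y] by (simp add: mom_simps)
    ultimately have "idot (mom v x - v j) (mom v x - v j) = 0" by (simp add: idot_simps)
    then have "mom v x = v j" by (simp add: idot_self_eq_0)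
    then show False using clusterD(3)[OF X x(1), of j] eta by simp
  qed
qed

text \<open>Three points in arithmetic progression form a degenerate parallelogram.\<close>

lemma no_opposite_black:
  fixes X :: "(int^'m::finite) set"
  assumes X: "cluster v X" and gen: "generic (2 * CARD('m)) v" and ij: "i \<noteq> j"
    and x: "x \<in> X" "x + axis i 1 - axis j 1 \<in> X"
  shows "x - axis i 1 + axis j 1 \<notin> X"
proof
  assume y: "x - axis i 1 + axis j 1 \<in> X"
  define r :: "int^'m" where "r = axis i 1 - axis j 1"
  have "x - r \<in> X" "x + r \<in> X" using x y by (simp_all add: r_def algebra_simps)
  then have "(x - (x - r)) $ i * r $ j + r $ i * (x - (x - r)) $ j = 0"
    using x(1) by (intro parallelogram[OF X gen _ _ _ _ ij]) simp_all
  then show False using ij by (simp add: r_def axis_nth_int)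
qed

text \<open>\<open>parallelogram\<close> forces y - x = t (e_i + e_j). Since \<eta> is 1 or -1 at
  both points, t is 0, 1 or -1, and in the last two cases y is a red neighbour of x through the same
  pair, which \<open>no_black_and_red\<close> excludes.\<close>

lemma black_unique:
  fixes X :: "(int^'m::finite) set"
  assumes X: "cluster v X" and gen: "generic (2 * CARD('m)) v" and ij: "i \<noteq> j"
    and x: "x \<in> X" "x + axis i 1 - axis j 1 \<in> X" and y: "y \<in> X" "y + axis i 1 - axis j 1 \<in> X"
  shows "x = y"
proof -
  define r :: "int^'m" where "r = axis i 1 - axis j 1"
  have r: "r $ i = 1" "r $ j = -1" "k \<noteq> i \<Longrightarrow> k \<noteq> j \<Longrightarrow> r $ k = 0" for k
    using ij by (auto simp: r_def axis_nth_int)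
  have p: "(y - x) $ a * r $ b + r $ a * (y - x) $ b = 0" if "a \<noteq> b" for a b
    using x y by (intro parallelogram[OF X gen _ _ _ _ that]) (simp_all add: r_def algebra_simps)
  define t where "t = (y - x) $ i"
  have tj: "(y - x) $ j = t" using p[OF ij] r by (simp add: t_def)
  have tk: "(y - x) $ k = 0" if "k \<noteq> i" "k \<noteq> j" for k using p[OF that(1)] r(1) r(3)[OF that] by simp
  have yx: "y = x + t *s (axis i 1 + axis j 1)"
  proof -
    have "y $ k = (x + t *s (axis i 1 + axis j 1)) $ k" for k
      using tj tk[of k] ij by (cases "k = i"; cases "k = j") (auto simp: t_def axis_nth_int)
    then show ?thesis by (simp add: Finite_Cartesian_Product.vec_eq_iff)
  qed
  have et: "eta y = eta x + 2 * t" by (simp add: yx eta_simps eta_scale)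
  have ey: "eta x = 1 \<or> eta x = -1" "eta y = 1 \<or> eta y = -1" using clusterD(2)[OF X] x y by blast+
  then consider "t = 0" | "t = 1" "eta x = -1" | "t = -1" "eta x = 1" using et by linarith
  then show ?thesis
  proof cases
    case 2
    then show ?thesis using no_black_and_red(1)[OF X x] y(1) yx by (simp add: add.assoc)
  next
    case 3
    then show ?thesis using no_black_and_red(2)[OF X x] y(1) yx by (simp add: minus_one_smult algebra_simps)
  qed (simp add: yx)
qed

text \<open>Two red edges with the same label join points that differ by \<open>t (e\<^sub>i - e\<^sub>j)\<close>. Both end
  points of such edges lie on the sphere with diameter \<open>v\<^sub>i, v\<^sub>j\<close>, and \<open>\<bar>t\<bar> \<le> 1\<close>
  is the Cauchy-Schwarz inequality.\<close>

lemma red_unique: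
  fixes X :: "(int^'m::finite) set"
  assumes X: "cluster v X" and gen: "generic (2 * CARD('m)) v" and v: "inj v" and ij: "i \<noteq> j"
    and x: "x \<in> X" "x + axis i 1 + axis j 1 \<in> X" "eta x = -1"
    and y: "y \<in> X" "y + axis i 1 + axis j 1 \<in> X" "eta y = -1"
  shows "x = y"
proof (rule ccontr)
  assume "x \<noteq> y"
  define r :: "int^'m" where "r = axis i 1 + axis j 1"
  have r: "r $ i = 1" "r $ j = 1" "k \<noteq> i \<Longrightarrow> k \<noteq> j \<Longrightarrow> r $ k = 0" for k
    using ij by (auto simp: r_def axis_nth_int)
  have p: "(y - x) $ a * r $ b + r $ a * (y - x) $ b = 0" if "a \<noteq> b" for a b
    using x y by (intro parallelogram[OF X gen _ _ _ _ that]) (simp_all add: r_def algebra_simps)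
  define t where "t = (y - x) $ i"
  have tj: "(y - x) $ j = - t" using p[OF ij] r by (simp add: t_def)
  have tk: "(y - x) $ k = 0" if "k \<noteq> i" "k \<noteq> j" for k using p[OF that(1)] r(1) r(3)[OF that] by simp
  have yx: "y = x + t *s (axis i 1 - axis j 1)"
  proof -
    have "y $ k = (x + t *s (axis i 1 - axis j 1)) $ k" for k
      using tj tk[of k] ij by (cases "k = i"; cases "k = j") (auto simp: t_def axis_nth_int)
    then show ?thesis by (simp add: Finite_Cartesian_Product.vec_eq_iff)
  qed
  have t0: "t \<noteq> 0" using \<open>x \<noteq> y\<close> yx by auto
  define p q where "p = mom v x" and "q = v i - v j"
  have e1: "idot (p + v i) (p + v j) = 0"
    using xen_red[OF x(3), of v i j] clusterD(4)[OF X x(1,2)] by (simp add: p_def)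
  have "xen v y - xen v x = t * (2 * idot p q + t * idot q q + idot (v i) (v i) - idot (v j) (v j))"
    unfolding xen_def x(3) y(3)
    by (simp add: yx mom_simps vsq_simps idot_simps p_def q_def idot_commute algebra_simps)
  then have e2: "2 * idot p q + t * idot q q + idot (v i) (v i) - idot (v j) (v j) = 0"
    using clusterD(4)[OF X x(1) y(1)] t0 by simp
  \<comment> \<open>By \<open>e2\<close>, w is the component of 2p + v_i + v_j orthogonal to q, the
    other component being -t q. By \<open>e1\<close> the whole vector has the length of q, so |w|^2
    = (1 - t^2) |q|^2.\<close>
  define w where "w = 2 *s p + v i + v j + t *s q"
  have "idot w w = 4 * idot (p + v i) (p + v j) + idot q q
      + 2 * t * (2 * idot p q + idot (v i) (v i) - idot (v j) (v j)) + t * t * idot q q"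
    unfolding w_def by (simp add: idot_simps q_def idot_commute algebra_simps)
  also have "2 * idot p q + idot (v i) (v i) - idot (v j) (v j) = - t * idot q q" using e2 by linarith
  finally have "idot w w = (1 - t * t) * idot q q" unfolding e1 by (simp add: algebra_simps)
  then have "(1 - t * t) * idot q q \<ge> 0" using idot_nonneg[of w] by simp
  moreover have "idot q q > 0"
    using idot_nonneg[of q] idot_self_eq_0[of q] v ij by (auto simp: q_def inj_eq less_le)
  ultimately have "t * t \<le> 1" by (simp add: zero_le_mult_iff)
  then have "\<bar>t\<bar> \<le> 1" using abs_square_le_1[of t] by (simp add: power2_eq_square)
  then consider "t = 1" | "t = -1" using t0 by linarith
  then show False
  proof cases
    case 1
    then have "x + axis i 1 - axis j 1 \<in> X" using y(1) yx by (simp add: algebra_simps)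
    then show False using no_black_and_red(1)[OF X x(1) _ x(3)] x(2) by blast
  next
    case 2
    then have "x + axis j 1 - axis i 1 \<in> X" using y(1) yx by (simp add: minus_one_smult algebra_simps)
    then have "x + axis j 1 + axis i 1 \<notin> X" by (rule no_black_and_red(1)[OF X x(1) _ x(3)])
    then show False using x(2) by (simp add: add_ac)
  qed
qed

theorem cluster_block_shape:
  fixes X :: "(int^'m::finite) set"
  assumes X: "cluster v X" and gen: "generic (2 * CARD('m)) v" and v: "inj v"
  shows "block_shape X"
proof -
  \<comment> \<open>Through a fixed pair i, j there are two opposite black neighbours and one red
    one, whose direction is fixed by \<eta>; any two of them exclude each other.\<close>
  have nb: "w = w'" if x: "x \<in> X" "w \<in> X" "w' \<in> X" and ij: "i \<noteq> j" and w: "pair_adj i j x w" "pair_adj i j x w'"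
    for x w w' and i j :: 'm
  proof -
    have ji: "j \<noteq> i" using ij by simp
    have sw: "x - axis i 1 + axis j 1 = x + axis j 1 - axis i (1::int)"
      "x + axis i 1 + axis j 1 = x + axis j 1 + axis i (1::int)" "x - axis i 1 - axis j 1 = x - axis j 1 - axis i (1::int)"
      by (simp_all add: algebra_simps)
    note f = no_opposite_black[OF X gen ij x(1)] no_black_and_red[OF X x(1), of i j] no_black_and_red[OF X x(1), of j i]
    show ?thesis
    proof (rule ccontr)
      assume ne: "w \<noteq> w'"
      have c: False if "w = x + axis i 1 - axis j 1 \<and> w' = x - axis i 1 + axis j 1 \<or> w' = x + axis i 1 - axis j 1 \<and> w = x - axis i 1 + axis j 1"
        using that f(1) x by blast
      have d: False if "u = x + axis i 1 - axis j 1 \<or> u = x - axis i 1 + axis j 1"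
        "eta x = -1 \<and> u' = x + axis i 1 + axis j 1 \<or> eta x = 1 \<and> u' = x - axis i 1 - axis j 1" "u \<in> X" "u' \<in> X" for u u'
        using that f(2-5) sw by metis
      have a: "w = x + axis i 1 - axis j 1 \<or> w = x - axis i 1 + axis j 1 \<or>
          (eta x = -1 \<and> w = x + axis i 1 + axis j 1 \<or> eta x = 1 \<and> w = x - axis i 1 - axis j 1)"
        and b: "w' = x + axis i 1 - axis j 1 \<or> w' = x - axis i 1 + axis j 1 \<or>
          (eta x = -1 \<and> w' = x + axis i 1 + axis j 1 \<or> eta x = 1 \<and> w' = x - axis i 1 - axis j 1)"
        using w unfolding pair_adj_def by blast+
      have e: "eta x \<noteq> 1 \<or> eta x \<noteq> -1" by simp
      show False using a b c d[of w w'] d[of w' w] x(2,3) ne e by metis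
    qed
  qed
  have "local_shape X"
    unfolding local_shape_def
    using cluster_card(1)[OF X gen] clusterD(2)[OF X] nb by blast
  then show ?thesis
    unfolding block_shape_def
    using clusterD(1,5)[OF X] black_unique[OF X gen] red_unique[OF X gen v] by blast
qed

section \<open>Connected components and the reduction of Q to \<open>pmat\<close>\<close>

definition joined_rel :: "('m::finite \<Rightarrow> int^'n::finite) \<Rightarrow> ('m grp \<times> 'm grp) set" where
  "joined_rel v = {(u, w). \<exists>x. joined v x u w}"

lemma joined_rel_iff:
  "(u, w) \<in> joined_rel v \<longleftrightarrow>
     u \<in> vertices v \<and> w \<in> vertices v \<and> adj (xc u) (xc w) \<and> xen v (xc u) = xen v (xc w)"
  by (simp only: joined_rel_def mem_Collect_eq case_prod_conv joined_iff)

lemma sym_joined_rel: "sym (joined_rel v)"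
proof (rule symI)
  fix u w assume "(u, w) \<in> joined_rel v"
  then show "(w, u) \<in> joined_rel v" unfolding joined_rel_iff using adj_sym by metis
qed

lemma joined_rel_rtrancl:
  assumes "(u, w) \<in> (joined_rel v)\<^sup>*" "u \<in> vertices v"
  shows "w \<in> vertices v" "xen v (xc w) = xen v (xc u)"
proof -
  have "w \<in> vertices v \<and> xen v (xc w) = xen v (xc u)"
    using assms by (induction rule: rtrancl_induct) (simp_all only: joined_rel_iff)
  then show "w \<in> vertices v" "xen v (xc w) = xen v (xc u)" by simp_all
qed

lemma block_component:
  assumes "C \<in> blocks v" "w \<in> C"
  shows "C = (joined_rel v)\<^sup>* `` {w}"
proof -
  obtain u where u: "C = (joined_rel v)\<^sup>* `` {u}"
    using assms(1) unfolding blocks_def joined_rel_def[symmetric] quotient_def by blast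
  have uw: "(u, w) \<in> (joined_rel v)\<^sup>*" using assms(2) unfolding u by blast
  then have wu: "(w, u) \<in> (joined_rel v)\<^sup>*" using sym_rtrancl[OF sym_joined_rel] by (rule symD[rotated])
  have "(u, z) \<in> (joined_rel v)\<^sup>* \<longleftrightarrow> (w, z) \<in> (joined_rel v)\<^sup>*" for z
    using rtrancl_trans[OF uw] rtrancl_trans[OF wu] by blast
  then show ?thesis unfolding u by blast
qed

lemma block_nonempty: "C \<in> blocks v \<Longrightarrow> \<exists>u. u \<in> C"
  unfolding blocks_def quotient_def by blast

lemma block_vertices:
  assumes "C \<in> blocks v"
  shows "C \<subseteq> vertices v"
proof -
  obtain u where u: "u \<in> vertices v" "C = (joined_rel v)\<^sup>* `` {u}"
    using assms unfolding blocks_def joined_rel_def[symmetric] quotient_def by blast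
  then show ?thesis using joined_rel_rtrancl(1)[OF _ u(1)] by blast
qed

lemma block_inj:
  assumes "C \<in> blocks v"
  shows "inj_on xc C"
  using block_vertices[OF assms] xc_vertices xc_inj by (intro inj_onI) blast

lemma block_eq:
  assumes C: "C \<in> blocks v" "C' \<in> blocks v" and eq: "xc ` C = xc ` C'"
  shows "C = C'"
proof -
  obtain u where u: "u \<in> C" using block_nonempty[OF C(1)] by blast
  obtain w where w: "w \<in> C'" "xc u = xc w" using u(1) eq by blast
  have "u = w" using block_vertices[OF C(1)] block_vertices[OF C(2)] u(1) w by (intro xc_inj) (auto simp: xc_vertices)
  then have "u \<in> C'" using w(1) by simp
  have "C = (joined_rel v)\<^sup>* `` {u}" by (rule block_component[OF C(1) u])
  also have "\<dots> = C'" by (rule block_component[OF C(2) \<open>u \<in> C'\<close>, symmetric])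
  finally show ?thesis .
qed

lemma block_joined:
  assumes C: "C \<in> blocks v" and u: "u \<in> C" "w \<in> C"
  shows "(\<exists>x. joined v x u w) \<longleftrightarrow> adj (xc u) (xc w)" "xen v (xc u) = xen v (xc w)"
proof -
  have v: "u \<in> vertices v" "w \<in> vertices v" using block_vertices[OF C] u by blast+
  have "C = (joined_rel v)\<^sup>* `` {u}" by (rule block_component[OF C u(1)])
  then show *: "xen v (xc u) = xen v (xc w)"
    using u(2) joined_rel_rtrancl(2)[OF _ v(1), of w] by simp
  show "(\<exists>x. joined v x u w) \<longleftrightarrow> adj (xc u) (xc w)"
    unfolding joined_iff using v * by blast
qed

lemma block_cluster:
  assumes C: "C \<in> blocks v"
  shows "cluster v (xc ` C)"
  unfolding cluster_def
proof (intro conjI ballI)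
  obtain u0 where u0: "u0 \<in> C" using block_nonempty[OF C] by blast
  then show "xc ` C \<noteq> {}" by blast
  show "xc ` C \<subseteq> xvertices v" using block_vertices[OF C] by (auto simp: xc_vertices)
  fix x y assume "x \<in> xc ` C" "y \<in> xc ` C"
  then obtain u w where uw: "u \<in> C" "w \<in> C" "x = xc u" "y = xc w" by blast
  show "xen v x = xen v y" using block_joined(2)[OF C uw(1,2)] uw by simp
  have Cu: "C = (joined_rel v)\<^sup>* `` {u}" by (rule block_component[OF C uw(1)])
  then have "(u, w) \<in> (joined_rel v)\<^sup>*" using uw by blast
  then have "(xc u, xc w) \<in> {(x, y). x \<in> xc ` C \<and> y \<in> xc ` C \<and> adj x y}\<^sup>*"
  proof (induction rule: rtrancl_induct)
    case (step y z)
    have "y \<in> C" "z \<in> C" using step.hyps Cu by (auto intro: rtrancl_into_rtrancl)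
    moreover have "adj (xc y) (xc z)" using step.hyps(2) by (simp only: joined_rel_iff)
    ultimately have "(xc y, xc z) \<in> {(x, y). x \<in> xc ` C \<and> y \<in> xc ` C \<and> adj x y}" by blast
    with step.IH show ?case by (rule rtrancl_into_rtrancl)
  qed simp
  then show "(x, y) \<in> {(x, y). x \<in> xc ` C \<and> y \<in> xc ` C \<and> adj x y}\<^sup>*" by (simp only: uw)
qed

lemma block_energy:
  assumes C: "C \<in> blocks v"
  shows "\<exists>K::int. \<forall>u\<in>C. energy v u = of_int K"
proof -
  obtain u0 where u0: "u0 \<in> C" using block_nonempty[OF C] by blast
  have "u0 \<in> vertices v" using block_vertices[OF C] u0 by blast
  then have "even (xen v (xc u0))" by (intro xen_even) (auto simp: xc_vertices xvertices_def)
  then obtain K where K: "xen v (xc u0) = 2 * K" by blast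
  have "energy v u = of_int K" if u: "u \<in> C" for u
  proof -
    have "eta (fst u) = -1" using block_vertices[OF C] u by (auto simp: xc_vertices)
    then show ?thesis using block_joined(2)[OF C u u0] by (simp add: energy_xen K)
  qed
  then show ?thesis by blast
qed

lemma joined_mark:
  assumes "joined v m u w"
  shows "snd m = (snd w = snd u)" "fst m = sg (snd w) *s (xc w - xc u)"
proof -
  have w: "fst w = fst m + sg (snd m) *s fst u" "snd w = (snd m = snd u)"
    using assms by (auto simp: joined_def gmult_def)
  then show "snd m = (snd w = snd u)" by auto
  have "sg (snd w) * sg (snd u) = sg (snd m)" using w(2) by (auto simp: sg_def)
  then have "sg (snd w) *s xc u = sg (snd m) *s fst u" by (simp add: xc_def vector_smult_assoc)
  moreover have "sg (snd w) *s xc w = fst w" by (simp add: xc_def vector_smult_assoc)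
  ultimately show "fst m = sg (snd w) *s (xc w - xc u)"
    using w(1) by (simp add: vector_ssub_ldistrib)
qed

text \<open>Conjugation by the diagonal matrix \<xi>^(-x/2). It turns \<xi>_k at a coordinate +1 of
  the root into one square root and supplies a square root at each coordinate -1, which together
  give \<open>mark_root\<close>.\<close>

lemma Qmat_block:
  assumes C: "C \<in> blocks v" and K: "\<And>u. u \<in> C \<Longrightarrow> energy v u = of_int K"
    and \<xi>: "\<And>i. \<xi> $ i \<noteq> 0" and u: "u \<in> C" "w \<in> C"
  defines "D \<equiv> \<lambda>x. \<Prod>k\<in>UNIV. csqrt (complex_of_real (\<xi> $ k)) powi (- (x $ k))"
  shows "Qmat v \<xi> u w = pmat (\<lambda>k. complex_of_real (\<xi> $ k)) (xc u) (xc w) * D (xc w) / D (xc u)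
           + (if u = w then of_int K else 0)"
proof -
  define \<rho> where "\<rho> k = csqrt (complex_of_real (\<xi> $ k))" for k
  have \<rho>: "complex_of_real (\<xi> $ k) = \<rho> k * \<rho> k" for k
    unfolding \<rho>_def power2_eq_square[symmetric] by (rule power2_csqrt[symmetric])
  have \<rho>0: "\<rho> k \<noteq> 0" for k using \<xi>[of k] by (simp add: \<rho>_def)
  have D0: "D x \<noteq> 0" for x unfolding D_def \<rho>_def[symmetric] using \<rho>0 by simp
  have etas: "eta (xc p) = - sg (snd p)" if "p \<in> C" for p
    using block_vertices[OF C] that by (auto simp: xc_vertices xc_def eta_scale)
  show ?thesis
  proof (cases "u = w")
    case True
    have "lform (xc u) \<xi> = of_int (sg (snd u)) * lform (fst u) \<xi>"
      by (simp add: lform_def xc_def sum_distrib_left mult.assoc)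
    then have "Qmat v \<xi> u w = of_int K - of_real (lform (xc u) \<xi>)"
      by (simp add: Qmat_def True[symmetric] K[OF u(1)])
    then show ?thesis using D0 by (simp add: True[symmetric] pmat_def lform_def)
  next
    case False
    then have x: "xc u \<noteq> xc w" using inj_onD[OF block_inj[OF C] _ u] by blast
    show ?thesis
    proof (cases "adj (xc u) (xc w)")
      case True
      then obtain m where m: "joined v m u w" using block_joined(1)[OF C u] by blast
      have the: "(THE x. joined v x u w) = m"
      proof (rule the_equality[where P = "\<lambda>x. joined v x u w"])
        fix x assume x: "joined v x u w"
        show "x = m"
          using joined_mark[OF x] joined_mark[OF m] by (simp add: prod_eq_iff)
      qed (rule m)
      let ?d = "xc w - xc u"
      have supp: "{i. fst m $ i \<noteq> 0} = {i. ?d $ i \<noteq> 0}"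
        unfolding joined_mark(2)[OF m] using sg_cases[of "snd w"] by auto
      obtain i j where ij: "i \<noteq> j" "pair_adj i j (xc u) (xc w)" using True unfolding adj_def by blast
      have fac: "(if ?d $ k = 1 then complex_of_real (\<xi> $ k) else 1) * \<rho> k powi (- (xc w $ k)) / \<rho> k powi (- (xc u $ k)) =
          (if ?d $ k \<noteq> 0 then \<rho> k else 1)" for k
      proof -
        have "?d $ k = -1 \<or> ?d $ k = 0 \<or> ?d $ k = 1"
          using pair_adj_odd(2)[OF ij(2,1), of k] by linarith
        moreover have "\<rho> k powi (- (xc w $ k)) / \<rho> k powi (- (xc u $ k)) = \<rho> k powi (- (?d $ k))"
          using \<rho>0[of k] power_int_diff[of "\<rho> k" "- (xc w $ k)" "- (xc u $ k)"] by simp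
        ultimately have "(if ?d $ k = 1 then \<rho> k * \<rho> k else 1) * (\<rho> k powi (- (xc w $ k)) / \<rho> k powi (- (xc u $ k))) =
            (if ?d $ k \<noteq> 0 then \<rho> k else 1)"
          using \<rho>0[of k] by (elim disjE) (simp_all only: minus_minus minus_zero power_int_minus, simp_all)
        then show ?thesis unfolding \<rho>[of k] by (simp only: times_divide_eq_right)
      qed
      have "(\<Prod>k | ?d $ k = 1. complex_of_real (\<xi> $ k)) * D (xc w) / D (xc u) =
          (\<Prod>k\<in>UNIV. (if ?d $ k = 1 then complex_of_real (\<xi> $ k) else 1) * \<rho> k powi (- (xc w $ k)) / \<rho> k powi (- (xc u $ k)))"
        unfolding D_def \<rho>_def[symmetric] prod_dividef prod.distrib by (simp add: prod.If_cases)
      also have "\<dots> = (\<Prod>k | ?d $ k \<noteq> 0. \<rho> k)" unfolding fac by (simp add: prod.If_cases)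
      also have "\<dots> = mark_root \<xi> m" by (simp add: mark_root_def supp \<rho>_def)
      finally have mr: "(\<Prod>k | ?d $ k = 1. complex_of_real (\<xi> $ k)) * D (xc w) / D (xc u) = mark_root \<xi> m" .
      have "Qmat v \<xi> u w = of_int (- 2 * eta (xc w)) * mark_root \<xi> m"
      proof -
        have "\<exists>x. joined v x u w" using m by (rule exI)
        then show ?thesis unfolding Qmat_def the if_not_P[OF False] by (simp only: if_True etas[OF u(2)]) simp
      qed
      also have "\<dots> = of_int (- 2 * eta (xc w)) * (\<Prod>k | ?d $ k = 1. complex_of_real (\<xi> $ k)) * D (xc w) / D (xc u)"
        unfolding mr[symmetric] by simp
      finally show ?thesis using False True x by (simp add: pmat_def)
    next
      case nadj: False
      then show ?thesis using False x block_joined(1)[OF C u] by (simp add: Qmat_def pmat_def)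
    qed
  qed
qed

lemma block_charpoly_pmat:
  assumes C: "C \<in> blocks v" "finite C" and K: "\<And>u. u \<in> C \<Longrightarrow> energy v u = of_int K"
    and \<xi>: "\<And>i. \<xi> $ i \<noteq> 0"
  shows "poly (block_charpoly v \<xi> C) (t + of_int K) =
    poly (leibniz_charpoly (xc ` C) (pmat (\<lambda>k. complex_of_real (\<xi> $ k)))) t"
proof -
  define D where "D x = (\<Prod>k\<in>UNIV. csqrt (complex_of_real (\<xi> $ k)) powi (- (x $ k)))" for x :: "int^'a"
  have D0: "D x \<noteq> 0" for x using \<xi> by (simp add: D_def)
  let ?P = "pmat (\<lambda>k. complex_of_real (\<xi> $ k))"
  have "block_charpoly v \<xi> C = leibniz_charpoly C (Qmat v \<xi>)"
    by (simp add: block_charpoly_def leibniz_charpoly_def)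
  also have "\<dots> = leibniz_charpoly C (\<lambda>u w. ?P (xc u) (xc w) * D (xc w) / D (xc u) + (if u = w then of_int K else 0))"
    by (rule leibniz_charpoly_cong) (use Qmat_block[OF C(1) K \<xi>] in \<open>simp only: D_def\<close>)
  finally have "poly (block_charpoly v \<xi> C) (t + of_int K) =
      poly (leibniz_charpoly C (\<lambda>u w. ?P (xc u) (xc w) * D (xc w) / D (xc u))) t"
    by (simp only: leibniz_charpoly_shift)
  also have "leibniz_charpoly C (\<lambda>u w. ?P (xc u) (xc w) * D (xc w) / D (xc u)) = leibniz_charpoly C (\<lambda>u w. ?P (xc u) (xc w))"
    by (rule leibniz_charpoly_similar[OF C(2), of "\<lambda>u. D (xc u)"]) (rule D0)
  also have "\<dots> = leibniz_charpoly (xc ` C) ?P"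
    using block_inj[OF C(1)] by (intro leibniz_charpoly_reindex[symmetric] C) (simp add: bij_betw_def)
  finally show ?thesis .
qed

lemma block_shape_translate:
  assumes X: "block_shape X" and b: "eta b = 0"
  shows "block_shape ((\<lambda>x. x + b) ` X)"
proof -
  let ?Y = "(\<lambda>x. x + b) ` X"
  have mem: "y \<in> ?Y \<longleftrightarrow> y - b \<in> X" for y by (auto simp: image_iff algebra_simps intro!: bexI[of _ "y - b"])
  note L = block_shapeD(1)[OF X]
  have L1: "local_shape ?Y"
    unfolding local_shape_def
  proof (intro conjI ballI allI impI)
    show "finite ?Y" using block_shapeD(3)[OF X] by simp
    show "eta x = 1 \<or> eta x = -1" if "x \<in> ?Y" for x
      using that local_shapeD(2)[OF L, of "x - b"] b unfolding mem by (simp add: eta_simps)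
    fix x w w' i j assume *: "x \<in> ?Y" "w \<in> ?Y" "w' \<in> ?Y" "i \<noteq> j" "pair_adj i j x w" "pair_adj i j x w'"
    have "pair_adj i j (x - b) (w - b)" "pair_adj i j (x - b) (w' - b)"
      using *(5,6) pair_adj_translate[OF b, of i j "x - b" "w - b"]
        pair_adj_translate[OF b, of i j "x - b" "w' - b"] by simp_all
    then have "w - b = w' - b"
      using L * unfolding local_shape_def mem by blast
    then show "w = w'" by simp
  qed
  have ne: "?Y \<noteq> {}" using block_shapeD(2)[OF X] by simp
  have "(x + b, y + b) \<in> {(x, y). x \<in> ?Y \<and> y \<in> ?Y \<and> adj x y}\<^sup>*" if "x \<in> X" "y \<in> X" for x y
    using block_shapeD(4)[OF X that]
  proof (induction rule: rtrancl_induct)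
    case (step y z)
    then have "(y + b, z + b) \<in> {(x, y). x \<in> ?Y \<and> y \<in> ?Y \<and> adj x y}" by (simp add: adj_translate[OF b])
    with step.IH show ?case by (rule rtrancl_into_rtrancl)
  qed simp
  then have conn: "\<forall>x\<in>?Y. \<forall>y\<in>?Y. (x, y) \<in> {(x, y). x \<in> ?Y \<and> y \<in> ?Y \<and> adj x y}\<^sup>*" by blast
  have black: "x = y" if "x \<in> ?Y" "y \<in> ?Y" "i \<noteq> j" "x + axis i 1 - axis j 1 \<in> ?Y" "y + axis i 1 - axis j 1 \<in> ?Y" for x y i j
  proof -
    have e: "x - b + axis i 1 - axis j 1 \<in> X" "y - b + axis i 1 - axis j 1 \<in> X"
      using that(4,5) unfolding mem by (simp_all add: algebra_simps)
    have "x - b = y - b"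
      using that(1,2) unfolding mem by (rule block_shapeD(5)[OF X _ _ that(3) e])
    then show ?thesis by simp
  qed
  have red: "x = y" if "x \<in> ?Y" "y \<in> ?Y" "i \<noteq> j" "eta x = -1" "eta y = -1"
    "x + axis i 1 + axis j 1 \<in> ?Y" "y + axis i 1 + axis j 1 \<in> ?Y" for x y i j
  proof -
    have c: "z - b + axis i 1 + axis j 1 = z + axis i 1 + axis j 1 - b" for z by (simp add: algebra_simps)
    have e: "x - b + axis i 1 + axis j 1 \<in> X" "y - b + axis i 1 + axis j 1 \<in> X"
      unfolding c using that(6,7) unfolding mem by simp_all
    have f: "eta (x - b) = -1" "eta (y - b) = -1" using that(4,5) b by (simp_all add: eta_simps(2))
    have "x - b = y - b"
      using that(1,2) unfolding mem by (rule block_shapeD(6)[OF X _ _ that(3) f e])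
    then show ?thesis by simp
  qed
  show ?thesis
    unfolding block_shape_def
  proof (intro conjI)
    show "\<forall>x\<in>?Y. \<forall>y\<in>?Y. \<forall>i j. i \<noteq> j \<longrightarrow> x + axis i 1 - axis j 1 \<in> ?Y \<longrightarrow> y + axis i 1 - axis j 1 \<in> ?Y \<longrightarrow> x = y"
      by (intro ballI allI impI) (rule black)
    show "\<forall>x\<in>?Y. \<forall>y\<in>?Y. \<forall>i j. i \<noteq> j \<longrightarrow> eta x = -1 \<longrightarrow> eta y = -1 \<longrightarrow>
        x + axis i 1 + axis j 1 \<in> ?Y \<longrightarrow> y + axis i 1 + axis j 1 \<in> ?Y \<longrightarrow> x = y"
      by (intro ballI allI impI) (rule red)
  qed (rule L1 ne conn)+
qed

subsection \<open>Root functions\<close>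

text \<open>The entries of the tuple need not be polynomial or continuous, only their power sums are
  polynomial. Symmetric expressions in roots can thus be handled with an arbitrary enumeration at
  every point.\<close>

definition psum :: "(real^'m::finite \<Rightarrow> nat \<Rightarrow> complex) \<Rightarrow> nat \<Rightarrow> bool" where
  "psum v n \<longleftrightarrow> (\<forall>k. cpoly_fun (\<lambda>\<xi>. \<Sum>s<n. v \<xi> s ^ k))"

lemma psum_roots:
  assumes fac: "\<And>\<xi>. p \<xi> = (\<Prod>s<n. [:- v \<xi> s, 1:])" and coef: "\<And>k. cpoly_fun (\<lambda>\<xi>. coeff (p \<xi>) k)"
  shows "psum v n"
  unfolding psum_def
proof
  fix k show "cpoly_fun (\<lambda>\<xi>. \<Sum>s<n. v \<xi> s ^ k)"
  proof (induction k rule: less_induct)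
    case (less k)
    show ?case
    proof (cases "k < n")
      case True
      have eq: "(\<lambda>\<xi>. \<Sum>s<n. v \<xi> s ^ k) = (\<lambda>\<xi>. of_nat (n - k) * coeff (p \<xi>) (n - k) -
          (\<Sum>l<k. coeff (p \<xi>) (n - k + l) * (\<Sum>s<n. v \<xi> s ^ l)))"
        unfolding fac by (rule ext) (rule newton_identity_low[OF True])
      show ?thesis
        unfolding eq
        by (intro cpoly_fun_diff cpoly_fun_mult cpoly_fun_const coef cpoly_fun_sum less) simp
    next
      case False
      then have nk: "n \<le> k" by simp
      have eq: "(\<lambda>\<xi>. \<Sum>s<n. v \<xi> s ^ k) = (\<lambda>\<xi>. - (\<Sum>l<n. coeff (p \<xi>) l * (\<Sum>s<n. v \<xi> s ^ (k - n + l))))"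
        unfolding fac by (rule ext) (rule newton_identity_high[OF nk])
      show ?thesis
        unfolding eq
        by (intro cpoly_fun_minus cpoly_fun_mult coef cpoly_fun_sum less) (use nk in simp)
    qed
  qed
qed

text \<open>The summand l = 0 of Newton's identity is N times the unknown coefficient; it is moved
  to the left-hand side so that the recursion can be solved.\<close>

lemma newton_identity:
  fixes a :: "nat \<Rightarrow> complex" and N :: nat
  defines "q \<equiv> (\<Prod>s<N. [:- a s, 1:])"
  assumes "0 < k" "k \<le> N"
  shows "coeff q (N - k) = - ((\<Sum>s<N. a s ^ k) + (\<Sum>l\<in>{1..<k}. coeff q (N - k + l) * (\<Sum>s<N. a s ^ l))) / of_nat k"
proof -
  let ?S = "\<Sum>l\<in>{1..<k}. coeff q (N - k + l) * (\<Sum>s<N. a s ^ l)"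
  have split: "(\<Sum>l<k. coeff q (N - k + l) * (\<Sum>s<N. a s ^ l)) = coeff q (N - k) * of_nat N + ?S"
  proof -
    have "{..<k} = insert 0 {1..<k}" using assms(2) by auto
    then show ?thesis by simp
  qed
  have "(\<Sum>s<N. a s ^ k) = of_nat (N - k) * coeff q (N - k) - (coeff q (N - k) * of_nat N + ?S)"
  proof (cases "k < N")
    case True
    then show ?thesis using newton_identity_low[OF True, of a] split by (simp add: q_def)
  next
    case False
    then have "k = N" using assms by simp
    then show ?thesis using newton_identity_high[of N N a] split by (simp add: q_def)
  qed
  moreover have "(of_nat (N - k) :: complex) = of_nat N - of_nat k" using assms(3) by simp
  ultimately show ?thesis using assms(2) by (simp add: field_simps)
qed

text \<open>Newton's identities recover the coefficients of the monic polynomial with these roots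
  from the power sums; up to sign the product is its constant coefficient.\<close>

lemma psum_prod:
  assumes "psum v n"
  shows "cpoly_fun (\<lambda>\<xi>. \<Prod>s<n. v \<xi> s)"
proof -
  define q where "q \<xi> = (\<Prod>s<n. [:- v \<xi> s, 1:])" for \<xi>
  have deg: "degree (q \<xi>) = n" for \<xi>
    unfolding q_def by (simp add: degree_prod_eq_sum_degree)
  have lead: "coeff (q \<xi>) n = 1" for \<xi>
  proof -
    have "lead_coeff (q \<xi>) = 1" unfolding q_def lead_coeff_prod by simp
    then show ?thesis unfolding deg .
  qed
  have "k \<le> n \<Longrightarrow> cpoly_fun (\<lambda>\<xi>. coeff (q \<xi>) (n - k))" for k
  proof (induction k rule: less_induct)
    case (less k)
    show ?case
    proof (cases "k = 0")
      case True
      have eq: "(\<lambda>\<xi>. coeff (q \<xi>) (n - k)) = (\<lambda>_. 1)" by (simp add: True lead)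
      show ?thesis unfolding eq by (rule cpoly_fun_const)
    next
      case False
      then have k: "0 < k" by simp
      have eq: "(\<lambda>\<xi>. coeff (q \<xi>) (n - k)) = (\<lambda>\<xi>. (- 1 / of_nat k) * ((\<Sum>s<n. v \<xi> s ^ k) +
          (\<Sum>l\<in>{1..<k}. coeff (q \<xi>) (n - (k - l)) * (\<Sum>s<n. v \<xi> s ^ l))))"
      proof (rule ext)
        fix \<xi>
        have "n - k + l = n - (k - l)" if "l \<in> {1..<k}" for l using that less.prems by simp
        then show "coeff (q \<xi>) (n - k) = (- 1 / of_nat k) * ((\<Sum>s<n. v \<xi> s ^ k) +
          (\<Sum>l\<in>{1..<k}. coeff (q \<xi>) (n - (k - l)) * (\<Sum>s<n. v \<xi> s ^ l)))"
          unfolding q_def by (subst newton_identity[OF k less.prems]) (simp add: diff_divide_distrib add_divide_distrib)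
      qed
      have ps: "cpoly_fun (\<lambda>\<xi>. \<Sum>s<n. v \<xi> s ^ l)" for l using assms unfolding psum_def by blast
      show ?thesis
        unfolding eq
        by (intro cpoly_fun_mult cpoly_fun_const cpoly_fun_add ps cpoly_fun_sum less.IH) (use less.prems in auto)
    qed
  qed
  from this[of n] have "cpoly_fun (\<lambda>\<xi>. coeff (q \<xi>) 0)" by simp
  moreover have "coeff (q \<xi>) 0 = (- 1) ^ n * (\<Prod>s<n. v \<xi> s)" for \<xi>
  proof -
    have "coeff (q \<xi>) 0 = poly (q \<xi>) 0" by (simp add: poly_0_coeff_0)
    also have "\<dots> = (\<Prod>s<n. - 1 * v \<xi> s)" by (simp add: q_def poly_prod)
    also have "\<dots> = (- 1) ^ n * (\<Prod>s<n. v \<xi> s)" unfolding prod.distrib by simp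
    finally show ?thesis .
  qed
  ultimately have "cpoly_fun (\<lambda>\<xi>. (- 1) ^ n * (\<Prod>s<n. v \<xi> s))" by simp
  then have "cpoly_fun (\<lambda>\<xi>. (- 1) ^ n * ((- 1) ^ n * (\<Prod>s<n. v \<xi> s)))"
    by (rule cpoly_fun_mult[OF cpoly_fun_const])
  then show ?thesis by (simp add: mult.assoc[symmetric] power_mult_distrib[symmetric])
qed

lemma sum_div_mod:
  fixes n m :: nat
  shows "(\<Sum>k<n * m. g (k div m) (k mod m)) = (\<Sum>s<n. \<Sum>t<m. g s t)"
proof (cases "m = 0")
  case False
  have "(\<Sum>s<n. \<Sum>t<m. g s t) = (\<Sum>(s, t)\<in>{..<n} \<times> {..<m}. g s t)" by (simp add: sum.cartesian_product)
  also have "\<dots> = (\<Sum>k<n * m. g (k div m) (k mod m))"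
  proof (rule sum.reindex_bij_witness[of _ "\<lambda>k. (k div m, k mod m)" "\<lambda>(s, t). s * m + t"])
    fix k assume k: "k \<in> {..<n * m}"
    then show "(k div m, k mod m) \<in> {..<n} \<times> {..<m}" using False by (simp add: less_mult_imp_div_less)
    show "(case (k div m, k mod m) of (s, t) \<Rightarrow> s * m + t) = k" by simp
  next
    fix x assume x: "x \<in> {..<n} \<times> {..<m}"
    obtain s t where st: "x = (s, t)" "s < n" "t < m" using x by blast
    have "s * m + t < Suc s * m" using st by simp
    also have "\<dots> \<le> n * m" using st by (intro mult_le_mono1) simp
    finally show "(case x of (s, t) \<Rightarrow> s * m + t) \<in> {..<n * m}" by (simp add: st)
    show "((case x of (s, t) \<Rightarrow> s * m + t) div m, (case x of (s, t) \<Rightarrow> s * m + t) mod m) = x"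
      using st by simp
    show "g ((case x of (s, t) \<Rightarrow> s * m + t) div m) ((case x of (s, t) \<Rightarrow> s * m + t) mod m) = (case x of (s, t) \<Rightarrow> g s t)"
      using st by simp
  qed
  finally show ?thesis ..
qed simp

text \<open>The single index runs through all pairs via \<open>div\<close> and \<open>mod\<close>.
  Expanding by the binomial theorem factors the double sums into products of power sums.\<close>

lemma psum_pair:
  assumes "psum v n" "psum w m" "cpoly_fun L"
  shows "psum (\<lambda>\<xi> k. \<alpha> * v \<xi> (k div m) + \<beta> * w \<xi> (k mod m) + L \<xi>) (n * m)"
  unfolding psum_def
proof
  fix k
  have eq: "(\<lambda>\<xi>. \<Sum>s<n * m. (\<alpha> * v \<xi> (s div m) + \<beta> * w \<xi> (s mod m) + L \<xi>) ^ k) =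
      (\<lambda>\<xi>. \<Sum>j\<le>k. of_nat (k choose j) * L \<xi> ^ (k - j) * (\<Sum>l\<le>j. of_nat (j choose l) * \<alpha> ^ l * \<beta> ^ (j - l) *
         ((\<Sum>s<n. v \<xi> s ^ l) * (\<Sum>t<m. w \<xi> t ^ (j - l)))))"
  proof (rule ext)
    fix \<xi>
    have "(\<Sum>s<n * m. (\<alpha> * v \<xi> (s div m) + \<beta> * w \<xi> (s mod m) + L \<xi>) ^ k) =
        (\<Sum>s<n. \<Sum>t<m. (\<alpha> * v \<xi> s + \<beta> * w \<xi> t + L \<xi>) ^ k)" by (rule sum_div_mod)
    also have "\<dots> = (\<Sum>s<n. \<Sum>t<m. \<Sum>j\<le>k. of_nat (k choose j) * L \<xi> ^ (k - j) *
        (\<Sum>l\<le>j. of_nat (j choose l) * \<alpha> ^ l * \<beta> ^ (j - l) * (v \<xi> s ^ l * w \<xi> t ^ (j - l))))"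
      unfolding binomial_ring[of "_ + _" "L \<xi>"] binomial_ring[of "\<alpha> * _" "\<beta> * _"] power_mult_distrib
      by (intro sum.cong refl) (simp add: sum_distrib_left sum_distrib_right mult_ac)
    also have "\<dots> = (\<Sum>j\<le>k. \<Sum>s<n. \<Sum>t<m. of_nat (k choose j) * L \<xi> ^ (k - j) *
        (\<Sum>l\<le>j. of_nat (j choose l) * \<alpha> ^ l * \<beta> ^ (j - l) * (v \<xi> s ^ l * w \<xi> t ^ (j - l))))"
      unfolding sum.swap[of _ "{..k}" "{..<m}"] unfolding sum.swap[of _ "{..k}" "{..<n}"] ..
    also have "\<dots> = (\<Sum>j\<le>k. of_nat (k choose j) * L \<xi> ^ (k - j) * (\<Sum>s<n. \<Sum>t<m.
        (\<Sum>l\<le>j. of_nat (j choose l) * \<alpha> ^ l * \<beta> ^ (j - l) * (v \<xi> s ^ l * w \<xi> t ^ (j - l)))))"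
      by (simp only: sum_distrib_left)
    also have "\<dots> = (\<Sum>j\<le>k. of_nat (k choose j) * L \<xi> ^ (k - j) * (\<Sum>l\<le>j. \<Sum>s<n. \<Sum>t<m.
        of_nat (j choose l) * \<alpha> ^ l * \<beta> ^ (j - l) * (v \<xi> s ^ l * w \<xi> t ^ (j - l))))"
      unfolding sum.swap[of _ "{.._}" "{..<m}"] unfolding sum.swap[of _ "{.._}" "{..<n}"] ..
    also have "\<dots> = (\<Sum>j\<le>k. of_nat (k choose j) * L \<xi> ^ (k - j) * (\<Sum>l\<le>j. of_nat (j choose l) * \<alpha> ^ l * \<beta> ^ (j - l) *
         ((\<Sum>s<n. v \<xi> s ^ l) * (\<Sum>t<m. w \<xi> t ^ (j - l)))))"
      unfolding sum_product by (simp only: sum_distrib_left)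
    finally show "(\<Sum>s<n * m. (\<alpha> * v \<xi> (s div m) + \<beta> * w \<xi> (s mod m) + L \<xi>) ^ k) =
       (\<Sum>j\<le>k. of_nat (k choose j) * L \<xi> ^ (k - j) * (\<Sum>l\<le>j. of_nat (j choose l) * \<alpha> ^ l * \<beta> ^ (j - l) *
         ((\<Sum>s<n. v \<xi> s ^ l) * (\<Sum>t<m. w \<xi> t ^ (j - l)))))" .
  qed
  have ps: "cpoly_fun (\<lambda>\<xi>. \<Sum>s<n. v \<xi> s ^ l)" "cpoly_fun (\<lambda>\<xi>. \<Sum>t<m. w \<xi> t ^ l)" for l
    using assms unfolding psum_def by blast+
  show "cpoly_fun (\<lambda>\<xi>. \<Sum>s<n * m. (\<alpha> * v \<xi> (s div m) + \<beta> * w \<xi> (s mod m) + L \<xi>) ^ k)"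
    unfolding eq
    by (rule ps cpoly_fun_mult cpoly_fun_const cpoly_fun_power assms(3) | rule cpoly_fun_sum)+
qed

lemma psum_hankel:
  assumes "psum v n"
  shows "cpoly_fun (\<lambda>\<xi>. hankel n (\<lambda>k. \<Sum>s<n. v \<xi> s ^ k))"
proof -
  have ps: "cpoly_fun (\<lambda>\<xi>. \<Sum>s<n. v \<xi> s ^ l)" for l using assms unfolding psum_def by blast
  show ?thesis
    unfolding hankel_def by (rule ps cpoly_fun_mult cpoly_fun_const cpoly_fun_prod | rule cpoly_fun_sum)+
qed

section \<open>Continuous enumeration of the roots\<close>

lemma strict_mono_self_map:
  fixes \<sigma> :: "nat \<Rightarrow> nat"
  assumes mono: "\<And>s t. s < t \<Longrightarrow> t < N \<Longrightarrow> \<sigma> s < \<sigma> t" and bound: "\<And>s. s < N \<Longrightarrow> \<sigma> s < N" and s: "s < N"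
  shows "\<sigma> s = s"
proof -
  have step: "\<sigma> s + j \<le> \<sigma> (s + j)" if "s + j < N" for s j
    using that
  proof (induction j)
    case (Suc j)
    then have "\<sigma> s + j \<le> \<sigma> (s + j)" by simp
    also have "\<dots> < \<sigma> (s + Suc j)" using Suc.prems by (intro mono) simp_all
    finally show ?case by simp
  qed simp
  have "\<sigma> s \<ge> s" using step[of 0 s] s by simp
  moreover have "\<sigma> s + (N - 1 - s) \<le> \<sigma> (N - 1)" using step[of s "N - 1 - s"] s by simp
  then have "\<sigma> s \<le> s" using bound[of "N - 1"] s by linarith
  ultimately show ?thesis by simp
qed

definition increasing_enum :: "nat \<Rightarrow> ('a \<Rightarrow> real) \<Rightarrow> 'a set \<Rightarrow> (nat \<Rightarrow> 'a) \<Rightarrow> bool" where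
  "increasing_enum N \<kappa> R g \<longleftrightarrow> bij_betw g {..<N} R \<and> (\<forall>s t. s < t \<longrightarrow> t < N \<longrightarrow> \<kappa> (g s) < \<kappa> (g t))"

lemma increasing_enum_exists:
  assumes "finite R" "inj_on \<kappa> R"
  shows "\<exists>g. increasing_enum (card R) \<kappa> R g"
proof -
  define L where "L = sorted_list_of_set (\<kappa> ` R)"
  have L: "sorted L" "distinct L" "set L = \<kappa> ` R" "length L = card R"
    using assms by (simp_all add: L_def card_image)
  define g where "g s = the_inv_into R \<kappa> (L ! s)" for s
  have "bij_betw (\<lambda>s. L ! s) {..<card R} (\<kappa> ` R)"
    using bij_betw_nth[OF L(2), of "{..<card R}" "\<kappa> ` R"] L by simp
  moreover have "bij_betw (the_inv_into R \<kappa>) (\<kappa> ` R) R"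
    using assms(2) by (intro bij_betw_the_inv_into) (simp add: bij_betw_def)
  ultimately have "bij_betw (the_inv_into R \<kappa> \<circ> (\<lambda>s. L ! s)) {..<card R} R" by (rule bij_betw_trans)
  moreover have "the_inv_into R \<kappa> \<circ> (\<lambda>s. L ! s) = g" by (simp add: fun_eq_iff g_def)
  moreover have "\<kappa> (g s) = L ! s" if "s < card R" for s
  proof -
    have "L ! s \<in> \<kappa> ` R" using that L by (metis nth_mem)
    then show ?thesis unfolding g_def by (rule f_the_inv_into_f[OF assms(2)])
  qed
  moreover have "L ! s < L ! t" if "s < t" "t < card R" for s t
  proof -
    have "L ! s \<le> L ! t" using that L(1,4) by (simp add: sorted_nth_mono)
    moreover have "L ! s \<noteq> L ! t" using that L(2,4) by (simp add: nth_eq_iff_index_eq)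
    ultimately show ?thesis by simp
  qed
  ultimately show ?thesis unfolding increasing_enum_def by (intro exI[of _ g]) simp
qed

lemma increasing_enum_unique:
  assumes g: "increasing_enum N \<kappa> R g" and h: "increasing_enum N \<kappa> R h" and s: "s < N"
  shows "g s = h s"
proof -
  have "\<exists>t<N. g s = h t" if "s < N" for s
  proof -
    have "g s \<in> h ` {..<N}" using g h that unfolding increasing_enum_def bij_betw_def by blast
    then show ?thesis by auto
  qed
  then obtain \<sigma> where \<sigma>: "\<And>s. s < N \<Longrightarrow> \<sigma> s < N" "\<And>s. s < N \<Longrightarrow> g s = h (\<sigma> s)" by metis
  have "\<sigma> s = s"
  proof (rule strict_mono_self_map[of N \<sigma>, OF _ \<sigma>(1) s])
    fix s t assume st: "s < t" "t < N"
    have "\<kappa> (g s) < \<kappa> (g t)" using g st unfolding increasing_enum_def by blast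
    then have "\<kappa> (h (\<sigma> s)) < \<kappa> (h (\<sigma> t))" using \<sigma>(2)[of s] \<sigma>(2)[of t] st by simp
    moreover have "\<kappa> (h (\<sigma> t)) \<le> \<kappa> (h (\<sigma> s))" if "\<sigma> t \<le> \<sigma> s"
      using that h \<sigma>(1)[of s] st unfolding increasing_enum_def by (cases "\<sigma> t = \<sigma> s") (auto intro: less_imp_le)
    ultimately show "\<sigma> s < \<sigma> t" by linarith
  qed
  then show ?thesis using \<sigma>(2)[OF s] by simp
qed


text \<open>The roots are enumerated in the order of \<open>\<plusminus>Re (\<omega> z)\<close> for a generic \<open>\<omega>\<close>. Since the set of roots
  is closed under conjugation, these values are distinct if the numbers \<open>\<omega> a + cnj \<omega> b\<close> for roots
  \<open>a, b\<close> are. The sign is that of one of the parameters; it makes the enumeration compatible with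
  negative scalars.\<close>

definition good_roots :: "complex \<Rightarrow> nat \<Rightarrow> complex set \<Rightarrow> bool" where
  "good_roots \<omega> N R \<longleftrightarrow> finite R \<and> card R = N \<and>
     (\<forall>a\<in>R. \<forall>b\<in>R. \<forall>a'\<in>R. \<forall>b'\<in>R. \<omega> * a + cnj \<omega> * b = \<omega> * a' + cnj \<omega> * b' \<longrightarrow> a = a' \<and> b = b')"

lemma good_roots_exists:
  assumes "finite R"
  shows "\<exists>\<omega>. good_roots \<omega> (card R) R"
proof -
  \<comment> \<open>For \<omega> = 1 + i y, two pairs collide either for exactly one complex value
    of y, whose real part is collected here, or only if the pairs are equal.\<close>
  define bad where "bad = (\<lambda>(a, b, a', b'). Re (\<i> * (a + b - a' - b') / (a - b - a' + b'))) ` (R \<times> R \<times> R \<times> R)"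
  have "finite bad" unfolding bad_def using assms by (intro finite_imageI finite_cartesian_product)
  then obtain y where y: "y \<notin> bad" using ex_new_if_finite[OF infinite_UNIV_char_0] by blast
  define \<omega> where "\<omega> = 1 + \<i> * complex_of_real y"
  have "a = a' \<and> b = b'"
    if R: "a \<in> R" "b \<in> R" "a' \<in> R" "b' \<in> R" and eq: "\<omega> * a + cnj \<omega> * b = \<omega> * a' + cnj \<omega> * b'" for a b a' b'
  proof -
    have *: "(a + b - a' - b') + \<i> * complex_of_real y * (a - b - a' + b') = 0"
      using eq by (simp add: \<omega>_def algebra_simps)
    have D: "a - b - a' + b' = 0"
    proof (rule ccontr)
      assume D: "a - b - a' + b' \<noteq> 0"
      have "\<i> * (a + b - a' - b') = complex_of_real y * (a - b - a' + b')"
      proof -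
        have "a + b - a' - b' = - (\<i> * complex_of_real y * (a - b - a' + b'))" using * by (simp add: eq_neg_iff_add_eq_0)
        then show ?thesis by (simp add: mult.assoc)
      qed
      then have "\<i> * (a + b - a' - b') / (a - b - a' + b') = complex_of_real y" using D by (simp add: divide_eq_eq)
      then have "y = Re (\<i> * (a + b - a' - b') / (a - b - a' + b'))" by simp
      then have "y \<in> bad" unfolding bad_def using R by (intro image_eqI[of _ _ "(a, b, a', b')"]) simp_all
      then show False using y by simp
    qed
    then have S: "a + b - a' - b' = 0" using * by simp
    have "2 * (a - a') = (a + b - a' - b') + (a - b - a' + b')" "2 * (b - b') = (a + b - a' - b') - (a - b - a' + b')"
      by simp_all
    then show ?thesis unfolding S D by simp
  qed
  then show ?thesis using assms unfolding good_roots_def by blast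
qed

definition root_key :: "complex \<Rightarrow> real \<Rightarrow> complex \<Rightarrow> real" where
  "root_key \<omega> c z = sgn c * Re (\<omega> * z)"

text \<open>2 Re(\<omega> z) is \<omega> z plus its conjugate, and the conjugate of z is a root too,
  so \<open>good_roots\<close> applies to the pair of z and its conjugate.\<close>

lemma root_key_inj:
  assumes good: "good_roots \<omega> N R" and R: "\<And>z. z \<in> R \<Longrightarrow> cnj z \<in> R" and c: "c \<noteq> 0"
  shows "inj_on (root_key \<omega> c) R"
proof (rule inj_onI)
  fix z z' assume z: "z \<in> R" "z' \<in> R" "root_key \<omega> c z = root_key \<omega> c z'"
  have "Re (\<omega> * z) = Re (\<omega> * z')" using z(3) c by (simp add: root_key_def sgn_eq_0_iff)
  then have "\<omega> * z + cnj (\<omega> * z) = \<omega> * z' + cnj (\<omega> * z')" by (simp only: complex_add_cnj)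
  then have "\<omega> * z + cnj \<omega> * cnj z = \<omega> * z' + cnj \<omega> * cnj z'" by (simp only: complex_cnj_mult)
  then show "z = z'" using good R z unfolding good_roots_def by blast
qed

text \<open>The N^2 combinations of pairs of roots have polynomial power sums by
  \<open>psum_pair\<close>. Their Hankel determinant is therefore polynomial, and it is nonzero
  exactly when they are distinct.\<close>

lemma good_roots_discriminant:
  assumes a: "psum a N" and fac: "\<And>\<xi>. p \<xi> = (\<Prod>s<N. [:- a \<xi> s, 1:])" and N: "N > 0"
  shows "\<exists>f. cpoly_fun f \<and> (\<forall>\<xi>. f \<xi> \<noteq> 0 \<longleftrightarrow> good_roots \<omega> N {t. poly (p \<xi>) t = 0})"
proof -
  define w where "w \<xi> k = \<omega> * a \<xi> (k div N) + cnj \<omega> * a \<xi> (k mod N) + 0" for \<xi> k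
  define f where "f \<xi> = hankel (N * N) (\<lambda>k. \<Sum>s<N * N. w \<xi> s ^ k)" for \<xi>
  have "psum w (N * N)" unfolding w_def[abs_def] by (rule psum_pair[OF a a cpoly_fun_const])
  then have "cpoly_fun f" unfolding f_def[abs_def] by (rule psum_hankel)
  moreover have "f \<xi> \<noteq> 0 \<longleftrightarrow> good_roots \<omega> N {t. poly (p \<xi>) t = 0}" for \<xi>
  proof -
    let ?R = "{t. poly (p \<xi>) t = 0}"
    have R: "?R = a \<xi> ` {..<N}" unfolding fac by (auto simp: poly_prod)
    have idx: "s * N + t < N * N" "(s * N + t) div N = s" "(s * N + t) mod N = t" if "s < N" "t < N" for s t
    proof -
      have "s * N + t < Suc s * N" using that by simp
      also have "\<dots> \<le> N * N" using that by (intro mult_le_mono1) simp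
      finally show "s * N + t < N * N" .
    qed (use that in simp_all)
    have "inj_on (w \<xi>) {..<N * N} \<longleftrightarrow> good_roots \<omega> N ?R"
    proof
      assume inj: "inj_on (w \<xi>) {..<N * N}"
      have pair: "s = s' \<and> t = t'" if "s < N" "t < N" "s' < N" "t' < N"
        "\<omega> * a \<xi> s + cnj \<omega> * a \<xi> t = \<omega> * a \<xi> s' + cnj \<omega> * a \<xi> t'" for s t s' t'
      proof -
        have "w \<xi> (s * N + t) = w \<xi> (s' * N + t')" using that by (simp add: w_def idx)
        then have "s * N + t = s' * N + t'" using inj idx(1) that by (auto dest: inj_onD)
        then show ?thesis using idx(2,3) that by metis
      qed
      have "inj_on (a \<xi>) {..<N}" by (rule inj_onI) (use pair in \<open>metis lessThan_iff\<close>)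
      then have "card ?R = N" unfolding R by (simp add: card_image)
      moreover have "finite ?R" unfolding R by simp
      ultimately show "good_roots \<omega> N ?R"
        unfolding good_roots_def R using pair by auto
    next
      assume good: "good_roots \<omega> N ?R"
      then have inj: "inj_on (a \<xi>) {..<N}" unfolding good_roots_def R by (simp add: eq_card_imp_inj_on)
      show "inj_on (w \<xi>) {..<N * N}"
      proof (rule inj_onI)
        fix k k' assume k: "k \<in> {..<N * N}" "k' \<in> {..<N * N}" "w \<xi> k = w \<xi> k'"
        have d: "k div N < N" "k mod N < N" "k' div N < N" "k' mod N < N"
          using k N by (simp_all add: less_mult_imp_div_less)
        then have mem: "a \<xi> (k div N) \<in> ?R" "a \<xi> (k mod N) \<in> ?R" "a \<xi> (k' div N) \<in> ?R" "a \<xi> (k' mod N) \<in> ?R"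
          unfolding R by simp_all
        have "\<omega> * a \<xi> (k div N) + cnj \<omega> * a \<xi> (k mod N) = \<omega> * a \<xi> (k' div N) + cnj \<omega> * a \<xi> (k' mod N)"
          using k(3) by (simp add: w_def)
        then have "a \<xi> (k div N) = a \<xi> (k' div N) \<and> a \<xi> (k mod N) = a \<xi> (k' mod N)"
          by (rule good[unfolded good_roots_def, THEN conjunct2, THEN conjunct2, rule_format, OF mem])
        then have "k div N = k' div N" "k mod N = k' mod N" using inj d by (auto dest: inj_onD)
        then show "k = k'" by (metis div_mult_mod_eq)
      qed
    qed
    then show ?thesis unfolding f_def hankel_power_sums .
  qed
  ultimately show ?thesis by blast
qed

text \<open>Off the zero set of the discriminant the keys of the roots are distinct, so the s-th
  root in increasing order is well defined. Near a given parameter there is a root close to each old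
  root, and the order is preserved. Multiplying \<xi> by c multiplies the keys by |c|, since the
  sign of \<xi>_i0 enters them.\<close>

lemma continuous_root_functions:
  fixes p :: "real^'m::finite \<Rightarrow> complex poly" and i0 :: 'm
  assumes N: "N > 0" and fac: "\<And>\<xi>. \<exists>a. p \<xi> = (\<Prod>s<N. [:- a s, 1:])"
    and coef: "\<And>k. cpoly_fun (\<lambda>\<xi>. coeff (p \<xi>) k)" and real_coef: "\<And>k \<xi>. coeff (p \<xi>) k \<in> \<real>"
    and hom: "\<And>\<xi> c t. c \<noteq> 0 \<Longrightarrow> poly (p \<xi>) t = 0 \<Longrightarrow> poly (p (c *\<^sub>R \<xi>)) (of_real c * t) = 0"
    and simple: "card {t. poly (p \<xi>0) t = 0} = N"
  shows "\<exists>f r. cpoly_fun f \<and> f \<xi>0 \<noteq> 0 \<and> (\<forall>\<xi> c. c \<noteq> 0 \<longrightarrow> f \<xi> \<noteq> 0 \<longrightarrow> f (c *\<^sub>R \<xi>) \<noteq> 0) \<and>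
    (\<forall>\<xi>. f \<xi> \<noteq> 0 \<longrightarrow> \<xi> $ i0 \<noteq> 0 \<longrightarrow> bij_betw (\<lambda>s. r s \<xi>) {..<N} {t. poly (p \<xi>) t = 0} \<and> p \<xi> = (\<Prod>s<N. [:- r s \<xi>, 1:])) \<and>
    (\<forall>s<N. continuous_on {\<xi>. f \<xi> \<noteq> 0 \<and> \<xi> $ i0 \<noteq> 0} (r s)) \<and>
    (\<forall>s<N. \<forall>\<xi> c. c \<noteq> 0 \<longrightarrow> f \<xi> \<noteq> 0 \<longrightarrow> \<xi> $ i0 \<noteq> 0 \<longrightarrow> r s (c *\<^sub>R \<xi>) = of_real c * r s \<xi>)"
proof -
  define R where "R \<xi> = {t. poly (p \<xi>) t = 0}" for \<xi>
  obtain a where a: "\<And>\<xi>. p \<xi> = (\<Prod>s<N. [:- a \<xi> s, 1:])" using fac by metis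
  have Ra: "R \<xi> = a \<xi> ` {..<N}" for \<xi> unfolding R_def a by (auto simp: poly_prod)
  have finR: "finite (R \<xi>)" for \<xi> unfolding Ra by simp
  have degp: "degree (p \<xi>) = N" for \<xi> unfolding a by (simp add: degree_prod_eq_sum_degree)
  have poly_sum: "poly (p \<xi>) z = (\<Sum>k\<le>N. coeff (p \<xi>) k * z ^ k)" for \<xi> z
    by (simp add: poly_altdef degp)
  have cnjR: "cnj z \<in> R \<xi>" if "z \<in> R \<xi>" for z \<xi>
  proof -
    have "cnj (coeff (p \<xi>) k) = coeff (p \<xi>) k" for k using real_coef[of \<xi> k] by (simp add: Reals_cnj_iff)
    then have "poly (p \<xi>) (cnj z) = cnj (poly (p \<xi>) z)" by (simp add: poly_sum)
    then show ?thesis using that by (simp add: R_def)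
  qed
  obtain \<omega> where \<omega>: "good_roots \<omega> N (R \<xi>0)" using good_roots_exists[OF finR[of \<xi>0]] simple unfolding R_def by auto
  obtain f where f: "cpoly_fun f" "\<And>\<xi>. f \<xi> \<noteq> 0 \<longleftrightarrow> good_roots \<omega> N (R \<xi>)"
    using good_roots_discriminant[OF psum_roots[OF a coef] a N, of \<omega>] unfolding R_def by blast
  have scaleR: "R (c *\<^sub>R \<xi>) = (\<lambda>t. of_real c * t) ` R \<xi>" if c: "c \<noteq> 0" for c \<xi>
  proof
    show "(\<lambda>t. of_real c * t) ` R \<xi> \<subseteq> R (c *\<^sub>R \<xi>)" using hom[OF c] by (auto simp: R_def)
    show "R (c *\<^sub>R \<xi>) \<subseteq> (\<lambda>t. of_real c * t) ` R \<xi>"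
    proof
      fix t assume "t \<in> R (c *\<^sub>R \<xi>)"
      then have "poly (p ((1 / c) *\<^sub>R (c *\<^sub>R \<xi>))) (of_real (1 / c) * t) = 0"
        using c by (intro hom) (simp_all add: R_def)
      then have "of_real (1 / c) * t \<in> R \<xi>" using c by (simp add: R_def)
      then show "t \<in> (\<lambda>t. of_real c * t) ` R \<xi>" using c by (intro image_eqI[of _ _ "of_real (1 / c) * t"]) simp_all
    qed
  qed
  have good_scale: "good_roots \<omega> N (R (c *\<^sub>R \<xi>))" if c: "c \<noteq> 0" and g: "good_roots \<omega> N (R \<xi>)" for c \<xi>
  proof -
    have inj: "inj_on (\<lambda>t. complex_of_real c * t) (R \<xi>)" using c by (intro inj_onI) simp
    have "x = x' \<and> y = y'" if R: "x \<in> R \<xi>" "y \<in> R \<xi>" "x' \<in> R \<xi>" "y' \<in> R \<xi>"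
      and eq: "\<omega> * (of_real c * x) + cnj \<omega> * (of_real c * y) = \<omega> * (of_real c * x') + cnj \<omega> * (of_real c * y')" for x y x' y'
    proof -
      have "of_real c * (\<omega> * x + cnj \<omega> * y) = of_real c * (\<omega> * x' + cnj \<omega> * y')"
        using eq by (simp only: distrib_left mult.left_commute)
      then have "\<omega> * x + cnj \<omega> * y = \<omega> * x' + cnj \<omega> * y'" using c by simp
      then show ?thesis by (rule g[unfolded good_roots_def, THEN conjunct2, THEN conjunct2, rule_format, OF R])
    qed
    then have "\<forall>A\<in>R (c *\<^sub>R \<xi>). \<forall>B\<in>R (c *\<^sub>R \<xi>). \<forall>A'\<in>R (c *\<^sub>R \<xi>). \<forall>B'\<in>R (c *\<^sub>R \<xi>).
        \<omega> * A + cnj \<omega> * B = \<omega> * A' + cnj \<omega> * B' \<longrightarrow> A = A' \<and> B = B'"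
      unfolding scaleR[OF c] by blast
    moreover have "card (R (c *\<^sub>R \<xi>)) = N"
      unfolding scaleR[OF c] card_image[OF inj] using g by (simp only: good_roots_def)
    ultimately show ?thesis unfolding good_roots_def using finR by blast
  qed
  define \<kappa> where "\<kappa> \<xi> = root_key \<omega> (\<xi> $ i0)" for \<xi> :: "real^'m"
  define r where "r s \<xi> = (SOME g. increasing_enum N (\<kappa> \<xi>) (R \<xi>) g) s" for s \<xi>
  have r: "increasing_enum N (\<kappa> \<xi>) (R \<xi>) (\<lambda>s. r s \<xi>)" if "f \<xi> \<noteq> 0" "\<xi> $ i0 \<noteq> 0" for \<xi>
  proof -
    have g: "good_roots \<omega> N (R \<xi>)" using that f(2) by blast
    then have "card (R \<xi>) = N" by (simp add: good_roots_def)
    then have "\<exists>g. increasing_enum N (\<kappa> \<xi>) (R \<xi>) g"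
      using increasing_enum_exists[OF finR[of \<xi>] root_key_inj[OF g cnjR that(2)]] by (simp add: \<kappa>_def)
    then show ?thesis unfolding r_def by (rule someI_ex)
  qed
  have bij: "bij_betw (\<lambda>s. r s \<xi>) {..<N} (R \<xi>)" if "f \<xi> \<noteq> 0" "\<xi> $ i0 \<noteq> 0" for \<xi>
    using r[OF that] by (simp add: increasing_enum_def)
  have rprod: "p \<xi> = (\<Prod>s<N. [:- r s \<xi>, 1:])" if "f \<xi> \<noteq> 0" "\<xi> $ i0 \<noteq> 0" for \<xi>
  proof -
    have "card (R \<xi>) = N" using that f(2) by (simp add: good_roots_def)
    then have "inj_on (a \<xi>) {..<N}" unfolding Ra by (simp add: eq_card_imp_inj_on)
    then have "p \<xi> = (\<Prod>z\<in>R \<xi>. [:- z, 1:])" unfolding Ra a by (simp add: prod.reindex)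
    also have "\<dots> = (\<Prod>s<N. [:- r s \<xi>, 1:])" 
      by (rule prod.reindex_bij_betw[OF bij[OF that], symmetric])
    finally show ?thesis .
  qed
  have rhom: "r s (c *\<^sub>R \<xi>) = of_real c * r s \<xi>" if "s < N" "c \<noteq> 0" "f \<xi> \<noteq> 0" "\<xi> $ i0 \<noteq> 0" for s c \<xi>
  proof (rule increasing_enum_unique[OF _ _ that(1)])
    show "increasing_enum N (\<kappa> (c *\<^sub>R \<xi>)) (R (c *\<^sub>R \<xi>)) (\<lambda>s. r s (c *\<^sub>R \<xi>))"
      using that f(2) good_scale by (intro r) auto
    have "bij_betw (\<lambda>t. complex_of_real c * t) (R \<xi>) (R (c *\<^sub>R \<xi>))"
      unfolding scaleR[OF that(2)] bij_betw_def using that(2) by (simp add: inj_on_def)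
    then have "bij_betw ((\<lambda>t. complex_of_real c * t) \<circ> (\<lambda>s. r s \<xi>)) {..<N} (R (c *\<^sub>R \<xi>))"
      by (rule bij_betw_trans[OF bij[OF that(3,4)]])
    moreover have "\<kappa> (c *\<^sub>R \<xi>) (complex_of_real c * z) = \<bar>c\<bar> * \<kappa> \<xi> z" for z
    proof -
      have "Re (\<omega> * (complex_of_real c * z)) = c * Re (\<omega> * z)" by (simp add: algebra_simps)
      moreover have "sgn c * c = \<bar>c\<bar>" by (simp add: sgn_if)
      ultimately show ?thesis by (simp add: \<kappa>_def root_key_def sgn_mult mult_ac)
    qed
    ultimately show "increasing_enum N (\<kappa> (c *\<^sub>R \<xi>)) (R (c *\<^sub>R \<xi>)) (\<lambda>s. of_real c * r s \<xi>)"
      using r[OF that(3,4)] that(2) by (simp add: increasing_enum_def o_def)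
  qed
  have cont: "continuous_on {\<xi>. f \<xi> \<noteq> 0 \<and> \<xi> $ i0 \<noteq> 0} (r s)" if s: "s < N" for s
    unfolding continuous_on_def
  proof (intro ballI tendstoI)
    fix \<xi>1 :: "real^'m" and e :: real
    assume \<xi>1: "\<xi>1 \<in> {\<xi>. f \<xi> \<noteq> 0 \<and> \<xi> $ i0 \<noteq> 0}" and e: "e > 0"
    let ?U = "{\<xi>. f \<xi> \<noteq> 0 \<and> \<xi> $ i0 \<noteq> 0}"
    \<comment> \<open>Choose \<eta> below \<open>e\<close> and so small that moving each root at
      \<xi>1 by less than \<eta>, which moves its key by at most |\<omega>| \<eta>, cannot change
      the order.\<close>
    define z where "z t = r t \<xi>1" for t
    define S where "S = sgn (\<xi>1 $ i0)"
    have zinc: "S * Re (\<omega> * z t) < S * Re (\<omega> * z u)" if "t < u" "u < N" for t u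
      using r[of \<xi>1] \<xi>1 that by (simp add: increasing_enum_def \<kappa>_def root_key_def z_def S_def)
    have "\<forall>\<^sub>F \<eta> in at_right 0. \<forall>t\<in>{..<N}. \<forall>u\<in>{..<N}. t < u \<longrightarrow> 2 * norm \<omega> * \<eta> < S * Re (\<omega> * z u) - S * Re (\<omega> * z t)"
    proof (intro eventually_ball_finite finite_lessThan ballI)
      fix t u assume "t \<in> {..<N}" "u \<in> {..<N}"
      show "\<forall>\<^sub>F \<eta> in at_right 0. t < u \<longrightarrow> 2 * norm \<omega> * \<eta> < S * Re (\<omega> * z u) - S * Re (\<omega> * z t)"
      proof (cases "t < u")
        case True
        have "((\<lambda>\<eta>::real. 2 * norm \<omega> * \<eta>) \<longlongrightarrow> 2 * norm \<omega> * 0) (at_right 0)"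
          by (intro tendsto_mult tendsto_const tendsto_ident_at)
        then have "\<forall>\<^sub>F \<eta> in at_right 0. 2 * norm \<omega> * \<eta> < S * Re (\<omega> * z u) - S * Re (\<omega> * z t)"
          using zinc[OF True] \<open>u \<in> {..<N}\<close> by (intro order_tendstoD(2)) auto
        then show ?thesis by (rule eventually_mono) simp
      qed simp
    qed
    moreover have "\<forall>\<^sub>F \<eta> in at_right 0. \<eta> < e" by (rule eventually_at_rightI[of 0 e]) (use e in simp_all)
    moreover have "\<forall>\<^sub>F \<eta> in at_right 0. (0::real) < \<eta>" by (simp add: eventually_at_right_less)
    ultimately have "\<forall>\<^sub>F \<eta> in at_right 0. 0 < \<eta> \<and> \<eta> < e \<and>
        (\<forall>t\<in>{..<N}. \<forall>u\<in>{..<N}. t < u \<longrightarrow> 2 * norm \<omega> * \<eta> < S * Re (\<omega> * z u) - S * Re (\<omega> * z t))"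
      by eventually_elim blast
    then have "\<exists>\<eta>. 0 < \<eta> \<and> \<eta> < e \<and>
        (\<forall>t\<in>{..<N}. \<forall>u\<in>{..<N}. t < u \<longrightarrow> 2 * norm \<omega> * \<eta> < S * Re (\<omega> * z u) - S * Re (\<omega> * z t))"
      by (rule eventually_happens'[rotated]) simp
    then obtain \<eta> where \<eta>: "0 < \<eta>" "\<eta> < e"
      and gap: "\<forall>t\<in>{..<N}. \<forall>u\<in>{..<N}. t < u \<longrightarrow> 2 * norm \<omega> * \<eta> < S * Re (\<omega> * z u) - S * Re (\<omega> * z t)"
      by (elim exE conjE)
    have gap: "2 * norm \<omega> * \<eta> < S * Re (\<omega> * z u) - S * Re (\<omega> * z t)" if "t < u" "u < N" for t u
      using gap that by (meson lessThan_iff less_trans)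
    \<comment> \<open>Near \<xi>1 the polynomial is smaller than \<eta>^N at each of the old roots,
      and \<xi>_i0 keeps its sign.\<close>
    let ?F = "at \<xi>1 within ?U"
    have "\<forall>\<^sub>F \<xi> in ?F. \<forall>t\<in>{..<N}. norm (poly (p \<xi>) (z t)) < \<eta> ^ N"
    proof (intro eventually_ball_finite finite_lessThan ballI)
      fix t assume t: "t \<in> {..<N}"
      have "((\<lambda>\<xi>. coeff (p \<xi>) k) \<longlongrightarrow> coeff (p \<xi>1) k) ?F" for k
        using cpoly_fun_continuous[OF coef[of k], of ?U] \<xi>1 unfolding continuous_on_def by blast
      then have "((\<lambda>\<xi>. poly (p \<xi>) (z t)) \<longlongrightarrow> poly (p \<xi>1) (z t)) ?F"
        unfolding poly_sum by (intro tendsto_sum tendsto_mult tendsto_const)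
      moreover have "poly (p \<xi>1) (z t) = 0"
        using bij_betwE[OF bij[of \<xi>1]] \<xi>1 t by (simp add: z_def R_def)
      ultimately have "((\<lambda>\<xi>. norm (poly (p \<xi>) (z t))) \<longlongrightarrow> 0) ?F" by (simp add: tendsto_norm_zero_iff)
      then show "\<forall>\<^sub>F \<xi> in ?F. norm (poly (p \<xi>) (z t)) < \<eta> ^ N" 
        by (rule order_tendstoD(2)) (rule zero_less_power[OF \<eta>(1)])
    qed
    moreover have "\<forall>\<^sub>F \<xi> in ?F. sgn (\<xi> $ i0) = S"
    proof -
      have lim: "((\<lambda>\<xi>. \<xi> $ i0) \<longlongrightarrow> \<xi>1 $ i0) ?F" by (intro tendsto_intros)
      show ?thesis
      proof (cases "\<xi>1 $ i0 > 0")
        case True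
        then have "\<forall>\<^sub>F \<xi> in ?F. \<xi> $ i0 > 0" by (rule order_tendstoD(1)[OF lim])
        then show ?thesis by (rule eventually_mono) (use True in \<open>simp add: S_def\<close>)
      next
        case False
        then have neg: "\<xi>1 $ i0 < 0" using \<xi>1 by simp
        then have "\<forall>\<^sub>F \<xi> in ?F. \<xi> $ i0 < 0" by (rule order_tendstoD(2)[OF lim])
        then show ?thesis by (rule eventually_mono) (use neg in \<open>simp add: S_def\<close>)
      qed
    qed
    moreover have "\<forall>\<^sub>F \<xi> in ?F. \<xi> \<in> ?U" by (simp add: eventually_at_filter)
    ultimately show "\<forall>\<^sub>F \<xi> in ?F. dist (r s \<xi>) (r s \<xi>1) < e"
    proof eventually_elim
      case (elim \<xi>)
      then have U: "f \<xi> \<noteq> 0" "\<xi> $ i0 \<noteq> 0" by simp_all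
      \<comment> \<open>The modulus of p at z_t is the product of the distances from z_t to the N
        roots, so one of them is below \<eta>.\<close>
      have "\<exists>u<N. norm (z t - r u \<xi>) < \<eta>" if t: "t < N" for t
      proof (rule ccontr)
        assume "\<not> ?thesis"
        then have ge: "\<eta> \<le> norm (z t - r u \<xi>)" if "u < N" for u using that by (meson not_le)
        have "\<eta> ^ N = (\<Prod>u<N. \<eta>)" by simp
        also have "\<dots> \<le> (\<Prod>u<N. norm (z t - r u \<xi>))" by (rule prod_mono) (use ge \<eta>(1) in auto)
        also have "\<dots> = norm (poly (p \<xi>) (z t))" unfolding rprod[OF U] by (simp add: poly_prod prod_norm)
        finally show False using elim(1) t by (auto simp: not_less[symmetric])
      qed
      then obtain \<sigma> where \<sigma>: "\<And>t. t < N \<Longrightarrow> \<sigma> t < N" "\<And>t. t < N \<Longrightarrow> norm (z t - r (\<sigma> t) \<xi>) < \<eta>" by metis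
      have near: "\<bar>S * Re (\<omega> * r (\<sigma> t) \<xi>) - S * Re (\<omega> * z t)\<bar> \<le> norm \<omega> * \<eta>" if t: "t < N" for t
      proof -
        have S1: "\<bar>S\<bar> \<le> 1" by (simp add: S_def sgn_if)
        have "\<bar>S * Re (\<omega> * r (\<sigma> t) \<xi>) - S * Re (\<omega> * z t)\<bar> = \<bar>S\<bar> * \<bar>Re (\<omega> * (r (\<sigma> t) \<xi> - z t))\<bar>"
          by (simp add: abs_mult[symmetric] algebra_simps)
        also have "\<dots> \<le> 1 * norm (\<omega> * (r (\<sigma> t) \<xi> - z t))"
          by (rule mult_mono[OF S1 abs_Re_le_cmod]) simp_all
        also have "\<dots> = norm \<omega> * norm (z t - r (\<sigma> t) \<xi>)" by (simp add: norm_mult norm_minus_commute)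
        also have "\<dots> \<le> norm \<omega> * \<eta>" using \<sigma>(2)[OF t] by (intro mult_left_mono) simp_all
        finally show ?thesis .
      qed
      have inc: "S * Re (\<omega> * r t \<xi>) \<le> S * Re (\<omega> * r u \<xi>)" if "t \<le> u" "u < N" for t u
        using r[OF U] that elim(2) by (cases "t = u") (auto simp: increasing_enum_def \<kappa>_def root_key_def less_imp_le)
      \<comment> \<open>The matching of old and new roots preserves the order, and a strictly
        increasing self-map of N indices is the identity.\<close>
      have "\<sigma> s = s"
      proof (rule strict_mono_self_map[OF _ \<sigma>(1) s])
        fix t u assume tu: "t < u" "u < N"
        show "\<sigma> t < \<sigma> u"
        proof (rule ccontr)
          assume "\<not> \<sigma> t < \<sigma> u"
          then have "S * Re (\<omega> * r (\<sigma> u) \<xi>) \<le> S * Re (\<omega> * r (\<sigma> t) \<xi>)" using \<sigma>(1)[of t] tu by (intro inc) simp_all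
          then show False using near[of t] near[of u] gap[OF tu] tu by (auto simp: abs_le_iff)
        qed
      qed
      then show ?case using \<sigma>(2)[OF s] \<eta>(2) by (simp add: dist_norm z_def norm_minus_commute)
    qed
  qed
  have "f \<xi>0 \<noteq> 0" using \<omega> f(2) by blast
  moreover have "f (c *\<^sub>R \<xi>) \<noteq> 0" if "c \<noteq> 0" "f \<xi> \<noteq> 0" for \<xi> c using that f(2) good_scale by blast
  ultimately show ?thesis
    using f(1) bij rprod cont rhom unfolding R_def by (intro exI[of _ f] exI[of _ r]) blast
qed

lemma poly_fun_coeff_leibniz:
  assumes h: "poly_functions h" and M: "\<And>u w. poly_fun h c (\<lambda>\<xi>. M \<xi> u w)"
  shows "poly_fun h c (\<lambda>\<xi>. coeff (leibniz_charpoly X (M \<xi>)) k)"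
proof -
  interpret poly_functions h c by (rule h)
  have pr: "poly_fun h c (\<lambda>\<xi>. coeff (\<Prod>u\<in>Y. (if q u = u then [:0, 1:] else 0) - [:M \<xi> u (q u):]) k)" for Y q k
  proof (induction Y arbitrary: k rule: infinite_finite_induct)
    case (infinite Y)
    then show ?case using of_int[of "of_bool (k = 0)"] by (simp add: coeff_pCons split: nat.splits)
  next
    case empty
    then show ?case using of_int[of "of_bool (k = 0)"] by (simp add: coeff_pCons split: nat.splits)
  next
    case (insert u Y)
    have "poly_fun h c (\<lambda>\<xi>. coeff ((if q u = u then [:0, 1:] else 0) - [:M \<xi> u (q u):]) j)" for j
    proof -
      have eq: "(\<lambda>\<xi>. coeff ((if q u = u then [:0, 1:] else 0) - [:M \<xi> u (q u):]) j) =
          (\<lambda>\<xi>. of_int (of_bool (q u = u \<and> j = 1)) - of_int (of_bool (j = 0)) * M \<xi> u (q u))"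
        by (auto simp: fun_eq_iff coeff_pCons split: nat.splits)
      show ?thesis unfolding eq by (rule diff[OF of_int mult[OF of_int M]])
    qed
    then show ?case
      unfolding prod.insert[OF insert.hyps] coeff_mult by (intro sum mult insert.IH)
  qed
  have eq: "(\<lambda>\<xi>. coeff (leibniz_charpoly X (M \<xi>)) k) = (\<lambda>\<xi>. \<Sum>q | q permutes X. of_int (sign q) *
      coeff (\<Prod>u\<in>X. (if q u = u then [:0, 1:] else 0) - [:M \<xi> u (q u):]) k)"
    by (simp add: fun_eq_iff leibniz_charpoly_def coeff_sum of_int_poly)
  show ?thesis unfolding eq by (intro sum mult of_int pr)
qed

subsection \<open>The families of characteristic polynomials\<close>

text \<open>The shift by \<open>\<xi>\<^bsub>i0\<^esub>\<close> compensates the condition \<open>\<eta>(a) = -1\<close> on the linear forms. The set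
  \<open>{0}\<close>, which is not a block, provides the function \<open>\<xi>\<^bsub>i0\<^esub>\<close>; comparing it with the others excludes
  the eigenvalue 0.\<close>

definition family :: "'m::finite \<Rightarrow> (int^'m) set \<Rightarrow> real^'m \<Rightarrow> complex poly" where
  "family i0 Y \<xi> = leibniz_charpoly Y (\<lambda>x w. pmat (\<lambda>k. complex_of_real (\<xi> $ k)) x w
     + (if x = w then complex_of_real (\<xi> $ i0) else 0))"

lemma poly_family:
  "poly (family i0 Y \<xi>) (t + of_real (\<xi> $ i0)) = poly (leibniz_charpoly Y (pmat (\<lambda>k. complex_of_real (\<xi> $ k)))) t"
  unfolding family_def by (rule leibniz_charpoly_shift)

lemma poly_family':
  "poly (family i0 Y \<xi>) t = poly (leibniz_charpoly Y (pmat (\<lambda>k. complex_of_real (\<xi> $ k)))) (t - of_real (\<xi> $ i0))"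
  using poly_family[of i0 Y \<xi> "t - of_real (\<xi> $ i0)"] by simp

lemma poly_leibniz_singleton: "poly (leibniz_charpoly {x} M) t = t - M x x"
proof -
  have "{p. p permutes {x}} = {id}" by (auto simp: permutes_sing)
  then show ?thesis unfolding poly_leibniz_charpoly by simp
qed

text \<open>An entry has degree 1 for a black edge and 2 or 0 for a red one, according to its
  direction; \<open>D\<close> compensates the deviation from degree 1.\<close>

lemma pmat_scale:
  fixes \<xi> :: "'m::finite \<Rightarrow> 'a::field"
  assumes c: "c \<noteq> 0"
  defines "D \<equiv> \<lambda>x. if eta x = 1 then c else 1"
  shows "pmat (\<lambda>k. c * \<xi> k) x w = c * pmat \<xi> x w * D w / D x"
proof (cases "x = w")
  case True
  then show ?thesis using c by (simp add: pmat_def D_def sum_distrib_left mult.left_commute)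
next
  case False
  show ?thesis
  proof (cases "adj x w")
    case True
    have p: "(\<Prod>k | (w - x) $ k = 1. c * \<xi> k) = c * (\<Prod>k | (w - x) $ k = 1. \<xi> k) * D w / D x"
      using True
    proof (cases rule: adj_cases)
      case (black i j)
      then have s: "{k. (w - x) $ k = 1} = {i}" by (auto simp: axis_nth_int split: if_splits)
      have "eta w = eta x" using black by (simp add: eta_simps)
      then show ?thesis unfolding s using c by (simp add: D_def)
    next
      case (red_up i j)
      then have s: "{k. (w - x) $ k = 1} = {i, j}" by (auto simp: axis_nth_int split: if_splits)
      have "eta w = 1" using red_up by (simp add: eta_simps)
      then show ?thesis unfolding s using c red_up by (simp add: D_def)
    next
      case (red_down i j)
      then have s: "{k. (w - x) $ k = 1} = {}" by (auto simp: axis_nth_int split: if_splits)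
      have "eta w = -1" using red_down by (simp add: eta_simps)
      then show ?thesis unfolding s using c red_down by (simp add: D_def)
    qed
    show ?thesis unfolding pmat_def if_not_P[OF False] if_P[OF True] p by (simp add: mult_ac)
  qed (use False in \<open>simp add: pmat_def\<close>)
qed

lemma family_scale:
  fixes c :: real
  assumes Y: "finite Y" and c: "c \<noteq> 0" and root: "poly (family i0 Y \<xi>) t = 0"
  shows "poly (family i0 Y (c *\<^sub>R \<xi>)) (of_real c * t) = 0"
proof -
  define D :: "int^'a \<Rightarrow> complex" where "D x = (if eta x = 1 then of_real c else 1)" for x
  let ?M = "\<lambda>\<xi> x w. pmat (\<lambda>k. complex_of_real (\<xi> $ k)) x w + (if x = w then complex_of_real (\<xi> $ i0) else 0)"
  have c': "complex_of_real c \<noteq> 0" using c by simp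
  have D0: "D x \<noteq> 0" for x using c by (simp add: D_def)
  have M: "?M (c *\<^sub>R \<xi>) x w = (of_real c * ?M \<xi> x w) * D w / D x" for x w
  proof -
    have P: "pmat (\<lambda>k. complex_of_real ((c *\<^sub>R \<xi>) $ k)) x w =
        complex_of_real c * pmat (\<lambda>k. complex_of_real (\<xi> $ k)) x w * D w / D x"
      using pmat_scale[OF c', of "\<lambda>k. complex_of_real (\<xi> $ k)" x w] by (simp add: D_def[symmetric])
    show ?thesis
    proof (cases "x = w")
      case True
      then show ?thesis using P D0[of w] by (simp add: distrib_left)
    next
      case False
      then show ?thesis unfolding P by simp
    qed
  qed
  have "family i0 Y (c *\<^sub>R \<xi>) = leibniz_charpoly Y (\<lambda>x w. of_real c * ?M \<xi> x w)"
    unfolding family_def M using D0 by (intro leibniz_charpoly_similar[OF Y])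
  then show ?thesis using root unfolding family_def by (simp add: leibniz_charpoly_scale)
qed

lemma poly_functions_of_rat: "poly_functions (of_rat :: rat \<Rightarrow> complex)"
  by unfold_locales (simp_all add: of_rat_add of_rat_mult)

lemma family_coeff_rational:
  "poly_fun of_rat (\<lambda>\<xi> i. complex_of_real (\<xi> $ i)) (\<lambda>\<xi>. coeff (family i0 Y \<xi>) k)"
  unfolding family_def
proof (rule poly_fun_coeff_leibniz[OF poly_functions_of_rat])
  fix x w :: "int^'a"
  interpret poly_functions "of_rat :: rat \<Rightarrow> complex" "\<lambda>(\<xi>::real^'a) i. complex_of_real (\<xi> $ i)"
    by (rule poly_functions_of_rat)
  consider "x = w" | "x \<noteq> w" "adj x w" | "x \<noteq> w" "\<not> adj x w" by blast
  then show "poly_fun of_rat (\<lambda>\<xi> i. complex_of_real (\<xi> $ i)) (\<lambda>\<xi>. pmat (\<lambda>k. complex_of_real (\<xi> $ k)) x w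
     + (if x = w then complex_of_real (\<xi> $ i0) else 0))"
  proof cases
    case 1
    show ?thesis unfolding pmat_def if_P[OF 1] by (intro add minus sum mult of_int var)
  next
    case 2
    show ?thesis unfolding pmat_def if_not_P[OF 2(1)] if_P[OF 2(2)]
      by (intro add zero mult of_int prod var)
  next
    case 3
    show ?thesis unfolding pmat_def if_not_P[OF 3(1)] if_not_P[OF 3(2)] by (intro add zero)
  qed
qed

lemma poly_fun_rational_real:
  assumes "poly_fun of_rat (\<lambda>\<xi> i. complex_of_real (\<xi> $ i)) f"
  shows "f \<xi> \<in> \<real>"
proof -
  obtain p where p: "f \<xi> = hom_eval of_rat p (\<lambda>i. complex_of_real (\<xi> $ i))"
    using assms unfolding poly_fun_def by blast
  have "complex_of_rat q \<in> \<real>" for q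
  proof -
    obtain a b where "quotient_of q = (a, b)" by fastforce
    then have "q = of_int a / of_int b" by (rule quotient_of_div)
    then have "complex_of_rat q = of_int a / of_int b" by (simp add: of_rat_divide)
    then show ?thesis by (simp add: Reals_divide)
  qed
  then show ?thesis unfolding p hom_eval_def monom_eval_def
    by (intro sum_in_Reals Reals_mult prod_in_Reals Reals_power) simp_all
qed

text \<open>The coefficients of the family are polynomials in \<xi> over the rationals, and the
  polynomial \<open>F\<close> assembled from them is nonzero because the family is monic.\<close>

lemma algebraic_function_family:
  fixes \<theta> :: "real^'m::finite \<Rightarrow> complex"
  assumes Y: "finite Y" and root: "\<And>\<xi>. \<xi> \<in> U \<Longrightarrow> poly (family i0 Y \<xi>) (\<theta> \<xi>) = 0" and cont: "continuous_on U \<theta>"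
  shows "algebraic_function_on U \<theta>"
proof -
  have "\<exists>G. \<forall>k. \<forall>\<xi>. coeff (family i0 Y \<xi>) k = hom_eval of_rat (G k :: ('m, rat) mpoly) (\<lambda>i. complex_of_real (\<xi> $ i))"
    using family_coeff_rational[of i0 Y] unfolding poly_fun_def by (intro choice allI) blast
  then obtain G :: "nat \<Rightarrow> ('m, rat) mpoly"
    where G: "\<And>k \<xi>. coeff (family i0 Y \<xi>) k = hom_eval of_rat (G k) (\<lambda>i. complex_of_real (\<xi> $ i))" by blast
  define F where "F = (\<Sum>k\<le>card Y. monom (G k) k)"
  have deg: "degree (family i0 Y \<xi>) = card Y" "coeff (family i0 Y \<xi>) (card Y) = 1" for \<xi>
    unfolding family_def by (rule leibniz_charpoly_degree[OF Y])+
  have cF: "coeff F k = (if k \<le> card Y then G k else 0)" for k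
    by (simp add: F_def coeff_sum coeff_monom)
  have "F \<noteq> 0"
  proof
    assume "F = 0"
    then have "G (card Y) = 0" using cF[of "card Y"] by simp
    then show False using G[of 0 "card Y"] deg(2)[of 0] by simp
  qed
  moreover have "map_poly (\<lambda>c. mpoly_eval (Poly_Mapping.map of_rat c) (\<lambda>i. complex_of_real (\<xi> $ i))) F = family i0 Y \<xi>" for \<xi>
  proof (rule poly_eqI)
    fix k
    have "coeff (map_poly (\<lambda>c. hom_eval of_rat c (\<lambda>i. complex_of_real (\<xi> $ i))) F) k =
        hom_eval of_rat (coeff F k) (\<lambda>i. complex_of_real (\<xi> $ i))"
      by (rule coeff_map_poly) simp
    also have "\<dots> = coeff (family i0 Y \<xi>) k"
      using deg(1)[of \<xi>] by (auto simp: cF G[symmetric] coeff_eq_0)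
    finally show "coeff (map_poly (\<lambda>c. mpoly_eval (Poly_Mapping.map of_rat c) (\<lambda>i. complex_of_real (\<xi> $ i))) F) k = coeff (family i0 Y \<xi>) k"
      by (simp only: hom_eval_map[where h = of_rat, OF of_rat_0])
  qed
  ultimately show ?thesis
    unfolding algebraic_function_on_def using cont root by (intro conjI exI[of _ F]) simp_all
qed

section \<open>Coincidence loci, representatives of shapes and separation of families\<close>

text \<open>The product of t - u + L over all pairs of roots t of p and u of q is symmetric in both,
  hence polynomial in \<xi>, and by hypothesis it is nonzero at \<open>b\<close>.\<close>

lemma locus_hypersurface:
  fixes p q :: "real^'m::finite \<Rightarrow> complex poly" and N M :: nat
  assumes p: "\<And>\<xi>. \<exists>a. p \<xi> = (\<Prod>s<N. [:- a s, 1:])" "\<And>k. cpoly_fun (\<lambda>\<xi>. coeff (p \<xi>) k)"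
    and q: "\<And>\<xi>. \<exists>a. q \<xi> = (\<Prod>s<M. [:- a s, 1:])" "\<And>k. cpoly_fun (\<lambda>\<xi>. coeff (q \<xi>) k)"
    and L: "cpoly_fun L"
    and b: "\<And>t u. poly (p b) t = 0 \<Longrightarrow> poly (q b) u = 0 \<Longrightarrow> t - u + L b \<noteq> 0"
  shows "\<exists>H. algebraic_hypersurface H \<and> {\<xi>. \<exists>t u. poly (p \<xi>) t = 0 \<and> poly (q \<xi>) u = 0 \<and> t - u + L \<xi> = 0} \<subseteq> H"
proof -
  obtain v where v: "\<And>\<xi>. p \<xi> = (\<Prod>s<N. [:- v \<xi> s, 1:])" using p(1) by metis
  obtain w where w: "\<And>\<xi>. q \<xi> = (\<Prod>s<M. [:- w \<xi> s, 1:])" using q(1) by metis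
  define f where "f \<xi> = (\<Prod>k<N * M. 1 * v \<xi> (k div M) + (- 1) * w \<xi> (k mod M) + L \<xi>)" for \<xi>
  have "cpoly_fun f"
    unfolding f_def[abs_def] by (intro psum_prod psum_pair psum_roots[OF v p(2)] psum_roots[OF w q(2)] L)
  moreover have "f b \<noteq> 0"
  proof -
    have "1 * v b (k div M) + (- 1) * w b (k mod M) + L b \<noteq> 0" if "k < N * M" for k
    proof -
      have "k div M < N" "k mod M < M" using that by (auto simp: less_mult_imp_div_less intro!: mod_less_divisor Nat.gr0I)
      then have "poly (p b) (v b (k div M)) = 0" "poly (q b) (w b (k mod M)) = 0"
        unfolding v w by (auto simp: poly_prod)
      then show ?thesis using b by fastforce
    qed
    then show ?thesis unfolding f_def by simp
  qed
  moreover have "f \<xi> = 0" if \<xi>: "\<xi> \<in> {\<xi>. \<exists>t u. poly (p \<xi>) t = 0 \<and> poly (q \<xi>) u = 0 \<and> t - u + L \<xi> = 0}" for \<xi>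
  proof -
    obtain t u where tu: "poly (p \<xi>) t = 0" "poly (q \<xi>) u = 0" "t - u + L \<xi> = 0" using \<xi> by blast
    obtain s where s: "s < N" "t = v \<xi> s" using tu(1) unfolding v by (auto simp: poly_prod)
    obtain s' where s': "s' < M" "u = w \<xi> s'" using tu(2) unfolding w by (auto simp: poly_prod)
    have "s * M + s' < Suc s * M" using s' by simp
    also have "\<dots> \<le> N * M" using s by (intro mult_le_mono1) simp
    finally have "s * M + s' \<in> {..<N * M}" by simp
    moreover have "1 * v \<xi> ((s * M + s') div M) + (- 1) * w \<xi> ((s * M + s') mod M) + L \<xi> = 0"
      using s s' tu(3) by simp
    ultimately show ?thesis unfolding f_def by (intro prod_zero) blast+
  qed
  ultimately show ?thesis by (rule zero_set_subset_hypersurface)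
qed

text \<open>Every shape of bounded extent can be moved into one finite box, which contains finitely
  many sets; one set is selected from each translation class.\<close>

lemma shape_representatives:
  "\<exists>\<R> :: (int^'m::finite) set set. finite \<R> \<and> (\<forall>Y\<in>\<R>. block_shape Y) \<and>
     (\<forall>Y\<in>\<R>. \<forall>Z\<in>\<R>. \<forall>b. eta b = 0 \<longrightarrow> Z = (\<lambda>x. x + b) ` Y \<longrightarrow> Y = Z) \<and>
     (\<forall>X. block_shape X \<longrightarrow> (\<forall>x\<in>X. \<forall>y\<in>X. \<forall>k. \<bar>(x - y) $ k\<bar> \<le> r) \<longrightarrow>
        (\<exists>Y\<in>\<R>. \<exists>b. eta b = 0 \<and> X = (\<lambda>x. x + b) ` Y))"
proof -
  define sim :: "(int^'m) set \<Rightarrow> (int^'m) set \<Rightarrow> bool"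
    where "sim Y Z \<longleftrightarrow> (\<exists>b. eta b = 0 \<and> Z = (\<lambda>x. x + b) ` Y)" for Y Z
  have refl: "sim Y Y" for Y unfolding sim_def by (intro exI[of _ 0]) (simp add: eta_simps)
  have sym: "sim Z Y" if YZ: "sim Y Z" for Y Z
  proof -
    obtain b where "eta b = 0" "Z = (\<lambda>x. x + b) ` Y" using YZ unfolding sim_def by blast
    then show ?thesis unfolding sim_def by (intro exI[of _ "- b"]) (simp add: eta_simps image_image)
  qed
  have trans: "sim Y W" if YZ: "sim Y Z" and ZW: "sim Z W" for Y Z W
  proof -
    obtain b where b: "eta b = 0" "Z = (\<lambda>x. x + b) ` Y" using YZ unfolding sim_def by blast
    obtain c where c: "eta c = 0" "W = (\<lambda>x. x + c) ` Z" using ZW unfolding sim_def by blast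
    have "eta (b + c) = 0" "W = (\<lambda>x. x + (b + c)) ` Y" using b c by (simp_all add: eta_simps image_image add.assoc)
    then show ?thesis unfolding sim_def by blast
  qed
  define \<S> :: "(int^'m) set set" where "\<S> = {Y \<in> Pow {d. \<forall>k. \<bar>d $ k\<bar> \<le> r + 1}. block_shape Y}"
  have "finite (Pow {d :: int^'m. \<forall>k. \<bar>d $ k\<bar> \<le> r + 1})" by (simp only: finite_Pow_iff finite_box)
  then have "finite \<S>" unfolding \<S>_def by simp
  define rep where "rep Y = (SOME Z. Z \<in> \<S> \<and> sim Y Z)" for Y
  have rep: "rep Y \<in> \<S>" "sim Y (rep Y)" if "Y \<in> \<S>" for Y
    using someI[of "\<lambda>Z. Z \<in> \<S> \<and> sim Y Z" Y] that refl unfolding rep_def by auto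
  have rep_eq: "rep Y = rep Z" if "sim Y Z" for Y Z
  proof -
    have "(\<lambda>W. W \<in> \<S> \<and> sim Y W) = (\<lambda>W. W \<in> \<S> \<and> sim Z W)" using that sym trans by blast
    then show ?thesis unfolding rep_def by simp
  qed
  have "Y = Z" if YZ: "Y \<in> rep ` \<S>" "Z \<in> rep ` \<S>" "sim Y Z" for Y Z
  proof -
    obtain Y0 Z0 where 0: "Y0 \<in> \<S>" "Y = rep Y0" "Z0 \<in> \<S>" "Z = rep Z0" using YZ(1,2) by blast
    have "sim Y0 (rep Z0)" using rep(2)[OF 0(1)] YZ(3) unfolding 0 by (rule trans)
    then have "sim Y0 Z0" using sym[OF rep(2)[OF 0(3)]] by (rule trans)
    then show ?thesis using rep_eq 0 by blast
  qed
  then have unique: "\<forall>Y\<in>rep ` \<S>. \<forall>Z\<in>rep ` \<S>. \<forall>b. eta b = 0 \<longrightarrow> Z = (\<lambda>x. x + b) ` Y \<longrightarrow> Y = Z"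
    unfolding sim_def by blast
  have "\<exists>Y\<in>rep ` \<S>. sim Y X"
    if X: "block_shape X" and d: "\<forall>x\<in>X. \<forall>y\<in>X. \<forall>k. \<bar>(x - y) $ k\<bar> \<le> r" for X
  proof -
    fix i0 :: 'm
    obtain x where x: "x \<in> X" using block_shapeD(2)[OF X] by blast
    \<comment> \<open>Moves x to the axis point e_i0 or -e_i0 with the same value of \<eta>; this
      point is responsible for the extra 1 in the size of the box.\<close>
    define b where "b = eta x *s axis i0 1 - x"
    have b: "eta b = 0" by (simp add: b_def eta_simps eta_scale)
    have ex: "eta x = 1 \<or> eta x = -1" using local_shapeD(2)[OF block_shapeD(1)[OF X]] x by blast
    have box: "\<bar>(y + b) $ k\<bar> \<le> r + 1" if "y \<in> X" for y k
    proof -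
      have "(y + b) $ k = (y - x) $ k + eta x * (axis i0 1 :: int^'m) $ k" by (simp add: b_def)
      moreover have "\<bar>eta x * (axis i0 1 :: int^'m) $ k\<bar> \<le> 1" using ex by (auto simp: axis_nth_int)
      moreover have "\<bar>(y - x) $ k\<bar> \<le> r" using d that x by blast
      ultimately show ?thesis by linarith
    qed
    have Y: "(\<lambda>x. x + b) ` X \<in> \<S>"
      unfolding \<S>_def using box block_shape_translate[OF X b] by blast
    have "sim X ((\<lambda>x. x + b) ` X)" unfolding sim_def using b by blast
    then have "sim X (rep ((\<lambda>x. x + b) ` X))" using rep(2)[OF Y] by (rule trans)
    then show ?thesis using sym Y by blast
  qed
  then have cover: "\<forall>X. block_shape X \<longrightarrow> (\<forall>x\<in>X. \<forall>y\<in>X. \<forall>k. \<bar>(x - y) $ k\<bar> \<le> r) \<longrightarrow>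
        (\<exists>Y\<in>rep ` \<S>. \<exists>b. eta b = 0 \<and> X = (\<lambda>x. x + b) ` Y)"
    unfolding sim_def by blast
  have "\<forall>Y\<in>rep ` \<S>. block_shape Y" using rep(1) by (auto simp: \<S>_def)
  then show ?thesis using \<open>finite \<S>\<close> unique cover by (intro exI[of _ "rep ` \<S>"]) simp
qed

lemma block_shape_singleton: "eta x = 1 \<Longrightarrow> block_shape {x}"
  by (simp add: block_shape_def local_shape_def)

lemma lform_simps: "lform (a + b) \<xi> = lform a \<xi> + lform b \<xi>" "lform (a - b) \<xi> = lform a \<xi> - lform b \<xi>"
  "lform (- a) \<xi> = - lform a \<xi>" "lform (axis i 1) \<xi> = \<xi> $ i" "lform a (c *\<^sub>R \<xi>) = c * lform a \<xi>"
proof -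
  show "lform (a + b) \<xi> = lform a \<xi> + lform b \<xi>" "lform (a - b) \<xi> = lform a \<xi> - lform b \<xi>"
    "lform (- a) \<xi> = - lform a \<xi>" "lform a (c *\<^sub>R \<xi>) = c * lform a \<xi>"
    by (simp_all add: lform_def algebra_simps sum.distrib sum_subtractf sum_negf sum_distrib_left)
  have "lform (axis i 1) \<xi> = (\<Sum>k\<in>UNIV. if k = i then \<xi> $ k else 0)"
    unfolding lform_def by (intro sum.cong refl) (auto simp: axis_def)
  then show "lform (axis i 1) \<xi> = \<xi> $ i" by simp
qed

lemma of_real_lform: "complex_of_real (lform b \<xi>) = (\<Sum>k\<in>UNIV. of_int (b $ k) * complex_of_real (\<xi> $ k))"
  by (simp add: lform_def)

lemma translate_fixed:
  fixes Y :: "(int^'m::finite) set"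
  assumes Y: "finite Y" "Y \<noteq> {}" and eq: "Y = (\<lambda>x. x + a) ` Y"
  shows "a = 0"
proof -
  have inj: "inj_on (\<lambda>x. x + a) Y" by (rule inj_onI) simp
  have "a $ k = 0" for k
  proof -
    have "(\<Sum>x\<in>Y. x $ k) = (\<Sum>x\<in>(\<lambda>x. x + a) ` Y. x $ k)" using eq by (rule arg_cong)
    also have "\<dots> = (\<Sum>x\<in>Y. x $ k) + of_nat (card Y) * a $ k" by (simp add: sum.reindex[OF inj] sum.distrib)
    finally show ?thesis using Y by simp
  qed
  then show ?thesis by (simp add: Finite_Cartesian_Product.vec_eq_iff)
qed

lemma poly_family_zero: "poly (family i0 {0} \<xi>) t = t - of_real (\<xi> $ i0)"
  unfolding poly_family' poly_leibniz_singleton by (simp add: pmat_def)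

text \<open>Translating a shape by \<open>a\<close> shifts its spectrum by the linear form, so a
  difference of roots equal to that form is a common root of Z and of the translate of Y. The index
  {0} has the single unshifted root 0 and is compared with shapes by the last property of
  \<open>separating_parameters\<close>.\<close>

lemma separated_families:
  fixes i0 :: "'m::finite"
  obtains \<xi> :: "real^'m" where "\<And>i. \<xi> $ i \<noteq> 0"
    "\<And>Y. block_shape Y \<or> Y = {0} \<Longrightarrow> card {t. poly (family i0 Y \<xi>) t = 0} = card Y"
    "\<And>Y Z t u a. block_shape Y \<or> Y = {0} \<Longrightarrow> block_shape Z \<or> Z = {0} \<Longrightarrow> eta a = 0 \<Longrightarrow>
      poly (family i0 Y \<xi>) t = 0 \<Longrightarrow> poly (family i0 Z \<xi>) u = 0 \<Longrightarrow> t - u = of_real (lform a \<xi>) \<Longrightarrow>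
      Y = {0} \<and> Z = {0} \<and> a = 0 \<or> block_shape Y \<and> block_shape Z \<and> Z = (\<lambda>x. x + a) ` Y"
proof (rule separating_parameters)
  fix \<xi> :: "real^'m"
  assume nz: "\<And>i. \<xi> $ i \<noteq> 0"
    and simple: "\<And>C. block_shape C \<Longrightarrow>
      card {l. poly (leibniz_charpoly C (pmat (\<lambda>k. complex_of_real (\<xi> $ k)))) l = 0} = card C"
    and sep: "\<And>C C' l. block_shape C \<Longrightarrow> block_shape C' \<Longrightarrow>
      poly (leibniz_charpoly C (pmat (\<lambda>k. complex_of_real (\<xi> $ k)))) l = 0 \<Longrightarrow>
      poly (leibniz_charpoly C' (pmat (\<lambda>k. complex_of_real (\<xi> $ k)))) l = 0 \<Longrightarrow> C = C'"
    and nlin: "\<And>C l b. block_shape C \<Longrightarrow> eta b = 0 \<Longrightarrow>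
      poly (leibniz_charpoly C (pmat (\<lambda>k. complex_of_real (\<xi> $ k)))) l = 0 \<Longrightarrow> l \<noteq> of_real (lform b \<xi>)"
  let ?M = "pmat (\<lambda>k. complex_of_real (\<xi> $ k))"
  \<comment> \<open>A linear relation among the parameters would give the singletons of e_i0 and
    e_i0 + a the same eigenvalue.\<close>
  have indep: "a = 0" if a: "eta a = 0" "lform a \<xi> = 0" for a
  proof -
    let ?x = "axis i0 1 :: int^'m"
    have diag: "?M x x = - of_real (lform x \<xi>)" for x by (simp add: pmat_def of_real_lform)
    have "{?x} = {?x + a}"
      by (rule sep[of "{?x}" "{?x + a}" "- of_real (lform ?x \<xi>)"])
        (use a in \<open>simp_all add: block_shape_singleton eta_simps poly_leibniz_singleton diag lform_simps\<close>)
    then show ?thesis by simp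
  qed
  show thesis
  proof (rule that[OF nz])
    fix Y :: "(int^'m) set" assume Y: "block_shape Y \<or> Y = {0}"
    show "card {t. poly (family i0 Y \<xi>) t = 0} = card Y"
    proof (cases "Y = {0}")
      case True
      have "{t. poly (family i0 {0} \<xi>) t = 0} = {of_real (\<xi> $ i0)}" by (auto simp: poly_family_zero)
      then show ?thesis by (simp add: True)
    next
      case False
      have "{t. poly (family i0 Y \<xi>) t = 0} = (\<lambda>l. l + of_real (\<xi> $ i0)) ` {l. poly (leibniz_charpoly Y ?M) l = 0}"
      proof (intro equalityI subsetI)
        fix t assume "t \<in> {t. poly (family i0 Y \<xi>) t = 0}"
        then show "t \<in> (\<lambda>l. l + of_real (\<xi> $ i0)) ` {l. poly (leibniz_charpoly Y ?M) l = 0}"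
          unfolding poly_family' by (intro image_eqI[of _ _ "t - of_real (\<xi> $ i0)"]) simp_all
      qed (auto simp: poly_family)
      moreover have "inj_on (\<lambda>l. l + complex_of_real (\<xi> $ i0)) A" for A by (rule inj_onI) simp
      ultimately show ?thesis using simple[of Y] Y False by (simp add: card_image)
    qed
  next
    fix Y Z :: "(int^'m) set" and t u a
    assume Y: "block_shape Y \<or> Y = {0}" and Z: "block_shape Z \<or> Z = {0}" and a: "eta a = 0"
      and t: "poly (family i0 Y \<xi>) t = 0" and u: "poly (family i0 Z \<xi>) u = 0" and tu: "t - u = of_real (lform a \<xi>)"
    define l where "l = t - of_real (\<xi> $ i0)"
    define l' where "l' = u - of_real (\<xi> $ i0)"
    have l: "poly (leibniz_charpoly Y ?M) l = 0" and l': "poly (leibniz_charpoly Z ?M) l' = 0"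
      using t u unfolding poly_family' l_def l'_def .
    have ll: "l - l' = of_real (lform a \<xi>)" using tu by (simp add: l_def l'_def)
    have zero: "m = 0" if "poly (leibniz_charpoly {0} ?M) m = 0" for m
      using that unfolding poly_leibniz_singleton by (simp add: pmat_def)
    consider "Y = {0}" "Z = {0}" | "Y = {0}" "block_shape Z" | "block_shape Y" "Z = {0}" | "block_shape Y" "block_shape Z"
      using Y Z by blast
    then show "Y = {0} \<and> Z = {0} \<and> a = 0 \<or> block_shape Y \<and> block_shape Z \<and> Z = (\<lambda>x. x + a) ` Y"
    proof cases
      case 1
      then have "l = 0" "l' = 0" using zero l l' by simp_all
      then have "a = 0" using ll by (intro indep a) simp
      then show ?thesis using 1 by blast
    next
      case 2
      then have "l = 0" using zero l by simp
      then have "l' = of_real (lform (- a) \<xi>)" using ll by (simp add: lform_simps minus_equation_iff[of l'])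
      then show ?thesis using nlin[OF 2(2) _ l', of "- a"] a by (simp add: eta_simps)
    next
      case 3
      then have "l' = 0" using zero l' by simp
      then show ?thesis using nlin[OF 3(1) a l] ll by simp
    next
      case 4
      have "poly (leibniz_charpoly ((\<lambda>x. x + a) ` Y) ?M) (l - of_real (lform a \<xi>)) = poly (leibniz_charpoly Y ?M) l"
        unfolding of_real_lform by (rule leibniz_charpoly_pmat_translate[OF block_shapeD(3)[OF 4(1)] a])
      moreover have "l - of_real (lform a \<xi>) = l'" using ll by (simp add: algebra_simps)
      ultimately have "poly (leibniz_charpoly ((\<lambda>x. x + a) ` Y) ?M) l' = 0" using l by simp
      then have "Z = (\<lambda>x. x + a) ` Y" by (rule sep[OF 4(2) block_shape_translate[OF 4(1) a] l'])
      then show ?thesis using 4 by blast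
    qed
  qed
qed

lemma rsquarefree_shift:
  fixes p q :: "complex poly" and z :: "nat \<Rightarrow> complex"
  assumes p: "p = (\<Prod>s<N. [:- z s, 1:])" "inj_on z {..<N}" and q: "\<And>t. poly q t = poly p (t + c)"
  shows "rsquarefree q"
proof -
  have qp: "q = pcompose p [:c, 1:]"
    by (rule poly_eq_poly_eq_iff[THEN iffD1], rule ext) (simp add: q poly_pcompose add.commute)
  show ?thesis
    unfolding rsquarefree_roots
  proof (intro allI notI)
    fix a assume a: "poly q a = 0 \<and> poly (pderiv q) a = 0"
    then have 0: "poly p (a + c) = 0" using q by simp
    have 1: "poly (pderiv p) (a + c) = 0"
      using a by (simp add: qp pderiv_pcompose poly_pcompose pderiv_pCons add.commute)
    obtain s where s: "s < N" "a + c = z s" using 0 unfolding p(1) by (auto simp: poly_prod)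
    define h where "h = (\<Prod>t\<in>{..<N} - {s}. [:- z t, 1:])"
    have "p = [:- z s, 1:] * h" unfolding p(1) h_def using s(1) by (intro prod.remove) simp_all
    then have "pderiv p = [:- z s, 1:] * pderiv h + h * pderiv [:- z s, 1:]" by (simp only: pderiv_mult)
    then have "poly (pderiv p) (z s) = poly h (z s)" by (simp only: poly_add poly_mult) (simp add: pderiv_pCons)
    also have "\<dots> \<noteq> 0" using p(2) s(1) by (auto simp: h_def poly_prod dest: inj_onD)
    finally show False using 1 s(2) by simp
  qed
qed

lemma family_roots_scale:
  assumes Y: "finite Y" and c: "c \<noteq> 0" and root: "poly (family i0 Y (c *\<^sub>R \<xi>)) t = 0"
  shows "\<exists>t'. poly (family i0 Y \<xi>) t' = 0 \<and> t = of_real c * t'"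
proof -
  have "poly (family i0 Y ((1 / c) *\<^sub>R (c *\<^sub>R \<xi>))) (of_real (1 / c) * t) = 0"
    by (rule family_scale[OF Y _ root]) (use c in simp)
  then show ?thesis using c by (intro exI[of _ "of_real (1 / c) * t"]) simp
qed

lemma family_factor: "finite Y \<Longrightarrow> \<exists>a. family i0 Y \<xi> = (\<Prod>s<card Y. [:- a s, 1:])"
  unfolding family_def by (rule leibniz_charpoly_factor)

lemma family_coeff: "cpoly_fun (\<lambda>\<xi>. coeff (family i0 Y \<xi>) k)"
  by (rule cpoly_fun_rational[OF family_coeff_rational])

text \<open>Scaling \<xi> by c multiplies the roots and the linear form but not n. For n \<noteq> 0
  all but finitely many c exclude a coincidence; for n = 0 the hypothesis at \<xi> does.\<close>

lemma family_locus:
  fixes \<xi> :: "real^'m::finite" and a :: "int^'m"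
  assumes Y: "finite Y" and Z: "finite Z"
    and sep: "\<And>t u. n = 0 \<Longrightarrow> poly (family i0 Y \<xi>) t = 0 \<Longrightarrow> poly (family i0 Z \<xi>) u = 0 \<Longrightarrow> t - u \<noteq> of_real (lform a \<xi>)"
  shows "\<exists>H. algebraic_hypersurface H \<and>
    {\<xi>. \<exists>t u. poly (family i0 Y \<xi>) t = 0 \<and> poly (family i0 Z \<xi>) u = 0 \<and> t - u + (of_int n - of_real (lform a \<xi>)) = 0} \<subseteq> H"
proof -
  let ?R = "\<lambda>Y. {t. poly (family i0 Y \<xi>) t = 0}"
  have fin: "finite (?R Y)" if Y: "finite Y" for Y
  proof -
    obtain a where "family i0 Y \<xi> = (\<Prod>s<card Y. [:- a s, 1:])" using family_factor[OF Y] by blast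
    then have "?R Y = a ` {..<card Y}" by (auto simp: poly_prod)
    then show ?thesis by simp
  qed
  define bad where "bad = (\<lambda>(t, u). Re (- of_int n / (t - u - of_real (lform a \<xi>)))) ` (?R Y \<times> ?R Z)"
  have "finite (insert 0 bad)" unfolding bad_def using fin[OF Y] fin[OF Z] by simp
  then obtain c where c: "c \<notin> insert 0 bad" using ex_new_if_finite[OF infinite_UNIV_char_0] by blast
  then have c0: "c \<noteq> 0" by simp
  have L: "cpoly_fun (\<lambda>\<xi>. of_int n - complex_of_real (lform a \<xi>))"
    unfolding of_real_lform by (intro cpoly_fun_diff cpoly_fun_const cpoly_fun_sum cpoly_fun_mult cpoly_fun_var)
  show ?thesis
  proof (rule locus_hypersurface[OF family_factor[OF Y] family_coeff family_factor[OF Z] family_coeff L])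
    fix t u assume tu: "poly (family i0 Y (c *\<^sub>R \<xi>)) t = 0" "poly (family i0 Z (c *\<^sub>R \<xi>)) u = 0"
    obtain t' where t': "poly (family i0 Y \<xi>) t' = 0" "t = of_real c * t'" using family_roots_scale[OF Y c0 tu(1)] by blast
    obtain u' where u': "poly (family i0 Z \<xi>) u' = 0" "u = of_real c * u'" using family_roots_scale[OF Z c0 tu(2)] by blast
    define D where "D = t' - u' - of_real (lform a \<xi>)"
    have eq: "t - u + (of_int n - of_real (lform a (c *\<^sub>R \<xi>))) = of_real c * D + of_int n"
      by (simp add: D_def t' u' lform_simps algebra_simps)
    show "t - u + (of_int n - of_real (lform a (c *\<^sub>R \<xi>))) \<noteq> 0"
    proof (cases "n = 0")
      case True
      then show ?thesis unfolding eq using sep[OF True t'(1) u'(1)] c0 by (simp add: D_def)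
    next
      case False
      show ?thesis
      proof
        assume "t - u + (of_int n - of_real (lform a (c *\<^sub>R \<xi>))) = 0"
        then have *: "of_real c * D = - of_int n" unfolding eq by (simp add: eq_neg_iff_add_eq_0)
        have "D \<noteq> 0" using * False by auto
        then have "of_real c * D / D = complex_of_real c" by simp
        then have "- of_int n / D = complex_of_real c" by (simp only: *)
        then have "c = Re (- of_int n / D)" by simp
        then have "c \<in> bad" unfolding bad_def D_def using t'(1) u'(1) by (intro image_eqI[of _ _ "(t', u')"]) simp_all
        then show False using c by simp
      qed
    qed
  qed
qed

lemma block_charpoly_family:
  assumes C: "C \<in> blocks v" "finite C" and Y: "finite Y" "xc ` C = (\<lambda>x. x + b) ` Y" "eta b = 0"
    and K: "\<And>u. u \<in> C \<Longrightarrow> energy v u = of_int K" and \<xi>: "\<And>i. \<xi> $ i \<noteq> 0"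
  shows "poly (block_charpoly v \<xi> C) z =
    poly (family i0 Y \<xi>) (z + (of_real (lform b \<xi>) + of_real (\<xi> $ i0) - of_int K))"
proof -
  let ?M = "pmat (\<lambda>k. complex_of_real (\<xi> $ k))"
  define t where "t = z - of_int K + of_real (lform b \<xi>)"
  have "poly (block_charpoly v \<xi> C) z = poly (leibniz_charpoly (xc ` C) ?M) (z - of_int K)"
    using block_charpoly_pmat[OF C K \<xi>, of "z - of_int K"] by simp
  also have "\<dots> = poly (leibniz_charpoly ((\<lambda>x. x + b) ` Y) ?M) (t - of_real (lform b \<xi>))"
    by (simp add: Y(2) t_def)
  also have "\<dots> = poly (leibniz_charpoly Y ?M) t"
    unfolding of_real_lform by (rule leibniz_charpoly_pmat_translate[OF Y(1,3)])
  also have "\<dots> = poly (family i0 Y \<xi>) (t + of_real (\<xi> $ i0))" by (rule poly_family[symmetric])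
  also have "t + of_real (\<xi> $ i0) = z + (of_real (lform b \<xi>) + of_real (\<xi> $ i0) - of_int K)"
    by (simp add: t_def)
  finally show ?thesis .
qed

section \<open>The functions \<theta>, the exceptional hypersurface and the distinctness of the
  eigenvalues\<close>

theorem corollary1p2:
  shows "\<exists>P :: ('m::finite \<times> 'n::finite, int) mpoly. P \<noteq> 0 \<and>
    (\<forall>v :: 'm \<Rightarrow> int^'n. inj v \<and> mpoly_eval P (\<lambda>(i, l). v i $ l) \<noteq> 0 \<longrightarrow>
      (\<forall>C\<in>blocks v. finite C) \<and>
      (\<exists>(A :: (real^'m) set) (d :: nat) (\<theta> :: nat \<Rightarrow> real^'m \<Rightarrow> complex).
        algebraic_hypersurface A \<and>
        (\<forall>j<d. algebraic_function_on (- A) (\<theta> j) \<and> homogeneous1_on (- A) (\<theta> j)) \<and>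
        (\<forall>C\<in>blocks v. \<exists>T :: (int \<times> nat \<times> (int^'m)) set.
           (\<forall>(n, j, a)\<in>T. j < d \<and> eta a = -1) \<and>
           (\<forall>\<xi>\<in>- A. block_eigenvalues v \<xi> C =
              (\<lambda>(n, j, a). of_int n + \<theta> j \<xi> + of_real (lform a \<xi>)) ` T)) \<and>
        (\<forall>(n, i, j, a)\<in>coincidence_indices d.
           \<exists>H. algebraic_hypersurface H \<and> coincidence_locus (- A) \<theta> n i j a \<subseteq> H) \<and>
        (\<forall>\<xi>\<in>- A - (\<Union>(n, i, j, a)\<in>coincidence_indices d. coincidence_locus (- A) \<theta> n i j a).
           eigenvalues_distinct v \<xi> \<and> (\<forall>C\<in>blocks v. 0 \<notin> block_eigenvalues v \<xi> C))))"
proof -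
  obtain P :: "('m \<times> 'n, int) mpoly" where P: "P \<noteq> 0"
    "\<And>v :: 'm \<Rightarrow> int^'n. mpoly_eval P (\<lambda>(i, l). v i $ l) \<noteq> 0 \<Longrightarrow> generic (2 * CARD('m)) v"
    using generic_polynomial by blast
  define i0 :: 'm where "i0 = undefined"
  obtain \<R> :: "(int^'m) set set" where \<R>: "finite \<R>" "\<forall>Y\<in>\<R>. block_shape Y"
    "\<forall>Y\<in>\<R>. \<forall>Z\<in>\<R>. \<forall>b. eta b = 0 \<longrightarrow> Z = (\<lambda>x. x + b) ` Y \<longrightarrow> Y = Z"
    "\<forall>X. block_shape X \<longrightarrow> (\<forall>x\<in>X. \<forall>y\<in>X. \<forall>k. \<bar>(x - y) $ k\<bar> \<le> 2 * int CARD('m)) \<longrightarrow>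
        (\<exists>Y\<in>\<R>. \<exists>b. eta b = 0 \<and> X = (\<lambda>x. x + b) ` Y)"
    using shape_representatives[of "2 * int CARD('m)"] by (elim exE conjE)
  define I where "I = insert {0} \<R>"
  have I: "finite I" "\<And>Y. Y \<in> I \<Longrightarrow> block_shape Y \<or> Y = {0}" "{0} \<in> I"
    using \<R>(1,2) by (auto simp: I_def)
  have zero_shape: "\<not> block_shape {0 :: int^'m}"
    using local_shapeD(2)[OF block_shapeD(1), of "{0}" 0] by (auto simp: eta_simps)
  have IY: "finite Y" "Y \<noteq> {}" "card Y > 0" if "Y \<in> I" for Y
    using I(2)[OF that] block_shapeD(2,3)[of Y] by (auto simp: card_gt_0_iff)
  show ?thesis
  proof (rule separated_families[of i0])
    fix \<xi>s :: "real^'m"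
    assume nz: "\<And>i. \<xi>s $ i \<noteq> 0"
      and simple: "\<And>Y. block_shape Y \<or> Y = {0} \<Longrightarrow> card {t. poly (family i0 Y \<xi>s) t = 0} = card Y"
      and sep: "\<And>Y Z t u a. block_shape Y \<or> Y = {0} \<Longrightarrow> block_shape Z \<or> Z = {0} \<Longrightarrow> eta a = 0 \<Longrightarrow>
        poly (family i0 Y \<xi>s) t = 0 \<Longrightarrow> poly (family i0 Z \<xi>s) u = 0 \<Longrightarrow> t - u = of_real (lform a \<xi>s) \<Longrightarrow>
        Y = {0} \<and> Z = {0} \<and> a = 0 \<or> block_shape Y \<and> block_shape Z \<and> Z = (\<lambda>x. x + a) ` Y"
    define Pr where "Pr Y f r \<longleftrightarrow> cpoly_fun f \<and> f \<xi>s \<noteq> 0 \<and> (\<forall>\<xi> c. c \<noteq> 0 \<longrightarrow> f \<xi> \<noteq> 0 \<longrightarrow> f (c *\<^sub>R \<xi>) \<noteq> 0) \<and>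
      (\<forall>\<xi>. f \<xi> \<noteq> 0 \<longrightarrow> \<xi> $ i0 \<noteq> 0 \<longrightarrow> bij_betw (\<lambda>s. r s \<xi>) {..<card Y} {t. poly (family i0 Y \<xi>) t = 0} \<and>
         family i0 Y \<xi> = (\<Prod>s<card Y. [:- r s \<xi>, 1:])) \<and>
      (\<forall>s<card Y. continuous_on {\<xi>. f \<xi> \<noteq> 0 \<and> \<xi> $ i0 \<noteq> 0} (r s)) \<and>
      (\<forall>s<card Y. \<forall>\<xi> c. c \<noteq> 0 \<longrightarrow> f \<xi> \<noteq> 0 \<longrightarrow> \<xi> $ i0 \<noteq> 0 \<longrightarrow> r s (c *\<^sub>R \<xi>) = of_real c * r s \<xi>)"
      for Y f and r :: "nat \<Rightarrow> real^'m \<Rightarrow> complex"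
    have "\<exists>f r. Pr Y f r" if Y: "Y \<in> I" for Y
      unfolding Pr_def
      by (rule continuous_root_functions[OF IY(3)[OF Y] family_factor[OF IY(1)[OF Y]] family_coeff
          poly_fun_rational_real[OF family_coeff_rational] family_scale[OF IY(1)[OF Y]] simple[OF I(2)[OF Y]]])
    then have "\<forall>Y\<in>I. \<exists>g. Pr Y (fst g) (snd g)" by simp
    then obtain g where g: "\<forall>Y\<in>I. Pr Y (fst (g Y)) (snd (g Y))" by (rule bchoice[THEN exE])
    define F where "F Y = fst (g Y)" for Y
    define r where "r Y = snd (g Y)" for Y
    have FP: "Pr Y (F Y) (r Y)" if "Y \<in> I" for Y using g that unfolding F_def r_def by blast
    have F: "cpoly_fun (F Y)" "F Y \<xi>s \<noteq> 0" "c \<noteq> 0 \<Longrightarrow> F Y \<xi> \<noteq> 0 \<Longrightarrow> F Y (c *\<^sub>R \<xi>) \<noteq> 0" if "Y \<in> I" for Y c \<xi>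
      using FP[OF that] unfolding Pr_def by (elim conjE; blast)+
    have r: "bij_betw (\<lambda>s. r Y s \<xi>) {..<card Y} {t. poly (family i0 Y \<xi>) t = 0}"
      "family i0 Y \<xi> = (\<Prod>s<card Y. [:- r Y s \<xi>, 1:])" if "Y \<in> I" "F Y \<xi> \<noteq> 0" "\<xi> $ i0 \<noteq> 0" for Y \<xi>
      using FP[OF that(1)] that(2,3) unfolding Pr_def by (elim conjE; blast)+
    have rc: "continuous_on {\<xi>. F Y \<xi> \<noteq> 0 \<and> \<xi> $ i0 \<noteq> 0} (r Y s)"
      "c \<noteq> 0 \<Longrightarrow> F Y \<xi> \<noteq> 0 \<Longrightarrow> \<xi> $ i0 \<noteq> 0 \<Longrightarrow> r Y s (c *\<^sub>R \<xi>) = of_real c * r Y s \<xi>"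
      if "Y \<in> I" "s < card Y" for Y s c \<xi>
      using FP[OF that(1)] that(2) unfolding Pr_def by (elim conjE; blast)+
    \<comment> \<open>The exceptional set consists of the coordinate hyperplanes, where the diagonal
      similarity degenerates, and of the zero sets of the discriminants of the finitely many
      families.\<close>
    define G where "G \<xi> = (\<Prod>k\<in>UNIV. complex_of_real (\<xi> $ k)) * (\<Prod>Y\<in>I. F Y \<xi>)" for \<xi> :: "real^'m"
    define A where "A = {\<xi>. G \<xi> = 0}"
    have U: "\<xi> \<in> - A \<longleftrightarrow> (\<forall>k. \<xi> $ k \<noteq> 0) \<and> (\<forall>Y\<in>I. F Y \<xi> \<noteq> 0)" for \<xi>
      unfolding A_def G_def using I(1) by (simp add: prod_zero_iff)
    have A: "algebraic_hypersurface A"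
      unfolding A_def
    proof (rule algebraic_hypersurface_zero_set)
      show "cpoly_fun G" unfolding G_def[abs_def] by (intro cpoly_fun_mult cpoly_fun_prod cpoly_fun_var F(1))
      have "(\<Prod>k\<in>UNIV. complex_of_real ((0 :: real^'m) $ k)) = 0" by simp
      then show "G 0 = 0" unfolding G_def by (simp only: mult_zero_left)
      have "\<xi>s \<in> - A" unfolding U using nz F(2) by blast
      then show "G \<xi>s \<noteq> 0" by (simp add: A_def)
    qed
    \<comment> \<open>One function \<theta>_j for each family and each position in the order of its
      roots.\<close>
    define J where "J = Sigma I (\<lambda>Y. {..<card Y})"
    define d where "d = card J"
    have "finite J" unfolding J_def using I(1) by simp
    then obtain e where e: "bij_betw e {0..<d} J" using ex_bij_betw_nat_finite unfolding d_def by blast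
    define \<theta> where "\<theta> j = r (fst (e j)) (snd (e j))" for j
    have eJ: "fst (e j) \<in> I" "snd (e j) < card (fst (e j))" if "j < d" for j
      using bij_betwE[OF e, rule_format, of j] that by (auto simp: J_def)
    have e_inj: "i = j" if "i < d" "j < d" "fst (e i) = fst (e j)" "snd (e i) = snd (e j)" for i j
    proof -
      have "e i = e j" using that(3,4) by (simp add: prod_eq_iff)
      then show ?thesis using inj_onD[OF bij_betw_imp_inj_on[OF e], of i j] that(1,2) by simp
    qed
    have e_surj: "\<exists>j<d. fst (e j) = Y \<and> snd (e j) = s" if "Y \<in> I" "s < card Y" for Y s
    proof -
      have "(Y, s) \<in> e ` {0..<d}" using bij_betw_imp_surj_on[OF e] that by (simp add: J_def)
      then obtain j where j: "j < d" "e j = (Y, s)" by auto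
      then show ?thesis by (intro exI[of _ j]) simp
    qed
    have roots: "{t. poly (family i0 Y \<xi>) t = 0} = (\<lambda>j. \<theta> j \<xi>) ` {j. j < d \<and> fst (e j) = Y}"
      if Y: "Y \<in> I" and \<xi>: "\<xi> \<in> - A" for Y \<xi>
    proof -
      have "{t. poly (family i0 Y \<xi>) t = 0} = (\<lambda>s. r Y s \<xi>) ` {..<card Y}"
        using bij_betw_imp_surj_on[OF r(1)[OF Y]] \<xi> Y unfolding U by simp
      also have "\<dots> = (\<lambda>j. \<theta> j \<xi>) ` {j. j < d \<and> fst (e j) = Y}"
      proof (intro equalityI subsetI)
        fix t assume "t \<in> (\<lambda>s. r Y s \<xi>) ` {..<card Y}"
        then obtain s where s: "s < card Y" "t = r Y s \<xi>" by blast
        obtain j where "j < d" "fst (e j) = Y" "snd (e j) = s" using e_surj[OF Y s(1)] by blast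
        then show "t \<in> (\<lambda>j. \<theta> j \<xi>) ` {j. j < d \<and> fst (e j) = Y}" using s(2) by (auto simp: \<theta>_def)
      next
        fix t assume "t \<in> (\<lambda>j. \<theta> j \<xi>) ` {j. j < d \<and> fst (e j) = Y}"
        then show "t \<in> (\<lambda>s. r Y s \<xi>) ` {..<card Y}" using eJ by (auto simp: \<theta>_def)
      qed
      finally show ?thesis .
    qed
    have \<theta>_root: "poly (family i0 (fst (e j)) \<xi>) (\<theta> j \<xi>) = 0" if "j < d" "\<xi> \<in> - A" for j \<xi>
      using roots[OF eJ(1)[OF that(1)] that(2)] that(1) by blast
    have \<theta>_distinct: "i = j" if ij: "i < d" "j < d" "fst (e i) = fst (e j)" and \<xi>: "\<xi> \<in> - A" and eq: "\<theta> i \<xi> = \<theta> j \<xi>" for i j \<xi>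
    proof -
      have "inj_on (\<lambda>s. r (fst (e i)) s \<xi>) {..<card (fst (e i))}"
        using bij_betw_imp_inj_on[OF r(1)[OF eJ(1)[OF ij(1)]]] \<xi> eJ(1)[OF ij(1)] unfolding U by simp
      then have "snd (e i) = snd (e j)"
        using eq eJ(2)[OF ij(1)] eJ(2)[OF ij(2)] ij(3) by (auto simp: \<theta>_def dest: inj_onD)
      then show ?thesis by (rule e_inj[OF ij])
    qed
    have \<theta>_fun: "algebraic_function_on (- A) (\<theta> j) \<and> homogeneous1_on (- A) (\<theta> j)" if j: "j < d" for j
    proof
      note Y = eJ[OF j]
      have sub: "- A \<subseteq> {\<xi>. F (fst (e j)) \<xi> \<noteq> 0 \<and> \<xi> $ i0 \<noteq> 0}" using Y(1) U by blast
      have "continuous_on (- A) (\<theta> j)" unfolding \<theta>_def by (rule continuous_on_subset[OF rc(1)[OF Y] sub])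
      then show "algebraic_function_on (- A) (\<theta> j)"
        using IY(1)[OF Y(1)] \<theta>_root[OF j] by (intro algebraic_function_family)
      show "homogeneous1_on (- A) (\<theta> j)"
        unfolding homogeneous1_on_def
      proof (intro ballI allI impI conjI)
        fix \<xi> and c :: real assume \<xi>: "\<xi> \<in> - A" and c: "c \<noteq> 0"
        show "c *\<^sub>R \<xi> \<in> - A" using \<xi> c F(3)[OF _ c] unfolding U by simp
        show "\<theta> j (c *\<^sub>R \<xi>) = of_real c * \<theta> j \<xi>"
          unfolding \<theta>_def using \<xi> Y(1) unfolding U by (intro rc(2)[OF Y c]) simp_all
      qed
    qed
    have loci: "\<exists>H. algebraic_hypersurface H \<and> coincidence_locus (- A) \<theta> n i j a \<subseteq> H"
      if ind: "(n, i, j, a) \<in> coincidence_indices d" for n i j a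
    proof -
      have ij: "i < d" "j < d" "eta a = 0" "i \<noteq> j \<or> n \<noteq> 0 \<or> a \<noteq> 0" using ind by (auto simp: coincidence_indices_def)
      define Y Z where "Y = fst (e i)" and "Z = fst (e j)"
      have YZ: "Y \<in> I" "Z \<in> I" unfolding Y_def Z_def using eJ(1) ij by blast+
      \<comment> \<open>Off \<open>A\<close> the roots of a single family are distinct, so the locus
        is empty for n = 0, a = 0 within one family. In all other cases \<open>sep\<close> rules out
        a coincidence at \<xi>s when n = 0, because representatives are pairwise inequivalent and a
        finite shape has no nontrivial translation symmetry.\<close>
      show ?thesis
      proof (cases "n = 0 \<and> a = 0 \<and> Y = Z")
        case True
        then have "i \<noteq> j" using ij(4) by simp
        have "\<xi> \<notin> coincidence_locus (- A) \<theta> n i j a" for \<xi>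
        proof
          assume "\<xi> \<in> coincidence_locus (- A) \<theta> n i j a"
          then have "\<xi> \<in> - A" "\<theta> i \<xi> = \<theta> j \<xi>" using True by (simp_all add: coincidence_locus_def lform_def)
          then show False using \<theta>_distinct[OF ij(1,2)] True \<open>i \<noteq> j\<close> unfolding Y_def Z_def by blast
        qed
        then show ?thesis using A by blast
      next
        case False
        have "t - u \<noteq> of_real (lform a \<xi>s)"
          if n: "n = 0" and tu: "poly (family i0 Y \<xi>s) t = 0" "poly (family i0 Z \<xi>s) u = 0" for t u
        proof
          assume eq: "t - u = of_real (lform a \<xi>s)"
          from sep[OF I(2)[OF YZ(1)] I(2)[OF YZ(2)] ij(3) tu eq] show False
          proof
            assume "Y = {0} \<and> Z = {0} \<and> a = 0"
            then show False using False n by simp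
          next
            assume s: "block_shape Y \<and> block_shape Z \<and> Z = (\<lambda>x. x + a) ` Y"
            then have "Y \<in> \<R>" "Z \<in> \<R>" using YZ zero_shape by (auto simp: I_def)
            then have YZ': "Y = Z" using \<R>(3) ij(3) s by blast
            then have "Y = (\<lambda>x. x + a) ` Y" using s by simp
            then have "a = 0" by (rule translate_fixed[OF IY(1,2)[OF YZ(1)]])
            then show False using False n YZ' by simp
          qed
        qed
        from family_locus[OF IY(1)[OF YZ(1)] IY(1)[OF YZ(2)], of n i0 \<xi>s a, OF this]
        obtain H where H: "algebraic_hypersurface H"
          "{\<xi>. \<exists>t u. poly (family i0 Y \<xi>) t = 0 \<and> poly (family i0 Z \<xi>) u = 0 \<and> t - u + (of_int n - of_real (lform a \<xi>)) = 0} \<subseteq> H"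
          by blast
        have "coincidence_locus (- A) \<theta> n i j a \<subseteq> H"
        proof
          fix \<xi> assume "\<xi> \<in> coincidence_locus (- A) \<theta> n i j a"
          then have \<xi>: "\<xi> \<in> - A" "\<theta> i \<xi> - \<theta> j \<xi> + (of_int n - of_real (lform a \<xi>)) = 0"
            by (simp_all add: coincidence_locus_def algebra_simps)
          then show "\<xi> \<in> H" using \<theta>_root[OF ij(1) \<xi>(1)] \<theta>_root[OF ij(2) \<xi>(1)] H(2) unfolding Y_def Z_def by blast
        qed
        then show ?thesis using H(1) by blast
      qed
    qed
    have main: "(\<forall>C\<in>blocks v. finite C) \<and> (\<forall>C\<in>blocks v. \<exists>T :: (int \<times> nat \<times> (int^'m)) set.
           (\<forall>(n, j, a)\<in>T. j < d \<and> eta a = -1) \<and>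
           (\<forall>\<xi>\<in>- A. block_eigenvalues v \<xi> C = (\<lambda>(n, j, a). of_int n + \<theta> j \<xi> + of_real (lform a \<xi>)) ` T)) \<and>
        (\<forall>\<xi>\<in>- A - (\<Union>(n, i, j, a)\<in>coincidence_indices d. coincidence_locus (- A) \<theta> n i j a).
           eigenvalues_distinct v \<xi> \<and> (\<forall>C\<in>blocks v. 0 \<notin> block_eigenvalues v \<xi> C))"
      if v: "inj v" "mpoly_eval P (\<lambda>(i, l). v i $ l) \<noteq> 0" for v :: "'m \<Rightarrow> int^'n"
    proof -
      note gen = P(2)[OF v(2)]
      have fin: "finite C" if C: "C \<in> blocks v" for C
        using cluster_card(1)[OF block_cluster[OF C] gen] block_inj[OF C] by (rule finite_imageD)
      \<comment> \<open>The data attached to a block: its representative shape, the translation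
        vector and the energy.\<close>
      define Q where "Q C q \<longleftrightarrow> fst q \<in> \<R> \<and> eta (fst (snd q)) = 0 \<and> xc ` C = (\<lambda>x. x + fst (snd q)) ` fst q \<and>
          (\<forall>u\<in>C. energy v u = of_int (snd (snd q)))" for C and q :: "(int^'m) set \<times> (int^'m) \<times> int"
      have "\<exists>q. Q C q" if C: "C \<in> blocks v" for C
      proof -
        note X = block_cluster[OF C]
        have "\<forall>x\<in>xc ` C. \<forall>y\<in>xc ` C. \<forall>k. \<bar>(x - y) $ k\<bar> \<le> 2 * int CARD('m)"
          by (intro ballI allI) (rule cluster_card(3)[OF X gen])
        with \<R>(4)[THEN spec, THEN mp, OF cluster_block_shape[OF X gen v(1)]]
        have "\<exists>Y\<in>\<R>. \<exists>b. eta b = 0 \<and> xc ` C = (\<lambda>x. x + b) ` Y" by (rule mp)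
        then obtain Y b where Y: "Y \<in> \<R>" "eta b = 0" "xc ` C = (\<lambda>x. x + b) ` Y" by (elim bexE exE conjE)
        obtain K :: int where "\<forall>u\<in>C. energy v u = of_int K" using block_energy[OF C] by blast
        then have "Q C (Y, b, K)" using Y unfolding Q_def by simp
        then show ?thesis by (rule exI)
      qed
      then have "\<forall>C\<in>blocks v. \<exists>q. Q C q" by blast
      then obtain q where q: "\<forall>C\<in>blocks v. Q C (q C)" by (rule bchoice[THEN exE])
      define sh where "sh C = fst (q C)" for C
      define tr where "tr C = fst (snd (q C))" for C
      define en where "en C = snd (snd (q C))" for C
      have sh: "sh C \<in> \<R>" "eta (tr C) = 0" "xc ` C = (\<lambda>x. x + tr C) ` sh C" "\<And>u. u \<in> C \<Longrightarrow> energy v u = of_int (en C)"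
        if "C \<in> blocks v" for C
      proof -
        have *: "sh C \<in> \<R> \<and> eta (tr C) = 0 \<and> xc ` C = (\<lambda>x. x + tr C) ` sh C \<and> (\<forall>u\<in>C. energy v u = of_int (en C))"
          using q that unfolding Q_def sh_def tr_def en_def by (rule bspec)
        show "sh C \<in> \<R>" by (rule *[THEN conjunct1])
        show "eta (tr C) = 0" by (rule *[THEN conjunct2, THEN conjunct1])
        show "xc ` C = (\<lambda>x. x + tr C) ` sh C" by (rule *[THEN conjunct2, THEN conjunct2, THEN conjunct1])
        show "energy v u = of_int (en C)" if "u \<in> C" for u
          using *[THEN conjunct2, THEN conjunct2, THEN conjunct2] that by (rule bspec)
      qed
      have shI: "sh C \<in> I" "sh C \<noteq> {0}" if "C \<in> blocks v" for C
        using sh(1)[OF that] \<R>(2) zero_shape by (auto simp: I_def)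
      have chi: "poly (block_charpoly v \<xi> C) z =
          poly (family i0 (sh C) \<xi>) (z + (of_real (lform (tr C) \<xi>) + of_real (\<xi> $ i0) - of_int (en C)))"
        if C: "C \<in> blocks v" and \<xi>: "\<xi> \<in> - A" for C \<xi> z
        by (rule block_charpoly_family[OF C fin[OF C] IY(1)[OF shI(1)[OF C]] sh(3)[OF C] sh(2)[OF C] sh(4)[OF C]])
          (use \<xi> U in blast)+
      have eig: "z \<in> block_eigenvalues v \<xi> C \<longleftrightarrow>
          (\<exists>j<d. fst (e j) = sh C \<and> z + (of_real (lform (tr C) \<xi>) + of_real (\<xi> $ i0) - of_int (en C)) = \<theta> j \<xi>)"
        if C: "C \<in> blocks v" and \<xi>: "\<xi> \<in> - A" for C \<xi> z
        using roots[OF shI(1)[OF C] \<xi>] unfolding block_eigenvalues_def mem_Collect_eq chi[OF C \<xi>] by blast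
      have T: "\<exists>T :: (int \<times> nat \<times> (int^'m)) set. (\<forall>(n, j, a)\<in>T. j < d \<and> eta a = -1) \<and>
           (\<forall>\<xi>\<in>- A. block_eigenvalues v \<xi> C = (\<lambda>(n, j, a). of_int n + \<theta> j \<xi> + of_real (lform a \<xi>)) ` T)"
        if C: "C \<in> blocks v" for C
      proof (intro exI conjI ballI)
        \<comment> \<open>All eigenvalues of the block share the energy as n and the form -e_i0 - b,
          with b the translation; only the root varies. The summand -e_i0, which undoes the shift in
          \<open>family\<close>, gives coefficient sum -1.\<close>
        let ?T = "(\<lambda>j. (en C, j, - axis i0 1 - tr C)) ` {j. j < d \<and> fst (e j) = sh C}"
        show "case x of (n, j, a) \<Rightarrow> j < d \<and> eta a = -1" if "x \<in> ?T" for x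
          using that sh(2)[OF C] by (auto simp: eta_simps)
        fix \<xi> assume \<xi>: "\<xi> \<in> - A"
        have val: "of_int (en C) + \<theta> j \<xi> + of_real (lform (- axis i0 1 - tr C) \<xi>) =
            \<theta> j \<xi> - (of_real (lform (tr C) \<xi>) + of_real (\<xi> $ i0) - of_int (en C))" for j
          by (simp add: lform_simps)
        have "z \<in> block_eigenvalues v \<xi> C \<longleftrightarrow> z \<in> (\<lambda>(n, j, a). of_int n + \<theta> j \<xi> + of_real (lform a \<xi>)) ` ?T" for z
          unfolding eig[OF C \<xi>] image_image prod.case val by (auto simp: image_iff eq_diff_eq)
        then show "block_eigenvalues v \<xi> C = (\<lambda>(n, j, a). of_int n + \<theta> j \<xi> + of_real (lform a \<xi>)) ` ?T" by blast
      qed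
      have avoid: "i = j \<and> n = 0 \<and> a = 0"
        if \<xi>: "\<xi> \<in> - A - (\<Union>(n, i, j, a)\<in>coincidence_indices d. coincidence_locus (- A) \<theta> n i j a)"
          and ij: "i < d" "j < d" "eta a = 0" "of_int n + \<theta> i \<xi> - \<theta> j \<xi> - of_real (lform a \<xi>) = 0" for \<xi> n i j a
      proof (rule ccontr)
        assume "\<not> (i = j \<and> n = 0 \<and> a = 0)"
        then have "(n, i, j, a) \<in> coincidence_indices d" using ij by (auto simp: coincidence_indices_def)
        moreover have "\<xi> \<in> coincidence_locus (- A) \<theta> n i j a" using \<xi> ij(4) by (simp add: coincidence_locus_def)
        ultimately show False using \<xi> by blast
      qed
      have "eigenvalues_distinct v \<xi> \<and> (\<forall>C\<in>blocks v. 0 \<notin> block_eigenvalues v \<xi> C)"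
        if \<xi>: "\<xi> \<in> - A - (\<Union>(n, i, j, a)\<in>coincidence_indices d. coincidence_locus (- A) \<theta> n i j a)" for \<xi>
        unfolding eigenvalues_distinct_def
      proof (intro conjI ballI)
        have \<xi>A: "\<xi> \<in> - A" using \<xi> by blast
        fix C assume C: "C \<in> blocks v"
        note Y = shI(1)[OF C]
        have FU: "F (sh C) \<xi> \<noteq> 0" "\<xi> $ i0 \<noteq> 0" using \<xi>A Y unfolding U by simp_all
        show "rsquarefree (block_charpoly v \<xi> C)"
          by (rule rsquarefree_shift[OF r(2)[OF Y FU] bij_betw_imp_inj_on[OF r(1)[OF Y FU]] chi[OF C \<xi>A]])
        show "0 \<notin> block_eigenvalues v \<xi> C"
        proof
          assume "0 \<in> block_eigenvalues v \<xi> C"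
          then obtain j where j: "j < d" "fst (e j) = sh C"
            "of_real (lform (tr C) \<xi>) + of_real (\<xi> $ i0) - of_int (en C) = \<theta> j \<xi>"
            unfolding eig[OF C \<xi>A] by auto
          \<comment> \<open>The eigenvalue 0 would be a coincidence of \<theta>_j with the root
            \<xi>_i0 of the family of {0}.\<close>
          obtain k where k: "k < d" "fst (e k) = {0}" using e_surj[OF I(3), of 0] by auto
          have "\<theta> k \<xi> = of_real (\<xi> $ i0)" using \<theta>_root[OF k(1) \<xi>A] by (simp add: k(2) poly_family_zero)
          then have "of_int (en C) + \<theta> j \<xi> - \<theta> k \<xi> - of_real (lform (tr C) \<xi>) = 0" by (simp add: j(3)[symmetric])
          then have "j = k" using avoid[OF \<xi> j(1) k(1) sh(2)[OF C]] by blast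
          then show False using j(2) k(2) shI(2)[OF C] by simp
        qed
      next
        have \<xi>A: "\<xi> \<in> - A" using \<xi> by blast
        show "disjoint_family_on (block_eigenvalues v \<xi>) (blocks v)"
          unfolding disjoint_family_on_def
        proof (intro ballI impI)
          fix C C' assume C: "C \<in> blocks v" "C' \<in> blocks v" "C \<noteq> C'"
          show "block_eigenvalues v \<xi> C \<inter> block_eigenvalues v \<xi> C' = {}"
          proof (rule ccontr)
            assume "\<not> ?thesis"
            then obtain z where z: "z \<in> block_eigenvalues v \<xi> C" "z \<in> block_eigenvalues v \<xi> C'" by blast
            obtain i where i: "i < d" "fst (e i) = sh C"
              "z + (of_real (lform (tr C) \<xi>) + of_real (\<xi> $ i0) - of_int (en C)) = \<theta> i \<xi>"
              using z(1) unfolding eig[OF C(1) \<xi>A] by blast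
            obtain j where j: "j < d" "fst (e j) = sh C'"
              "z + (of_real (lform (tr C') \<xi>) + of_real (\<xi> $ i0) - of_int (en C')) = \<theta> j \<xi>"
              using z(2) unfolding eig[OF C(2) \<xi>A] by blast
            \<comment> \<open>A common eigenvalue is a coincidence with the difference of the
              energies as n and the difference of the translations as a. Off the loci both blocks
              then have the same representative and translation, hence the same points.\<close>
            have "of_int (en C - en C') + \<theta> i \<xi> - \<theta> j \<xi> - of_real (lform (tr C - tr C') \<xi>) = 0"
              by (simp add: i(3)[symmetric] j(3)[symmetric] lform_simps)
            moreover have "eta (tr C - tr C') = 0" using sh(2)[OF C(1)] sh(2)[OF C(2)] by (simp add: eta_simps)
            ultimately have "i = j" "tr C - tr C' = 0" using avoid[OF \<xi> i(1) j(1)] by blast+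
            then have "xc ` C = xc ` C'" using i(2) j(2) sh(3)[OF C(1)] sh(3)[OF C(2)] by simp
            then show False using block_eq[OF C(1,2)] C(3) by blast
          qed
        qed
      qed
      then show ?thesis using fin T by blast
    qed
    show ?thesis
    proof (intro exI[of _ P] conjI allI impI)
      show "P \<noteq> 0" by (rule P(1))
      fix v :: "'m \<Rightarrow> int^'n" assume v: "inj v \<and> mpoly_eval P (\<lambda>(i, l). v i $ l) \<noteq> 0"
      note m = main[OF conjunct1[OF v] conjunct2[OF v]]
      show "\<forall>C\<in>blocks v. finite C" by (rule conjunct1[OF m])
      show "\<exists>(A :: (real^'m) set) (d :: nat) (\<theta> :: nat \<Rightarrow> real^'m \<Rightarrow> complex).
        algebraic_hypersurface A \<and>
        (\<forall>j<d. algebraic_function_on (- A) (\<theta> j) \<and> homogeneous1_on (- A) (\<theta> j)) \<and>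
        (\<forall>C\<in>blocks v. \<exists>T :: (int \<times> nat \<times> (int^'m)) set.
           (\<forall>(n, j, a)\<in>T. j < d \<and> eta a = -1) \<and>
           (\<forall>\<xi>\<in>- A. block_eigenvalues v \<xi> C =
              (\<lambda>(n, j, a). of_int n + \<theta> j \<xi> + of_real (lform a \<xi>)) ` T)) \<and>
        (\<forall>(n, i, j, a)\<in>coincidence_indices d.
           \<exists>H. algebraic_hypersurface H \<and> coincidence_locus (- A) \<theta> n i j a \<subseteq> H) \<and>
        (\<forall>\<xi>\<in>- A - (\<Union>(n, i, j, a)\<in>coincidence_indices d. coincidence_locus (- A) \<theta> n i j a).
           eigenvalues_distinct v \<xi> \<and> (\<forall>C\<in>blocks v. 0 \<notin> block_eigenvalues v \<xi> C))"
      proof (intro exI[of _ A] exI[of _ d] exI[of _ \<theta>], intro conjI)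
        show "algebraic_hypersurface A" by (rule A)
        show "\<forall>j<d. algebraic_function_on (- A) (\<theta> j) \<and> homogeneous1_on (- A) (\<theta> j)"
          by (intro allI impI) (rule \<theta>_fun)
        show "\<forall>(n, i, j, a)\<in>coincidence_indices d.
           \<exists>H. algebraic_hypersurface H \<and> coincidence_locus (- A) \<theta> n i j a \<subseteq> H"
          using loci by blast
      qed (rule conjunct1[OF conjunct2[OF m]] conjunct2[OF conjunct2[OF m]])+
    qed
  qed
qed

end
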